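(* Assume that $V:\mathbf{R}\to\mathbf{R}$ is $C^5$, $V'(0)=0$, and $c\neq 0$ is a $V$-admissible wave speed; let $\beta>0$ and $\sigma\in E^2_\beta$ be the corresponding exponent and function furnished by the definition of $V$-admissibility. Fix $\kappa>0$. For $n\in\mathbf{N}$ set $$\mu=\mu_n:=\frac{\kappa}{4\pi^2c^2n^2-\kappa},$$ so that $\sqrt{\kappa(1+\mu)/(c^2\mu)}=2n\pi$. Then there exist $C>0$ and $N\in\mathbf{N}$ such that $n\ge N$ implies the existence of unique functions $\rho_1,\rho_2\in H^2_\beta$ with the following properties: (i) $\rho_1$ and $\rho_2$ solve (with $\mu=\mu_n$) $$c^2\rho_1''-\delta^2V'(\rho_1)-\kappa\,\delta\rho_2=0,\qquad c^2\mu\rho_2''+\kappa(1+\mu)\rho_2+\mu\,\delta V'(\rho_1)=0.$$ (ii) $\rho_1$ is even and $\rho_2$ is odd. (iii) $\|\sigma-\rho_1\|_{2,\beta}\le C/n^2$ and $\|\rho_2\|_{2,\beta}\le C/n$. Moreover, if $V$ is smooth ($C^\infty$), then so are $\rho_1$ and $\rho_2$, and the estimates in (iii) improve to: for any $s\ge 0$ there is a constant $C>0$ (which may depend on $s$ but not on $n$) such that $\|\sigma-\rho_1\|_{s,\beta}+\|\rho_2\|_{s,\beta}\le C/n^2$ for all $n\ge N$.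
   Context: $\mathbf{N}=\{1,2,3,\dots\}$. The operator $\delta$ is $\delta f(x):=f(x+1/2)-f(x-1/2)$, and $\delta^2=\delta\circ\delta$. For a function $f$, $V'(f)$ denotes the composition $V'\circ f$, and $V''(\sigma)f$ is the pointwise product of $V''\circ\sigma$ and $f$. Function spaces (functions on $\mathbf{R}$): $H^s=H^s(\mathbf{R})$ is the usual Sobolev space; for $b\ge 0$, $$H^s_b:=\{f\in H^s:\cosh(\cdot)^bf\in H^s\},\qquad \|f\|_{s,b}:=\|\cosh(\cdot)^bf\|_{H^s},$$ $E^s_b:=H^s_b\cap\{\text{even functions}\}$, and $E^s_{b,0}:=E^s_b\cap\{f:\int_{\mathbf{R}}f(x)\,dx=0\}$. Definition. For a potential $V$, $c\in\mathbf{R}$ is a $V$-admissible wave speed if there exist $\beta>0$ and a nonzero function $\sigma\in E^2_\beta$ such that (i) $c^2\sigma''-\delta^2V'(\sigma)=0$, and (ii) the operator $\mathcal{H}f:=c^2f''-\delta^2V''(\sigma)f$ (i.e. $\delta^2$ is applied to the product $V''(\sigma)f$) is a homeomorphism from $E^2_\beta$ onto $E^0_{\beta,0}$. Moreover, if $V$ is smooth then so is $\sigma$, and $\mathcal{H}$ is a homeomorphism from $E^{s+2}_\beta$ to $E^s_{\beta,0}$ for all $s\ge 0$ (this is part of the definition). *)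

theory Defs
  imports "HOL-Analysis.Analysis"
begin

(* Elements of L^2 and of the Sobolev spaces are represented by Borel functions real => real;
   two functions represent the same element iff they agree almost everywhere.  Accordingly
   equations, parity, smoothness and uniqueness are all understood up to null sets. *)

definition ae_eq :: "(real \<Rightarrow> real) \<Rightarrow> (real \<Rightarrow> real) \<Rightarrow> bool" where
  "ae_eq f g \<longleftrightarrow> (AE x in lborel. f x = g x)"

definition ae_even :: "(real \<Rightarrow> real) \<Rightarrow> bool" where
  "ae_even f \<longleftrightarrow> (AE x in lborel. f (- x) = f x)"

definition ae_odd :: "(real \<Rightarrow> real) \<Rightarrow> bool" where
  "ae_odd f \<longleftrightarrow> (AE x in lborel. f (- x) = - f x)"

definition C_k :: "nat \<Rightarrow> (real \<Rightarrow> real) \<Rightarrow> bool" where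
  "C_k k f \<longleftrightarrow>
     (\<forall>j<k. \<forall>x. (deriv ^^ j) f field_differentiable (at x)) \<and>
     continuous_on UNIV ((deriv ^^ k) f)"

definition smooth :: "(real \<Rightarrow> real) \<Rightarrow> bool" where
  "smooth f \<longleftrightarrow> (\<forall>k. C_k k f)"

definition ae_smooth :: "(real \<Rightarrow> real) \<Rightarrow> bool" where
  "ae_smooth f \<longleftrightarrow> (\<exists>g. smooth g \<and> ae_eq f g)"

definition delta :: "(real \<Rightarrow> real) \<Rightarrow> real \<Rightarrow> real" where
  "delta f x = f (x + 1/2) - f (x - 1/2)"


definition locally_integrable :: "(real \<Rightarrow> real) \<Rightarrow> bool" where
  "locally_integrable f \<longleftrightarrow>
     f \<in> borel_measurable lborel \<and> (\<forall>a b. set_integrable lborel {a..b} f)"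

definition test_function :: "(real \<Rightarrow> real) \<Rightarrow> bool" where
  "test_function \<phi> \<longleftrightarrow> smooth \<phi> \<and> (\<exists>R. \<forall>x. \<bar>x\<bar> > R \<longrightarrow> \<phi> x = 0)"

definition has_weak_deriv :: "(real \<Rightarrow> real) \<Rightarrow> (real \<Rightarrow> real) \<Rightarrow> bool" where
  "has_weak_deriv f g \<longleftrightarrow>
     locally_integrable f \<and> locally_integrable g \<and>
     (\<forall>\<phi>. test_function \<phi> \<longrightarrow>
        (LINT x|lborel. f x * deriv \<phi> x) = - (LINT x|lborel. g x * \<phi> x))"

(* Determined up to a null set; only meaningful if a weak derivative exists, which is the
   case for the first and second derivatives of elements of H^2. *)
definition weak_deriv :: "(real \<Rightarrow> real) \<Rightarrow> real \<Rightarrow> real" where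
  "weak_deriv f = (SOME g. has_weak_deriv f g)"


definition square_integrable :: "(real \<Rightarrow> 'a::{banach, second_countable_topology}) \<Rightarrow> bool" where
  "square_integrable f \<longleftrightarrow>
     f \<in> borel_measurable lborel \<and> integrable lborel (\<lambda>x. (norm (f x))\<^sup>2)"

(* The unitary Fourier transform on L^2, as the L^2 limit of the transforms of the truncations
   of f to [-R, R].  The nonnegative integral is used so that convergence to 0 cannot hold
   by a non-integrable function having integral 0. *)
definition is_fourier :: "(real \<Rightarrow> real) \<Rightarrow> (real \<Rightarrow> complex) \<Rightarrow> bool" where
  "is_fourier f g \<longleftrightarrow>
     square_integrable f \<and> square_integrable g \<and>
     ((\<lambda>R::real. \<integral>\<^sup>+ k. ennreal ((norm (g k -
          complex_of_real (1 / sqrt (2 * pi)) *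
          (LINT x:{-R..R}|lborel. exp (- (\<i> * complex_of_real (k * x))) * complex_of_real (f x))))\<^sup>2)
        \<partial>lborel) \<longlongrightarrow> 0) at_top"

definition fourier :: "(real \<Rightarrow> real) \<Rightarrow> real \<Rightarrow> complex" where
  "fourier f = (SOME g. is_fourier f g)"

definition sobolev :: "real \<Rightarrow> (real \<Rightarrow> real) set" where
  "sobolev s = {f. square_integrable f \<and>
     (\<exists>g. is_fourier f g \<and> integrable lborel (\<lambda>k. (1 + k\<^sup>2) powr s * (norm (g k))\<^sup>2))}"

definition sobolev_norm :: "real \<Rightarrow> (real \<Rightarrow> real) \<Rightarrow> real" where
  "sobolev_norm s f = sqrt (LINT k|lborel. (1 + k\<^sup>2) powr s * (norm (fourier f k))\<^sup>2)"

definition wsobolev :: "real \<Rightarrow> real \<Rightarrow> (real \<Rightarrow> real) set" where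
  "wsobolev s b = {f \<in> sobolev s. (\<lambda>x. cosh x powr b * f x) \<in> sobolev s}"

definition wnorm :: "real \<Rightarrow> real \<Rightarrow> (real \<Rightarrow> real) \<Rightarrow> real" where
  "wnorm s b f = sobolev_norm s (\<lambda>x. cosh x powr b * f x)"

definition wsobolev_even :: "real \<Rightarrow> real \<Rightarrow> (real \<Rightarrow> real) set" where
  "wsobolev_even s b = {f \<in> wsobolev s b. ae_even f}"

(* Integrability is automatic for b > 0. *)
definition wsobolev_even0 :: "real \<Rightarrow> real \<Rightarrow> (real \<Rightarrow> real) set" where
  "wsobolev_even0 s b =
     {f \<in> wsobolev_even s b. integrable lborel f \<and> (LINT x|lborel. f x) = 0}"


definition ae_class :: "(real \<Rightarrow> real) \<Rightarrow> (real \<Rightarrow> real) set" where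
  "ae_class f = {g \<in> borel_measurable lborel. ae_eq g f}"

definition ae_rep :: "(real \<Rightarrow> real) set \<Rightarrow> real \<Rightarrow> real" where
  "ae_rep A = (SOME f. f \<in> A)"

(* The norm topology on the set of almost-everywhere classes of a subset X of wsobolev s b. *)
definition wsobolev_topology ::
    "real \<Rightarrow> real \<Rightarrow> (real \<Rightarrow> real) set \<Rightarrow> (real \<Rightarrow> real) set topology" where
  "wsobolev_topology s b X =
     Metric_space.mtopology (ae_class ` X) (\<lambda>A B. wnorm s b (\<lambda>x. ae_rep A x - ae_rep B x))"

definition linearized_op ::
    "(real \<Rightarrow> real) \<Rightarrow> real \<Rightarrow> (real \<Rightarrow> real) \<Rightarrow> (real \<Rightarrow> real) \<Rightarrow> real \<Rightarrow> real" where
  "linearized_op V c \<sigma> f =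
     (\<lambda>x. c\<^sup>2 * weak_deriv (weak_deriv f) x
          - delta (delta (\<lambda>y. deriv (deriv V) (\<sigma> y) * f y)) x)"

definition linearized_homeo ::
    "(real \<Rightarrow> real) \<Rightarrow> real \<Rightarrow> real \<Rightarrow> (real \<Rightarrow> real) \<Rightarrow> real \<Rightarrow> bool" where
  "linearized_homeo V c \<beta> \<sigma> s \<longleftrightarrow>
     homeomorphic_map
       (wsobolev_topology (s + 2) \<beta> (wsobolev_even (s + 2) \<beta>))
       (wsobolev_topology s \<beta> (wsobolev_even0 s \<beta>))
       (\<lambda>A. ae_class (linearized_op V c \<sigma> (ae_rep A)))"

definition admissible_with ::
    "(real \<Rightarrow> real) \<Rightarrow> real \<Rightarrow> real \<Rightarrow> (real \<Rightarrow> real) \<Rightarrow> bool" where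
  "admissible_with V c \<beta> \<sigma> \<longleftrightarrow>
     \<beta> > 0 \<and> \<sigma> \<in> wsobolev_even 2 \<beta> \<and> \<not> ae_eq \<sigma> (\<lambda>x. 0) \<and>
     (AE x in lborel. c\<^sup>2 * weak_deriv (weak_deriv \<sigma>) x
                        - delta (delta (\<lambda>y. deriv V (\<sigma> y))) x = 0) \<and>
     linearized_homeo V c \<beta> \<sigma> 0 \<and>
     (smooth V \<longrightarrow> ae_smooth \<sigma> \<and> (\<forall>s\<ge>0. linearized_homeo V c \<beta> \<sigma> s))"

definition admissible :: "(real \<Rightarrow> real) \<Rightarrow> real \<Rightarrow> bool" where
  "admissible V c \<longleftrightarrow> (\<exists>\<beta> \<sigma>. admissible_with V c \<beta> \<sigma>)"


definition wave_system ::
    "(real \<Rightarrow> real) \<Rightarrow> real \<Rightarrow> real \<Rightarrow> real \<Rightarrow> (real \<Rightarrow> real) \<Rightarrow> (real \<Rightarrow> real) \<Rightarrow> bool" where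
  "wave_system V c \<kappa> \<mu> \<rho>1 \<rho>2 \<longleftrightarrow>
     (AE x in lborel. c\<^sup>2 * weak_deriv (weak_deriv \<rho>1) x
        - delta (delta (\<lambda>y. deriv V (\<rho>1 y))) x - \<kappa> * delta \<rho>2 x = 0) \<and>
     (AE x in lborel. c\<^sup>2 * \<mu> * weak_deriv (weak_deriv \<rho>2) x
        + \<kappa> * (1 + \<mu>) * \<rho>2 x + \<mu> * delta (\<lambda>y. deriv V (\<rho>1 y)) x = 0)"

definition mu :: "real \<Rightarrow> real \<Rightarrow> nat \<Rightarrow> real" where
  "mu c \<kappa> n = \<kappa> / (4 * pi\<^sup>2 * c\<^sup>2 * (real n)\<^sup>2 - \<kappa>)"

definition nearby_wave ::
    "(real \<Rightarrow> real) \<Rightarrow> real \<Rightarrow> real \<Rightarrow> real \<Rightarrow> (real \<Rightarrow> real) \<Rightarrow> real \<Rightarrow> nat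
       \<Rightarrow> (real \<Rightarrow> real) \<Rightarrow> (real \<Rightarrow> real) \<Rightarrow> bool" where
  "nearby_wave V c \<kappa> \<beta> \<sigma> C n \<rho>1 \<rho>2 \<longleftrightarrow>
     \<rho>1 \<in> wsobolev 2 \<beta> \<and> \<rho>2 \<in> wsobolev 2 \<beta> \<and>
     wave_system V c \<kappa> (mu c \<kappa> n) \<rho>1 \<rho>2 \<and>
     ae_even \<rho>1 \<and> ae_odd \<rho>2 \<and>
     wnorm 2 \<beta> (\<lambda>x. \<sigma> x - \<rho>1 x) \<le> C / (real n)\<^sup>2 \<and>
     wnorm 2 \<beta> \<rho>2 \<le> C / real n"

end

theory Submission
  imports Defs "HOL-Probability.Probability"
begin

text \<open>The frequency \<open>2\<pi>n\<close> is a zero of the symbol of \<open>\<delta>\<close>. Hence the second equation, written as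
  \<open>\<rho>\<^sub>2'' + (2\<pi>n)\<^sup>2 \<rho>\<^sub>2 = - c\<^sup>-\<^sup>2 \<delta> V'(\<rho>\<^sub>1)\<close>, has a localized solution \<open>\<rho>\<^sub>2\<close>: the solution operator is
  convolution with a kernel of size \<open>1/n\<close> supported in a unit window, and integrating by parts
  trades one derivative of the right-hand side for a further factor \<open>1/n\<close>. The solution is unique
  because the homogeneous oscillator has no nonzero square integrable solution.
  Substituting \<open>\<rho>\<^sub>2\<close> and \<open>\<rho>\<^sub>1 = \<sigma> + F\<close> in the first equation gives \<open>F = H\<^sup>-\<^sup>1(N F)\<close>, where \<open>H\<close> is the
  linearization at \<open>\<sigma>\<close> and \<open>N F\<close> consists of a term quadratic in \<open>F\<close> and a term of order \<open>1/n\<^sup>2\<close>;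
  this is a contraction on a small ball of the weighted \<open>H\<^sup>2\<close>. For smooth \<open>V\<close> the same equation for
  \<open>c\<^sup>2 F''\<close> bounds one further derivative at a time. Plancherel's theorem identifies the Sobolev
  spaces of integer order with chains of absolutely continuous functions.\<close>

section \<open>Square integrable functions on the line\<close>

text \<open>The hypotheses speak of classes up to null sets, of chosen weak derivatives and of norms
  of real order, whereas composition, integration by parts and bootstrapping want genuine functions.
  Each element is therefore replaced by a continuous representative with a chain of primitives, and
  norms by radii of balls (\<open>wbound\<close>). The homeomorphism hypothesis is purely
  topological. Openness at the zero class and homogeneity give a linear bound for solutions, and
  injectivity extends it to every solution of the linear equation. The contraction runs on
  right-hand sides in weighted L^2, where completeness is at hand, not in H^2. Its Lipschitz
  constant is of size sup norm + 1/n, while the value at F = 0 is of order 1/n^2, since V'(S) has a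
  derivative to spend there; hence the ball of radius O(1/n^2). For rho2 in H^2 the argument leaves
  no derivative of V'(rho1) to spend, so its rate stays 1/n until V is smooth. The constants are
  fixed in the order existence radius, C, radius of the competitors, N: a competing wave is only
  known to lie in a ball that may exceed the one of the constructed solution.\<close>

definition l2_norm :: "(real \<Rightarrow> 'a::{banach, second_countable_topology}) \<Rightarrow> real" where
  "l2_norm f = sqrt (LINT x|lborel. (norm (f x))\<^sup>2)"

lemma l2_norm_nonneg [simp]: "0 \<le> l2_norm f"
  by (simp add: l2_norm_def)

lemma l2_norm_sq: "(l2_norm f)\<^sup>2 = (LINT x|lborel. (norm (f x))\<^sup>2)"
  by (simp add: l2_norm_def)

lemma square_integrableD:
  assumes "square_integrable f"
  shows "f \<in> borel_measurable borel" "integrable lborel (\<lambda>x. (norm (f x))\<^sup>2)"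
  using assms by (auto simp: square_integrable_def)

lemma square_integrable_norm: "square_integrable f \<Longrightarrow> square_integrable (\<lambda>x. norm (f x))"
  by (auto simp: square_integrable_def)

lemma square_integrable_bound:
  assumes "square_integrable f" "g \<in> borel_measurable borel" "AE x in lborel. norm (g x) \<le> C * norm (f x)"
  shows "square_integrable g"
proof -
  have "integrable lborel (\<lambda>x. C\<^sup>2 * (norm (f x))\<^sup>2)"
    using square_integrableD(2)[OF assms(1)] by simp
  then have "integrable lborel (\<lambda>x. (norm (g x))\<^sup>2)"
  proof (rule Bochner_Integration.integrable_bound)
    show "AE x in lborel. norm ((norm (g x))\<^sup>2) \<le> norm (C\<^sup>2 * (norm (f x))\<^sup>2)"
      using assms(3) by eventually_elim (auto simp: power_mult_distrib[symmetric] intro!: power_mono)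
  qed (use assms(2) in measurable)
  then show ?thesis using assms(2) by (simp add: square_integrable_def)
qed

lemma l2_norm_bound:
  assumes "square_integrable f" "g \<in> borel_measurable borel" "AE x in lborel. norm (g x) \<le> C * norm (f x)" "C \<ge> 0"
  shows "l2_norm g \<le> C * l2_norm f"
proof -
  have "(LINT x|lborel. (norm (g x))\<^sup>2) \<le> (LINT x|lborel. C\<^sup>2 * (norm (f x))\<^sup>2)"
  proof (rule integral_mono_AE)
    show "integrable lborel (\<lambda>x. (norm (g x))\<^sup>2)"
      using square_integrable_bound[OF assms(1-3)] by (rule square_integrableD)
    show "integrable lborel (\<lambda>x. C\<^sup>2 * (norm (f x))\<^sup>2)"
      using square_integrableD(2)[OF assms(1)] by simp
    show "AE x in lborel. (norm (g x))\<^sup>2 \<le> C\<^sup>2 * (norm (f x))\<^sup>2"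
      using assms(3) by eventually_elim (auto simp: power_mult_distrib[symmetric] intro!: power_mono)
  qed
  also have "\<dots> = (C * l2_norm f)\<^sup>2" by (simp add: power_mult_distrib l2_norm_sq)
  finally show ?thesis using assms(4)
    by (simp add: l2_norm_def real_le_lsqrt)
qed

lemma l2_norm_cong_AE:
  assumes "f \<in> borel_measurable borel" "g \<in> borel_measurable borel" "AE x in lborel. f x = g x"
  shows "l2_norm f = l2_norm g"
  unfolding l2_norm_def by (intro arg_cong[where f = sqrt] integral_cong_AE) (use assms in auto)

lemma square_integrable_cong_AE:
  assumes "square_integrable f" "g \<in> borel_measurable borel" "AE x in lborel. f x = g x"
  shows "square_integrable g"
  by (rule square_integrable_bound[OF assms(1,2), of 1]) (use assms(3) in auto)

lemma square_integrable_0 [simp]: "square_integrable (\<lambda>x. 0)"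
  by (simp add: square_integrable_def)

lemma l2_norm_0 [simp]: "l2_norm (\<lambda>x. 0) = 0"
  by (simp add: l2_norm_def)

lemma l2_norm_eq_0D:
  assumes "square_integrable f" "l2_norm f = 0"
  shows "AE x in lborel. f x = 0"
proof -
  have "(LINT x|lborel. (norm (f x))\<^sup>2) = 0" using assms(2) l2_norm_sq[of f] by simp
  then show ?thesis
    using integral_nonneg_eq_0_iff_AE[OF square_integrableD(2)[OF assms(1)]] by simp
qed

lemma square_integrable_mult_integrable:
  fixes f g :: "real \<Rightarrow> 'a::{banach, second_countable_topology, real_normed_algebra}"
  assumes "square_integrable f" "square_integrable g"
  shows "integrable lborel (\<lambda>x. f x * g x)"
proof (rule Bochner_Integration.integrable_bound)
  show "integrable lborel (\<lambda>x. (norm (f x))\<^sup>2 + (norm (g x))\<^sup>2)"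
    using assms by (auto dest: square_integrableD)
  have "norm (a * b) \<le> (norm a)\<^sup>2 + (norm b)\<^sup>2" for a b :: 'a
  proof -
    have "norm (a * b) \<le> norm a * norm b" by (rule norm_mult_ineq)
    also have "\<dots> \<le> (norm a)\<^sup>2 + (norm b)\<^sup>2"
      using sum_squares_bound[of "norm a" "norm b"] mult_nonneg_nonneg[of "norm a" "norm b"]
      by (simp add: mult.assoc del: mult_nonneg_nonneg)
    finally show ?thesis .
  qed
  then show "AE x in lborel. norm (f x * g x) \<le> norm ((norm (f x))\<^sup>2 + (norm (g x))\<^sup>2)"
    by (auto intro: order_trans)
  show "(\<lambda>x. f x * g x) \<in> borel_measurable lborel"
    using square_integrableD(1)[OF assms(1)] square_integrableD(1)[OF assms(2)] by simp
qed

text \<open>With a and b the two norms, integrating 2xy <= (b/a) x^2 + (a/b) y^2 gives exactly 2ab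
  on the right. The weights divide by the norms, so a vanishing norm is treated first, through the
  function being zero almost everywhere.\<close>

lemma l2_cauchy_schwarz:
  fixes f g :: "real \<Rightarrow> 'a::{banach, second_countable_topology}"
  assumes f: "square_integrable f" and g: "square_integrable g"
  shows "(LINT x|lborel. norm (f x) * norm (g x)) \<le> l2_norm f * l2_norm g"
proof -
  have int: "integrable lborel (\<lambda>x. norm (f x) * norm (g x))"
    using square_integrable_mult_integrable[OF square_integrable_norm[OF f] square_integrable_norm[OF g]] .
  consider "l2_norm f = 0" | "l2_norm g = 0" | "l2_norm f > 0" "l2_norm g > 0"
    using l2_norm_nonneg[of f] l2_norm_nonneg[of g] by linarith
  then show ?thesis
  proof cases
    case 1
    have "(LINT x|lborel. norm (f x) * norm (g x)) = 0"
      by (rule integral_eq_zero_AE) (use l2_norm_eq_0D[OF f 1] in auto)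
    then show ?thesis using 1 by simp
  next
    case 2
    have "(LINT x|lborel. norm (f x) * norm (g x)) = 0"
      by (rule integral_eq_zero_AE) (use l2_norm_eq_0D[OF g 2] in auto)
    then show ?thesis using 2 by simp
  next
    case 3
    define a b where "a = l2_norm f" and "b = l2_norm g"
    have ab: "a > 0" "b > 0" using 3 by (auto simp: a_def b_def)
    have pt: "2 * (x * y) \<le> (b / a) * x\<^sup>2 + (a / b) * y\<^sup>2" for x y :: real
    proof -
      have "0 \<le> (b * x - a * y)\<^sup>2" by simp
      then have "2 * (x * y) * (a * b) \<le> b\<^sup>2 * x\<^sup>2 + a\<^sup>2 * y\<^sup>2" 
        by (simp add: power2_eq_square algebra_simps)
      then show ?thesis using ab by (simp add: field_simps power2_eq_square)
    qed
    have "2 * (LINT x|lborel. norm (f x) * norm (g x)) = (LINT x|lborel. 2 * (norm (f x) * norm (g x)))"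
      by simp
    also have "\<dots> \<le> (LINT x|lborel. (b / a) * (norm (f x))\<^sup>2 + (a / b) * (norm (g x))\<^sup>2)"
      using int square_integrableD[OF f] square_integrableD[OF g] pt
      by (intro integral_mono) auto
    also have "\<dots> = (b / a) * a\<^sup>2 + (a / b) * b\<^sup>2"
      using square_integrableD[OF f] square_integrableD[OF g]
      by (simp add: a_def b_def l2_norm_sq)
    also have "\<dots> = 2 * (a * b)" using ab by (simp add: power2_eq_square field_simps)
    finally show ?thesis by (simp add: a_def b_def)
  qed
qed

lemma square_integrable_add:
  assumes f: "square_integrable f" and g: "square_integrable g"
  shows "square_integrable (\<lambda>x. f x + g x)"
proof -
  have "integrable lborel (\<lambda>x. (norm (f x + g x))\<^sup>2)"
  proof (rule Bochner_Integration.integrable_bound)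
    show "integrable lborel (\<lambda>x. 2 * (norm (f x))\<^sup>2 + 2 * (norm (g x))\<^sup>2)"
      using square_integrableD(2)[OF assms(1)] square_integrableD(2)[OF assms(2)] by simp
    have "(norm (a + b))\<^sup>2 \<le> 2 * (norm a)\<^sup>2 + 2 * (norm b)\<^sup>2" for a b :: 'a
    proof -
      have "(norm (a + b))\<^sup>2 \<le> (norm a + norm b)\<^sup>2"
        by (intro power_mono norm_triangle_ineq) auto
      also have "\<dots> \<le> 2 * (norm a)\<^sup>2 + 2 * (norm b)\<^sup>2"
        using sum_squares_bound[of "norm a" "norm b"] by (simp add: power2_sum)
      finally show ?thesis .
    qed
    then show "AE x in lborel. norm ((norm (f x + g x))\<^sup>2) \<le> norm (2 * (norm (f x))\<^sup>2 + 2 * (norm (g x))\<^sup>2)"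
      by (auto intro: order_trans)
  qed (use square_integrableD(1)[OF f] square_integrableD(1)[OF g] in simp)
  then show ?thesis using assms by (auto simp: square_integrable_def)
qed

lemma l2_norm_triangle:
  assumes f: "square_integrable f" and g: "square_integrable g"
  shows "l2_norm (\<lambda>x. f x + g x) \<le> l2_norm f + l2_norm g"
proof -
  have int: "integrable lborel (\<lambda>x. norm (f x) * norm (g x))"
    using square_integrable_mult_integrable[OF square_integrable_norm[OF f] square_integrable_norm[OF g]] .
  have "(LINT x|lborel. (norm (f x + g x))\<^sup>2) \<le>
    (LINT x|lborel. (norm (f x))\<^sup>2 + 2 * (norm (f x) * norm (g x)) + (norm (g x))\<^sup>2)"
  proof (rule integral_mono)
    show "(norm (f x + g x))\<^sup>2 \<le> (norm (f x))\<^sup>2 + 2 * (norm (f x) * norm (g x)) + (norm (g x))\<^sup>2" for x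
      using power_mono[OF norm_triangle_ineq[of "f x" "g x"], of 2] by (simp add: power2_sum)
  qed (use int square_integrableD[OF f] square_integrableD[OF g] 
     square_integrableD[OF square_integrable_add[OF f g]] in auto)
  also have "\<dots> = (l2_norm f)\<^sup>2 + 2 * (LINT x|lborel. norm (f x) * norm (g x)) + (l2_norm g)\<^sup>2"
    using int square_integrableD[OF f] square_integrableD[OF g] by (simp add: l2_norm_sq)
  also have "\<dots> \<le> (l2_norm f + l2_norm g)\<^sup>2"
    using l2_cauchy_schwarz[OF f g] by (simp add: power2_sum)
  finally show ?thesis by (simp add: l2_norm_def[of "\<lambda>x. f x + g x"] real_le_lsqrt)
qed

lemma square_integrable_scaleR:
  "square_integrable f \<Longrightarrow> square_integrable (\<lambda>x. c *\<^sub>R f x)"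
  by (auto simp: square_integrable_def power_mult_distrib)

lemma square_integrable_cmult:
  fixes c :: "'a::{banach, second_countable_topology, real_normed_field}"
  shows "square_integrable f \<Longrightarrow> square_integrable (\<lambda>x. c * f x)"
  by (auto simp: square_integrable_def power_mult_distrib norm_mult)

lemma l2_norm_cmult:
  fixes c :: "'a::{banach, second_countable_topology, real_normed_field}"
  shows "l2_norm (\<lambda>x. c * f x) = norm c * l2_norm f"
  by (simp add: l2_norm_def power_mult_distrib real_sqrt_mult norm_mult)

lemma square_integrable_minus: "square_integrable f \<Longrightarrow> square_integrable (\<lambda>x. - f x)"
  using square_integrable_scaleR[of f "-1"] by simp

lemma l2_norm_minus [simp]: "l2_norm (\<lambda>x. - f x) = l2_norm f"
  by (simp add: l2_norm_def)

lemma square_integrable_diff: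
  "square_integrable f \<Longrightarrow> square_integrable g \<Longrightarrow> square_integrable (\<lambda>x. f x - g x)"
  using square_integrable_add[OF _ square_integrable_minus, of f g] by simp

lemma l2_norm_triangle_diff:
  "square_integrable f \<Longrightarrow> square_integrable g \<Longrightarrow> l2_norm (\<lambda>x. f x - g x) \<le> l2_norm f + l2_norm g"
  using l2_norm_triangle[OF _ square_integrable_minus, of f g] by simp

lemma l2_norm_diff_commute: "l2_norm (\<lambda>x. f x - g x) = l2_norm (\<lambda>x. g x - f x)"
  by (simp add: l2_norm_def norm_minus_commute)

lemma l2_norm_abs_diff:
  assumes "square_integrable f" "square_integrable g"
  shows "\<bar>l2_norm f - l2_norm g\<bar> \<le> l2_norm (\<lambda>x. f x - g x)"
  using l2_norm_triangle[OF assms(2) square_integrable_diff[OF assms]]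
    l2_norm_triangle[OF assms(1) square_integrable_diff[OF assms(2,1)]]
    l2_norm_diff_commute[of f g] by simp

lemma nn_integral_square:
  assumes "square_integrable f"
  shows "(\<integral>\<^sup>+ x. ennreal ((norm (f x))\<^sup>2) \<partial>lborel) = ennreal ((l2_norm f)\<^sup>2)"
  unfolding l2_norm_sq by (rule nn_integral_eq_integral) (use square_integrableD[OF assms] in auto)

lemma square_integrable_nn_integralI:
  assumes "f \<in> borel_measurable borel" "(\<integral>\<^sup>+ x. ennreal ((norm (f x))\<^sup>2) \<partial>lborel) \<le> ennreal (c\<^sup>2)" "c \<ge> 0"
  shows "square_integrable f" "l2_norm f \<le> c"
proof -
  have "integrable lborel (\<lambda>x. (norm (f x))\<^sup>2)"
    by (rule integrableI_nonneg) (use assms in \<open>auto simp: le_less_trans\<close>)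
  then show s: "square_integrable f" using assms(1) by (simp add: square_integrable_def)
  show "l2_norm f \<le> c"
    using assms(2,3) nn_integral_square[OF s] by (simp add: power2_le_iff_abs_le ennreal_le_iff)
qed

text \<open>Fatou's lemma for the squared norms. Membership of the limit comes out together with the
  bound.\<close>

lemma l2_fatou:
  fixes f :: "nat \<Rightarrow> real \<Rightarrow> 'a::{banach, second_countable_topology}"
  assumes "\<And>n. square_integrable (f n)" "g \<in> borel_measurable borel"
    "AE x in lborel. (\<lambda>n. f n x) \<longlonglongrightarrow> g x" "\<forall>\<^sub>F n in sequentially. l2_norm (f n) \<le> c" "c \<ge> 0"
  shows "square_integrable g" "l2_norm g \<le> c"
proof -
  have "(\<integral>\<^sup>+ x. ennreal ((norm (g x))\<^sup>2) \<partial>lborel)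
      = (\<integral>\<^sup>+ x. liminf (\<lambda>n. ennreal ((norm (f n x))\<^sup>2)) \<partial>lborel)"
  proof (rule nn_integral_cong_AE)
    show "AE x in lborel. ennreal ((norm (g x))\<^sup>2) = liminf (\<lambda>n. ennreal ((norm (f n x))\<^sup>2))"
      using assms(3)
    proof eventually_elim
      case (elim x)
      have "(\<lambda>n. ennreal ((norm (f n x))\<^sup>2)) \<longlonglongrightarrow> ennreal ((norm (g x))\<^sup>2)"
        using elim by (intro tendsto_ennrealI tendsto_intros)
      then show ?case using lim_imp_Liminf[OF trivial_limit_sequentially] by metis
    qed
  qed
  also have "\<dots> \<le> liminf (\<lambda>n. \<integral>\<^sup>+ x. ennreal ((norm (f n x))\<^sup>2) \<partial>lborel)"
    using square_integrableD(1)[OF assms(1)] by (intro nn_integral_liminf) simp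
  also have "\<dots> \<le> ennreal (c\<^sup>2)"
  proof (rule Liminf_le)
    show "\<forall>\<^sub>F n in sequentially. (\<integral>\<^sup>+ x. ennreal ((norm (f n x))\<^sup>2) \<partial>lborel) \<le> ennreal (c\<^sup>2)"
      using assms(4) by eventually_elim (auto simp: nn_integral_square[OF assms(1)] intro!: ennreal_leI power_mono)
  qed simp
  finally show "square_integrable g" "l2_norm g \<le> c"
    using square_integrable_nn_integralI assms(2,5) by blast+
qed

section \<open>Completeness of L^2\<close>

lemma square_integrable_sum:
  "(\<And>i. i \<in> A \<Longrightarrow> square_integrable (f i)) \<Longrightarrow> square_integrable (\<lambda>x. \<Sum>i\<in>A. f i x)"
  by (induction A rule: infinite_finite_induct) (auto intro: square_integrable_add)

lemma l2_norm_sum_le: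
  "(\<And>i. i \<in> A \<Longrightarrow> square_integrable (f i)) \<Longrightarrow> l2_norm (\<lambda>x. \<Sum>i\<in>A. f i x) \<le> (\<Sum>i\<in>A. l2_norm (f i))"
proof (induction A rule: infinite_finite_induct)
  case (insert a A)
  then have "l2_norm (\<lambda>x. f a x + (\<Sum>i\<in>A. f i x)) \<le> l2_norm (f a) + l2_norm (\<lambda>x. \<Sum>i\<in>A. f i x)"
    by (intro l2_norm_triangle square_integrable_sum) auto
  with insert show ?case by simp
qed auto

text \<open>The partial sums of the absolute increments have L^2 norm at most 2 and increase, so by
  monotone convergence their supremum is finite almost everywhere. At such points the telescoping
  series converges absolutely.\<close>

lemma l2_summable_AE_convergent:
  fixes f :: "nat \<Rightarrow> real \<Rightarrow> 'a::{banach, second_countable_topology}"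
  assumes f: "\<And>n. square_integrable (f n)"
    and step: "\<And>n. l2_norm (\<lambda>x. f (Suc n) x - f n x) \<le> (1/2) ^ n"
  shows "AE x in lborel. convergent (\<lambda>n. f n x)"
proof -
  define u where "u = (\<lambda>n x. norm (f (Suc n) x - f n x))"
  have u: "square_integrable (u n)" for n
    unfolding u_def by (intro square_integrable_norm square_integrable_diff f)
  have un: "l2_norm (u n) \<le> (1/2)^n" for n
    using step[of n] by (simp add: u_def l2_norm_def)
  define S where "S = (\<lambda>N x. \<Sum>n<N. u n x)"
  have Sq: "square_integrable (S N)" for N unfolding S_def by (intro square_integrable_sum u)
  have SN: "l2_norm (S N) \<le> 2" for N
  proof -
    have "l2_norm (S N) \<le> (\<Sum>n<N. l2_norm (u n))" unfolding S_def by (intro l2_norm_sum_le u)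
    also have "\<dots> \<le> (\<Sum>n<N. (1/2)^n)" by (intro sum_mono un)
    also have "\<dots> \<le> (\<Sum>n. (1/2::real)^n)" by (intro sum_le_suminf) (auto intro!: summable_geometric)
    also have "\<dots> = 2" by (simp add: suminf_geometric)
    finally show ?thesis .
  qed
  have S0: "0 \<le> S N x" for N x by (simp add: S_def u_def sum_nonneg)
  have mono: "incseq (\<lambda>N. ennreal ((norm (S N x))\<^sup>2))" for x
  proof (rule incseq_SucI)
    fix N show "ennreal ((norm (S N x))\<^sup>2) \<le> ennreal ((norm (S (Suc N) x))\<^sup>2)"
      using S0[of N x] by (auto simp: S_def u_def intro!: ennreal_leI power_mono)
  qed
  have "(\<integral>\<^sup>+ x. (SUP N. ennreal ((norm (S N x))\<^sup>2)) \<partial>lborel) = (SUP N. \<integral>\<^sup>+ x. ennreal ((norm (S N x))\<^sup>2) \<partial>lborel)"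
    by (rule nn_integral_monotone_convergence_SUP)
       (use mono square_integrableD(1)[OF Sq] in \<open>auto simp: incseq_def le_fun_def\<close>)
  also have "\<dots> \<le> ennreal (2\<^sup>2)"
    by (intro SUP_least) (subst nn_integral_square[OF Sq], intro ennreal_leI power_mono SN, simp)
  finally have "(\<integral>\<^sup>+ x. (SUP N. ennreal ((norm (S N x))\<^sup>2)) \<partial>lborel) \<noteq> \<infinity>"
    by (auto simp: top_unique)
  then have "AE x in lborel. (SUP N. ennreal ((norm (S N x))\<^sup>2)) \<noteq> \<infinity>"
    by (intro nn_integral_PInf_AE) (use square_integrableD(1)[OF Sq] in simp_all)
  then show ?thesis
  proof eventually_elim
    case (elim x)
    then obtain B where B: "(SUP N. ennreal ((norm (S N x))\<^sup>2)) = ennreal B" "B \<ge> 0"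
      by (cases "SUP N. ennreal ((norm (S N x))\<^sup>2)") auto
    have "S N x \<le> sqrt B" for N
    proof -
      have "ennreal ((norm (S N x))\<^sup>2) \<le> ennreal B" unfolding B(1)[symmetric] by (rule SUP_upper) simp
      then show ?thesis using B(2) by (auto intro: real_le_rsqrt)
    qed
    then have "summable (\<lambda>n. u n x)"
      by (intro summableI_nonneg_bounded[of _ "sqrt B"]) (auto simp: S_def u_def)
    then have "summable (\<lambda>n. f (Suc n) x - f n x)"
      unfolding u_def by (rule summable_norm_cancel)
    then have "convergent (\<lambda>N. \<Sum>n<N. f (Suc n) x - f n x)"
      by (simp add: summable_iff_convergent)
    then have "convergent (\<lambda>N. f N x - f 0 x)"
      using sum_lessThan_telescope[of "\<lambda>n. f n x"] by simp
    then have "convergent (\<lambda>N. (f N x - f 0 x) + f 0 x)"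
      by (intro convergent_add convergent_const)
    then show ?case by simp
  qed
qed

theorem l2_complete:
  fixes f :: "nat \<Rightarrow> real \<Rightarrow> 'a::{banach, second_countable_topology}"
  assumes f: "\<And>n. square_integrable (f n)"
    and cauchy: "\<And>e. e > 0 \<Longrightarrow> \<exists>N. \<forall>m\<ge>N. \<forall>n\<ge>N. l2_norm (\<lambda>x. f m x - f n x) < e"
  obtains g where "square_integrable g" "(\<lambda>n. l2_norm (\<lambda>x. f n x - g x)) \<longlonglongrightarrow> 0"
proof -
  obtain N where N: "\<And>k m n. m \<ge> N k \<Longrightarrow> n \<ge> N k \<Longrightarrow> l2_norm (\<lambda>x. f m x - f n x) < (1/2)^k"
    using cauchy[of "(1/2)^_"] by (metis zero_less_divide_1_iff zero_less_numeral zero_less_power)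
  \<comment> \<open>Indices at least \<open>N k\<close> make consecutive members of the subsequence
    2^-k-close; the successor in the maximum keeps it strictly increasing.\<close>
  define r where "r = rec_nat (N 0) (\<lambda>k a. max (Suc a) (N (Suc k)))"
  have r: "r (Suc k) \<ge> Suc (r k)" "r k \<ge> N k" for k
    by (auto simp: r_def) (cases k; auto simp: r_def)
  have sm: "strict_mono r" using r(1) by (auto simp: strict_mono_Suc_iff less_eq_Suc_le)
  have NS: "N k \<le> r (Suc k)" for k using r[of k] by linarith
  have "AE x in lborel. convergent (\<lambda>k. f (r k) x)"
  proof (rule l2_summable_AE_convergent)
    show "l2_norm (\<lambda>x. f (r (Suc k)) x - f (r k) x) \<le> (1/2)^k" for k
      by (rule less_imp_le, rule N[OF NS r(2)])
  qed (use f in auto)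
  then have lim: "AE x in lborel. (\<lambda>k. f (r k) x) \<longlonglongrightarrow> lim (\<lambda>k. f (r k) x)"
    by eventually_elim (auto simp: convergent_LIMSEQ_iff)
  define g where "g = (\<lambda>x. lim (\<lambda>k. f (r k) x))"
  have gm: "g \<in> borel_measurable borel"
    unfolding g_def by (rule borel_measurable_lim_metric) (use f in \<open>auto dest: square_integrableD\<close>)
  \<comment> \<open>Fatou in j replaces the member of the subsequence by the limit g, and the rate
    holds for the whole sequence, not just along r.\<close>
  have diff: "square_integrable (\<lambda>x. f m x - g x) \<and> l2_norm (\<lambda>x. f m x - g x) \<le> (1/2)^k" if "m \<ge> N k" for m k
  proof -
    have fm: "(\<lambda>x. f m x - g x) \<in> borel_measurable borel"
      using gm square_integrableD(1)[OF f[of m]] by measurable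
    have lm: "AE x in lborel. (\<lambda>j. f m x - f (r j) x) \<longlonglongrightarrow> f m x - g x"
      using lim by eventually_elim (auto simp: g_def intro!: tendsto_intros)
    have "\<forall>\<^sub>F j in sequentially. l2_norm (\<lambda>x. f m x - f (r j) x) \<le> (1/2)^k"
    proof (rule eventually_sequentiallyI[of k])
      fix j assume "k \<le> j"
      then have "N k \<le> r j" using r(2)[of k] sm by (meson order_trans strict_mono_less_eq)
      then show "l2_norm (\<lambda>x. f m x - f (r j) x) \<le> (1/2)^k" using N that less_imp_le by blast
    qed
    from l2_fatou[OF square_integrable_diff[OF f f] fm lm this] show ?thesis by auto
  qed
  have "square_integrable (\<lambda>x. f (N 0) x - (f (N 0) x - g x))"
    by (rule square_integrable_diff[OF f]) (use diff[of 0 "N 0"] in auto)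
  then have "square_integrable g" by simp
  moreover have "(\<lambda>n. l2_norm (\<lambda>x. f n x - g x)) \<longlonglongrightarrow> 0"
  proof (rule LIMSEQ_I)
    fix e :: real assume "e > 0"
    then obtain k where k: "(1/2)^k < e" using real_arch_pow_inv[of e "1/2"] by auto
    show "\<exists>no. \<forall>n\<ge>no. norm (l2_norm (\<lambda>x. f n x - g x) - 0) < e"
      using diff[of k] k by (intro exI[of _ "N k"]) (auto intro: le_less_trans)
  qed
  ultimately show ?thesis using that by blast
qed

section \<open>Translation invariance and continuity of translation in the mean\<close>

lemma l2_norm_shift: "l2_norm (\<lambda>x. f (x + h)) = l2_norm f"
  using lborel_integral_real_affine[of 1 "\<lambda>x. (norm (f x))\<^sup>2" h] by (simp add: l2_norm_def add.commute)

lemma square_integrable_shift: "square_integrable f \<Longrightarrow> square_integrable (\<lambda>x. f (x + h))"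
  using lborel_integrable_real_affine[of "\<lambda>x. (norm (f x))\<^sup>2" 1 h]
  by (auto simp: square_integrable_def add.commute)

lemma integrable_shift:
  fixes f :: "real \<Rightarrow> 'a::{banach, second_countable_topology}"
  shows "integrable lborel f \<Longrightarrow> integrable lborel (\<lambda>x. f (x + h))"
  using lborel_integrable_real_affine[of f 1 h] by (simp add: add.commute)

lemma integral_shift:
  fixes f :: "real \<Rightarrow> 'a::{banach, second_countable_topology}"
  shows "(LINT x|lborel. f (x + h)) = (LINT x|lborel. f x)"
  using lborel_integral_real_affine[of 1 f h] by (simp add: add.commute)

definition l1_translation_continuous :: "(real \<Rightarrow> real) \<Rightarrow> bool" where
  "l1_translation_continuous f \<longleftrightarrow> ((\<lambda>h. LINT x|lborel. \<bar>f (x + h) - f x\<bar>) \<longlongrightarrow> 0) (at 0)"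

text \<open>A three-epsilon argument: translation invariance of the integral makes the error at x +
  h equal to the error at x, so only the middle term depends on h.\<close>

lemma l1_translation_continuous_approx:
  assumes f: "integrable lborel f"
    and g: "\<And>e. e > 0 \<Longrightarrow> \<exists>g. integrable lborel g \<and> l1_translation_continuous g \<and> (LINT x|lborel. \<bar>f x - g x\<bar>) < e"
  shows "l1_translation_continuous f"
  unfolding l1_translation_continuous_def
proof (rule tendstoI)
  fix e :: real assume "e > 0"
  then obtain g where gi: "integrable lborel g" and gt: "l1_translation_continuous g"
    and gd: "(LINT x|lborel. \<bar>f x - g x\<bar>) < e / 3"
    using g[of "e / 3"] by auto
  have "\<forall>\<^sub>F h in at 0. dist (LINT x|lborel. \<bar>g (x + h) - g x\<bar>) 0 < e / 3"
    using gt \<open>e > 0\<close> unfolding l1_translation_continuous_def by (intro tendstoD) auto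
  then show "\<forall>\<^sub>F h in at 0. dist (LINT x|lborel. \<bar>f (x + h) - f x\<bar>) 0 < e"
  proof eventually_elim
    case (elim h)
    have "(LINT x|lborel. \<bar>f (x + h) - f x\<bar>) \<le>
      (LINT x|lborel. \<bar>f (x + h) - g (x + h)\<bar> + (\<bar>g (x + h) - g x\<bar> + \<bar>f x - g x\<bar>))"
      using f gi integrable_shift[OF f, of h] integrable_shift[OF gi, of h]
      by (intro integral_mono) auto
    also have "\<dots> = (LINT x|lborel. \<bar>f (x + h) - g (x + h)\<bar>) + (LINT x|lborel. \<bar>g (x + h) - g x\<bar>)
        + (LINT x|lborel. \<bar>f x - g x\<bar>)"
      using f gi integrable_shift[OF f, of h] integrable_shift[OF gi, of h] by simp
    also have "(LINT x|lborel. \<bar>f (x + h) - g (x + h)\<bar>) = (LINT x|lborel. \<bar>f x - g x\<bar>)"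
      using integral_shift[of "\<lambda>x. \<bar>f x - g x\<bar>" h] by simp
    finally show ?case using gd elim by (simp add: dist_real_def)
  qed
qed

text \<open>Openness makes the indicator at x + h eventually 1 for x in U. Hence the overlap of U
  with its translate tends to the measure of U by dominated convergence, and the symmetric
  difference is twice the measure minus twice the overlap. Points outside U are removed by the
  factor \<open>indicator U x\<close>.\<close>

lemma l1_translation_continuous_open:
  assumes U: "open U" "emeasure lborel U < \<infinity>"
  shows "l1_translation_continuous (indicator U)"
proof -
  have iU: "integrable lborel (indicator U :: real \<Rightarrow> real)"
    using U by (intro integrable_real_indicator) auto
  have "(\<lambda>h. LINT x|lborel. \<bar>indicator U (x + h) - indicator U x\<bar> :: real) \<midarrow>0\<rightarrow> 0"
    unfolding tendsto_at_iff_sequentially comp_def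
  proof (intro allI impI)
    fix X :: "nat \<Rightarrow> real" assume X: "\<forall>i. X i \<in> UNIV - {0}" "X \<longlonglongrightarrow> 0"
    have iX: "integrable lborel (\<lambda>x. indicator U x * indicator U (x + X n) :: real)" for n
      by (rule Bochner_Integration.integrable_bound[OF iU]) (use U(1) borel_measurable_integrable[OF iU]
         borel_measurable_integrable[OF integrable_shift[OF iU, of "X n"]] in \<open>auto simp: indicator_def[abs_def] split: if_splits\<close>)
    have "(\<lambda>n. LINT x|lborel. indicator U x * indicator U (x + X n) :: real) \<longlonglongrightarrow> (LINT x|lborel. indicator U x)"
    proof (rule integral_dominated_convergence[where w = "indicator U"])
      show "AE x in lborel. (\<lambda>n. indicator U x * indicator U (x + X n) :: real) \<longlonglongrightarrow> indicator U x"
      proof (intro AE_I2)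
        fix x
        show "(\<lambda>n. indicator U x * indicator U (x + X n) :: real) \<longlonglongrightarrow> indicator U x"
        proof (cases "x \<in> U")
          case True
          have "(\<lambda>n. x + X n) \<longlonglongrightarrow> x + 0" by (intro tendsto_intros X)
          then have "\<forall>\<^sub>F n in sequentially. x + X n \<in> U"
            using topological_tendstoD[OF _ U(1)] True by fastforce
          then have "\<forall>\<^sub>F n in sequentially. indicator U x * indicator U (x + X n) = (1::real)"
            by eventually_elim (use True in auto)
          then show ?thesis using True by (simp add: tendsto_eventually)
        qed simp
      qed
    qed (use iU borel_measurable_integrable[OF iU] borel_measurable_integrable[OF iX] in \<open>auto simp: indicator_def[abs_def]\<close>)
    then have "(\<lambda>n. (LINT x|lborel. indicator U x) + (LINT x|lborel. indicator U x)
        - 2 * (LINT x|lborel. indicator U x * indicator U (x + X n)) :: real) \<longlonglongrightarrow>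
        (LINT x|lborel. indicator U x) + (LINT x|lborel. indicator U x) - 2 * (LINT x|lborel. indicator U x)"
      by (intro tendsto_intros)
    moreover have "(LINT x|lborel. \<bar>indicator U (x + X n) - indicator U x\<bar>) =
      (LINT x|lborel. indicator U x) + (LINT x|lborel. indicator U x)
        - 2 * (LINT x|lborel. indicator U x * indicator U (x + X n) :: real)" for n
    proof -
      have "(LINT x|lborel. \<bar>indicator U (x + X n) - indicator U x\<bar> :: real) =
        (LINT x|lborel. indicator U (x + X n) + indicator U x - 2 * (indicator U x * indicator U (x + X n)))"
        by (intro Bochner_Integration.integral_cong) (auto simp: indicator_def)
      also have "\<dots> = (LINT x|lborel. indicator U (x + X n)) + (LINT x|lborel. indicator U x)
        - 2 * (LINT x|lborel. indicator U x * indicator U (x + X n))"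
        using iU iX[of n] integrable_shift[OF iU, of "X n"] by simp
      also have "(LINT x|lborel. indicator U (x + X n) :: real) = (LINT x|lborel. indicator U x)"
        by (rule integral_shift)
      finally show ?thesis .
    qed
    ultimately show "(\<lambda>n. LINT x|lborel. \<bar>indicator U (x + X n) - indicator U x\<bar> :: real) \<longlonglongrightarrow> 0"
      by simp
  qed
  then show ?thesis by (simp add: l1_translation_continuous_def)
qed

text \<open>Outer regularity: an open set exceeding A by measure below e approximates the indicator
  of A in the mean, and its measure is finite because that of A is.\<close>

lemma l1_translation_continuous_indicator:
  assumes A: "A \<in> sets lborel" "emeasure lborel A < \<infinity>"
  shows "l1_translation_continuous (indicator A)"
proof (rule l1_translation_continuous_approx)
  show "integrable lborel (indicator A :: real \<Rightarrow> real)"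
    using A by (intro integrable_real_indicator) auto
  fix e :: real assume "e > 0"
  have "A \<in> sets lebesgue" using A(1) by auto
  then obtain U where U: "open U" "A \<subseteq> U" "emeasure lebesgue (U - A) < ennreal e"
    using sets_lebesgue_outer_open \<open>e > 0\<close> by metis
  have Um: "U \<in> sets lborel" "U - A \<in> sets lborel" using U(1) A by auto
  have e: "emeasure lborel (U - A) < ennreal e"
    using U(3) Um by simp
  have "ennreal e < \<infinity>" by simp
  with e have fin: "emeasure lborel (U - A) < \<infinity>" by (rule less_trans)
  have "emeasure lborel U = emeasure lborel (A \<union> (U - A))" using U(2) by (simp add: Un_absorb1)
  also have "\<dots> \<le> emeasure lborel A + emeasure lborel (U - A)"
    by (intro emeasure_subadditive) (use A Um in auto)
  also have "\<dots> < \<infinity>" using fin A(2) by (simp add: ennreal_add_less_top)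
  finally have Ufin: "emeasure lborel U < \<infinity>" .
  have "(LINT x|lborel. \<bar>indicator A x - indicator U x\<bar>) = (LINT x|lborel. indicator (U - A) x :: real)"
    using U(2) by (intro Bochner_Integration.integral_cong) (auto simp: indicator_def)
  also have "\<dots> = measure lborel (U - A)" using Um by simp
  also have "\<dots> < e" using e \<open>e > 0\<close> fin
    by (metis emeasure_eq_ennreal_measure ennreal_less_iff infinity_ennreal_def measure_nonneg order_less_irrefl)
  finally show "\<exists>g. integrable lborel g \<and> l1_translation_continuous g \<and> (LINT x|lborel. \<bar>indicator A x - g x\<bar>) < e"
    using l1_translation_continuous_open[OF U(1) Ufin] Ufin Um
    by (intro exI[of _ "indicator U"]) (auto intro!: integrable_real_indicator)
qed

lemma l1_translation_continuous_add:
  assumes f: "integrable lborel f" "l1_translation_continuous f"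
    and g: "integrable lborel g" "l1_translation_continuous g"
  shows "l1_translation_continuous (\<lambda>x. f x + g x)"
  unfolding l1_translation_continuous_def
proof (rule Lim_null_comparison[where g = "\<lambda>h. (LINT x|lborel. \<bar>f (x + h) - f x\<bar>) + (LINT x|lborel. \<bar>g (x + h) - g x\<bar>)"])
  show "((\<lambda>h. (LINT x|lborel. \<bar>f (x + h) - f x\<bar>) + (LINT x|lborel. \<bar>g (x + h) - g x\<bar>)) \<longlongrightarrow> 0) (at 0)"
    using tendsto_add[OF f(2)[unfolded l1_translation_continuous_def] g(2)[unfolded l1_translation_continuous_def]] by simp
  show "\<forall>\<^sub>F h in at 0. norm (LINT x|lborel. \<bar>f (x + h) + g (x + h) - (f x + g x)\<bar>)
      \<le> (LINT x|lborel. \<bar>f (x + h) - f x\<bar>) + (LINT x|lborel. \<bar>g (x + h) - g x\<bar>)"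
  proof (rule always_eventually, rule allI)
    fix h
    have "(LINT x|lborel. \<bar>f (x + h) + g (x + h) - (f x + g x)\<bar>) \<le>
       (LINT x|lborel. \<bar>f (x + h) - f x\<bar> + \<bar>g (x + h) - g x\<bar>)"
      using f(1) g(1) integrable_shift[OF f(1), of h] integrable_shift[OF g(1), of h]
      by (intro integral_mono) auto
    also have "\<dots> = (LINT x|lborel. \<bar>f (x + h) - f x\<bar>) + (LINT x|lborel. \<bar>g (x + h) - g x\<bar>)"
      using f(1) g(1) integrable_shift[OF f(1), of h] integrable_shift[OF g(1), of h] by simp
    finally show "norm (LINT x|lborel. \<bar>f (x + h) + g (x + h) - (f x + g x)\<bar>)
      \<le> (LINT x|lborel. \<bar>f (x + h) - f x\<bar>) + (LINT x|lborel. \<bar>g (x + h) - g x\<bar>)" by simp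
  qed
qed

theorem integrable_l1_translation_continuous:
  fixes f :: "real \<Rightarrow> real"
  assumes "integrable lborel f"
  shows "l1_translation_continuous f"
  using assms
proof (induction rule: integrable_induct)
  case (base A c)
  have "(\<lambda>h. \<bar>c\<bar> * (LINT x|lborel. \<bar>indicator A (x + h) - indicator A x\<bar>)) \<midarrow>0\<rightarrow> \<bar>c\<bar> * 0"
    using l1_translation_continuous_indicator[OF base]
    unfolding l1_translation_continuous_def by (intro tendsto_intros)
  moreover have "(LINT x|lborel. \<bar>indicator A (x + h) *\<^sub>R c - indicator A x *\<^sub>R c\<bar>) =
     \<bar>c\<bar> * (LINT x|lborel. \<bar>indicator A (x + h) - indicator A x\<bar>)" for h
    unfolding integral_mult_right_zero[symmetric]
    by (intro Bochner_Integration.integral_cong) (auto simp: indicator_def)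
  ultimately show ?case unfolding l1_translation_continuous_def by simp
next
  case (add f g)
  then show ?case by (intro l1_translation_continuous_add)
next
  case (lim f s)
  show ?case
  proof (rule l1_translation_continuous_approx[OF lim(4)])
    fix e :: real assume "e > 0"
    have "(\<lambda>i. LINT x|lborel. \<bar>f x - s i x\<bar>) \<longlonglongrightarrow> (LINT x::real|lborel. 0)"
    proof (rule integral_dominated_convergence[where w = "\<lambda>x. 3 * \<bar>f x\<bar>"])
      show "AE x in lborel. (\<lambda>i. \<bar>f x - s i x\<bar>) \<longlonglongrightarrow> 0"
      proof (intro AE_I2)
        fix x have "(\<lambda>i. \<bar>f x - s i x\<bar>) \<longlonglongrightarrow> \<bar>f x - f x\<bar>" by (intro tendsto_intros lim(2)) simp
        then show "(\<lambda>i. \<bar>f x - s i x\<bar>) \<longlonglongrightarrow> 0" by simp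
      qed
      show "AE x in lborel. norm \<bar>f x - s i x\<bar> \<le> 3 * \<bar>f x\<bar>" for i
      proof (intro AE_I2)
        fix x show "norm \<bar>f x - s i x\<bar> \<le> 3 * \<bar>f x\<bar>" using lim(3)[of x i] by auto
      qed
    qed (use lim(1,4) in auto)
    then have "\<forall>\<^sub>F i in sequentially. dist (LINT x|lborel. \<bar>f x - s i x\<bar>) (LINT x::real|lborel. 0) < e"
      using \<open>e > 0\<close> by (rule tendstoD)
    then obtain i where "dist (LINT x|lborel. \<bar>f x - s i x\<bar>) (LINT x::real|lborel. 0) < e"
      by (auto simp: eventually_sequentially)
    then show "\<exists>g. integrable lborel g \<and> l1_translation_continuous g \<and> (LINT x|lborel. \<bar>f x - g x\<bar>) < e"
      using lim(1,5) by (intro exI[of _ "s i"]) (auto simp: dist_real_def)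
  qed
qed

text \<open>For nonnegative \<open>a\<close> and \<open>b\<close> one has \<open>(a - b)\<^sup>2 \<le> \<bar>a\<^sup>2 - b\<^sup>2\<bar>\<close>, which reduces the claim
  to continuity of translation in the mean for the integrable function \<open>f\<^sup>2\<close>.\<close>

lemma l2_translation_continuous_nonneg:
  fixes f :: "real \<Rightarrow> real"
  assumes f: "square_integrable f" and nonneg: "\<And>x. f x \<ge> 0"
  shows "(\<lambda>h. l2_norm (\<lambda>x. f (x + h) - f x)) \<midarrow>0\<rightarrow> 0"
proof (rule Lim_null_comparison[where g = "\<lambda>h. sqrt (LINT x|lborel. \<bar>(f (x + h))\<^sup>2 - (f x)\<^sup>2\<bar>)"])
  have int: "integrable lborel (\<lambda>x. (f x)\<^sup>2)" using square_integrableD(2)[OF f] by simp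
  have "(\<lambda>h. sqrt (LINT x|lborel. \<bar>(f (x + h))\<^sup>2 - (f x)\<^sup>2\<bar>)) \<midarrow>0\<rightarrow> sqrt 0"
    using integrable_l1_translation_continuous[OF int] unfolding l1_translation_continuous_def
    by (intro tendsto_intros)
  then show "(\<lambda>h. sqrt (LINT x|lborel. \<bar>(f (x + h))\<^sup>2 - (f x)\<^sup>2\<bar>)) \<midarrow>0\<rightarrow> 0" by simp
  have pt: "(a - b)\<^sup>2 \<le> \<bar>a\<^sup>2 - b\<^sup>2\<bar>" if "a \<ge> 0" "b \<ge> 0" for a b :: real
  proof -
    have "\<bar>a - b\<bar> * \<bar>a - b\<bar> \<le> \<bar>a - b\<bar> * \<bar>a + b\<bar>" using that by (intro mult_left_mono) auto
    also have "\<dots> = \<bar>a\<^sup>2 - b\<^sup>2\<bar>" unfolding abs_mult[symmetric] by (simp add: power2_eq_square algebra_simps)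
    finally show ?thesis by (simp add: power2_eq_square)
  qed
  show "\<forall>\<^sub>F h in at 0. norm (l2_norm (\<lambda>x. f (x + h) - f x)) \<le> sqrt (LINT x|lborel. \<bar>(f (x + h))\<^sup>2 - (f x)\<^sup>2\<bar>)"
  proof (rule always_eventually, rule allI)
    fix h
    have "(LINT x|lborel. (f (x + h) - f x)\<^sup>2) \<le> (LINT x|lborel. \<bar>(f (x + h))\<^sup>2 - (f x)\<^sup>2\<bar>)"
      using int integrable_shift[OF int, of h] pt[OF nonneg nonneg]
        square_integrableD(2)[OF square_integrable_diff[OF square_integrable_shift[OF f] f], of h]
      by (intro integral_mono) auto
    then show "norm (l2_norm (\<lambda>x. f (x + h) - f x)) \<le> sqrt (LINT x|lborel. \<bar>(f (x + h))\<^sup>2 - (f x)\<^sup>2\<bar>)"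
      by (simp add: l2_norm_def)
  qed
qed

text \<open>Real and imaginary part are split into positive and negative parts, because the
  comparison of squares behind the preceding lemma works for nonnegative functions.\<close>

theorem l2_translation_continuous:
  fixes f :: "real \<Rightarrow> complex"
  assumes f: "square_integrable f"
  shows "(\<lambda>h. l2_norm (\<lambda>x. f (x + h) - f x)) \<midarrow>0\<rightarrow> 0"
proof -
  define p where "p = (\<lambda>(i::nat) x. if i = 0 then max 0 (Re (f x)) else if i = 1 then max 0 (- Re (f x))
      else if i = 2 then max 0 (Im (f x)) else max 0 (- Im (f x)))"
  have fm: "f \<in> borel_measurable borel" using square_integrableD(1)[OF f] .
  have p: "square_integrable (p i)" for i
  proof (rule square_integrable_bound[OF f, of _ 1])
    show "p i \<in> borel_measurable borel" using fm unfolding p_def by measurable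
    show "AE x in lborel. norm (p i x) \<le> 1 * norm (f x)"
      using abs_Re_le_cmod[of "f _"] abs_Im_le_cmod[of "f _"] by (intro AE_I2) (auto simp: p_def max_def abs_le_iff)
  qed
  have p0: "p i x \<ge> 0" for i x by (auto simp: p_def)
  let ?d = "\<lambda>h i x. p i (x + h) - p i x"
  have sq: "square_integrable (?d h i)" for h i by (intro square_integrable_diff square_integrable_shift p)
  show ?thesis
  proof (rule Lim_null_comparison[where g = "\<lambda>h. \<Sum>i<4. l2_norm (?d h i)"])
    have "(\<lambda>h. \<Sum>i<4. l2_norm (?d h i)) \<midarrow>0\<rightarrow> (\<Sum>i<(4::nat). 0)"
      by (intro tendsto_sum l2_translation_continuous_nonneg p p0)
    then show "(\<lambda>h. \<Sum>i<4. l2_norm (?d h i)) \<midarrow>0\<rightarrow> 0" by simp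
    show "\<forall>\<^sub>F h in at 0. norm (l2_norm (\<lambda>x. f (x + h) - f x)) \<le> (\<Sum>i<4. l2_norm (?d h i))"
    proof (rule always_eventually, rule allI)
      fix h
      have eq: "Re (f x) = p 0 x - p 1 x" "Im (f x) = p 2 x - p 3 x" for x by (auto simp: p_def)
      have "norm (f (x + h) - f x) \<le> (\<Sum>i<4. \<bar>?d h i x\<bar>)" for x
      proof -
        have "norm (f (x + h) - f x) \<le> \<bar>Re (f (x + h) - f x)\<bar> + \<bar>Im (f (x + h) - f x)\<bar>" by (rule cmod_le)
        also have "\<dots> \<le> (\<Sum>i<4. \<bar>?d h i x\<bar>)" by (simp add: eq eval_nat_numeral)
        finally show ?thesis .
      qed
      then have "l2_norm (\<lambda>x. f (x + h) - f x) \<le> 1 * l2_norm (\<lambda>x. \<Sum>i<4. \<bar>?d h i x\<bar>)"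
        using sq square_integrable_norm[OF sq] square_integrable_shift[OF f, of h] fm
        by (intro l2_norm_bound square_integrable_sum AE_I2) auto
      also have "\<dots> \<le> (\<Sum>i<4. l2_norm (\<lambda>x. \<bar>?d h i x\<bar>))"
        using l2_norm_sum_le[of "{..<4}" "\<lambda>i x. \<bar>?d h i x\<bar>"] square_integrable_norm[OF sq] by auto
      also have "\<dots> = (\<Sum>i<4. l2_norm (?d h i))" by (simp add: l2_norm_def)
      finally show "norm (l2_norm (\<lambda>x. f (x + h) - f x)) \<le> (\<Sum>i<4. l2_norm (?d h i))" by simp
    qed
  qed
qed

section \<open>The Fourier transform on square integrable functions\<close>

lemma norm_exp_minus_i [simp]: "norm (exp (- (\<i> * complex_of_real t))) = 1"
  using norm_exp_i_times[of "- t"] by simp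

lemma norm_exp_minus_i_mult [simp]: "norm (exp (- (\<i> * (complex_of_real t * complex_of_real s)))) = 1"
  using norm_exp_minus_i[of "t * s"] by simp

lemma cnj_exp_minus_i: "cnj (exp (- (\<i> * complex_of_real t))) = exp (\<i> * complex_of_real t)"
  by (simp add: exp_cnj)

lemma borel_measurable_cnj [measurable]:
  "f \<in> borel_measurable M \<Longrightarrow> (\<lambda>x. cnj (f x)) \<in> borel_measurable M"
  by (rule measurable_compose[of f M borel cnj])
     (auto intro!: borel_measurable_continuous_onI continuous_intros)

definition ft :: "(real \<Rightarrow> complex) \<Rightarrow> real \<Rightarrow> complex" where
  "ft f k = complex_of_real (1 / sqrt (2 * pi)) *
     (LINT x|lborel. exp (- (\<i> * complex_of_real (k * x))) * f x)"

lemma integrable_exp_mult: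
  assumes "integrable lborel f"
  shows "integrable lborel (\<lambda>x. exp (- (\<i> * complex_of_real (k * x))) * f x)"
  by (rule Bochner_Integration.integrable_bound[OF assms])
     (use borel_measurable_integrable[OF assms] in \<open>auto simp: norm_mult simp del: of_real_mult\<close>)

lemma ft_measurable [measurable]:
  assumes [measurable]: "f \<in> borel_measurable borel"
  shows "ft f \<in> borel_measurable borel"
  unfolding ft_def by measurable

lemma ft_add:
  assumes "integrable lborel f" "integrable lborel g"
  shows "ft (\<lambda>x. f x + g x) k = ft f k + ft g k"
  using integrable_exp_mult[OF assms(1), of k] integrable_exp_mult[OF assms(2), of k]
  by (simp add: ft_def distrib_left)

lemma ft_cmult: "ft (\<lambda>x. c * f x) k = c * ft f k"
proof -
  have "(LINT x|lborel. exp (- (\<i> * complex_of_real (k * x))) * (c * f x)) =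
     (LINT x|lborel. c * (exp (- (\<i> * complex_of_real (k * x))) * f x))"
    by (intro Bochner_Integration.integral_cong) auto
  then show ?thesis by (simp add: ft_def)
qed

lemma ft_diff:
  assumes "integrable lborel f" "integrable lborel g"
  shows "ft (\<lambda>x. f x - g x) k = ft f k - ft g k"
  using integrable_exp_mult[OF assms(1), of k] integrable_exp_mult[OF assms(2), of k]
  by (simp add: ft_def right_diff_distrib)

lemma integrable_product_bound:
  fixes f :: "real \<Rightarrow> 'a::{banach, second_countable_topology}"
    and g :: "real \<Rightarrow> 'b::{banach, second_countable_topology}"
    and F :: "real \<Rightarrow> real \<Rightarrow> 'c::{banach, second_countable_topology}"
  assumes f: "integrable lborel f" and g: "integrable lborel g"
    and F: "case_prod F \<in> borel_measurable (lborel \<Otimes>\<^sub>M lborel)"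
    and bound: "\<And>x y. norm (F x y) \<le> norm (f x) * norm (g y)"
  shows "integrable (lborel \<Otimes>\<^sub>M lborel) (case_prod F)"
proof (rule Bochner_Integration.integrable_bound)
  have [measurable]: "f \<in> borel_measurable borel" "g \<in> borel_measurable borel" using f g by auto
  show "integrable (lborel \<Otimes>\<^sub>M lborel) (\<lambda>(x, y). norm (f x) * norm (g y))"
  proof (rule lborel_pair.Fubini_integrable)
    show "integrable lborel (\<lambda>x. LINT y|lborel. norm (case (x, y) of (x, y) \<Rightarrow> norm (f x) * norm (g y)))"
      using f g by simp
    show "AE x in lborel. integrable lborel (\<lambda>y. case (x, y) of (x, y) \<Rightarrow> norm (f x) * norm (g y))"
      using g by simp
  qed measurable
  show "AE x in lborel \<Otimes>\<^sub>M lborel. norm (case_prod F x) \<le> norm (case x of (x, y) \<Rightarrow> norm (f x) * norm (g y))"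
    using bound by auto
qed (rule F)

text \<open>The kernel exp(-ikx) is symmetric in k and x, so Fubini moves the transform from one
  factor to the other.\<close>

lemma ft_multiplication_formula:
  assumes f: "integrable lborel f" and g: "integrable lborel g"
  shows "(LINT k|lborel. ft f k * g k) = (LINT x|lborel. f x * ft g x)"
proof -
  have [measurable]: "f \<in> borel_measurable borel" "g \<in> borel_measurable borel" using f g by auto
  let ?e = "\<lambda>t. exp (- (\<i> * complex_of_real t))"
  let ?c = "complex_of_real (1 / sqrt (2 * pi))"
  have int: "integrable (lborel \<Otimes>\<^sub>M lborel) (\<lambda>(x, k). ?e (k * x) * f x * g k)"
    by (rule integrable_product_bound[OF f g]) (auto simp: norm_mult simp del: of_real_mult)
  have "(LINT k|lborel. ft f k * g k) = (LINT k|lborel. ?c * (LINT x|lborel. ?e (k * x) * f x * g k))"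
    by (simp only: ft_def integral_mult_left_zero) (simp only: mult.assoc)
  also have "\<dots> = ?c * (LINT k|lborel. (LINT x|lborel. ?e (k * x) * f x * g k))" by simp
  also have "(LINT k|lborel. (LINT x|lborel. ?e (k * x) * f x * g k)) =
      (LINT x|lborel. (LINT k|lborel. ?e (k * x) * f x * g k))"
    using lborel_pair.Fubini_integral[OF int] .
  also have "\<dots> = (LINT x|lborel. f x * (LINT k|lborel. ?e (x * k) * g k))"
    by (simp only: integral_mult_right_zero[symmetric]) (simp add: mult_ac)
  also have "?c * \<dots> = (LINT x|lborel. ?c * (f x * (LINT k|lborel. ?e (x * k) * g k)))" by simp
  also have "\<dots> = (LINT x|lborel. f x * ft g x)" by (simp add: ft_def mult_ac)
  finally show ?thesis .
qed

text \<open>The characteristic function of the standard normal distribution, read at frequency -t/e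
  after the substitution x -> e x.\<close>

lemma ft_gaussian:
  assumes e: "e > 0"
  shows "ft (\<lambda>k. complex_of_real (exp (- ((e * k)\<^sup>2 / 2)))) t = complex_of_real (exp (- ((t / e)\<^sup>2 / 2)) / e)"
proof -
  have char: "(LINT x|lborel. complex_of_real (std_normal_density x) * exp (\<i> * complex_of_real (s * x))) =
     complex_of_real (exp (- (s\<^sup>2 / 2)))" for s
  proof -
    have "char std_normal_distribution s = complex_of_real (exp (- (s\<^sup>2) / 2))"
      by (simp add: char_std_normal_distribution)
    moreover have "char std_normal_distribution s = 
       (LINT x|lborel. std_normal_density x *\<^sub>R exp (\<i> * complex_of_real (s * x)))"
      unfolding char_def by (subst integral_density) (auto simp: normal_density_nonneg)
    ultimately show ?thesis by (simp add: scaleR_conv_of_real)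
  qed
  let ?e = "\<lambda>t. exp (- (\<i> * complex_of_real t))"
  have "complex_of_real (exp (- ((t / e)\<^sup>2 / 2))) = 
      (LINT x|lborel. complex_of_real (std_normal_density x) * exp (\<i> * complex_of_real (- (t / e) * x)))"
    using char[of "- (t / e)", symmetric] by (simp only: power2_minus)
  also have "\<dots> = \<bar>e\<bar> *\<^sub>R (LINT x|lborel. complex_of_real (std_normal_density (0 + e * x)) *
       exp (\<i> * complex_of_real (- (t / e) * (0 + e * x))))"
    using e by (intro lborel_integral_real_affine) auto
  also have "(LINT x|lborel. complex_of_real (std_normal_density (0 + e * x)) *
       exp (\<i> * complex_of_real (- (t / e) * (0 + e * x)))) =
     (LINT x|lborel. complex_of_real (1 / sqrt (2 * pi)) * (?e (t * x) * complex_of_real (exp (- ((e * x)\<^sup>2 / 2)))))"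
    using e by (intro Bochner_Integration.integral_cong) (auto simp: std_normal_density_def)
  also have "\<dots> = ft (\<lambda>k. complex_of_real (exp (- ((e * k)\<^sup>2 / 2)))) t"
    by (simp add: ft_def)
  finally show ?thesis using e by (simp add: scaleR_conv_of_real field_simps)
qed

lemma integrable_gaussian:
  assumes "e > 0"
  shows "integrable lborel (\<lambda>k::real. exp (- ((e * k)\<^sup>2 / 2)))"
proof -
  have "integrable lborel (\<lambda>x. std_normal_density (0 + e * x))"
    using assms integrable_normal_moment[of 1 0 0] by (intro lborel_integrable_real_affine) auto
  then have "integrable lborel (\<lambda>x. sqrt (2 * pi) * std_normal_density (0 + e * x))" by simp
  then show ?thesis by (simp add: std_normal_density_def)
qed

text \<open>The autocorrelation of f: its transform is a multiple of |ft f|^2 and its value at 0 is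
  the squared L^2 norm, so Plancherel's theorem amounts to Fourier inversion of this one function at
  the single point 0.\<close>

definition autocorr :: "(real \<Rightarrow> complex) \<Rightarrow> real \<Rightarrow> complex" where
  "autocorr f t = (LINT y|lborel. f (y + t) * cnj (f y))"

lemma integrable_autocorr_kernel:
  fixes f :: "real \<Rightarrow> complex"
  assumes f: "integrable lborel f"
  shows "integrable (lborel \<Otimes>\<^sub>M lborel) (\<lambda>(y, t). f (y + t) * cnj (f y))"
proof (rule lborel_pair.Fubini_integrable)
  have [measurable]: "f \<in> borel_measurable borel" using f by auto
  show "(\<lambda>(y, t). f (y + t) * cnj (f y)) \<in> borel_measurable (lborel \<Otimes>\<^sub>M lborel)" by measurable
  have "(LINT t|lborel. norm (f (y + t) * cnj (f y))) = (LINT t|lborel. norm (f t)) * norm (f y)" for y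
    using integral_shift[of "\<lambda>t::real. norm (f t)" y] by (simp add: norm_mult add.commute)
  then show "integrable lborel (\<lambda>y. LINT t|lborel. norm (case (y, t) of (y, t) \<Rightarrow> f (y + t) * cnj (f y)))"
    using f by simp
  show "AE y in lborel. integrable lborel (\<lambda>t. case (y, t) of (y, t) \<Rightarrow> f (y + t) * cnj (f y))"
    using integrable_shift[OF f] by (auto simp: add.commute)
qed

lemma integrable_autocorr: "integrable lborel f \<Longrightarrow> integrable lborel (autocorr f)"
  unfolding autocorr_def[abs_def]
  using lborel_pair.integrable_snd[of "\<lambda>y t. f (y + t) * cnj (f y)"] integrable_autocorr_kernel by auto

lemma ft_autocorr:
  assumes f: "integrable lborel f"
  shows "ft (autocorr f) k = complex_of_real (sqrt (2 * pi) * (norm (ft f k))\<^sup>2)"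
proof -
  let ?e = "\<lambda>t. exp (- (\<i> * complex_of_real t))"
  let ?c = "complex_of_real (1 / sqrt (2 * pi))"
  have [measurable]: "f \<in> borel_measurable borel" using f by auto
  have int: "integrable (lborel \<Otimes>\<^sub>M lborel) (\<lambda>(y, t). ?e (k * t) * (f (y + t) * cnj (f y)))"
    by (rule Bochner_Integration.integrable_bound[OF integrable_autocorr_kernel[OF f]])
       (auto simp: norm_mult simp del: of_real_mult)
  \<comment> \<open>Substituting x = y + t splits the phase kt into kx - ky, so the integral over t
    factors.\<close>
  have inner: "(LINT t|lborel. ?e (k * t) * (f (y + t) * cnj (f y))) = cnj (?e (k * y) * f y) * (LINT x|lborel. ?e (k * x) * f x)" for y
  proof -
    have "(LINT t|lborel. ?e (k * t) * (f (y + t) * cnj (f y))) =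
      (LINT t|lborel. cnj (?e (k * y) * f y) * (?e (k * (t + y)) * f (t + y)))"
    proof (intro Bochner_Integration.integral_cong refl)
      fix t
      have "cnj (?e (k * y)) * ?e (k * (t + y)) = ?e (k * t)"
        unfolding cnj_exp_minus_i exp_add[symmetric] by (simp add: algebra_simps)
      then show "?e (k * t) * (f (y + t) * cnj (f y)) = cnj (?e (k * y) * f y) * (?e (k * (t + y)) * f (t + y))"
        by (simp add: add.commute mult_ac del: of_real_mult of_real_add)
    qed
    also have "\<dots> = cnj (?e (k * y) * f y) * (LINT t|lborel. ?e (k * (t + y)) * f (t + y))" by simp
    also have "(LINT t|lborel. ?e (k * (t + y)) * f (t + y)) = (LINT x|lborel. ?e (k * x) * f x)"
      by (rule integral_shift)
    finally show ?thesis .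
  qed
  have "ft (autocorr f) k = ?c * (LINT t|lborel. (LINT y|lborel. ?e (k * t) * (f (y + t) * cnj (f y))))"
    by (simp add: ft_def autocorr_def)
  also have "(LINT t|lborel. (LINT y|lborel. ?e (k * t) * (f (y + t) * cnj (f y)))) =
     (LINT y|lborel. (LINT t|lborel. ?e (k * t) * (f (y + t) * cnj (f y))))"
    using lborel_pair.Fubini_integral[OF int] .
  also have "\<dots> = (LINT y|lborel. cnj (?e (k * y) * f y)) * (LINT x|lborel. ?e (k * x) * f x)"
    unfolding inner by simp
  also have "(LINT y|lborel. cnj (?e (k * y) * f y)) = cnj (LINT y|lborel. ?e (k * y) * f y)"
    by (rule Bochner_Integration.integral_cnj)
  also have "?c * (cnj (LINT y|lborel. ?e (k * y) * f y) * (LINT x|lborel. ?e (k * x) * f x)) =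
     complex_of_real (sqrt (2 * pi)) * (ft f k * cnj (ft f k))"
    by (simp add: ft_def field_simps power2_eq_square[symmetric] of_real_power[symmetric] del: of_real_power)
  also have "\<dots> = complex_of_real (sqrt (2 * pi) * (norm (ft f k))\<^sup>2)"
    by (simp only: complex_norm_square of_real_mult)
  finally show ?thesis .
qed

lemma norm_autocorr_le:
  assumes f: "square_integrable f"
  shows "norm (autocorr f t) \<le> (l2_norm f)\<^sup>2"
proof -
  have "norm (autocorr f t) \<le> (LINT y|lborel. norm (f (y + t)) * norm (f y))"
    unfolding autocorr_def by (rule order_trans[OF integral_norm_bound]) (simp add: norm_mult)
  also have "\<dots> \<le> l2_norm (\<lambda>y. f (y + t)) * l2_norm f"
    by (intro l2_cauchy_schwarz square_integrable_shift f)
  finally show ?thesis by (simp add: l2_norm_shift power2_eq_square)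
qed

lemma square_integrable_cnj: "square_integrable f \<Longrightarrow> square_integrable (\<lambda>x. cnj (f x))"
  by (auto simp: square_integrable_def)

text \<open>By Cauchy-Schwarz the deviation is at most the L^2 distance of f to its translate times
  the norm of f.\<close>

lemma autocorr_tendsto:
  assumes f: "square_integrable f"
  shows "autocorr f \<midarrow>0\<rightarrow> complex_of_real ((l2_norm f)\<^sup>2)"
proof -
  have "(LINT y|lborel. f y * cnj (f y)) = (LINT y|lborel. complex_of_real ((norm (f y))\<^sup>2))"
    by (simp only: complex_norm_square)
  also have "\<dots> = complex_of_real ((l2_norm f)\<^sup>2)"
    unfolding l2_norm_sq by (rule integral_complex_of_real)
  finally have 0: "(LINT y|lborel. f y * cnj (f y)) = complex_of_real ((l2_norm f)\<^sup>2)" .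
  have "(\<lambda>t. autocorr f t - complex_of_real ((l2_norm f)\<^sup>2)) \<midarrow>0\<rightarrow> 0"
  proof (rule Lim_null_comparison[where g = "\<lambda>t. l2_norm (\<lambda>x. f (x + t) - f x) * l2_norm f"])
    have "(\<lambda>t. l2_norm (\<lambda>x. f (x + t) - f x) * l2_norm f) \<midarrow>0\<rightarrow> 0 * l2_norm f"
      by (intro tendsto_intros l2_translation_continuous f)
    then show "(\<lambda>t. l2_norm (\<lambda>x. f (x + t) - f x) * l2_norm f) \<midarrow>0\<rightarrow> 0" by simp
    show "\<forall>\<^sub>F t in at 0. norm (autocorr f t - complex_of_real ((l2_norm f)\<^sup>2)) \<le> l2_norm (\<lambda>x. f (x + t) - f x) * l2_norm f"
    proof (rule always_eventually, rule allI)
      fix t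
      have sd: "square_integrable (\<lambda>x. f (x + t) - f x)" by (intro square_integrable_diff square_integrable_shift f)
      have "autocorr f t - complex_of_real ((l2_norm f)\<^sup>2) = (LINT y|lborel. f (y + t) * cnj (f y) - f y * cnj (f y))"
        unfolding autocorr_def 0[symmetric]
        by (intro Bochner_Integration.integral_diff[symmetric] square_integrable_mult_integrable square_integrable_shift square_integrable_cnj f)
      also have "\<dots> = (LINT y|lborel. (f (y + t) - f y) * cnj (f y))" by (simp add: algebra_simps)
      also have "norm \<dots> \<le> (LINT y|lborel. norm (f (y + t) - f y) * norm (f y))"
        by (rule order_trans[OF integral_norm_bound]) (simp add: norm_mult)
      also have "\<dots> \<le> l2_norm (\<lambda>x. f (x + t) - f x) * l2_norm f"
        by (rule l2_cauchy_schwarz[OF sd f])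
      finally show "norm (autocorr f t - complex_of_real ((l2_norm f)\<^sup>2)) \<le> l2_norm (\<lambda>x. f (x + t) - f x) * l2_norm f" .
    qed
  qed
  then show ?thesis by (simp add: LIM_zero_iff)
qed

lemma ft_bound:
  assumes "integrable lborel f"
  shows "norm (ft f k) \<le> (LINT x|lborel. norm (f x))"
proof -
  have "norm (ft f k) \<le> (1 / sqrt (2 * pi)) * (LINT x|lborel. norm (f x))"
    unfolding ft_def norm_mult
    by (intro mult_mono order_trans[OF integral_norm_bound]) (auto simp: norm_mult norm_divide)
  also have "\<dots> \<le> 1 * (LINT x|lborel. norm (f x))"
    by (intro mult_right_mono) (use pi_gt3 in \<open>auto simp: real_sqrt_ge_1_iff\<close>)
  finally show ?thesis by simp
qed

text \<open>A regularized Plancherel identity. The multiplication formula with a wide Gaussian moves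
  the transform from the autocorrelation to the Gaussian; rescaling x = e s turns the result into an
  average of the autocorrelation at scale e.\<close>

lemma ft_gaussian_mean:
  assumes f: "integrable lborel f" and e: "e > 0"
  shows "complex_of_real (LINT k|lborel. (norm (ft f k))\<^sup>2 * exp (- ((e * k)\<^sup>2 / 2))) =
    (LINT s|lborel. autocorr f (e * s) * complex_of_real (std_normal_density s))"
proof -
  let ?G = "\<lambda>k. complex_of_real (exp (- ((e * k)\<^sup>2 / 2)))"
  have G: "integrable lborel ?G" using integrable_gaussian[OF e] by simp
  have "complex_of_real (sqrt (2 * pi)) * complex_of_real (LINT k|lborel. (norm (ft f k))\<^sup>2 * exp (- ((e * k)\<^sup>2 / 2)))
     = complex_of_real (sqrt (2 * pi)) * (LINT k|lborel. complex_of_real ((norm (ft f k))\<^sup>2 * exp (- ((e * k)\<^sup>2 / 2))))"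
    by (simp only: integral_complex_of_real)
  also have "\<dots> = (LINT k|lborel. ft (autocorr f) k * ?G k)"
    unfolding ft_autocorr[OF f] integral_mult_right_zero[symmetric] by (simp add: mult_ac)
  also have "\<dots> = (LINT x|lborel. autocorr f x * ft ?G x)"
    by (rule ft_multiplication_formula[OF integrable_autocorr[OF f] G])
  also have "\<dots> = \<bar>e\<bar> *\<^sub>R (LINT s|lborel. autocorr f (0 + e * s) * ft ?G (0 + e * s))"
    using e by (intro lborel_integral_real_affine) auto
  also have "\<dots> = (LINT s|lborel. complex_of_real (sqrt (2 * pi)) * (autocorr f (e * s) * complex_of_real (std_normal_density s)))"
    unfolding scaleR_conv_of_real integral_mult_right_zero[symmetric] ft_gaussian[OF e] std_normal_density_def
    using e by (intro Bochner_Integration.integral_cong) (auto simp: mult_ac)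
  finally have "complex_of_real (sqrt (2 * pi)) * complex_of_real (LINT k|lborel. (norm (ft f k))\<^sup>2 * exp (- ((e * k)\<^sup>2 / 2)))
     = complex_of_real (sqrt (2 * pi)) * (LINT s|lborel. autocorr f (e * s) * complex_of_real (std_normal_density s))" by simp
  then show ?thesis by simp
qed

text \<open>Let e tend to 0 in the regularized identity. On the right the averages converge by
  domination to the limit of the autocorrelation at 0; on the left the Gaussians increase to 1, so
  monotone convergence delivers integrability of |ft f|^2 together with its integral.\<close>

theorem plancherel_l1_l2:
  assumes f1: "integrable lborel f" and f2: "square_integrable f"
  shows "square_integrable (ft f)" "l2_norm (ft f) = l2_norm f"
proof -
  have fm [measurable]: "f \<in> borel_measurable borel" using f1 by auto
  define e where "e = (\<lambda>n::nat. 1 / real (Suc n))"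
  have e: "e n > 0" for n by (simp add: e_def)
  have e0: "e \<longlonglongrightarrow> 0" unfolding e_def using LIMSEQ_inverse_real_of_nat by (simp add: inverse_eq_divide)
  have am: "autocorr f \<in> borel_measurable borel" using integrable_autocorr[OF f1] by auto
  have lim: "(\<lambda>n. (LINT s|lborel. autocorr f (e n * s) * complex_of_real (std_normal_density s)))
     \<longlonglongrightarrow> (LINT s|lborel. complex_of_real ((l2_norm f)\<^sup>2) * complex_of_real (std_normal_density s))"
  proof (rule integral_dominated_convergence[where w = "\<lambda>s. (l2_norm f)\<^sup>2 * std_normal_density s"])
    show "AE s in lborel. (\<lambda>n. autocorr f (e n * s) * complex_of_real (std_normal_density s)) \<longlonglongrightarrow>
       complex_of_real ((l2_norm f)\<^sup>2) * complex_of_real (std_normal_density s)"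
    \<comment> \<open>The limit of the autocorrelation is a punctured one, so e s must be nonzero;
      the point s = 0 is a null set.\<close>
    proof (rule AE_mp[OF AE_lborel_singleton[of 0]], intro AE_I2 impI)
      fix s :: real assume "s \<noteq> 0"
      have "(\<lambda>n. e n * s) \<longlonglongrightarrow> 0 * s" by (intro tendsto_intros e0)
      then have "(\<lambda>n. autocorr f (e n * s)) \<longlonglongrightarrow> complex_of_real ((l2_norm f)\<^sup>2)"
        using autocorr_tendsto[OF f2, unfolded tendsto_at_iff_sequentially comp_def, rule_format, of "\<lambda>n. e n * s"]
          e \<open>s \<noteq> 0\<close> by (simp add: less_imp_neq[THEN not_sym])
      then show "(\<lambda>n. autocorr f (e n * s) * complex_of_real (std_normal_density s)) \<longlonglongrightarrow>
       complex_of_real ((l2_norm f)\<^sup>2) * complex_of_real (std_normal_density s)"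
        by (intro tendsto_intros)
    qed
    show "integrable lborel (\<lambda>s. (l2_norm f)\<^sup>2 * std_normal_density s)"
      using integrable_normal_moment[of 1 0 0] by simp
    show "AE s in lborel. norm (autocorr f (e n * s) * complex_of_real (std_normal_density s))
       \<le> (l2_norm f)\<^sup>2 * std_normal_density s" for n
      using norm_autocorr_le[OF f2] by (intro AE_I2) (simp add: norm_mult mult_right_mono)
  qed (use am in measurable)
  also have "(LINT s|lborel. complex_of_real ((l2_norm f)\<^sup>2) * complex_of_real (std_normal_density s)) =
      complex_of_real ((l2_norm f)\<^sup>2)"
    using integral_normal_moment_even[of 1 0 0] by (simp add: integral_normal_density)
  finally have lim2: "(\<lambda>n. LINT k|lborel. (norm (ft f k))\<^sup>2 * exp (- ((e n * k)\<^sup>2 / 2))) \<longlonglongrightarrow> (l2_norm f)\<^sup>2"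
    unfolding ft_gaussian_mean[OF f1 e, symmetric] by (rule tendsto_of_real_iff[THEN iffD1])
  have intn: "integrable lborel (\<lambda>k. (norm (ft f k))\<^sup>2 * exp (- ((e n * k)\<^sup>2 / 2)))" for n
  proof (rule Bochner_Integration.integrable_bound)
    show "integrable lborel (\<lambda>k. (LINT x|lborel. norm (f x))\<^sup>2 * exp (- ((e n * k)\<^sup>2 / 2)))"
      using integrable_gaussian[OF e] by simp
    show "AE k in lborel. norm ((norm (ft f k))\<^sup>2 * exp (- ((e n * k)\<^sup>2 / 2)))
      \<le> norm ((LINT x|lborel. norm (f x))\<^sup>2 * exp (- ((e n * k)\<^sup>2 / 2)))"
      using ft_bound[OF f1] by (intro AE_I2) (auto intro!: mult_right_mono power_mono)
  qed measurable
  have "(\<lambda>n. \<integral>\<^sup>+ k. ennreal ((norm (ft f k))\<^sup>2 * exp (- ((e n * k)\<^sup>2 / 2))) \<partial>lborel) \<longlonglongrightarrow>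
     (\<integral>\<^sup>+ k. ennreal ((norm (ft f k))\<^sup>2) \<partial>lborel)"
  proof (rule nn_integral_LIMSEQ)
    show "incseq (\<lambda>n k. ennreal ((norm (ft f k))\<^sup>2 * exp (- ((e n * k)\<^sup>2 / 2))))"
    proof (rule incseq_SucI, rule le_funI)
      fix n k
      have "(e (Suc n) * k)\<^sup>2 \<le> (e n * k)\<^sup>2"
        unfolding power_mult_distrib by (intro mult_right_mono power_mono) (auto simp: e_def field_simps)
      then show "ennreal ((norm (ft f k))\<^sup>2 * exp (- ((e n * k)\<^sup>2 / 2)))
        \<le> ennreal ((norm (ft f k))\<^sup>2 * exp (- ((e (Suc n) * k)\<^sup>2 / 2)))"
        by (intro ennreal_leI mult_left_mono) auto
    qed
    show "(\<lambda>n. ennreal ((norm (ft f k))\<^sup>2 * exp (- ((e n * k)\<^sup>2 / 2)))) \<longlonglongrightarrow> ennreal ((norm (ft f k))\<^sup>2)" for k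
    proof (intro tendsto_ennrealI)
      have "(\<lambda>n. (norm (ft f k))\<^sup>2 * exp (- ((e n * k)\<^sup>2 / 2))) \<longlonglongrightarrow> (norm (ft f k))\<^sup>2 * exp (- ((0 * k)\<^sup>2 / 2))"
        by (intro tendsto_intros e0) auto
      then show "(\<lambda>n. (norm (ft f k))\<^sup>2 * exp (- ((e n * k)\<^sup>2 / 2))) \<longlonglongrightarrow> (norm (ft f k))\<^sup>2" by simp
    qed
  qed measurable
  moreover have "(\<integral>\<^sup>+ k. ennreal ((norm (ft f k))\<^sup>2 * exp (- ((e n * k)\<^sup>2 / 2))) \<partial>lborel) =
     ennreal (LINT k|lborel. (norm (ft f k))\<^sup>2 * exp (- ((e n * k)\<^sup>2 / 2)))" for n
    by (intro nn_integral_eq_integral intn) auto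
  ultimately have "(\<lambda>n. ennreal (LINT k|lborel. (norm (ft f k))\<^sup>2 * exp (- ((e n * k)\<^sup>2 / 2)))) \<longlonglongrightarrow>
     (\<integral>\<^sup>+ k. ennreal ((norm (ft f k))\<^sup>2) \<partial>lborel)" by simp
  then have nn: "(\<integral>\<^sup>+ k. ennreal ((norm (ft f k))\<^sup>2) \<partial>lborel) = ennreal ((l2_norm f)\<^sup>2)"
    by (rule LIMSEQ_unique) (rule tendsto_ennrealI[OF lim2])
  show s: "square_integrable (ft f)"
    by (rule square_integrable_nn_integralI[of _ "l2_norm f"]) (use nn in auto)
  show "l2_norm (ft f) = l2_norm f"
    using nn unfolding nn_integral_square[OF s] by (simp add: power2_eq_iff_nonneg)
qed

section \<open>The L^2 Fourier transform as a limit over truncations\<close>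

definition truncate :: "real \<Rightarrow> (real \<Rightarrow> complex) \<Rightarrow> real \<Rightarrow> complex" where
  "truncate R f x = indicator {-R..R} x * f x"

lemma truncate_measurable [measurable]:
  "f \<in> borel_measurable borel \<Longrightarrow> truncate R f \<in> borel_measurable borel"
  unfolding truncate_def[abs_def] by measurable

lemma norm_truncate_le: "norm (truncate R f x) \<le> norm (f x)"
  by (auto simp: truncate_def indicator_def)

lemma square_integrable_truncate: "square_integrable f \<Longrightarrow> square_integrable (truncate R f)"
  by (rule square_integrable_bound[where C = 1])
     (use norm_truncate_le in \<open>auto dest: square_integrableD\<close>)

lemma square_integrable_indicator: 
  "square_integrable (\<lambda>x. indicator {a..b} x :: 'a::{banach, second_countable_topology, real_normed_algebra_1})"
proof -
  have "integrable lborel (indicator {a..b} :: real \<Rightarrow> real)"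
    by (intro integrable_real_indicator) (auto simp: emeasure_lborel_Icc_eq)
  also have "(indicator {a..b} :: real \<Rightarrow> real) = (\<lambda>x. (norm (indicator {a..b} x :: 'a))\<^sup>2)"
    by (auto simp: indicator_def)
  finally show ?thesis by (simp add: square_integrable_def)
qed

lemma integrable_truncate: "square_integrable f \<Longrightarrow> integrable lborel (truncate R f)"
  unfolding truncate_def[abs_def]
  by (intro square_integrable_mult_integrable square_integrable_indicator)

lemma truncate_tendsto:
  assumes f: "square_integrable f"
  shows "((\<lambda>R. l2_norm (\<lambda>x. f x - truncate R f x)) \<longlongrightarrow> 0) at_top"
proof -
  have [measurable]: "f \<in> borel_measurable borel" using square_integrableD[OF f] by auto
  have "((\<lambda>R. LINT x|lborel. (norm (f x - truncate R f x))\<^sup>2) \<longlongrightarrow> (LINT x::real|lborel. 0)) at_top"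
  proof (rule integral_dominated_convergence_at_top[where w = "\<lambda>x. (norm (f x))\<^sup>2"])
    show "AE x in lborel. ((\<lambda>R. (norm (f x - truncate R f x))\<^sup>2) \<longlongrightarrow> 0) at_top"
    proof (intro AE_I2 tendsto_eventually)
      fix x
      show "\<forall>\<^sub>F R in at_top. (norm (f x - truncate R f x))\<^sup>2 = 0"
        by (rule eventually_mono[OF eventually_ge_at_top[of "\<bar>x\<bar>"]]) (auto simp: truncate_def indicator_def)
    qed
    show "\<forall>\<^sub>F R in at_top. AE x in lborel. norm ((norm (f x - truncate R f x))\<^sup>2) \<le> (norm (f x))\<^sup>2"
      by (intro always_eventually allI AE_I2) (auto simp: truncate_def indicator_def)
  qed (use square_integrableD(2)[OF f] in auto)
  then show ?thesis unfolding l2_norm_def using tendsto_real_sqrt by fastforce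
qed

text \<open>The relation \<open>is_fourier\<close> for complex functions, with the L^2 norm in place
  of the nonnegative integral. It stays a relation because transforms are determined only up to null
  sets.\<close>

definition l2_ft :: "(real \<Rightarrow> complex) \<Rightarrow> (real \<Rightarrow> complex) \<Rightarrow> bool" where
  "l2_ft f g \<longleftrightarrow> square_integrable f \<and> square_integrable g \<and>
     ((\<lambda>R. l2_norm (\<lambda>k. g k - ft (truncate R f) k)) \<longlongrightarrow> 0) at_top"

lemma l2_ftD:
  assumes "l2_ft f g"
  shows "square_integrable f" "square_integrable g"
    "((\<lambda>R. l2_norm (\<lambda>k. g k - ft (truncate R f) k)) \<longlongrightarrow> 0) at_top"
  using assms by (auto simp: l2_ft_def)

lemma square_integrable_ft_truncate: "square_integrable f \<Longrightarrow> square_integrable (ft (truncate R f))"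
  by (intro plancherel_l1_l2 integrable_truncate square_integrable_truncate)

lemma l2_norm_ft_diff:
  assumes "integrable lborel f" "square_integrable f" "integrable lborel g" "square_integrable g"
  shows "l2_norm (\<lambda>k. ft f k - ft g k) = l2_norm (\<lambda>x. f x - g x)"
proof -
  have "l2_norm (\<lambda>k. ft f k - ft g k) = l2_norm (ft (\<lambda>x. f x - g x))"
    using ft_diff[OF assms(1,3)] by (intro arg_cong[where f = l2_norm]) auto
  also have "\<dots> = l2_norm (\<lambda>x. f x - g x)"
    using assms by (intro plancherel_l1_l2 square_integrable_diff) auto
  finally show ?thesis .
qed

lemma l2_norm_triangle3:
  assumes "square_integrable f" "square_integrable g" "square_integrable h"
  shows "l2_norm (\<lambda>x. f x - h x) \<le> l2_norm (\<lambda>x. f x - g x) + l2_norm (\<lambda>x. g x - h x)"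
  using l2_norm_triangle[OF square_integrable_diff[OF assms(1,2)] square_integrable_diff[OF assms(2,3)]] by simp

text \<open>The truncations converge to f and the transform is isometric on them, so their
  transforms form a Cauchy family.\<close>

theorem ex_l2_ft:
  assumes f: "square_integrable f"
  obtains g where "l2_ft f g"
proof -
  let ?t = "\<lambda>R. truncate R f"
  note st = square_integrable_truncate[OF f] and it = integrable_truncate[OF f] and sf = square_integrable_ft_truncate[OF f]
  have d: "l2_norm (\<lambda>k. ft (?t m) k - ft (?t n) k) \<le> l2_norm (\<lambda>x. f x - ?t m x) + l2_norm (\<lambda>x. f x - ?t n x)" for m n
  proof -
    have "l2_norm (\<lambda>k. ft (?t m) k - ft (?t n) k) = l2_norm (\<lambda>x. ?t m x - ?t n x)"
      by (intro l2_norm_ft_diff it st)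
    also have "\<dots> \<le> l2_norm (\<lambda>x. ?t m x - f x) + l2_norm (\<lambda>x. f x - ?t n x)"
      by (intro l2_norm_triangle3 st f)
    finally show ?thesis by (simp add: l2_norm_diff_commute)
  qed
  have tail: "\<exists>N. \<forall>R\<ge>N. l2_norm (\<lambda>x. f x - ?t R x) < e" if "e > 0" for e
    using tendstoD[OF truncate_tendsto[OF f] that] by (auto simp: eventually_at_top_linorder)
  obtain g where g: "square_integrable g" "(\<lambda>n. l2_norm (\<lambda>k. ft (?t (real n)) k - g k)) \<longlonglongrightarrow> 0"
  proof (rule l2_complete[of "\<lambda>n. ft (?t (real n))"])
    fix e :: real assume "e > 0"
    then obtain N where N: "\<And>R. R \<ge> N \<Longrightarrow> l2_norm (\<lambda>x. f x - ?t R x) < e / 2" using tail[of "e / 2"] by auto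
    obtain M where M: "real M \<ge> N" using real_arch_simple by blast
    show "\<exists>N. \<forall>m\<ge>N. \<forall>n\<ge>N. l2_norm (\<lambda>k. ft (?t (real m)) k - ft (?t (real n)) k) < e"
    proof (intro exI allI impI)
      fix m n assume "M \<le> m" "M \<le> n"
      then have "real m \<ge> N" "real n \<ge> N" using M by auto
      then show "l2_norm (\<lambda>k. ft (?t (real m)) k - ft (?t (real n)) k) < e"
        using N[of "real m"] N[of "real n"] d[of "real m" "real n"] by linarith
    qed
  qed (use sf in auto)
  \<comment> \<open>Completeness yields a limit along integer truncations; comparison with one far
    integer extends the convergence to all real R.\<close>
  have "((\<lambda>R. l2_norm (\<lambda>k. g k - ft (?t R) k)) \<longlongrightarrow> 0) at_top"
  proof (rule tendstoI)
    fix e :: real assume e: "e > 0"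
    then obtain N where N: "\<And>R. R \<ge> N \<Longrightarrow> l2_norm (\<lambda>x. f x - ?t R x) < e / 3" using tail[of "e / 3"] by auto
    have "\<forall>\<^sub>F n in sequentially. dist (l2_norm (\<lambda>k. ft (?t (real n)) k - g k)) 0 < e / 3 \<and> real n \<ge> N"
      using tendstoD[OF g(2), of "e / 3"] e filterlim_real_sequentially
      by (auto simp: filterlim_at_top intro: eventually_conj)
    then obtain n where n: "l2_norm (\<lambda>k. ft (?t (real n)) k - g k) < e / 3" "real n \<ge> N"
      by (auto simp: eventually_sequentially)
    show "\<forall>\<^sub>F R in at_top. dist (l2_norm (\<lambda>k. g k - ft (?t R) k)) 0 < e"
    proof (rule eventually_mono[OF eventually_ge_at_top[of N]])
      fix R assume "N \<le> R"
      have "l2_norm (\<lambda>k. g k - ft (?t R) k) \<le> l2_norm (\<lambda>k. g k - ft (?t (real n)) k)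
         + l2_norm (\<lambda>k. ft (?t (real n)) k - ft (?t R) k)"
        by (intro l2_norm_triangle3 g sf)
      then show "dist (l2_norm (\<lambda>k. g k - ft (?t R) k)) 0 < e"
        using n(1) N[OF n(2)] N[OF \<open>N \<le> R\<close>] d[of "real n" R] 
        by (simp add: l2_norm_diff_commute[of g])
    qed
  qed
  then show ?thesis using that f g(1) by (auto simp: l2_ft_def)
qed

lemma l2_norm_tendsto:
  assumes "square_integrable g" "\<And>R. square_integrable (h R)" "((\<lambda>R. l2_norm (\<lambda>k. g k - h R k)) \<longlongrightarrow> 0) F"
  shows "((\<lambda>R. l2_norm (h R)) \<longlongrightarrow> l2_norm g) F"
proof -
  have "((\<lambda>R. l2_norm (h R) - l2_norm g) \<longlongrightarrow> 0) F"
  proof (rule Lim_null_comparison[OF always_eventually assms(3)], rule allI)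
    fix R show "norm (l2_norm (h R) - l2_norm g) \<le> l2_norm (\<lambda>k. g k - h R k)"
      using l2_norm_abs_diff[OF assms(2)[of R] assms(1)] by (simp add: l2_norm_diff_commute)
  qed
  then show ?thesis by (simp add: LIM_zero_iff)
qed

theorem l2_ft_norm:
  assumes "l2_ft f g"
  shows "l2_norm g = l2_norm f"
proof -
  note fg = l2_ftD[OF assms]
  have "((\<lambda>R. l2_norm (ft (truncate R f))) \<longlongrightarrow> l2_norm g) at_top"
    by (intro l2_norm_tendsto fg square_integrable_ft_truncate)
  moreover have "((\<lambda>R. l2_norm (truncate R f)) \<longlongrightarrow> l2_norm f) at_top"
    by (intro l2_norm_tendsto fg square_integrable_truncate truncate_tendsto)
  moreover have "l2_norm (ft (truncate R f)) = l2_norm (truncate R f)" for R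
    by (intro plancherel_l1_l2 integrable_truncate square_integrable_truncate fg)
  ultimately show ?thesis using tendsto_unique[of "at_top :: real filter"] by force
qed

lemma truncate_add: "truncate R (\<lambda>x. f x + g x) = (\<lambda>x. truncate R f x + truncate R g x)"
  by (auto simp: truncate_def distrib_left)

lemma truncate_cmult: "truncate R (\<lambda>x. c * f x) = (\<lambda>x. c * truncate R f x)"
  by (auto simp: truncate_def)

lemma l2_ft_add:
  assumes "l2_ft f g" "l2_ft f' g'"
  shows "l2_ft (\<lambda>x. f x + f' x) (\<lambda>k. g k + g' k)"
proof -
  note fg = l2_ftD[OF assms(1)] and fg' = l2_ftD[OF assms(2)]
  have "((\<lambda>R. l2_norm (\<lambda>k. g k - ft (truncate R f) k) + l2_norm (\<lambda>k. g' k - ft (truncate R f') k)) \<longlongrightarrow> 0 + 0) at_top"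
    by (intro tendsto_add fg fg')
  then have lim: "((\<lambda>R. l2_norm (\<lambda>k. g k - ft (truncate R f) k) + l2_norm (\<lambda>k. g' k - ft (truncate R f') k)) \<longlongrightarrow> 0) at_top"
    by simp
  have "((\<lambda>R. l2_norm (\<lambda>k. g k + g' k - ft (truncate R (\<lambda>x. f x + f' x)) k)) \<longlongrightarrow> 0) at_top"
  proof (rule Lim_null_comparison[OF always_eventually lim], intro allI)
    fix R
    have "(\<lambda>k. g k + g' k - ft (truncate R (\<lambda>x. f x + f' x)) k) =
        (\<lambda>k. (g k - ft (truncate R f) k) + (g' k - ft (truncate R f') k))"
      unfolding truncate_add
      using ft_add[OF integrable_truncate[OF fg(1)] integrable_truncate[OF fg'(1)]] by auto
    then show "norm (l2_norm (\<lambda>k. g k + g' k - ft (truncate R (\<lambda>x. f x + f' x)) k)) \<le>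
        l2_norm (\<lambda>k. g k - ft (truncate R f) k) + l2_norm (\<lambda>k. g' k - ft (truncate R f') k)"
      using l2_norm_triangle[OF square_integrable_diff[OF fg(2) square_integrable_ft_truncate[OF fg(1), of R]] 
         square_integrable_diff[OF fg'(2) square_integrable_ft_truncate[OF fg'(1), of R]]] by simp
  qed
  then show ?thesis using fg fg' by (auto simp: l2_ft_def intro: square_integrable_add)
qed

lemma l2_ft_cmult:
  assumes "l2_ft f g"
  shows "l2_ft (\<lambda>x. c * f x) (\<lambda>k. c * g k)"
proof -
  note fg = l2_ftD[OF assms(1)]
  have "((\<lambda>R. norm c * l2_norm (\<lambda>k. g k - ft (truncate R f) k)) \<longlongrightarrow> norm c * 0) at_top"
    by (intro tendsto_intros fg)
  moreover have "l2_norm (\<lambda>k. c * g k - ft (truncate R (\<lambda>x. c * f x)) k) = norm c * l2_norm (\<lambda>k. g k - ft (truncate R f) k)" for R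
    unfolding truncate_cmult ft_cmult l2_norm_cmult[symmetric] by (simp add: right_diff_distrib)
  ultimately show ?thesis using fg by (auto simp: l2_ft_def intro: square_integrable_cmult)
qed

lemma l2_ft_diff:
  assumes "l2_ft f g" "l2_ft f' g'"
  shows "l2_ft (\<lambda>x. f x - f' x) (\<lambda>k. g k - g' k)"
  using l2_ft_add[OF assms(1) l2_ft_cmult[OF assms(2), of "-1"]] by simp

lemma l2_ft_cong:
  assumes fg: "l2_ft f g" and "f' \<in> borel_measurable borel" "AE x in lborel. f x = f' x"
     "g' \<in> borel_measurable borel" "AE x in lborel. g x = g' x"
  shows "l2_ft f' g'"
proof -
  note * = l2_ftD[OF fg]
  have [measurable]: "f \<in> borel_measurable borel" "g \<in> borel_measurable borel" 
    "f' \<in> borel_measurable borel" "g' \<in> borel_measurable borel"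
    using * assms by (auto dest: square_integrableD)
  have "ft (truncate R f') = ft (truncate R f)" for R
    unfolding ft_def truncate_def using assms(3)
    by (intro ext arg_cong2[where f = "(*)"] refl integral_cong_AE) auto
  moreover have "l2_norm (\<lambda>k. g' k - ft (truncate R f) k) = l2_norm (\<lambda>k. g k - ft (truncate R f) k)" for R
    by (rule l2_norm_cong_AE) (use assms(5) in auto)
  moreover have "square_integrable f'" "square_integrable g'"
    using square_integrable_cong_AE[OF *(1) assms(2,3)] square_integrable_cong_AE[OF *(2) assms(4,5)] by auto
  ultimately show ?thesis using * by (simp add: l2_ft_def)
qed

text \<open>By linearity the difference of two transforms of f is a transform of 0, and the isometry
  makes it vanish.\<close>

lemma l2_ft_unique:
  assumes "l2_ft f g" "l2_ft f g'"
  shows "AE k in lborel. g k = g' k"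
proof -
  have "l2_ft (\<lambda>x. 0) (\<lambda>k. g k - g' k)" using l2_ft_diff[OF assms] by simp
  from l2_norm_eq_0D[OF l2_ftD(2)[OF this]] l2_ft_norm[OF this] show ?thesis by simp
qed

lemma l2_ft_integrable:
  assumes f: "square_integrable f" "integrable lborel f"
  shows "l2_ft f (ft f)"
proof -
  have "l2_norm (\<lambda>k. ft f k - ft (truncate R f) k) = l2_norm (\<lambda>x. f x - truncate R f x)" for R
    by (intro l2_norm_ft_diff f integrable_truncate square_integrable_truncate)
  then show ?thesis
    using truncate_tendsto[OF f(1)] plancherel_l1_l2[OF f(2,1)] f by (simp add: l2_ft_def)
qed

lemma l2_pairing_tendsto:
  fixes h :: "real \<Rightarrow> real \<Rightarrow> complex"
  assumes g: "square_integrable g" and h: "\<And>R. square_integrable (h R)" and v: "square_integrable v"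
    and lim: "((\<lambda>R. l2_norm (\<lambda>k. g k - h R k)) \<longlongrightarrow> 0) F"
  shows "((\<lambda>R. LINT k|lborel. h R k * v k) \<longlongrightarrow> (LINT k|lborel. g k * v k)) F"
proof -
  have "((\<lambda>R. (LINT k|lborel. h R k * v k) - (LINT k|lborel. g k * v k)) \<longlongrightarrow> 0) F"
  proof (rule Lim_null_comparison[where g = "\<lambda>R. l2_norm (\<lambda>k. g k - h R k) * l2_norm v"])
    show "((\<lambda>R. l2_norm (\<lambda>k. g k - h R k) * l2_norm v) \<longlongrightarrow> 0) F"
      using tendsto_mult_right[OF lim, of "l2_norm v"] by simp
    show "\<forall>\<^sub>F R in F. norm ((LINT k|lborel. h R k * v k) - (LINT k|lborel. g k * v k)) \<le> l2_norm (\<lambda>k. g k - h R k) * l2_norm v"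
    proof (rule always_eventually, rule allI)
      fix R
      have "(LINT k|lborel. g k * v k) - (LINT k|lborel. h R k * v k) = (LINT k|lborel. (g k - h R k) * v k)"
        using square_integrable_mult_integrable[OF g v] square_integrable_mult_integrable[OF h v]
        by (simp add: left_diff_distrib)
      also have "norm \<dots> \<le> (LINT k|lborel. norm (g k - h R k) * norm (v k))"
        by (rule order_trans[OF integral_norm_bound]) (simp add: norm_mult)
      also have "\<dots> \<le> l2_norm (\<lambda>k. g k - h R k) * l2_norm v"
        by (intro l2_cauchy_schwarz square_integrable_diff g h v)
      finally show "norm ((LINT k|lborel. h R k * v k) - (LINT k|lborel. g k * v k)) \<le> l2_norm (\<lambda>k. g k - h R k) * l2_norm v"
        by (simp add: norm_minus_commute)
    qed
  qed
  then show ?thesis by (simp add: LIM_zero_iff)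
qed

lemma l2_ft_multiplication_formula:
  assumes fg: "l2_ft f g" and v: "integrable lborel v" "square_integrable v"
  shows "(LINT k|lborel. g k * v k) = (LINT x|lborel. f x * ft v x)"
proof -
  note * = l2_ftD[OF fg]
  have "((\<lambda>R. LINT k|lborel. ft (truncate R f) k * v k) \<longlongrightarrow> (LINT k|lborel. g k * v k)) at_top"
    by (intro l2_pairing_tendsto * v square_integrable_ft_truncate)
  moreover have "((\<lambda>R. LINT x|lborel. truncate R f x * ft v x) \<longlongrightarrow> (LINT x|lborel. f x * ft v x)) at_top"
    by (intro l2_pairing_tendsto * v plancherel_l1_l2 square_integrable_truncate truncate_tendsto)
  moreover have "(LINT k|lborel. ft (truncate R f) k * v k) = (LINT x|lborel. truncate R f x * ft v x)" for R
    by (intro ft_multiplication_formula integrable_truncate * v)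
  ultimately show ?thesis using tendsto_unique[of "at_top :: real filter"] by force
qed

lemma l2_norm_add_sq:
  fixes f g :: "real \<Rightarrow> complex"
  assumes f: "square_integrable f" and g: "square_integrable g"
  shows "(l2_norm (\<lambda>x. f x + g x))\<^sup>2 = (l2_norm f)\<^sup>2 + 2 * Re (LINT x|lborel. f x * cnj (g x)) + (l2_norm g)\<^sup>2"
proof -
  have int: "integrable lborel (\<lambda>x. f x * cnj (g x))"
    by (intro square_integrable_mult_integrable f square_integrable_cnj g)
  have "(norm (a + b))\<^sup>2 = (norm a)\<^sup>2 + 2 * Re (a * cnj b) + (norm b)\<^sup>2" for a b :: complex
    unfolding cmod_power2 by (simp add: power2_eq_square algebra_simps)
  then have "(l2_norm (\<lambda>x. f x + g x))\<^sup>2 = (LINT x|lborel. (norm (f x))\<^sup>2 + 2 * Re (f x * cnj (g x)) + (norm (g x))\<^sup>2)"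
    by (simp add: l2_norm_sq)
  also have "\<dots> = (l2_norm f)\<^sup>2 + 2 * (LINT x|lborel. Re (f x * cnj (g x))) + (l2_norm g)\<^sup>2"
    using square_integrableD(2)[OF f] square_integrableD(2)[OF g] integrable_Re[OF int]
    by (simp add: l2_norm_sq del: times_complex.simps)
  also have "(LINT x|lborel. Re (f x * cnj (g x))) = Re (LINT x|lborel. f x * cnj (g x))"
    by (rule integral_Re[OF int])
  finally show ?thesis .
qed

text \<open>Polarization of the isometry. The norm of a sum sees only the real part of the pairing,
  and that is enough for pairing real functions with indicators.\<close>

lemma l2_ft_parseval_Re:
  assumes "l2_ft f g" "l2_ft v w"
  shows "Re (LINT x|lborel. f x * cnj (v x)) = Re (LINT k|lborel. g k * cnj (w k))"
  using l2_norm_add_sq[OF l2_ftD(1)[OF assms(1)] l2_ftD(1)[OF assms(2)]]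
    l2_norm_add_sq[OF l2_ftD(2)[OF assms(1)] l2_ftD(2)[OF assms(2)]]
    l2_ft_norm[OF assms(1)] l2_ft_norm[OF assms(2)] l2_ft_norm[OF l2_ft_add[OF assms]] by simp

lemma cnj_ft: "cnj (ft f k) = ft (\<lambda>x. cnj (f (- x))) k"
proof -
  have "cnj (LINT x|lborel. exp (- (\<i> * complex_of_real (k * x))) * f x) =
    (LINT x|lborel. exp (\<i> * complex_of_real (k * x)) * cnj (f x))"
    by (simp only: Bochner_Integration.integral_cnj[symmetric] complex_cnj_mult cnj_exp_minus_i)
  also have "\<dots> = (LINT x|lborel. exp (\<i> * complex_of_real (k * (0 + (- 1) * x))) * cnj (f (0 + (- 1) * x)))"
    using lborel_integral_real_affine[of "-1" "\<lambda>x. exp (\<i> * complex_of_real (k * x)) * cnj (f x)" 0] by simp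
  also have "\<dots> = (LINT x|lborel. exp (- (\<i> * complex_of_real (k * x))) * cnj (f (- x)))" by simp
  finally show ?thesis by (simp add: ft_def)
qed

lemma integrable_indicator_Icc:
  "integrable lborel (\<lambda>x. indicator {a..b::real} x :: 'a::{banach, second_countable_topology, real_normed_algebra_1})"
proof -
  have "integrable lborel (\<lambda>x. indicator {a..b} x *\<^sub>R (1::'a))"
    by (intro integrable_scaleR_left integrable_real_indicator) (auto simp: emeasure_lborel_Icc_eq)
  also have "(\<lambda>x. indicator {a..b} x *\<^sub>R (1::'a)) = (\<lambda>x. indicator {a..b} x)"
    by (auto simp: indicator_def)
  finally show ?thesis .
qed

lemma cnj_ft_indicator:
  "cnj (ft (indicator {a..b}) k) = ft (indicator {-b..-a}) k"
proof -
  have "(\<lambda>x. cnj (indicator {a..b} (- x))) = (indicator {-b..-a} :: real \<Rightarrow> complex)"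
    by (rule ext) (auto simp: indicator_def of_bool_def)
  then show ?thesis using cnj_ft[of "indicator {a..b}" k] by simp
qed

lemma l2_ft_indicator: "l2_ft (indicator {a..b}) (ft (indicator {a..b}))"
  by (intro l2_ft_integrable square_integrable_indicator integrable_indicator_Icc)

section \<open>Absolutely continuous functions\<close>

text \<open>Absolute continuity expressed through interval integrals: f matters only up to a null
  set, while F is a genuine function at every point.\<close>

definition primitive :: "(real \<Rightarrow> real) \<Rightarrow> (real \<Rightarrow> real) \<Rightarrow> bool" where
  "primitive F f \<longleftrightarrow> locally_integrable f \<and>
     (\<forall>a b. a \<le> b \<longrightarrow> F b - F a = (LINT x:{a..b}|lborel. f x))"

lemma locally_integrableD:
  assumes "locally_integrable f"
  shows "f \<in> borel_measurable borel" "set_integrable lborel {a..b} f"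
  using assms by (auto simp: locally_integrable_def)

lemma primitiveD:
  assumes "primitive F f"
  shows "locally_integrable f" "f \<in> borel_measurable borel" "set_integrable lborel {a..b} f"
    "a \<le> b \<Longrightarrow> F b - F a = (LINT x:{a..b}|lborel. f x)"
  using assms by (auto simp: primitive_def locally_integrable_def)

lemma locally_integrable_cmult: "locally_integrable f \<Longrightarrow> locally_integrable (\<lambda>x. c * f x)"
  by (auto simp: locally_integrable_def)

lemma locally_integrable_add:
  "locally_integrable f \<Longrightarrow> locally_integrable g \<Longrightarrow> locally_integrable (\<lambda>x. f x + g x)"
  by (auto simp: locally_integrable_def intro: set_integral_add)

lemma locally_integrable_diff:
  "locally_integrable f \<Longrightarrow> locally_integrable g \<Longrightarrow> locally_integrable (\<lambda>x. f x - g x)"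
  by (auto simp: locally_integrable_def intro: set_integral_diff)

lemma continuous_locally_integrable:
  "continuous_on UNIV f \<Longrightarrow> locally_integrable f"
  unfolding locally_integrable_def
  by (auto intro!: borel_integrable_atLeastAtMost' borel_measurable_continuous_onI continuous_on_subset[of UNIV f])

lemma square_integrable_locally_integrable:
  assumes f: "square_integrable f"
  shows "locally_integrable f"
  using square_integrable_mult_integrable[OF square_integrable_indicator f] square_integrableD(1)[OF f]
  by (auto simp: locally_integrable_def set_integrable_def)

lemma set_integrable_mult_continuous:
  fixes f h :: "real \<Rightarrow> real"
  assumes f: "locally_integrable f" and h: "continuous_on UNIV h"
  shows "set_integrable lborel {a..b} (\<lambda>x. f x * h x)"
proof -
  have "bounded (h ` {a..b})"
    by (intro compact_imp_bounded compact_continuous_image continuous_on_subset[OF h]) auto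
  then obtain B where B: "\<And>x. x \<in> {a..b} \<Longrightarrow> \<bar>h x\<bar> \<le> B" unfolding bounded_iff by (metis imageI real_norm_def)
  have hm: "h \<in> borel_measurable borel" using h by (intro borel_measurable_continuous_onI)
  show ?thesis unfolding set_integrable_def
  proof (rule Bochner_Integration.integrable_bound)
    show "integrable lborel (\<lambda>x. B * (indicator {a..b} x *\<^sub>R f x))"
      using locally_integrableD(2)[OF f, of a b] by (simp add: set_integrable_def)
    show "AE x in lborel. norm (indicator {a..b} x *\<^sub>R (f x * h x)) \<le> norm (B * (indicator {a..b} x *\<^sub>R f x))"
    proof (intro AE_I2)
      fix x show "norm (indicator {a..b} x *\<^sub>R (f x * h x)) \<le> norm (B * (indicator {a..b} x *\<^sub>R f x))"
      proof (cases "x \<in> {a..b}")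
        case True
        from B[OF this] have "\<bar>h x\<bar> \<le> \<bar>B\<bar>" by linarith
        then show ?thesis using True by (simp add: abs_mult mult.commute[of _ "\<bar>f x\<bar>"] mult_left_mono)
      qed simp
    qed
  qed (use hm locally_integrableD(1)[OF f] in measurable)
qed

lemma locally_integrable_mult_continuous:
  assumes f: "locally_integrable f" and h: "continuous_on UNIV h"
  shows "locally_integrable (\<lambda>x. f x * h x)"
  using set_integrable_mult_continuous[OF assms] locally_integrableD(1)[OF f] borel_measurable_continuous_onI[OF h]
  by (auto simp: locally_integrable_def)

text \<open>Closed intervals generate the Borel sets, so on each window [-n, n] the difference has
  integral zero over every Borel set, and a density with that property is zero almost everywhere.
  The windows are there because the difference is only locally integrable.\<close>

theorem AE_eq_if_interval_integrals_eq:
  assumes f: "locally_integrable f" and g: "locally_integrable g"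
    and eq: "\<And>a b. a \<le> b \<Longrightarrow> (LINT x:{a..b}|lborel. f x) = (LINT x:{a..b}|lborel. g x)"
  shows "AE x in lborel. f x = g x"
proof -
  define d where "d = (\<lambda>x. f x - g x)"
  have d: "locally_integrable d" unfolding d_def by (intro locally_integrable_diff f g)
  have d0: "(LINT x:{a..b}|lborel. d x) = 0" for a b
  proof (cases "a \<le> b")
    case True
    then show ?thesis unfolding d_def
      using set_integral_diff(2)[OF locally_integrableD(2)[OF f, of a b] locally_integrableD(2)[OF g, of a b]] eq by simp
  qed (simp add: set_lebesgue_integral_def)
  have "AE x in lborel. indicator {- real n..real n} x * d x = 0" for n
  proof (rule sigma_finite_measure.density_zero[OF sigma_finite_lborel])
    let ?I = "{- real n..real n}"
    let ?d = "\<lambda>x. indicator ?I x * d x"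
    show int: "integrable lborel ?d"
      using locally_integrableD(2)[OF d, of "- real n" "real n"] by (simp add: set_integrable_def)
    fix A :: "real set" assume "A \<in> sets lborel"
    then have "A \<in> sets borel" by simp
    then show "set_lebesgue_integral lborel A ?d = 0"
    proof (induction A rule: borel_set_induct)
      case (interval a b)
      have "set_lebesgue_integral lborel {a..b} ?d = (LINT x:{max a (- real n)..min b (real n)}|lborel. d x)"
        unfolding set_lebesgue_integral_def by (intro Bochner_Integration.integral_cong) (auto simp: indicator_def)
      then show ?case using d0 by simp
    next
      case (compl A)
      have "set_lebesgue_integral lborel UNIV ?d = set_lebesgue_integral lborel A ?d + set_lebesgue_integral lborel (-A) ?d"
      proof -
        have si: "set_integrable lborel B ?d" if "B \<in> sets borel" for B
          unfolding set_integrable_def by (rule integrable_mult_indicator) (use that int in auto)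
        show ?thesis using set_integral_Un[OF _ si si, of A "- A"] compl by simp
      qed
      moreover have "set_lebesgue_integral lborel UNIV ?d = 0"
        using d0[of "- real n" "real n"] by (simp add: set_lebesgue_integral_def)
      ultimately show ?case using compl by simp
    next
      case (union A)
      have "set_integrable lborel (\<Union>i. A i) ?d"
        unfolding set_integrable_def using union int by (intro integrable_mult_indicator) auto
      then have "set_lebesgue_integral lborel (\<Union>i. A i) ?d = (\<Sum>i. set_lebesgue_integral lborel (A i) ?d)"
        using union by (intro lebesgue_integral_countable_add) (auto simp: disjoint_family_on_def)
      then show ?case using union by simp
    qed (simp add: set_lebesgue_integral_def)
  qed
  then have "AE x in lborel. \<forall>n. indicator {- real n..real n} x * d x = 0"
    by (intro AE_all_countable[THEN iffD2] allI)
  then show ?thesis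
  proof eventually_elim
    case (elim x)
    obtain n where "\<bar>x\<bar> \<le> real n" using real_arch_simple by blast
    then show ?case using elim[rule_format, of n] by (auto simp: d_def indicator_def abs_le_iff)
  qed
qed

lemma primitive_unique_AE:
  assumes "primitive F f" "primitive F g"
  shows "AE x in lborel. f x = g x"
  by (rule AE_eq_if_interval_integrals_eq[OF primitiveD(1)[OF assms(1)] primitiveD(1)[OF assms(2)]])
     (use primitiveD(4)[OF assms(1)] primitiveD(4)[OF assms(2)] in metis)

lemma set_integral_cong_AE_lborel:
  fixes f g :: "real \<Rightarrow> real"
  assumes "f \<in> borel_measurable borel" "g \<in> borel_measurable borel" "AE x in lborel. f x = g x"
  shows "(LINT x:{a..b}|lborel. f x) = (LINT x:{a..b}|lborel. g x)"
  unfolding set_lebesgue_integral_def by (intro integral_cong_AE) (use assms in auto)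

lemma locally_integrable_cong_AE:
  assumes f: "locally_integrable f" and g: "g \<in> borel_measurable borel" and fg: "AE x in lborel. f x = g x"
  shows "locally_integrable g"
proof -
  have "set_integrable lborel {a..b} g" for a b
    using locally_integrableD(2)[OF f, of a b] unfolding set_integrable_def
    by (rule integrable_cong_AE_imp) (use g fg locally_integrableD(1)[OF f] in auto)
  then show ?thesis using g by (simp add: locally_integrable_def)
qed

lemma primitive_cong_AE:
  assumes F: "primitive F f" and g: "g \<in> borel_measurable borel" and fg: "AE x in lborel. f x = g x"
  shows "primitive F g"
  using locally_integrable_cong_AE[OF primitiveD(1)[OF F] g fg] primitiveD(4)[OF F]
    set_integral_cong_AE_lborel[OF primitiveD(2)[OF F] g fg] by (simp add: primitive_def)

lemma primitive_add:
  "primitive F f \<Longrightarrow> primitive G g \<Longrightarrow> primitive (\<lambda>x. F x + G x) (\<lambda>x. f x + g x)"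
  unfolding primitive_def
  using set_integral_add(2)[OF locally_integrableD(2) locally_integrableD(2), of f g]
  by (auto simp: locally_integrable_add algebra_simps)

lemma primitive_cmult: "primitive F f \<Longrightarrow> primitive (\<lambda>x. c * F x) (\<lambda>x. c * f x)"
  unfolding primitive_def by (auto simp: locally_integrable_cmult right_diff_distrib[symmetric])

lemma primitive_diff:
  "primitive F f \<Longrightarrow> primitive G g \<Longrightarrow> primitive (\<lambda>x. F x - G x) (\<lambda>x. f x - g x)"
  using primitive_add[OF _ primitive_cmult, of F f G g "-1"] by simp

lemma primitive_continuous:
  assumes F: "primitive F f"
  shows "continuous_on UNIV F"
proof -
  have "isCont F x" for x
  proof -
    have int: "f integrable_on {x - 1..x + 1}"
      using set_borel_integral_eq_integral(1)[OF primitiveD(3)[OF F]] .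
    have "continuous_on {x - 1..x + 1} (\<lambda>y. F (x - 1) + integral {x - 1..y} f)"
      by (intro continuous_intros indefinite_integral_continuous_1 int)
    then have "continuous_on {x - 1..x + 1} F"
    proof (rule continuous_on_eq)
      fix y assume "y \<in> {x - 1..x + 1}"
      then show "F (x - 1) + integral {x - 1..y} f = F y"
        using primitiveD(4)[OF F, of "x - 1" y] set_borel_integral_eq_integral(2)[OF primitiveD(3)[OF F]] by simp
    qed
    then have "continuous_on {x - 1<..<x + 1} F" by (rule continuous_on_subset) auto
    then show ?thesis by (simp add: continuous_on_eq_continuous_at)
  qed
  then show ?thesis by (simp add: continuous_on_eq_continuous_at)
qed

lemma primitive_measurable: "primitive F f \<Longrightarrow> F \<in> borel_measurable borel"
  by (intro borel_measurable_continuous_onI primitive_continuous)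

lemma primitive_C1:
  assumes "\<And>x. (F has_real_derivative f x) (at x)" "continuous_on UNIV f"
  shows "primitive F f"
  unfolding primitive_def
proof (intro conjI allI impI)
  show "locally_integrable f" using assms(2) by (rule continuous_locally_integrable)
  fix a b :: real assume "a \<le> b"
  then show "F b - F a = (LINT x:{a..b}|lborel. f x)"
    unfolding set_lebesgue_integral_def
    by (intro integral_FTC_atLeastAtMost[symmetric] continuous_on_subset[OF assms(2)])
       (use assms(1) in \<open>auto simp: has_real_derivative_iff_has_vector_derivative[symmetric] intro: has_field_derivative_at_within\<close>)
qed

lemma primitive_has_derivative:
  assumes F: "primitive F f" and f: "continuous_on UNIV f"
  shows "(F has_real_derivative f x) (at x)"
proof -
  have "((\<lambda>y. integral {x - 1..y} f) has_vector_derivative f x) (at x within {x - 1..x + 1})"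
    by (intro integral_has_vector_derivative continuous_on_subset[OF f]) auto
  then have "((\<lambda>y. F (x - 1) + integral {x - 1..y} f) has_vector_derivative f x) (at x within {x - 1..x + 1})"
    by (auto intro!: derivative_eq_intros)
  then have "(F has_vector_derivative f x) (at x within {x - 1..x + 1})"
  proof (rule has_vector_derivative_transform[rotated 2])
    fix y assume "y \<in> {x - 1..x + 1}"
    then show "F y = F (x - 1) + integral {x - 1..y} f"
      using primitiveD(4)[OF F, of "x - 1" y] set_borel_integral_eq_integral(2)[OF primitiveD(3)[OF F]] by simp
  qed auto
  then show ?thesis
    by (simp add: has_real_derivative_iff_has_vector_derivative at_within_interior[of x "{x - 1..x + 1}"])
qed

text \<open>The product of the two increments is the integral of f(x) g(y) over a square. Cutting it
  along the diagonal and applying Fubini to each half gives the integrals of f (G - G a) and of (F -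
  F a) g, which is the product rule after rearranging; no pointwise derivatives enter.\<close>

theorem primitive_mult:
  assumes F: "primitive F f" and G: "primitive G g"
  shows "primitive (\<lambda>x. F x * G x) (\<lambda>x. f x * G x + F x * g x)"
  unfolding primitive_def
proof (intro conjI allI impI)
  note cF = primitive_continuous[OF F] and cG = primitive_continuous[OF G]
  have fG: "locally_integrable (\<lambda>x. f x * G x)" and gF: "locally_integrable (\<lambda>x. g x * F x)"
    using locally_integrable_mult_continuous primitiveD(1) F G cF cG by blast+
  then show "locally_integrable (\<lambda>x. f x * G x + F x * g x)"
    using locally_integrable_add[OF fG gF] by (simp add: mult.commute)
  fix a b :: real assume ab: "a \<le> b"
  have [measurable]: "f \<in> borel_measurable borel" "g \<in> borel_measurable borel" using primitiveD(2) F G by auto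
  define u v where "u = (\<lambda>x. indicator {a..b} x * f x)" and "v = (\<lambda>x. indicator {a..b} x * g x)"
  have [measurable]: "u \<in> borel_measurable borel" "v \<in> borel_measurable borel" unfolding u_def v_def by measurable
  have u: "integrable lborel u" and v: "integrable lborel v"
    using primitiveD(3)[OF F, of a b] primitiveD(3)[OF G, of a b] by (auto simp: set_integrable_def u_def v_def)
  have uv: "(LINT x|lborel. u x) = F b - F a" "(LINT x|lborel. v x) = G b - G a"
    using primitiveD(4)[OF F ab] primitiveD(4)[OF G ab] by (auto simp: set_lebesgue_integral_def u_def v_def)
  let ?L = "\<lambda>x y. u x * v y * indicator {..x} y" and ?U = "\<lambda>x y. u x * v y * indicator {..<y} x"
  have split: "u x * v y = ?L x y + ?U x y" for x y by (auto simp: indicator_def)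
  have mL: "(\<lambda>(x, y). ?L x y) \<in> borel_measurable (lborel \<Otimes>\<^sub>M lborel)"
  proof -
    have "(\<lambda>(x, y). ?L x y) = (\<lambda>p. u (fst p) * v (snd p) * (if snd p \<le> fst p then 1 else 0))"
      by (auto simp: indicator_def fun_eq_iff)
    also have "\<dots> \<in> borel_measurable (lborel \<Otimes>\<^sub>M lborel)" by measurable
    finally show ?thesis .
  qed
  have mU: "(\<lambda>(x, y). ?U x y) \<in> borel_measurable (lborel \<Otimes>\<^sub>M lborel)"
  proof -
    have "(\<lambda>(x, y). ?U x y) = (\<lambda>p. u (fst p) * v (snd p) * (if fst p < snd p then 1 else 0))"
      by (auto simp: indicator_def fun_eq_iff)
    also have "\<dots> \<in> borel_measurable (lborel \<Otimes>\<^sub>M lborel)" by measurable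
    finally show ?thesis .
  qed
  have iL: "integrable (lborel \<Otimes>\<^sub>M lborel) (\<lambda>(x, y). ?L x y)"
    by (rule integrable_product_bound[OF u v mL]) (auto simp: indicator_def abs_mult)
  have iU: "integrable (lborel \<Otimes>\<^sub>M lborel) (\<lambda>(x, y). ?U x y)"
    by (rule integrable_product_bound[OF u v mU]) (auto simp: indicator_def abs_mult)
  have L: "(LINT y|lborel. ?L x y) = u x * (G x - G a)" for x
  proof (cases "x \<in> {a..b}")
    case True
    have "(LINT y|lborel. ?L x y) = u x * (LINT y|lborel. v y * indicator {..x} y)"
      by (simp add: mult.assoc)
    also have "(LINT y|lborel. v y * indicator {..x} y) = (LINT y:{a..x}|lborel. g y)"
      using True unfolding set_lebesgue_integral_def v_def
      by (intro Bochner_Integration.integral_cong) (auto simp: indicator_def)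
    finally show ?thesis using primitiveD(4)[OF G, of a x] True by simp
  qed (simp add: u_def)
  have U: "(LINT x|lborel. ?U x y) = v y * (F y - F a)" for y
  proof (cases "y \<in> {a..b}")
    case True
    have "(LINT x|lborel. ?U x y) = (LINT x|lborel. v y * (u x * indicator {..<y} x))"
      by (intro Bochner_Integration.integral_cong) auto
    also have "\<dots> = v y * (LINT x|lborel. u x * indicator {..<y} x)" by simp
    also have "(LINT x|lborel. u x * indicator {..<y} x) = (LINT x:{a..y}|lborel. f x)"
      unfolding set_lebesgue_integral_def
    \<comment> \<open>The strict half of the square gives the interval up to y without its right
      endpoint, a null set.\<close>
    proof (rule integral_cong_AE)
      show "AE x in lborel. u x * indicator {..<y} x = indicator {a..y} x *\<^sub>R f x"
        using AE_lborel_singleton[of y] by eventually_elim (use True in \<open>auto simp: u_def indicator_def\<close>)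
    qed measurable
    finally show ?thesis using primitiveD(4)[OF F, of a y] True by simp
  qed (simp add: v_def)
  have iu: "integrable lborel (\<lambda>x. u x * G x)" "integrable lborel (\<lambda>x. v x * F x)"
    using locally_integrableD(2)[OF fG, of a b] locally_integrableD(2)[OF gF, of a b]
    by (auto simp: set_integrable_def u_def v_def mult.assoc)
  have "(F b - F a) * (G b - G a) = (LINT x|lborel. (LINT y|lborel. ?L x y + ?U x y))"
    unfolding split[symmetric] by (simp add: uv)
  also have "\<dots> = (LINT x|lborel. (LINT y|lborel. ?L x y) + (LINT y|lborel. ?U x y))"
  proof (intro integral_cong_AE)
    show "AE x in lborel. (LINT y|lborel. ?L x y + ?U x y) = (LINT y|lborel. ?L x y) + (LINT y|lborel. ?U x y)"
      using lborel_pair.AE_integrable_fst[OF iL] lborel_pair.AE_integrable_fst[OF iU]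
      by eventually_elim (rule Bochner_Integration.integral_add)
    show "(\<lambda>x. LINT y|lborel. ?L x y + ?U x y) \<in> borel_measurable lborel"
      unfolding split[symmetric] by measurable
    have "(\<lambda>x. LINT y|lborel. ?U x y) \<in> borel_measurable lborel"
      using borel_measurable_integrable[OF lborel_pair.integrable_fst[OF iU]] by simp
    moreover have "(\<lambda>x. LINT y|lborel. ?L x y) \<in> borel_measurable lborel"
      using borel_measurable_integrable[OF lborel_pair.integrable_fst[OF iL]] by simp
    ultimately show "(\<lambda>x. (LINT y|lborel. ?L x y) + (LINT y|lborel. ?U x y)) \<in> borel_measurable lborel"
      by simp
  qed
  also have "\<dots> = (LINT x|lborel. (LINT y|lborel. ?L x y)) + (LINT x|lborel. (LINT y|lborel. ?U x y))"
    using lborel_pair.integrable_fst[OF iL] lborel_pair.integrable_fst[OF iU]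
    by (intro Bochner_Integration.integral_add) auto
  also have "(LINT x|lborel. (LINT y|lborel. ?U x y)) = (LINT y|lborel. (LINT x|lborel. ?U x y))"
    using lborel_pair.Fubini_integral[OF iU] by simp
  also have "(LINT x|lborel. (LINT y|lborel. ?L x y)) = (LINT x|lborel. u x * G x - G a * u x)"
    unfolding L by (simp add: algebra_simps)
  also have "\<dots> = (LINT x|lborel. u x * G x) - G a * (F b - F a)"
    using iu u by (simp add: uv)
  also have "(LINT y|lborel. (LINT x|lborel. ?U x y)) = (LINT x|lborel. v x * F x - F a * v x)"
    unfolding U by (simp add: algebra_simps)
  also have "\<dots> = (LINT x|lborel. v x * F x) - F a * (G b - G a)"
    using iu v by (simp add: uv)
  finally have 1: "(LINT x|lborel. u x * G x) + (LINT x|lborel. v x * F x) = F b * G b - F a * G a"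
    by (simp add: algebra_simps)
  have "(LINT x:{a..b}|lborel. f x * G x + F x * g x) = (LINT x|lborel. u x * G x + v x * F x)"
    unfolding set_lebesgue_integral_def u_def v_def by (simp add: algebra_simps)
  also have "\<dots> = F b * G b - F a * G a" using iu 1 by simp
  finally show "F b * G b - F a * G a = (LINT x:{a..b}|lborel. f x * G x + F x * g x)" by simp
qed

lemma primitive_shift:
  assumes F: "primitive F f"
  shows "primitive (\<lambda>x. F (x + h)) (\<lambda>x. f (x + h))"
proof -
  have *: "indicator {a..b} x * f (x + h) = (\<lambda>x. indicator {a + h..b + h} x * f x) (x + h)" for a b x
    by (auto simp: indicator_def)
  have "set_integrable lborel {a..b} (\<lambda>x. f (x + h))" for a b
    using integrable_shift[of "\<lambda>x. indicator {a + h..b + h} x * f x" h] primitiveD(3)[OF F, of "a + h" "b + h"]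
    by (simp add: set_integrable_def *)
  moreover have "(LINT x:{a..b}|lborel. f (x + h)) = (LINT x:{a + h..b + h}|lborel. f x)" for a b
    using integral_shift[of "\<lambda>x. indicator {a + h..b + h} x * f x" h] by (simp add: set_lebesgue_integral_def *)
  moreover have "(\<lambda>x. f (x + h)) \<in> borel_measurable borel" using primitiveD(2)[OF F] by measurable
  ultimately show ?thesis using primitiveD(4)[OF F] by (auto simp: primitive_def locally_integrable_def)
qed

lemma set_integral_power2_le:
  fixes f :: "real \<Rightarrow> real"
  assumes f: "square_integrable f" and ab: "a \<le> b"
  shows "(LINT x:{a..b}|lborel. f x)\<^sup>2 \<le> (b - a) * (LINT x:{a..b}|lborel. (f x)\<^sup>2)"
proof -
  let ?i = "\<lambda>x. indicator {a..b} x :: real"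
  have fi: "square_integrable (\<lambda>x. ?i x * f x)"
    by (rule square_integrable_bound[OF f, of _ 1]) (use square_integrableD[OF f] in \<open>auto simp: indicator_def\<close>)
  have "\<bar>LINT x:{a..b}|lborel. f x\<bar> \<le> (LINT x|lborel. norm (?i x) * norm (?i x * f x))"
    unfolding set_lebesgue_integral_def
    by (rule order_trans[OF integral_abs_bound]) (auto intro!: eq_refl Bochner_Integration.integral_cong simp: indicator_def)
  also have "\<dots> \<le> l2_norm ?i * l2_norm (\<lambda>x. ?i x * f x)"
    by (intro l2_cauchy_schwarz square_integrable_indicator fi)
  finally have "(LINT x:{a..b}|lborel. f x)\<^sup>2 \<le> (l2_norm ?i * l2_norm (\<lambda>x. ?i x * f x))\<^sup>2"
    by (metis abs_ge_zero power2_abs power_mono)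
  also have "\<dots> = (LINT x|lborel. (norm (?i x))\<^sup>2) * (LINT x|lborel. (norm (?i x * f x))\<^sup>2)"
    by (simp only: power_mult_distrib l2_norm_sq)
  also have "(LINT x|lborel. (norm (?i x))\<^sup>2) = (LINT x|lborel. ?i x)"
    by (intro Bochner_Integration.integral_cong) (auto simp: indicator_def)
  also have "\<dots> = b - a" using ab by simp
  also have "(LINT x|lborel. (norm (?i x * f x))\<^sup>2) = (LINT x:{a..b}|lborel. (f x)\<^sup>2)"
    unfolding set_lebesgue_integral_def by (intro Bochner_Integration.integral_cong) (auto simp: indicator_def)
  finally show ?thesis .
qed

text \<open>Averaging \<open>f x = f y + (f x - f y)\<close> over \<open>y\<close> in the unit interval next to \<open>x\<close>.\<close>

lemma primitive_power2_le:
  assumes F: "primitive F f" and sF: "square_integrable F" and sf: "square_integrable f"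
  shows "(F x)\<^sup>2 \<le> 2 * (LINT y:{x..x+1}|lborel. (F y)\<^sup>2) + 2 * (LINT y:{x..x+1}|lborel. (f y)\<^sup>2)"
proof -
  have i2: "set_integrable lborel {a..b} (\<lambda>x. (f x)\<^sup>2)" "set_integrable lborel {a..b} (\<lambda>x. (F x)\<^sup>2)" for a b
    using square_integrableD(2)[OF sf] square_integrableD(2)[OF sF]
    by (auto simp: set_integrable_def intro!: integrable_mult_indicator simp del: real_scaleR_def)
  let ?J = "LINT y:{x..x+1}|lborel. (f y)\<^sup>2"
  have pt: "(F x)\<^sup>2 \<le> 2 * (F y)\<^sup>2 + 2 * ?J" if "y \<in> {x..x+1}" for y
  proof -
    have "(F y - F x)\<^sup>2 \<le> (y - x) * (LINT y:{x..y}|lborel. (f y)\<^sup>2)"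
      using set_integral_power2_le[OF sf, of x y] primitiveD(4)[OF F, of x y] that by simp
    also have "(LINT y:{x..y}|lborel. (f y)\<^sup>2) \<le> ?J"
      unfolding set_lebesgue_integral_def
      by (rule integral_mono) (use that i2(1) in \<open>auto simp: set_integrable_def indicator_def\<close>)
    then have "(y - x) * (LINT y:{x..y}|lborel. (f y)\<^sup>2) \<le> 1 * ?J"
      using that by (intro mult_mono) (auto simp: set_lebesgue_integral_def intro!: Bochner_Integration.integral_nonneg)
    finally have "(F y - F x)\<^sup>2 \<le> ?J" by simp
    moreover have "(F x)\<^sup>2 \<le> 2 * (F y)\<^sup>2 + 2 * (F y - F x)\<^sup>2"
      using zero_le_power2[of "2 * F y - F x"] by (simp add: power2_eq_square algebra_simps)
    ultimately show ?thesis by linarith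
  qed
  have [continuous_intros]: "continuous_on {x..x+1} F"
    by (rule continuous_on_subset[OF primitive_continuous[OF F]]) simp
  have "(LINT y:{x..x+1}|lborel. (F x)\<^sup>2) \<le> (LINT y:{x..x+1}|lborel. 2 * (F y)\<^sup>2 + 2 * ?J)"
    by (rule set_integral_mono) (use pt i2(2) in \<open>auto intro!: set_integral_add borel_integrable_atLeastAtMost' continuous_intros\<close>)
  also have "\<dots> = 2 * (LINT y:{x..x+1}|lborel. (F y)\<^sup>2) + (LINT y:{x..x+1}|lborel. 2 * ?J)"
    by (subst set_integral_add) (use i2(2) in \<open>auto intro!: borel_integrable_atLeastAtMost'\<close>)
  finally show ?thesis by (simp add: set_integral_const[of "{x..x+1}" lborel])
qed

section \<open>Fourier transform and differentiation\<close>

lemma square_integrable_of_real_iff: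
  "square_integrable (\<lambda>x. complex_of_real (f x)) \<longleftrightarrow> square_integrable f"
proof -
  have "f \<in> borel_measurable borel" if "(\<lambda>x. complex_of_real (f x)) \<in> borel_measurable borel"
    using measurable_compose[OF that borel_measurable_Re] by simp
  moreover have "(\<lambda>x. complex_of_real (f x)) \<in> borel_measurable borel" if "f \<in> borel_measurable borel"
    using that by measurable
  ultimately have "(\<lambda>x. complex_of_real (f x)) \<in> borel_measurable lborel \<longleftrightarrow> f \<in> borel_measurable lborel"
    unfolding measurable_lborel2 by blast
  then show ?thesis unfolding square_integrable_def norm_of_real real_norm_def by (rule conj_cong) (rule refl)
qed

lemma l2_norm_of_real [simp]: "l2_norm (\<lambda>x. complex_of_real (f x)) = l2_norm f"
  by (simp add: l2_norm_def)

text \<open>Once both functions are square integrable, the nonnegative integral is the square of an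
  L^2 norm and tends to 0 exactly when the norm does; otherwise both sides fail.\<close>

lemma is_fourier_iff_l2_ft: "is_fourier f g \<longleftrightarrow> l2_ft (\<lambda>x. complex_of_real (f x)) g"
proof -
  let ?f = "\<lambda>x. complex_of_real (f x)"
  have t: "complex_of_real (1 / sqrt (2 * pi)) *
          (LINT x:{-R..R}|lborel. exp (- (\<i> * complex_of_real (k * x))) * complex_of_real (f x)) = ft (truncate R ?f) k" for R k
    unfolding ft_def truncate_def set_lebesgue_integral_def
    by (intro arg_cong2[where f = "(*)"] refl Bochner_Integration.integral_cong) (auto simp: indicator_def)
  show ?thesis
  proof (cases "square_integrable f \<and> square_integrable g")
    case True
    have sq: "square_integrable (\<lambda>k. g k - ft (truncate R ?f) k)" for R
      using True by (intro square_integrable_diff square_integrable_ft_truncate) (auto simp: square_integrable_of_real_iff)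
    have "((\<lambda>R. ennreal ((l2_norm (\<lambda>k. g k - ft (truncate R ?f) k))\<^sup>2)) \<longlongrightarrow> 0) at_top \<longleftrightarrow>
       ((\<lambda>R. l2_norm (\<lambda>k. g k - ft (truncate R ?f) k)) \<longlongrightarrow> 0) at_top"
    proof
      assume "((\<lambda>R. ennreal ((l2_norm (\<lambda>k. g k - ft (truncate R ?f) k))\<^sup>2)) \<longlongrightarrow> 0) at_top"
      then have "((\<lambda>R. ennreal ((l2_norm (\<lambda>k. g k - ft (truncate R ?f) k))\<^sup>2)) \<longlongrightarrow> ennreal 0) at_top" by simp
      then have "((\<lambda>R. (l2_norm (\<lambda>k. g k - ft (truncate R ?f) k))\<^sup>2) \<longlongrightarrow> 0) at_top"
        by (rule tendsto_ennrealD) (auto intro: always_eventually)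
      then have "((\<lambda>R. sqrt ((l2_norm (\<lambda>k. g k - ft (truncate R ?f) k))\<^sup>2)) \<longlongrightarrow> sqrt 0) at_top"
        by (intro tendsto_intros)
      then show "((\<lambda>R. l2_norm (\<lambda>k. g k - ft (truncate R ?f) k)) \<longlongrightarrow> 0) at_top" by simp
    next
      assume "((\<lambda>R. l2_norm (\<lambda>k. g k - ft (truncate R ?f) k)) \<longlongrightarrow> 0) at_top"
      then have "((\<lambda>R. ennreal ((l2_norm (\<lambda>k. g k - ft (truncate R ?f) k))\<^sup>2)) \<longlongrightarrow> ennreal (0\<^sup>2)) at_top"
        by (intro tendsto_ennrealI tendsto_intros)
      then show "((\<lambda>R. ennreal ((l2_norm (\<lambda>k. g k - ft (truncate R ?f) k))\<^sup>2)) \<longlongrightarrow> 0) at_top" by simp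
    qed
    then show ?thesis
      unfolding is_fourier_def l2_ft_def t nn_integral_square[OF sq] square_integrable_of_real_iff using True by simp
  next
    case False
    then show ?thesis by (auto simp: is_fourier_def l2_ft_def square_integrable_of_real_iff)
  qed
qed

lemma integrable_inverse_1_plus_power2: "integrable lborel (\<lambda>x::real. inverse (1 + x\<^sup>2))"
  using integrable_inverse_1_plus_square(1) by (simp add: set_integrable_def)

text \<open>Cauchy--Schwarz against \<open>(1 + k\<^sup>2)\<^sup>-\<^sup>1\<^sup>/\<^sup>2\<close>.\<close>

lemma integrable_if_weighted_square_integrable:
  fixes g :: "real \<Rightarrow> complex"
  assumes g: "square_integrable g" and kg: "square_integrable (\<lambda>k. complex_of_real k * g k)"
  shows "integrable lborel g"
proof -
  have [measurable]: "g \<in> borel_measurable borel" using square_integrableD[OF g] by auto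
  let ?w = "\<lambda>k::real. sqrt (inverse (1 + k\<^sup>2))" 
  have p: "1 + k\<^sup>2 > 0" for k :: real by (smt (verit) zero_le_power2)
  have "square_integrable (\<lambda>k. complex_of_real (?w k))"
    unfolding square_integrable_def
    using integrable_inverse_1_plus_power2 p by (auto simp: less_imp_le)
  moreover have "square_integrable (\<lambda>k. complex_of_real (sqrt (1 + k\<^sup>2)) * g k)"
  proof -
    have "(norm (complex_of_real (sqrt (1 + k\<^sup>2)) * g k))\<^sup>2 = (norm (g k))\<^sup>2 + (norm (complex_of_real k * g k))\<^sup>2" for k
      using p[of k] by (simp add: norm_mult power_mult_distrib algebra_simps)
    then show ?thesis unfolding square_integrable_def
      using square_integrableD(2)[OF g] square_integrableD(2)[OF kg] by simp
  qed
  ultimately have "integrable lborel (\<lambda>k. complex_of_real (?w k) * (complex_of_real (sqrt (1 + k\<^sup>2)) * g k))"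
    by (rule square_integrable_mult_integrable)
  moreover have "complex_of_real (?w k) * (complex_of_real (sqrt (1 + k\<^sup>2)) * g k) = g k" for k
    unfolding mult.assoc[symmetric] of_real_mult[symmetric] real_sqrt_mult[symmetric]
    using p[of k] by simp
  ultimately show ?thesis by simp
qed

lemma square_integrable_reflect: "square_integrable f \<Longrightarrow> square_integrable (\<lambda>x. f (- x))"
  using lborel_integrable_real_affine[of "\<lambda>x. (norm (f x))\<^sup>2" "-1" 0]
  by (auto simp: square_integrable_def)

lemma set_integral_Re_reflect:
  assumes h: "square_integrable h"
  shows "(LINT x:{a..b}|lborel. Re (h (- x))) = Re (LINT x|lborel. h x * indicator {-b..-a} x)"
proof -
  have "(LINT x:{a..b}|lborel. Re (h (- x))) = (LINT x|lborel. Re (h x * indicator {-b..-a} x))"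
    using lborel_integral_real_affine[of "-1" "\<lambda>x. Re (h x * indicator {-b..-a} x)" 0]
    unfolding set_lebesgue_integral_def
    by (auto intro!: Bochner_Integration.integral_cong simp: indicator_def)
  also have "\<dots> = Re (LINT x|lborel. h x * indicator {-b..-a} x)"
    by (intro integral_Re square_integrable_mult_integrable h square_integrable_indicator)
  finally show ?thesis .
qed

lemma set_integral_eq_fourier:
  assumes fg: "l2_ft (\<lambda>x. complex_of_real (f x)) g"
  shows "(LINT x:{a..b}|lborel. f x) = Re (LINT k|lborel. g k * ft (indicator {-b..-a}) k)"
proof -
  have "(LINT x:{a..b}|lborel. f x) = (LINT x|lborel. Re (complex_of_real (f x) * cnj (indicator {a..b} x)))"
    unfolding set_lebesgue_integral_def by (intro Bochner_Integration.integral_cong) (auto simp: indicator_def)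
  also have "\<dots> = Re (LINT x|lborel. complex_of_real (f x) * cnj (indicator {a..b} x))"
    by (intro integral_Re square_integrable_mult_integrable l2_ftD(1)[OF fg] square_integrable_cnj square_integrable_indicator)
  also have "\<dots> = Re (LINT k|lborel. g k * cnj (ft (indicator {a..b}) k))"
    by (rule l2_ft_parseval_Re[OF fg l2_ft_indicator])
  finally show ?thesis by (simp add: cnj_ft_indicator)
qed

lemma set_integral_inverse_fourier:
  assumes gh: "l2_ft g h"
  shows "(LINT x:{a..b}|lborel. Re (h (- x))) = Re (LINT k|lborel. g k * ft (indicator {-b..-a}) k)"
  unfolding set_integral_Re_reflect[OF l2_ftD(2)[OF gh]]
  by (subst l2_ft_multiplication_formula[OF gh integrable_indicator_Icc square_integrable_indicator]) simp

text \<open>Tested on intervals: Parseval rewrites the integrals of f, the multiplication formula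
  those of the inverse transform, and both give the same pairing of g with the transform of a
  reflected indicator. No pointwise inversion integral is involved.\<close>

theorem l2_ft_inversion:
  assumes fg: "l2_ft (\<lambda>x. complex_of_real (f x)) g" and gh: "l2_ft g h"
  shows "AE x in lborel. f x = Re (h (- x))"
proof (rule AE_eq_if_interval_integrals_eq)
  show "locally_integrable f"
    using l2_ftD(1)[OF fg] by (intro square_integrable_locally_integrable) (simp add: square_integrable_of_real_iff)
  have h: "square_integrable (\<lambda>x. h (- x))" by (rule square_integrable_reflect[OF l2_ftD(2)[OF gh]])
  have "(\<lambda>x. Re (h (- x))) \<in> borel_measurable borel" using square_integrableD(1)[OF h] by measurable
  then have "square_integrable (\<lambda>x. Re (h (- x)))"
    by (intro square_integrable_bound[OF h, of _ 1]) (auto intro: abs_Re_le_cmod)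
  then show "locally_integrable (\<lambda>x. Re (h (- x)))" by (rule square_integrable_locally_integrable)
qed (simp add: set_integral_eq_fourier[OF fg] set_integral_inverse_fourier[OF gh])

text \<open>The factor ik stays on the left, so the formula includes k = 0 and can be integrated in
  k as it stands.\<close>

lemma ft_indicator:
  assumes "a \<le> b"
  shows "\<i> * complex_of_real k * ft (indicator {-b..-a}) k =
     complex_of_real (1 / sqrt (2 * pi)) * (exp (\<i> * complex_of_real (k * b)) - exp (\<i> * complex_of_real (k * a)))"
proof -
  let ?e = "\<lambda>x. exp (- (\<i> * complex_of_real (k * x)))"
  have "(LINT x|lborel. indicator {-b..-a} x *\<^sub>R (- (\<i> * complex_of_real k) * ?e x)) = ?e (- a) - ?e (- b)"
  proof (rule integral_FTC_atLeastAtMost)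
    fix x
    have "((\<lambda>z. exp (- (\<i> * (complex_of_real k * z)))) has_field_derivative
        - (\<i> * complex_of_real k) * exp (- (\<i> * (complex_of_real k * complex_of_real x)))) (at (complex_of_real x))"
      by (auto intro!: derivative_eq_intros)
    from has_vector_derivative_real_field[OF this]
    show "(?e has_vector_derivative - (\<i> * complex_of_real k) * ?e x) (at x within {- b..- a})" by simp
  qed (use assms in \<open>auto intro!: continuous_intros\<close>)
  also have "(LINT x|lborel. indicator {-b..-a} x *\<^sub>R (- (\<i> * complex_of_real k) * ?e x)) =
     (LINT x|lborel. - (\<i> * complex_of_real k) * (?e x * indicator {-b..-a} x))"
    by (intro Bochner_Integration.integral_cong) (auto simp: indicator_def)
  also have "\<dots> = - (\<i> * complex_of_real k) * (LINT x|lborel. ?e x * indicator {-b..-a} x)"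
    by simp
  finally show ?thesis by (simp add: ft_def algebra_simps)
qed

text \<open>The witness is \<open>F x = Re (ft g (- x))\<close>, the continuous representative of \<open>f\<close>.\<close>

lemma weighted_ft_imp_primitive:
  assumes fg: "l2_ft (\<lambda>x. complex_of_real (f x)) g" and kg: "square_integrable (\<lambda>k. complex_of_real k * g k)"
  obtains F h where "AE x in lborel. f x = F x" "primitive F h" "square_integrable h"
proof -
  have g: "square_integrable g" using l2_ftD(2)[OF fg] .
  have gi: "integrable lborel g" by (rule integrable_if_weighted_square_integrable[OF g kg])
  define F where "F = (\<lambda>x. Re (ft g (- x)))"
  have AE: "AE x in lborel. f x = F x"
    unfolding F_def by (rule l2_ft_inversion[OF fg l2_ft_integrable[OF g gi]])
  \<comment> \<open>The derivative h is the inverse transform of ik g; in the pairing with an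
    indicator the factor ik turns the transform of the indicator into a difference of exponentials,
    which leaves the increment of F.\<close>
  have ik: "square_integrable (\<lambda>k. \<i> * (complex_of_real k * g k))" by (rule square_integrable_cmult[OF kg])
  obtain H where H: "l2_ft (\<lambda>k. \<i> * (complex_of_real k * g k)) H" using ex_l2_ft[OF ik] .
  define h where "h = (\<lambda>x. Re (H (- x)))"
  have Hs: "square_integrable (\<lambda>x. H (- x))" by (rule square_integrable_reflect[OF l2_ftD(2)[OF H]])
  have "h \<in> borel_measurable borel" using square_integrableD(1)[OF Hs] unfolding h_def by measurable
  then have hs: "square_integrable h"
    by (intro square_integrable_bound[OF Hs, of _ 1]) (auto intro: abs_Re_le_cmod simp: h_def)
  have "primitive F h"
    unfolding primitive_def
  proof (intro conjI allI impI)
    fix a b :: real assume ab: "a \<le> b"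
    let ?c = "complex_of_real (1 / sqrt (2 * pi))"
    have ie: "integrable lborel (\<lambda>k. exp (\<i> * complex_of_real (k * x)) * g k)" for x
      using integrable_exp_mult[OF gi, of "- x"] by (simp add: mult.commute)
    have Fx: "F x = Re (?c * (LINT k|lborel. exp (\<i> * complex_of_real (k * x)) * g k))" for x
      by (simp add: F_def ft_def mult.commute)
    have "(LINT x:{a..b}|lborel. h x) = Re (LINT k|lborel. \<i> * (complex_of_real k * g k) * ft (indicator {-b..-a}) k)"
      unfolding h_def by (rule set_integral_inverse_fourier[OF H])
    also have "(\<lambda>k. \<i> * (complex_of_real k * g k) * ft (indicator {-b..-a}) k) =
       (\<lambda>k. ?c * (exp (\<i> * complex_of_real (k * b)) * g k - exp (\<i> * complex_of_real (k * a)) * g k))"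
    proof
      fix k
      have "\<i> * (complex_of_real k * g k) * ft (indicator {-b..-a}) k = (\<i> * complex_of_real k * ft (indicator {-b..-a}) k) * g k"
        by simp
      also have "\<dots> = ?c * (exp (\<i> * complex_of_real (k * b)) * g k - exp (\<i> * complex_of_real (k * a)) * g k)"
        unfolding ft_indicator[OF ab] by (simp only: mult.assoc left_diff_distrib)
      finally show "\<i> * (complex_of_real k * g k) * ft (indicator {-b..-a}) k = 
         ?c * (exp (\<i> * complex_of_real (k * b)) * g k - exp (\<i> * complex_of_real (k * a)) * g k)" .
    qed
    also have "Re (LINT k|lborel. ?c * (exp (\<i> * complex_of_real (k * b)) * g k - exp (\<i> * complex_of_real (k * a)) * g k)) = F b - F a"
      unfolding Fx using ie[of a] ie[of b]
      by (simp only: integral_mult_right_zero Bochner_Integration.integral_diff) (simp only: right_diff_distrib minus_complex.simps)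
    finally show "F b - F a = (LINT x:{a..b}|lborel. h x)" by simp
  qed (rule square_integrable_locally_integrable[OF hs])
  then show ?thesis using that AE hs by blast
qed

lemma integrable_tail_tendsto_0:
  fixes f :: "real \<Rightarrow> real"
  assumes f: "integrable lborel f" and "filterlim (\<lambda>R. \<bar>u R\<bar>) at_top (at_top :: real filter)"
  shows "((\<lambda>R. LINT x:{u R..u R+1}|lborel. f x) \<longlongrightarrow> 0) at_top"
proof -
  have "((\<lambda>R. LINT x|lborel. indicator {u R..u R+1} x *\<^sub>R f x) \<longlongrightarrow> (LINT x::real|lborel. 0)) at_top"
  proof (rule integral_dominated_convergence_at_top[where w = "\<lambda>x. norm (f x)"])
    show "AE x in lborel. ((\<lambda>R. indicator {u R..u R+1} x *\<^sub>R f x) \<longlongrightarrow> 0) at_top"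
    proof (intro AE_I2 tendsto_eventually)
      fix x
      have "\<forall>\<^sub>F R in at_top. \<bar>u R\<bar> \<ge> \<bar>x\<bar> + 2"
        using assms(2) by (auto simp: filterlim_at_top)
      then show "\<forall>\<^sub>F R in at_top. indicator {u R..u R+1} x *\<^sub>R f x = 0"
        by eventually_elim (auto simp: indicator_def)
    qed
    show "\<forall>\<^sub>F R in at_top. AE x in lborel. norm (indicator {u R..u R+1} x *\<^sub>R f x) \<le> norm (f x)"
      by (intro always_eventually allI AE_I2) (auto simp: indicator_def)
  qed (use f in auto)
  then show ?thesis by (simp add: set_lebesgue_integral_def)
qed

text \<open>The square of F at a point is bounded by integrals over the adjacent unit interval,
  which are tails of convergent integrals. In the uses the path u is R, -R or x + R.\<close>

lemma primitive_tendsto_0: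
  assumes F: "primitive F f" and sF: "square_integrable F" and sf: "square_integrable f"
    and u: "filterlim (\<lambda>R. \<bar>u R\<bar>) at_top (at_top :: real filter)"
  shows "((\<lambda>R. F (u R)) \<longlongrightarrow> 0) at_top"
proof -
  have "((\<lambda>R. 2 * (LINT y:{u R..u R+1}|lborel. (F y)\<^sup>2) + 2 * (LINT y:{u R..u R+1}|lborel. (f y)\<^sup>2)) \<longlongrightarrow> 2 * 0 + 2 * 0) at_top"
    using square_integrableD(2)[OF sF] square_integrableD(2)[OF sf]
    by (intro tendsto_intros integrable_tail_tendsto_0 u) auto
  then have "((\<lambda>R. (F (u R))\<^sup>2) \<longlongrightarrow> 0) at_top"
    using primitive_power2_le[OF F sF sf]
    by (intro Lim_null_comparison[of "\<lambda>R. (F (u R))\<^sup>2"]) (auto intro!: always_eventually)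
  then have "((\<lambda>R. sqrt ((F (u R))\<^sup>2)) \<longlongrightarrow> sqrt 0) at_top" by (intro tendsto_intros)
  then show ?thesis by (simp add: tendsto_rabs_zero_iff)
qed

text \<open>The split into cosine and sine integrals lets the real product rule for primitives
  integrate by parts.\<close>

lemma ft_truncate_of_real:
  assumes f: "locally_integrable f"
  shows "ft (truncate R (\<lambda>x. complex_of_real (f x))) k = complex_of_real (1 / sqrt (2 * pi)) *
    Complex (LINT x:{-R..R}|lborel. f x * cos (k * x)) (- (LINT x:{-R..R}|lborel. f x * sin (k * x)))"
proof -
  have e: "exp (- (\<i> * complex_of_real t)) = Complex (cos t) (- sin t)" for t
    by (simp add: complex_eq_iff Re_exp Im_exp)
  have i: "integrable lborel (\<lambda>x. indicator {-R..R} x * (f x * cos (k * x)))" "integrable lborel (\<lambda>x. indicator {-R..R} x * (f x * sin (k * x)))"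
    using set_integrable_mult_continuous[OF f, of "\<lambda>x. cos (k * x)" "-R" R] set_integrable_mult_continuous[OF f, of "\<lambda>x. sin (k * x)" "-R" R]
    by (auto simp: set_integrable_def continuous_intros)
  have "(LINT x|lborel. exp (- (\<i> * complex_of_real (k * x))) * truncate R (\<lambda>x. complex_of_real (f x)) x) =
    (LINT x|lborel. complex_of_real (indicator {-R..R} x * (f x * cos (k * x))) + 
       (- \<i>) * complex_of_real (indicator {-R..R} x * (f x * sin (k * x))))"
    unfolding e by (intro Bochner_Integration.integral_cong) (auto simp: complex_eq_iff truncate_def indicator_def)
  also have "\<dots> = complex_of_real (LINT x|lborel. indicator {-R..R} x * (f x * cos (k * x))) + 
       (- \<i>) * complex_of_real (LINT x|lborel. indicator {-R..R} x * (f x * sin (k * x)))"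
    using i by (subst Bochner_Integration.integral_add) (auto simp del: of_real_mult)
  finally show ?thesis by (simp add: ft_def set_lebesgue_integral_def complex_eq_iff)
qed

lemma ft_truncate_derivative:
  assumes F: "primitive F f" and R: "R \<ge> 0"
  shows "ft (truncate R (\<lambda>x. complex_of_real (f x))) k = 
    complex_of_real (1 / sqrt (2 * pi)) * (exp (- (\<i> * complex_of_real (k * R))) * complex_of_real (F R)
       - exp (\<i> * complex_of_real (k * R)) * complex_of_real (F (- R)))
    + \<i> * complex_of_real k * ft (truncate R (\<lambda>x. complex_of_real (F x))) k"
proof -
  have lF: "locally_integrable F" by (intro continuous_locally_integrable primitive_continuous[OF F])
  have e: "exp (- (\<i> * complex_of_real t)) = Complex (cos t) (- sin t)"
    "exp (\<i> * complex_of_real t) = Complex (cos t) (sin t)" for t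
    by (simp_all add: complex_eq_iff Re_exp Im_exp)
  have pc: "primitive (\<lambda>x. cos (k * x)) (\<lambda>x. - k * sin (k * x))" and ps: "primitive (\<lambda>x. sin (k * x)) (\<lambda>x. k * cos (k * x))"
    by (rule primitive_C1; auto intro!: derivative_eq_intros continuous_intros)+
  have iF: "set_integrable lborel {-R..R} (\<lambda>x. F x * cos (k * x))" "set_integrable lborel {-R..R} (\<lambda>x. F x * sin (k * x))"
    "set_integrable lborel {-R..R} (\<lambda>x. f x * cos (k * x))" "set_integrable lborel {-R..R} (\<lambda>x. f x * sin (k * x))"
    by (auto intro!: set_integrable_mult_continuous lF primitiveD(1)[OF F] continuous_intros)
  have c: "(LINT x:{-R..R}|lborel. f x * cos (k * x)) = F R * cos (k * R) - F (- R) * cos (k * R) + k * (LINT x:{-R..R}|lborel. F x * sin (k * x))"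
  proof -
    have "(LINT x:{-R..R}|lborel. f x * cos (k * x) + F x * (- k * sin (k * x))) =
      (LINT x:{-R..R}|lborel. f x * cos (k * x) - k * (F x * sin (k * x)))" by (simp add: mult_ac)
    also have "\<dots> = (LINT x:{-R..R}|lborel. f x * cos (k * x)) - k * (LINT x:{-R..R}|lborel. F x * sin (k * x))"
      using iF by (subst set_integral_diff) auto
    finally show ?thesis using primitiveD(4)[OF primitive_mult[OF F pc], of "-R" R] R by simp
  qed
  have s: "(LINT x:{-R..R}|lborel. f x * sin (k * x)) = F R * sin (k * R) + F (- R) * sin (k * R) - k * (LINT x:{-R..R}|lborel. F x * cos (k * x))"
  proof -
    have "(LINT x:{-R..R}|lborel. f x * sin (k * x) + F x * (k * cos (k * x))) =
      (LINT x:{-R..R}|lborel. f x * sin (k * x) + k * (F x * cos (k * x)))" by (simp add: mult_ac)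
    also have "\<dots> = (LINT x:{-R..R}|lborel. f x * sin (k * x)) + k * (LINT x:{-R..R}|lborel. F x * cos (k * x))"
      using iF by (subst set_integral_add) auto
    finally show ?thesis using primitiveD(4)[OF primitive_mult[OF F ps], of "-R" R] R by simp
  qed
  show ?thesis
    unfolding ft_truncate_of_real[OF lF] ft_truncate_of_real[OF primitiveD(1)[OF F]] e c s
    by (simp add: complex_eq_iff field_simps)
qed

text \<open>For truncations, integration by parts leaves boundary terms at R and -R, which vanish as
  R grows because F and f are square integrable. Multiplication by ik is unbounded on L^2, so the
  two sides are compared on each window of frequencies up to K, where it costs a factor K.\<close>

theorem l2_ft_derivative:
  assumes F: "primitive F f" and sF: "l2_ft (\<lambda>x. complex_of_real (F x)) g" and sf: "l2_ft (\<lambda>x. complex_of_real (f x)) g'"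
  shows "AE k in lborel. g' k = \<i> * complex_of_real k * g k"
proof -
  let ?F = "\<lambda>x. complex_of_real (F x)" and ?f = "\<lambda>x. complex_of_real (f x)"
  note D = l2_ftD[OF sF] and D' = l2_ftD[OF sf]
  have F2: "square_integrable F" "square_integrable f" using D(1) D'(1) by (auto simp: square_integrable_of_real_iff)
  have [measurable]: "g \<in> borel_measurable borel" "g' \<in> borel_measurable borel"
    using square_integrableD D(2) D'(2) by auto
  define d where "d = (\<lambda>k. g' k - \<i> * complex_of_real k * g k)"
  have [measurable]: "d \<in> borel_measurable borel" unfolding d_def by measurable
  have "AE k in lborel. truncate (real K) d k = 0" for K :: nat
  proof -
    let ?I = "indicator {- real K..real K} :: real \<Rightarrow> complex"
    let ?b = "\<lambda>R. \<bar>F R\<bar> + \<bar>F (- R)\<bar>"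
    let ?B = "\<lambda>R. l2_norm (\<lambda>k. g' k - ft (truncate R ?f) k) + ?b R * l2_norm ?I
       + real K * l2_norm (\<lambda>k. g k - ft (truncate R ?F) k)"
    have "(?B \<longlongrightarrow> 0 + (\<bar>0\<bar> + \<bar>0\<bar>) * l2_norm ?I + real K * 0) at_top"
      by (intro tendsto_intros D D' primitive_tendsto_0[OF F F2])
         (auto intro: filterlim_abs_real filterlim_compose[OF filterlim_abs_real filterlim_ident] )
    moreover have bound: "square_integrable (truncate (real K) d) \<and> l2_norm (truncate (real K) d) \<le> ?B R" if R: "R \<ge> 0" for R
    proof -
      let ?u = "\<lambda>k. norm (g' k - ft (truncate R ?f) k)" and ?v = "\<lambda>k. ?b R * norm (?I k)"
        and ?w = "\<lambda>k. real K * norm (g k - ft (truncate R ?F) k)"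
      have su: "square_integrable ?u" by (intro square_integrable_norm square_integrable_diff D' square_integrable_ft_truncate)
      have sv: "square_integrable ?v" by (intro square_integrable_cmult square_integrable_norm square_integrable_indicator)
      have sw: "square_integrable ?w" by (intro square_integrable_cmult square_integrable_norm square_integrable_diff D square_integrable_ft_truncate)
      have pt: "norm (truncate (real K) d k) \<le> 1 * norm (?u k + ?v k + ?w k)" for k
      proof (cases "\<bar>k\<bar> \<le> real K")
        case True
        let ?bd = "complex_of_real (1 / sqrt (2 * pi)) * (exp (- (\<i> * complex_of_real (k * R))) * complex_of_real (F R)
           - exp (\<i> * complex_of_real (k * R)) * complex_of_real (F (- R)))"
        have "norm ?bd \<le> 1 * (\<bar>F R\<bar> + \<bar>F (- R)\<bar>)"
          unfolding norm_mult
        proof (intro mult_mono)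
          show "norm (complex_of_real (1 / sqrt (2 * pi))) \<le> 1"
            using pi_gt3 by (simp add: norm_divide real_sqrt_ge_1_iff)
          show "norm (exp (- (\<i> * complex_of_real (k * R))) * complex_of_real (F R)
           - exp (\<i> * complex_of_real (k * R)) * complex_of_real (F (- R))) \<le> \<bar>F R\<bar> + \<bar>F (- R)\<bar>"
            by (rule order_trans[OF norm_triangle_ineq4]) (simp add: norm_mult del: of_real_mult)
        qed auto
        moreover have tri: "norm (a + b - c) \<le> norm a + norm b + norm c" for a b c :: complex
          using norm_triangle_ineq4[of "a + b" c] norm_triangle_ineq[of a b] by linarith
        have dk: "d k = (g' k - ft (truncate R ?f) k) + ?bd - \<i> * complex_of_real k * (g k - ft (truncate R ?F) k)"
          unfolding ft_truncate_derivative[OF F R] d_def by (simp add: algebra_simps)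
        have "norm (d k) \<le> ?u k + norm ?bd + norm (\<i> * complex_of_real k * (g k - ft (truncate R ?F) k))"
          unfolding dk by (rule tri)
        moreover have "norm (\<i> * complex_of_real k * (g k - ft (truncate R ?F) k)) \<le> ?w k"
          using True by (simp add: norm_mult mult_right_mono)
        ultimately show ?thesis using True by (simp add: truncate_def indicator_def abs_le_iff)
      qed (auto simp: truncate_def indicator_def abs_le_iff)
      have suv: "square_integrable (\<lambda>k. ?u k + ?v k)" by (intro square_integrable_add su sv)
      have suvw: "square_integrable (\<lambda>k. ?u k + ?v k + ?w k)" by (intro square_integrable_add suv sw)
      have m: "truncate (real K) d \<in> borel_measurable borel" by measurable
      have "l2_norm (truncate (real K) d) \<le> 1 * l2_norm (\<lambda>k. ?u k + ?v k + ?w k)"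
        by (rule l2_norm_bound[OF suvw m]) (use pt in auto)
      also have "\<dots> \<le> l2_norm ?u + l2_norm ?v + l2_norm ?w"
        using l2_norm_triangle[OF suv sw] l2_norm_triangle[OF su sv] by simp
      also have "\<dots> = ?B R"
        unfolding l2_norm_cmult by (simp add: l2_norm_def)
      finally show ?thesis using square_integrable_bound[OF suvw m, of 1] pt by auto
    qed
    ultimately have "l2_norm (truncate (real K) d) \<le> 0"
      by (intro tendsto_lowerbound[of ?B 0 at_top]) (auto intro: eventually_mono[OF eventually_ge_at_top[of 0]])
    then show ?thesis
      using bound[of 0] by (intro l2_norm_eq_0D) (auto intro: antisym)
  qed
  then have "AE k in lborel. \<forall>K::nat. truncate (real K) d k = 0" by (intro AE_all_countable[THEN iffD2] allI)
  then show ?thesis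
  proof eventually_elim
    case (elim k)
    obtain K where "\<bar>k\<bar> \<le> real K" using real_arch_simple by blast
    then show ?case using elim[rule_format, of K] by (auto simp: d_def truncate_def indicator_def abs_le_iff)
  qed
qed

section \<open>Exponentially weighted spaces\<close>

definition wsq :: "real \<Rightarrow> (real \<Rightarrow> real) \<Rightarrow> bool" where
  "wsq b f \<longleftrightarrow> square_integrable (\<lambda>x. cosh x powr b * f x)"

definition wl2 :: "real \<Rightarrow> (real \<Rightarrow> real) \<Rightarrow> real" where
  "wl2 b f = l2_norm (\<lambda>x. cosh x powr b * f x)"

lemma cosh_powr_mult: "cosh x powr a * (cosh x powr b * y) = cosh x powr (a + b) * y" for x y :: real
  by (simp add: powr_add)

lemma cosh_powr_0 [simp]: "cosh x powr 0 = 1" for x :: real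
  using cosh_real_pos[of x] by simp

lemma continuous_cosh_powr [continuous_intros]: "continuous_on A (\<lambda>x::real. cosh x powr b)"
  by (intro continuous_intros) (auto simp: cosh_real_nonzero)

lemma wl2_nonneg [simp]: "0 \<le> wl2 b f" by (simp add: wl2_def)

lemma wsq_0 [simp]: "wsq 0 f = square_integrable f" by (simp add: wsq_def)

lemma wl2_0 [simp]: "wl2 0 f = l2_norm f" by (simp add: wl2_def)

lemma wsq_measurable:
  assumes "wsq b f"
  shows "f \<in> borel_measurable borel"
proof -
  have "(\<lambda>x. cosh x powr (- b) * (cosh x powr b * f x)) \<in> borel_measurable borel"
    by (intro borel_measurable_times[OF borel_measurable_continuous_onI[OF continuous_cosh_powr]]
        square_integrableD(1)[OF assms[unfolded wsq_def]])
  then show ?thesis unfolding cosh_powr_mult by simp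
qed

lemma measurable_cosh_powr_mult:
  "f \<in> borel_measurable borel \<Longrightarrow> (\<lambda>x::real. cosh x powr b * f x :: real) \<in> borel_measurable borel"
  by (intro borel_measurable_times[OF borel_measurable_continuous_onI[OF continuous_cosh_powr]])

lemma wsq_add: "wsq b f \<Longrightarrow> wsq b g \<Longrightarrow> wsq b (\<lambda>x. f x + g x)"
  unfolding wsq_def distrib_left by (rule square_integrable_add)

lemma wsq_diff: "wsq b f \<Longrightarrow> wsq b g \<Longrightarrow> wsq b (\<lambda>x. f x - g x)"
  unfolding wsq_def right_diff_distrib by (rule square_integrable_diff)

lemma wsq_cmult: "wsq b f \<Longrightarrow> wsq b (\<lambda>x. c * f x)"
  unfolding wsq_def mult.left_commute[of _ c] by (rule square_integrable_cmult)

lemma wl2_triangle: "wsq b f \<Longrightarrow> wsq b g \<Longrightarrow> wl2 b (\<lambda>x. f x + g x) \<le> wl2 b f + wl2 b g"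
  unfolding wsq_def wl2_def distrib_left by (rule l2_norm_triangle)

lemma wl2_triangle_diff: "wsq b f \<Longrightarrow> wsq b g \<Longrightarrow> wl2 b (\<lambda>x. f x - g x) \<le> wl2 b f + wl2 b g"
  unfolding wsq_def wl2_def right_diff_distrib by (rule l2_norm_triangle_diff)

lemma wl2_cmult: "wl2 b (\<lambda>x. c * f x) = \<bar>c\<bar> * wl2 b f"
  unfolding wl2_def mult.left_commute[of _ c] by (simp add: l2_norm_cmult)

lemma wsq_bound:
  assumes "wsq b f" "g \<in> borel_measurable borel" "AE x in lborel. \<bar>g x\<bar> \<le> C * \<bar>f x\<bar>"
  shows "wsq b g"
  unfolding wsq_def
proof (rule square_integrable_bound[OF assms(1)[unfolded wsq_def] measurable_cosh_powr_mult[OF assms(2)]])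
  show "AE x in lborel. norm (cosh x powr b * g x) \<le> C * norm (cosh x powr b * f x)"
    using assms(3)
  proof eventually_elim
    case (elim x)
    from mult_left_mono[OF elim, of "cosh x powr b"] show ?case by (simp add: abs_mult mult_ac)
  qed
qed

lemma wl2_bound:
  assumes "wsq b f" "g \<in> borel_measurable borel" "AE x in lborel. \<bar>g x\<bar> \<le> C * \<bar>f x\<bar>" "C \<ge> 0"
  shows "wl2 b g \<le> C * wl2 b f"
  unfolding wl2_def
proof (rule l2_norm_bound[OF assms(1)[unfolded wsq_def] measurable_cosh_powr_mult[OF assms(2)] _ assms(4)])
  show "AE x in lborel. norm (cosh x powr b * g x) \<le> C * norm (cosh x powr b * f x)"
    using assms(3)
  proof eventually_elim
    case (elim x)
    from mult_left_mono[OF elim, of "cosh x powr b"] show ?case by (simp add: abs_mult mult_ac)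
  qed
qed

lemma wl2_cong_AE:
  assumes "f \<in> borel_measurable borel" "g \<in> borel_measurable borel" "AE x in lborel. f x = g x"
  shows "wl2 b f = wl2 b g"
  unfolding wl2_def
  by (intro l2_norm_cong_AE measurable_cosh_powr_mult) (use assms in auto)

lemma wsq_weaken:
  assumes "wsq b f" "b \<ge> 0"
  shows "square_integrable f" "l2_norm f \<le> wl2 b f"
proof -
  have m: "f \<in> borel_measurable borel" using wsq_measurable[OF assms(1)] .
  have pt: "norm (f x) \<le> 1 * norm (cosh x powr b * f x)" for x
    using mult_right_mono[OF ge_one_powr_ge_zero[OF cosh_real_ge_1 assms(2), of x], of "\<bar>f x\<bar>"] by (simp add: abs_mult)
  show "square_integrable f"
    by (rule square_integrable_bound[OF assms(1)[unfolded wsq_def] m, of 1]) (use pt in auto)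
  have "l2_norm f \<le> 1 * l2_norm (\<lambda>x. cosh x powr b * f x)"
    by (rule l2_norm_bound[OF assms(1)[unfolded wsq_def] m]) (use pt in auto)
  then show "l2_norm f \<le> wl2 b f" by (simp add: wl2_def)
qed

text \<open>A ball in the weighted space of order m: f and its first m derivatives each have
  weighted L^2 norm at most r. A predicate with a radius, and not a norm, because the derivatives
  are existentially chosen representatives.\<close>

fun wbound :: "real \<Rightarrow> nat \<Rightarrow> real \<Rightarrow> (real \<Rightarrow> real) \<Rightarrow> bool" where
  "wbound b 0 r f \<longleftrightarrow> wsq b f \<and> wl2 b f \<le> r"
| "wbound b (Suc m) r f \<longleftrightarrow> wsq b f \<and> wl2 b f \<le> r \<and> (\<exists>f'. primitive f f' \<and> wbound b m r f')"

lemma wboundD: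
  assumes "wbound b m r f"
  shows "wsq b f" "wl2 b f \<le> r" "r \<ge> 0"
proof -
  show *: "wsq b f" "wl2 b f \<le> r" using assms by (cases m; simp)+
  show "r \<ge> 0" using *(2) wl2_nonneg[of b f] by linarith
qed

lemma wbound_mono_radius: "wbound b m r f \<Longrightarrow> r \<le> r' \<Longrightarrow> wbound b m r' f"
proof (induction m arbitrary: f)
  case (Suc m)
  then show ?case by (meson order_trans wbound.simps(2))
qed auto

lemma wbound_lower: "wbound b m r f \<Longrightarrow> m' \<le> m \<Longrightarrow> wbound b m' r f"
proof (induction m arbitrary: f m')
  case (Suc m)
  show ?case
  proof (cases m')
    case 0
    then show ?thesis using Suc.prems by simp
  next
    case (Suc k)
    then show ?thesis using Suc.prems Suc.IH[of _ k] by auto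
  qed
qed auto

lemma wbound_add: "wbound b m r f \<Longrightarrow> wbound b m s g \<Longrightarrow> wbound b m (r + s) (\<lambda>x. f x + g x)"
proof (induction m arbitrary: f g)
  case 0
  then show ?case using wsq_add wl2_triangle[of b f g] by auto
next
  case (Suc m)
  then obtain f' g' where "primitive f f'" "wbound b m r f'" "primitive g g'" "wbound b m s g'" by auto
  then have "primitive (\<lambda>x. f x + g x) (\<lambda>x. f' x + g' x)" "wbound b m (r + s) (\<lambda>x. f' x + g' x)"
    using Suc.IH primitive_add by auto
  then show ?case using Suc.prems wsq_add[of b f g] wl2_triangle[of b f g] by auto
qed

lemma wbound_cmult: "wbound b m r f \<Longrightarrow> wbound b m (\<bar>c\<bar> * r) (\<lambda>x. c * f x)"
proof (induction m arbitrary: f)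
  case 0
  then show ?case by (auto simp: wsq_cmult wl2_cmult mult_left_mono)
next
  case (Suc m)
  then obtain f' where "primitive f f'" "wbound b m r f'" by auto
  then have "primitive (\<lambda>x. c * f x) (\<lambda>x. c * f' x)" "wbound b m (\<bar>c\<bar> * r) (\<lambda>x. c * f' x)"
    using Suc.IH primitive_cmult by auto
  then show ?case using Suc.prems by (auto simp: wsq_cmult wl2_cmult mult_left_mono)
qed

lemma wbound_diff: "wbound b m r f \<Longrightarrow> wbound b m s g \<Longrightarrow> wbound b m (r + s) (\<lambda>x. f x - g x)"
  using wbound_add[of b m r f s "\<lambda>x. - g x"] wbound_cmult[of b m s g "-1"] by simp

lemma wbound_weaken: "wbound b m r f \<Longrightarrow> b \<ge> 0 \<Longrightarrow> wbound 0 m r f"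
proof (induction m arbitrary: f)
  case 0
  then show ?case using wsq_weaken[of b f] by auto
next
  case (Suc m)
  then show ?case using wsq_weaken[of b f] by auto
qed

lemma wbound_continuous: "wbound b (Suc m) r f \<Longrightarrow> continuous_on UNIV f"
  using primitive_continuous by auto

text \<open>Differentiating the weight cosh^b multiplies it by b tanh. Polynomials in tanh are
  bounded, and they are closed under differentiation because tanh' = 1 - tanh^2; they are the
  multipliers that arise when weights pass through derivatives.\<close>

lemma has_real_derivative_tanh_poly:
  "((\<lambda>x. poly p (tanh x)) has_real_derivative poly (pderiv p * [:1, 0, -1:]) (tanh x)) (at x)"
proof -
  have "((\<lambda>x. poly p (tanh x)) has_real_derivative (poly (pderiv p) (tanh x) * (1 - tanh x ^ 2))) (at x)"
    by (rule DERIV_chain2[OF poly_DERIV]) (auto intro!: derivative_eq_intros simp: cosh_real_nonzero)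
  moreover have "poly (pderiv p) (tanh x) * (1 - tanh x ^ 2) = poly (pderiv p * [:1, 0, -1:]) (tanh x)"
    by (simp add: power2_eq_square algebra_simps)
  ultimately show ?thesis by (simp only:)
qed

lemma continuous_tanh_poly: "continuous_on A (\<lambda>x::real. poly p (tanh x))"
  by (intro continuous_intros) (auto simp: cosh_real_nonzero)

text \<open>The polynomial varies in the induction, since the product rule brings in p' (1 - X^2) at
  the next lower order.\<close>

lemma wbound_tanh_poly:
  "\<exists>C\<ge>0. \<forall>r f. wbound b m r f \<longrightarrow> wbound b m (C * r) (\<lambda>x. poly p (tanh x) * f x)"
proof (induction m arbitrary: p)
  case (0 p)
  have "bounded (poly p ` {-1..1})" by (intro compact_imp_bounded compact_continuous_image continuous_intros) auto
  then obtain C where "\<forall>y\<in>poly p ` {-1..1}. \<bar>y\<bar> \<le> C" by (auto simp: bounded_iff)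
  then have C: "\<bar>poly p (tanh x)\<bar> \<le> C" for x :: real
    using tanh_real_abs[of x] tanh_real_lt_1[of x] tanh_real_gt_neg1[of x] by (auto simp: less_imp_le)
  then have C0: "C \<ge> 0" by (meson abs_ge_zero order_trans)
  have "wbound b 0 (C * r) (\<lambda>x. poly p (tanh x) * f x)" if f: "wbound b 0 r f" for r f
  proof -
    have m: "(\<lambda>x. poly p (tanh x) * f x) \<in> borel_measurable borel"
      by (intro borel_measurable_times[OF borel_measurable_continuous_onI[OF continuous_tanh_poly]]) (use wsq_measurable[of b f] f in simp)
    have pt: "AE x in lborel. \<bar>poly p (tanh x) * f x\<bar> \<le> C * \<bar>f x\<bar>" using C by (simp add: abs_mult mult_right_mono)
    have "wl2 b (\<lambda>x. poly p (tanh x) * f x) \<le> C * wl2 b f" by (rule wl2_bound[OF _ m pt C0]) (use f in simp)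
    also have "\<dots> \<le> C * r" using f C0 by (simp add: mult_left_mono)
    finally show ?thesis using wsq_bound[OF _ m pt] f by simp
  qed
  then show ?case using C0 by blast
next
  case (Suc m p)
  let ?q = "pderiv p * [:1, 0, -1:]"
  obtain C where C: "C \<ge> 0" "\<And>r f. wbound b m r f \<Longrightarrow> wbound b m (C * r) (\<lambda>x. poly p (tanh x) * f x)"
    using Suc.IH[of p] by blast
  obtain D where D: "D \<ge> 0" "\<And>r f. wbound b m r f \<Longrightarrow> wbound b m (D * r) (\<lambda>x. poly ?q (tanh x) * f x)"
    using Suc.IH[of ?q] by blast
  have "wbound b (Suc m) ((C + D) * r) (\<lambda>x. poly p (tanh x) * f x)" if f: "wbound b (Suc m) r f" for r f
  proof -
    obtain f' where f': "primitive f f'" "wbound b m r f'" using f by auto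
    have fm: "wbound b m r f" using f by (rule wbound_lower) simp
    have r: "r \<ge> 0" using wboundD(3)[OF f] .
    have "primitive (\<lambda>x. poly p (tanh x)) (\<lambda>x. poly ?q (tanh x))"
      by (rule primitive_C1[OF has_real_derivative_tanh_poly continuous_tanh_poly])
    from primitive_mult[OF this f'(1)]
    have "primitive (\<lambda>x. poly p (tanh x) * f x) (\<lambda>x. poly ?q (tanh x) * f x + poly p (tanh x) * f' x)" .
    moreover have "wbound b m ((C + D) * r) (\<lambda>x. poly ?q (tanh x) * f x + poly p (tanh x) * f' x)"
      using wbound_add[OF D(2)[OF fm] C(2)[OF f'(2)]] by (simp add: algebra_simps)
    moreover have "wbound b m ((C + D) * r) (\<lambda>x. poly p (tanh x) * f x)"
      by (rule wbound_mono_radius[OF C(2)[OF fm]]) (use D(1) r in \<open>simp add: mult_right_mono\<close>)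
    ultimately show ?thesis using wboundD(1,2) by auto
  qed
  then show ?case using C(1) D(1) by (meson add_nonneg_nonneg)
qed

lemma has_real_derivative_cosh_powr:
  "((\<lambda>x. cosh x powr b) has_real_derivative (b * tanh x * cosh x powr b)) (at x)" for x :: real
proof -
  have "((\<lambda>x. cosh x powr b) has_real_derivative (b * cosh x powr (b - 1) * sinh x)) (at x)"
    by (rule DERIV_chain2[of "\<lambda>y. y powr b"])
       (use cosh_real_pos[of x] in \<open>auto intro!: derivative_eq_intros has_real_derivative_powr\<close>)
  moreover have "cosh x powr (b - 1) * sinh x = tanh x * cosh x powr b"
    using cosh_real_pos[of x] by (simp add: powr_diff tanh_def)
  ultimately show ?thesis by (simp add: mult.assoc)
qed

lemma primitive_cosh_powr: "primitive (\<lambda>x. cosh x powr b) (\<lambda>x. b * tanh x * cosh x powr b)"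
  by (rule primitive_C1[OF has_real_derivative_cosh_powr])
     (intro continuous_intros; simp add: cosh_real_nonzero)

text \<open>The exponent b may have either sign. Positive b passes from weighted derivatives to
  derivatives of the weighted function, negative b passes back; this reconciles
  \<open>wbound\<close> with \<open>wnorm\<close>, where the weight stands inside the
  derivatives.\<close>

lemma wbound_weight:
  "\<exists>C\<ge>0. \<forall>r f. wbound (b + d) m r f \<longrightarrow> wbound d m (C * r) (\<lambda>x. cosh x powr b * f x)"
proof (induction m)
  case 0
  have "wbound d 0 (1 * r) (\<lambda>x. cosh x powr b * f x)" if "wbound (b + d) 0 r f" for r f
    using that by (simp add: wsq_def wl2_def cosh_powr_mult add.commute)
  then show ?case by (intro exI[of _ 1]) auto
next
  case (Suc m)
  obtain C where C: "C \<ge> 0" "\<And>r f. wbound (b + d) m r f \<Longrightarrow> wbound d m (C * r) (\<lambda>x. cosh x powr b * f x)"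
    using Suc.IH by blast
  obtain D where D: "D \<ge> 0" "\<And>r f. wbound (b + d) m r f \<Longrightarrow> wbound (b + d) m (D * r) (\<lambda>x. poly [:0, b:] (tanh x) * f x)"
    using wbound_tanh_poly by blast
  have "wbound d (Suc m) ((1 + C * (D + 1)) * r) (\<lambda>x. cosh x powr b * f x)" if f: "wbound (b + d) (Suc m) r f" for r f
  proof -
    obtain f' where f': "primitive f f'" "wbound (b + d) m r f'" using f by auto
    have r: "r \<ge> 0" using wboundD(3)[OF f] .
    have fm: "wbound (b + d) m r f" using f by (rule wbound_lower) simp
    have "wbound (b + d) m ((D + 1) * r) (\<lambda>x. b * tanh x * f x + f' x)"
      using wbound_add[OF D(2)[OF fm] f'(2)] by (simp add: algebra_simps)
    from C(2)[OF this] have "wbound d m (C * (D + 1) * r) (\<lambda>x. cosh x powr b * (b * tanh x * f x + f' x))"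
      by (simp add: mult.assoc)
    then have 1: "wbound d m ((1 + C * (D + 1)) * r) (\<lambda>x. cosh x powr b * (b * tanh x * f x + f' x))"
      by (rule wbound_mono_radius) (use r in \<open>simp add: algebra_simps\<close>)
    have 2: "primitive (\<lambda>x. cosh x powr b * f x) (\<lambda>x. cosh x powr b * (b * tanh x * f x + f' x))"
      using primitive_mult[OF primitive_cosh_powr f'(1)] by (simp add: algebra_simps)
    have "wl2 d (\<lambda>x. cosh x powr b * f x) = wl2 (b + d) f" "wsq d (\<lambda>x. cosh x powr b * f x) = wsq (b + d) f"
      by (simp_all add: wsq_def wl2_def cosh_powr_mult add.commute)
    moreover have "wl2 (b + d) f \<le> (1 + C * (D + 1)) * r"
    proof -
      have "0 \<le> C * (D + 1) * r" using C(1) D(1) r by simp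
      moreover have "wl2 (b + d) f \<le> r" using f by simp
      ultimately show ?thesis by (simp add: distrib_right)
    qed
    ultimately show ?thesis using 1 2 f by auto
  qed
  then show ?case using C(1) D(1) by (intro exI[of _ "1 + C * (D + 1)"]) auto
qed

lemma integrable_mono_nonneg:
  fixes f g :: "real \<Rightarrow> real"
  assumes "integrable lborel g" "f \<in> borel_measurable borel" "\<And>x. 0 \<le> f x" "\<And>x. f x \<le> g x"
  shows "integrable lborel f" "(LINT x|lborel. f x) \<le> (LINT x|lborel. g x)"
proof -
  show i: "integrable lborel f"
  proof (rule Bochner_Integration.integrable_bound[OF assms(1)])
    have "norm (f x) \<le> norm (g x)" for x using assms(3,4)[of x] by simp
    then show "AE x in lborel. norm (f x) \<le> norm (g x)" by simp
  qed (use assms(2) in simp)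
  show "(LINT x|lborel. f x) \<le> (LINT x|lborel. g x)" by (intro integral_mono i assms)
qed

text \<open>One factor 1 + k^2 of the weight dominates k^2, so the derivative, whose transform is
  ikg, satisfies the hypothesis at the next lower order with the same r.\<close>

lemma fourier_weight_imp_wbound:
  assumes "l2_ft (\<lambda>x. complex_of_real (f x)) g" "integrable lborel (\<lambda>k. (1 + k\<^sup>2) ^ m * (norm (g k))\<^sup>2)"
    "(LINT k|lborel. (1 + k\<^sup>2) ^ m * (norm (g k))\<^sup>2) \<le> r\<^sup>2" "r \<ge> 0"
  shows "\<exists>F. (AE x in lborel. f x = F x) \<and> wbound 0 m r F"
  using assms
proof (induction m arbitrary: f g)
  case (0 f g)
  then have "(l2_norm f)\<^sup>2 \<le> r\<^sup>2" using l2_ft_norm[OF 0(1)] l2_norm_sq[of g] by simp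
  then have "l2_norm f \<le> r" using 0(4) by (simp add: power2_le_iff_abs_le)
  then show ?case using l2_ftD(1)[OF 0(1)] by (intro exI[of _ f]) (auto simp: square_integrable_of_real_iff)
next
  case (Suc m f g)
  note fg = l2_ftD[OF Suc.prems(1)]
  have gm [measurable]: "g \<in> borel_measurable borel" using fg(2) square_integrableD by auto
  have 1: "1 \<le> (1 + k\<^sup>2) ^ n" for k :: real and n by (simp add: one_le_power)
  have kgm: "(\<lambda>k. \<i> * complex_of_real k * g k) \<in> borel_measurable borel" by measurable
  have le: "(1 + k\<^sup>2) ^ m * (norm (\<i> * complex_of_real k * g k))\<^sup>2 \<le> (1 + k\<^sup>2) ^ Suc m * (norm (g k))\<^sup>2" for k
  proof -
    have "(1 + k\<^sup>2) ^ m * (norm (\<i> * complex_of_real k * g k))\<^sup>2 = (1 + k\<^sup>2) ^ m * (k\<^sup>2 * (norm (g k))\<^sup>2)"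
      by (simp add: norm_mult power_mult_distrib)
    also have "\<dots> \<le> (1 + k\<^sup>2) ^ m * ((1 + k\<^sup>2) * (norm (g k))\<^sup>2)"
      by (intro mult_left_mono mult_right_mono) auto
    finally show ?thesis by (simp add: mult_ac)
  qed
  have I: "integrable lborel (\<lambda>k. (1 + k\<^sup>2) ^ m * (norm (\<i> * complex_of_real k * g k))\<^sup>2)"
    "(LINT k|lborel. (1 + k\<^sup>2) ^ m * (norm (\<i> * complex_of_real k * g k))\<^sup>2) \<le> (LINT k|lborel. (1 + k\<^sup>2) ^ Suc m * (norm (g k))\<^sup>2)"
    by (rule integrable_mono_nonneg[OF Suc.prems(2) _ _ le]; simp)+
  have "integrable lborel (\<lambda>k. (norm (complex_of_real k * g k))\<^sup>2)"
  proof (rule integrable_mono_nonneg(1)[OF I(1)])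
    fix k show "(norm (complex_of_real k * g k))\<^sup>2 \<le> (1 + k\<^sup>2) ^ m * (norm (\<i> * complex_of_real k * g k))\<^sup>2"
      using mult_right_mono[OF 1[of k m], of "(norm (complex_of_real k * g k))\<^sup>2"] by (simp add: norm_mult)
  qed auto
  then have kg: "square_integrable (\<lambda>k. complex_of_real k * g k)" by (simp add: square_integrable_def)
  obtain F h where F: "AE x in lborel. f x = F x" "primitive F h" "square_integrable h"
    using weighted_ft_imp_primitive[OF Suc.prems(1) kg] .
  have Fm: "F \<in> borel_measurable borel" by (rule primitive_measurable[OF F(2)])
  have Fg: "l2_ft (\<lambda>x. complex_of_real (F x)) g"
    by (rule l2_ft_cong[OF Suc.prems(1)]) (use Fm F(1) in \<open>auto elim!: eventually_mono\<close>)
  obtain g1 where g1: "l2_ft (\<lambda>x. complex_of_real (h x)) g1"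
    using ex_l2_ft F(3) square_integrable_of_real_iff by blast
  have "l2_ft (\<lambda>x. complex_of_real (h x)) (\<lambda>k. \<i> * complex_of_real k * g k)"
    by (rule l2_ft_cong[OF g1]) (use l2_ft_derivative[OF F(2) Fg g1] kgm l2_ftD(1)[OF g1] square_integrableD in auto)
  from Suc.IH[OF this I(1)] I(2) Suc.prems(3,4) obtain H where H: "AE x in lborel. h x = H x" "wbound 0 m r H"
    by fastforce
  have "primitive F H" by (rule primitive_cong_AE[OF F(2) wsq_measurable[OF wboundD(1)[OF H(2)]] H(1)])
  moreover have "square_integrable F" using l2_ftD(1)[OF Fg] by (simp add: square_integrable_of_real_iff)
  moreover have "l2_norm F \<le> r"
  proof -
    have "(l2_norm F)\<^sup>2 = (LINT k|lborel. (norm (g k))\<^sup>2)" using l2_ft_norm[OF Fg] by (simp add: l2_norm_sq[of g, symmetric])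
    also have "\<dots> \<le> (LINT k|lborel. (1 + k\<^sup>2) ^ Suc m * (norm (g k))\<^sup>2)"
    proof (rule integrable_mono_nonneg(2)[OF Suc.prems(2)])
      fix k show "(norm (g k))\<^sup>2 \<le> (1 + k\<^sup>2) ^ Suc m * (norm (g k))\<^sup>2"
        using mult_right_mono[OF 1[of k "Suc m"], of "(norm (g k))\<^sup>2"] by simp
    qed auto
    also have "\<dots> \<le> r\<^sup>2" by (rule Suc.prems(3))
    finally show ?thesis using Suc.prems(4) by (simp add: power2_le_iff_abs_le)
  qed
  ultimately show ?case using F(1) H(2) by auto
qed

text \<open>The splitting (1 + k^2)|g|^2 = |g|^2 + |kg|^2 refers order m + 1 to order m for the
  function and for its derivative; adding the two bounds doubles the constant at each level, hence
  2^m.\<close>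

lemma wbound_imp_fourier_weight:
  assumes "wbound 0 m r f" "l2_ft (\<lambda>x. complex_of_real (f x)) g"
  shows "integrable lborel (\<lambda>k. (1 + k\<^sup>2) ^ m * (norm (g k))\<^sup>2) \<and>
    (LINT k|lborel. (1 + k\<^sup>2) ^ m * (norm (g k))\<^sup>2) \<le> 2 ^ m * r\<^sup>2"
  using assms
proof (induction m arbitrary: f g)
  case (0 f g)
  have "(LINT k|lborel. (norm (g k))\<^sup>2) = (l2_norm f)\<^sup>2" using l2_ft_norm[OF 0(2)] by (simp add: l2_norm_sq[of g, symmetric])
  also have "\<dots> \<le> r\<^sup>2" using 0(1) by (intro power_mono) auto
  finally show ?case using square_integrableD(2)[OF l2_ftD(2)[OF 0(2)]] by simp
next
  case (Suc m f g)
  have gm [measurable]: "g \<in> borel_measurable borel" using l2_ftD(2)[OF Suc.prems(2)] square_integrableD by auto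
  obtain h where h: "primitive f h" "wbound 0 m r h" using Suc.prems(1) by auto
  have fm: "wbound 0 m r f" by (rule wbound_lower[OF Suc.prems(1)]) simp
  have "square_integrable h" using wboundD(1)[OF h(2)] by simp
  then obtain g1 where g1: "l2_ft (\<lambda>x. complex_of_real (h x)) g1"
    using ex_l2_ft square_integrable_of_real_iff by blast
  have [measurable]: "g1 \<in> borel_measurable borel" using l2_ftD(2)[OF g1] square_integrableD by auto
  note A = Suc.IH[OF fm Suc.prems(2)] and B = Suc.IH[OF h(2) g1]
  have eq: "AE k in lborel. (1 + k\<^sup>2) ^ m * (norm (g k))\<^sup>2 + (1 + k\<^sup>2) ^ m * (norm (g1 k))\<^sup>2 = (1 + k\<^sup>2) ^ Suc m * (norm (g k))\<^sup>2"
    using l2_ft_derivative[OF h(1) Suc.prems(2) g1]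
    by eventually_elim (simp add: norm_mult power_mult_distrib algebra_simps)
  have i: "integrable lborel (\<lambda>k. (1 + k\<^sup>2) ^ m * (norm (g k))\<^sup>2 + (1 + k\<^sup>2) ^ m * (norm (g1 k))\<^sup>2)"
    using A B by auto
  have "integrable lborel (\<lambda>k. (1 + k\<^sup>2) ^ Suc m * (norm (g k))\<^sup>2)"
    by (rule integrable_cong_AE_imp[OF i _ eq]) measurable
  moreover have "(LINT k|lborel. (1 + k\<^sup>2) ^ Suc m * (norm (g k))\<^sup>2) =
     (LINT k|lborel. (1 + k\<^sup>2) ^ m * (norm (g k))\<^sup>2 + (1 + k\<^sup>2) ^ m * (norm (g1 k))\<^sup>2)"
    by (rule integral_cong_AE) (use eq in \<open>auto elim!: eventually_mono\<close>)
  moreover have "\<dots> \<le> 2 ^ Suc m * r\<^sup>2" using A B by simp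
  ultimately show ?case by simp
qed

section \<open>Comparison of the Fourier norms of integer order with chains of primitives\<close>

lemma powr_real_nat: "(1 + k\<^sup>2) powr real m = (1 + k\<^sup>2) ^ m" for k :: real
  by (rule powr_realpow) (smt (verit) zero_le_power2)

lemma ex_is_fourier:
  assumes "square_integrable f"
  obtains g where "is_fourier f g"
  using ex_l2_ft[of "\<lambda>x. complex_of_real (f x)"] assms
  by (auto simp: square_integrable_of_real_iff is_fourier_iff_l2_ft)

lemma is_fourier_fourier: "is_fourier f g \<Longrightarrow> is_fourier f (fourier f)"
  unfolding fourier_def by (rule someI[of "is_fourier f"])

lemma is_fourier_unique_AE: "is_fourier f g \<Longrightarrow> is_fourier f h \<Longrightarrow> AE k in lborel. g k = h k"
  unfolding is_fourier_iff_l2_ft by (rule l2_ft_unique)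

lemma is_fourier_measurable: "is_fourier f g \<Longrightarrow> g \<in> borel_measurable borel"
  unfolding is_fourier_iff_l2_ft using l2_ftD(2) square_integrableD by blast

lemma sobolev_integrable_fourier:
  assumes "f \<in> sobolev s"
  shows "is_fourier f (fourier f)" "integrable lborel (\<lambda>k. (1 + k\<^sup>2) powr s * (norm (fourier f k))\<^sup>2)"
proof -
  obtain g where g: "is_fourier f g" "integrable lborel (\<lambda>k. (1 + k\<^sup>2) powr s * (norm (g k))\<^sup>2)"
    using assms by (auto simp: sobolev_def)
  show *: "is_fourier f (fourier f)" by (rule is_fourier_fourier[OF g(1)])
  have [measurable]: "g \<in> borel_measurable borel" "fourier f \<in> borel_measurable borel"
    using is_fourier_measurable g * by auto
  show "integrable lborel (\<lambda>k. (1 + k\<^sup>2) powr s * (norm (fourier f k))\<^sup>2)"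
    by (rule integrable_cong_AE_imp[OF g(2)])
       (use is_fourier_unique_AE[OF g(1) *] in \<open>auto elim!: eventually_mono\<close>)
qed

lemma sobolev_imp_wbound:
  assumes f: "f \<in> sobolev (real m)" and r: "sobolev_norm (real m) f \<le> r"
  shows "\<exists>F. (AE x in lborel. f x = F x) \<and> wbound 0 m r F"
proof (rule fourier_weight_imp_wbound)
  note * = sobolev_integrable_fourier[OF f]
  show "l2_ft (\<lambda>x. complex_of_real (f x)) (fourier f)" using * by (simp add: is_fourier_iff_l2_ft)
  show "integrable lborel (\<lambda>k. (1 + k\<^sup>2) ^ m * (norm (fourier f k))\<^sup>2)" using * by (simp add: powr_real_nat)
  have n: "(LINT k|lborel. (1 + k\<^sup>2) ^ m * (norm (fourier f k))\<^sup>2) \<ge> 0" by (intro Bochner_Integration.integral_nonneg) auto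
  then have "0 \<le> sobolev_norm (real m) f" unfolding sobolev_norm_def powr_real_nat by (rule real_sqrt_ge_zero)
  then show "r \<ge> 0" using r by linarith
  then show "(LINT k|lborel. (1 + k\<^sup>2) ^ m * (norm (fourier f k))\<^sup>2) \<le> r\<^sup>2"
    using r n by (simp add: sobolev_norm_def powr_real_nat sqrt_le_D)
qed

lemma wbound_imp_sobolev:
  assumes F: "wbound 0 m r F" and f: "f \<in> borel_measurable borel" "AE x in lborel. f x = F x"
  shows "f \<in> sobolev (real m)" "sobolev_norm (real m) f \<le> 2 ^ m * r"
proof -
  have sF: "square_integrable F" using wboundD(1)[OF F] by simp
  have sf: "square_integrable f" by (rule square_integrable_cong_AE[OF sF f(1)]) (use f(2) in \<open>auto elim!: eventually_mono\<close>)
  obtain g where g: "is_fourier f g" using ex_is_fourier[OF sf] .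
  have Fg: "l2_ft (\<lambda>x. complex_of_real (F x)) h" if "is_fourier f h" for h
    using that[unfolded is_fourier_iff_l2_ft]
    by (rule l2_ft_cong) (use f(2) square_integrableD(1)[OF sF] is_fourier_measurable[OF that] in \<open>auto elim!: eventually_mono\<close>)
  show "f \<in> sobolev (real m)"
    unfolding sobolev_def using sf g wbound_imp_fourier_weight[OF F Fg[OF g]] by (auto simp: powr_real_nat)
  have "sqrt (LINT k|lborel. (1 + k\<^sup>2) ^ m * (norm (fourier f k))\<^sup>2) \<le> sqrt (2 ^ m * r\<^sup>2)"
    using wbound_imp_fourier_weight[OF F Fg[OF is_fourier_fourier[OF g]]] by simp
  also have "\<dots> \<le> sqrt ((2 ^ m * r)\<^sup>2)"
    unfolding power_mult_distrib by (intro real_sqrt_le_mono mult_right_mono) (auto simp: power2_eq_square)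
  also have "\<dots> = 2 ^ m * r" using wboundD(3)[OF F] by simp
  finally show "sobolev_norm (real m) f \<le> 2 ^ m * r" by (simp add: sobolev_norm_def powr_real_nat)
qed

lemma sobolev_mono:
  assumes f: "f \<in> sobolev t" and st: "s \<le> t"
  shows "f \<in> sobolev s" "sobolev_norm s f \<le> sobolev_norm t f"
proof -
  note * = sobolev_integrable_fourier[OF f]
  have [measurable]: "fourier f \<in> borel_measurable borel" by (rule is_fourier_measurable[OF *(1)])
  have le: "(1 + k\<^sup>2) powr s * (norm (fourier f k))\<^sup>2 \<le> (1 + k\<^sup>2) powr t * (norm (fourier f k))\<^sup>2" for k
    by (intro mult_right_mono powr_mono st) auto
  note I = integrable_mono_nonneg[OF *(2) _ _ le, simplified]
  then show "f \<in> sobolev s" using *(1) f by (auto simp: sobolev_def)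
  show "sobolev_norm s f \<le> sobolev_norm t f" using I(2) by (simp add: sobolev_norm_def)
qed

lemma wsobolev_mono:
  assumes "f \<in> wsobolev t b" "s \<le> t"
  shows "f \<in> wsobolev s b" "wnorm s b f \<le> wnorm t b f"
  using assms sobolev_mono by (auto simp: wsobolev_def wnorm_def)

theorem wsobolev_imp_wbound:
  "\<exists>C\<ge>0. \<forall>f r. f \<in> wsobolev (real m) b \<longrightarrow> wnorm (real m) b f \<le> r \<longrightarrow>
     (\<exists>F. (AE x in lborel. f x = F x) \<and> wbound b m (C * r) F)"
proof -
  obtain C where C: "C \<ge> 0" "\<And>r f. wbound 0 m r f \<Longrightarrow> wbound b m (C * r) (\<lambda>x. cosh x powr (- b) * f x)"
    using wbound_weight[of "- b" b m] by auto
  have "\<exists>F. (AE x in lborel. f x = F x) \<and> wbound b m (C * r) F"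
    if f: "f \<in> wsobolev (real m) b" and r: "wnorm (real m) b f \<le> r" for f r
  proof -
    obtain G where G: "AE x in lborel. cosh x powr b * f x = G x" "wbound 0 m r G"
      using sobolev_imp_wbound[of "\<lambda>x. cosh x powr b * f x" m r] f r unfolding wsobolev_def wnorm_def by blast
    have A: "AE x in lborel. f x = cosh x powr (- b) * G x"
      using G(1)
    proof eventually_elim
      case (elim x)
      show ?case unfolding elim[symmetric] cosh_powr_mult by simp
    qed
    show ?thesis by (intro exI[of _ "\<lambda>x. cosh x powr (- b) * G x"] conjI A C(2)[OF G(2)])
  qed
  then show ?thesis using C(1) by blast
qed

theorem wbound_imp_wsobolev:
  assumes b: "b \<ge> 0"
  shows "\<exists>C\<ge>0. \<forall>f F r. wbound b m r F \<longrightarrow> f \<in> borel_measurable borel \<longrightarrow> (AE x in lborel. f x = F x) \<longrightarrow>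
     f \<in> wsobolev (real m) b \<and> wnorm (real m) b f \<le> C * r"
proof -
  obtain C where C: "C \<ge> 0" "\<And>r f. wbound b m r f \<Longrightarrow> wbound 0 m (C * r) (\<lambda>x. cosh x powr b * f x)"
    using wbound_weight[of b 0 m] by auto
  have "f \<in> wsobolev (real m) b \<and> wnorm (real m) b f \<le> 2 ^ m * C * r"
    if F: "wbound b m r F" and f: "f \<in> borel_measurable borel" "AE x in lborel. f x = F x" for f F r
  proof -
    have "AE x in lborel. cosh x powr b * f x = cosh x powr b * F x" using f(2) by eventually_elim simp
    note w = wbound_imp_sobolev[OF C(2)[OF F] measurable_cosh_powr_mult[OF f(1)] this]
    show ?thesis
      using w wbound_imp_sobolev(1)[OF wbound_weaken[OF F b] f] by (auto simp: wsobolev_def wnorm_def mult.assoc)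
  qed
  then show ?thesis using C(1) by (intro exI[of _ "2 ^ m * C"]) auto
qed

section \<open>Bump functions and weak derivatives\<close>

lemma C_k_0: "C_k 0 f \<longleftrightarrow> continuous_on UNIV f"
  by (simp add: C_k_def)

lemma C_k_Suc: "C_k (Suc k) f \<longleftrightarrow> (\<forall>x. f field_differentiable (at x)) \<and> C_k k (deriv f)"
proof -
  have "(\<forall>j<Suc k. P j) \<longleftrightarrow> P 0 \<and> (\<forall>j<k. P (Suc j))" for P :: "nat \<Rightarrow> bool"
    by (metis Suc_less_eq gr0_conv_Suc less_Suc_eq_0_disj)
  then show ?thesis unfolding C_k_def by (simp add: funpow_Suc_right del: funpow.simps)
qed

lemma C_k_imp_continuous: "C_k k f \<Longrightarrow> continuous_on UNIV f"
  by (cases k) (auto simp: C_k_0 C_k_Suc continuous_on_eq_continuous_at field_differentiable_imp_continuous_at)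

lemma C_k_lower: "C_k k f \<Longrightarrow> j \<le> k \<Longrightarrow> C_k j f"
proof (induction k arbitrary: f j)
  case (Suc k)
  show ?case
  proof (cases j)
    case 0
    then show ?thesis using C_k_imp_continuous[OF Suc.prems(1)] by (simp add: C_k_0)
  next
    case (Suc i)
    then show ?thesis using Suc.prems Suc.IH[of _ i] by (auto simp: C_k_Suc)
  qed
qed auto

lemma C_k_derivative: "C_k (Suc k) f \<Longrightarrow> (f has_real_derivative deriv f x) (at x)"
  by (auto simp: C_k_Suc DERIV_deriv_iff_field_differentiable)

lemma C_k_SucI:
  assumes "\<And>x. (f has_real_derivative f' x) (at x)" "C_k k f'"
  shows "C_k (Suc k) f"
proof -
  have "deriv f = f'" using assms(1) DERIV_imp_deriv by blast
  then show ?thesis using assms by (auto simp: C_k_Suc field_differentiable_def)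
qed

lemma C_k_add: "C_k k f \<Longrightarrow> C_k k g \<Longrightarrow> C_k k (\<lambda>x. f x + g x)"
proof (induction k arbitrary: f g)
  case 0
  then show ?case by (auto simp: C_k_0 intro: continuous_on_add)
next
  case (Suc k)
  then have "C_k k (\<lambda>x. deriv f x + deriv g x)" by (auto simp: C_k_Suc)
  then show ?case by (rule C_k_SucI[rotated]) (use Suc.prems C_k_derivative in \<open>auto intro!: DERIV_add\<close>)
qed

lemma C_k_const: "C_k k (\<lambda>x. c)"
  by (induction k arbitrary: c) (auto simp: C_k_0 intro: C_k_SucI[where f' = "\<lambda>_. 0"])

lemma C_k_mult: "C_k k f \<Longrightarrow> C_k k g \<Longrightarrow> C_k k (\<lambda>x. f x * g x)"
proof (induction k arbitrary: f g)
  case 0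
  then show ?case by (auto simp: C_k_0 intro: continuous_on_mult)
next
  case (Suc k)
  then have "C_k k f" "C_k k g" "C_k k (deriv f)" "C_k k (deriv g)"
    using C_k_lower[of "Suc k" _ k] by (auto simp: C_k_Suc)
  then have "C_k k (\<lambda>x. deriv f x * g x + deriv g x * f x)" by (intro C_k_add Suc.IH)
  then show ?case by (rule C_k_SucI[rotated]) (use Suc.prems C_k_derivative in \<open>auto intro!: DERIV_mult\<close>)
qed

lemma C_k_affine: "C_k k f \<Longrightarrow> C_k k (\<lambda>x. f (a * x + b))"
proof (induction k arbitrary: f)
  case 0
  then show ?case unfolding C_k_0 by (intro continuous_on_compose2[of UNIV f UNIV "\<lambda>x. a * x + b"] continuous_intros) auto
next
  case (Suc k)
  then have "C_k k (\<lambda>x. deriv f (a * x + b) * a)" by (intro C_k_mult C_k_const Suc.IH) (auto simp: C_k_Suc)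
  then show ?case
    by (rule C_k_SucI[rotated])
       (auto intro!: DERIV_chain2[OF C_k_derivative[OF Suc.prems]] derivative_eq_intros)
qed

text \<open>Dividing by powers of x makes the family closed under differentiation: the derivative of
  index j combines the indices j + 2 and j + 1, so all members are smooth by one induction.\<close>

definition exp_bump :: "nat \<Rightarrow> real \<Rightarrow> real" where
  "exp_bump j x = (if x > 0 then exp (- (1 / x)) / x ^ j else 0)"

lemma power_div_fact_le_exp:
  fixes t :: real
  assumes "t \<ge> 0"
  shows "t ^ n / fact n \<le> exp t"
proof -
  have "(\<Sum>n\<in>{n}. inverse (fact n) * t ^ n) \<le> (\<Sum>n. inverse (fact n) * t ^ n)"
    by (rule sum_le_suminf[OF summable_exp]) (use assms in auto)
  then show ?thesis by (simp add: exp_def scaleR_conv_of_real divide_inverse mult.commute)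
qed

text \<open>Keeping the single term of order j + 2 of the series of exp(1/x) gives x^(j+2) against
  the denominator x^j. The remaining x^2 is what makes the difference quotient at 0 vanish.\<close>

lemma exp_bump_bound: "\<bar>exp_bump j x\<bar> \<le> fact (j + 2) * x\<^sup>2"
proof (cases "x > 0")
  case True
  have inv: "inverse e \<le> F * p" if "(1 / p) / F \<le> e" "p > 0" "F > 0" for e p F :: real
  proof -
    have "0 < 1 / p / F" using that by simp
    from le_imp_inverse_le[OF that(1) this] show ?thesis using that by (simp add: mult.commute)
  qed
  have "(1 / x) ^ (j + 2) / fact (j + 2) \<le> exp (1 / x)" using True by (intro power_div_fact_le_exp) auto
  then have "exp (- (1 / x)) \<le> fact (j + 2) * x ^ (j + 2)"
    unfolding exp_minus power_one_over by (rule inv) (use True in auto)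
  also have "\<dots> = fact (j + 2) * x\<^sup>2 * x ^ j" by (simp add: power_add power2_eq_square)
  finally show ?thesis using True by (simp add: exp_bump_def field_simps)
qed (auto simp: exp_bump_def)

lemma exp_bump_derivative:
  "(exp_bump j has_real_derivative (exp_bump (j + 2) x + (- real j) * exp_bump (j + 1) x)) (at x)"
proof -
  consider "x > 0" | "x < 0" | "x = 0" by linarith
  then show ?thesis
  proof cases
    case 1
    have "((\<lambda>x. exp (- (1 / x)) / x ^ j) has_real_derivative
       (exp (- (1 / x)) / x ^ (j + 2) + (- real j) * (exp (- (1 / x)) / x ^ (j + 1)))) (at x)"
    proof -
      have e: "((\<lambda>x. exp (- (1 / x))) has_real_derivative exp (- (1 / x)) / x ^ 2) (at x)"
        using 1 by (auto intro!: derivative_eq_intros simp: field_simps power2_eq_square)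
      show ?thesis
      proof (cases j)
        case (Suc i)
        have p: "x ^ j = x * x ^ i" by (simp add: Suc)
        show ?thesis
          using DERIV_quotient[OF e DERIV_pow[of j x UNIV]] 1
          by (rule_tac DERIV_cong) (auto simp: Suc field_simps power2_eq_square)
      qed (use e in \<open>simp add: power2_eq_square\<close>)
    qed
    then have "((\<lambda>x. exp (- (1 / x)) / x ^ j) has_real_derivative
       (exp_bump (j + 2) x + (- real j) * exp_bump (j + 1) x)) (at x)"
      using 1 by (simp add: exp_bump_def)
    then show ?thesis
      by (rule has_field_derivative_transform_within_open[of _ _ _ "{0<..}"]) (use 1 in \<open>auto simp: exp_bump_def\<close>)
  next
    case 2
    have "((\<lambda>x. 0) has_real_derivative (exp_bump (j + 2) x + (- real j) * exp_bump (j + 1) x)) (at x)"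
      using 2 by (simp add: exp_bump_def)
    then show ?thesis
      by (rule has_field_derivative_transform_within_open[of _ _ _ "{..<0}"]) (use 2 in \<open>auto simp: exp_bump_def\<close>)
  next
    case 3
    have "(\<lambda>h. (exp_bump j (0 + h) - exp_bump j 0) / h) \<midarrow>0\<rightarrow> 0"
    proof (rule Lim_null_comparison[where g = "\<lambda>h. fact (j + 2) * \<bar>h\<bar>"])
      show "\<forall>\<^sub>F h in at 0. norm ((exp_bump j (0 + h) - exp_bump j 0) / h) \<le> fact (j + 2) * \<bar>h\<bar>"
        unfolding eventually_at_filter
      proof (rule always_eventually, intro allI impI)
        fix h :: real assume "h \<noteq> 0"
        then show "norm ((exp_bump j (0 + h) - exp_bump j 0) / h) \<le> fact (j + 2) * \<bar>h\<bar>"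
        proof -
          have "\<bar>exp_bump j h\<bar> \<le> (fact (j + 2) * \<bar>h\<bar>) * \<bar>h\<bar>"
            using exp_bump_bound[of j h] by (simp only: mult.assoc abs_mult_self_eq power2_eq_square)
          then show ?thesis using \<open>h \<noteq> 0\<close>
            by (simp add: exp_bump_def[of _ 0] pos_divide_le_eq del: fact_Suc)
        qed
      qed
      have "(\<lambda>h::real. fact (j + 2) * \<bar>h\<bar>) \<midarrow>0\<rightarrow> fact (j + 2) * \<bar>0\<bar>" by (intro tendsto_intros)
      then show "(\<lambda>h::real. fact (j + 2) * \<bar>h\<bar>) \<midarrow>0\<rightarrow> 0" by simp
    qed
    then show ?thesis using 3 by (simp add: DERIV_def exp_bump_def[of _ 0])
  qed
qed

lemma smooth_exp_bump: "smooth (exp_bump j)"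
proof -
  have "C_k k (exp_bump j)" for k
  proof (induction k arbitrary: j)
    case 0
    have "isCont (exp_bump j) x" for x by (rule DERIV_isCont[OF exp_bump_derivative])
    then show ?case by (simp add: C_k_0 continuous_on_eq_continuous_at)
  next
    case (Suc k)
    then show ?case by (intro C_k_SucI[OF exp_bump_derivative] C_k_add C_k_mult C_k_const) auto
  qed
  then show ?thesis by (simp add: smooth_def)
qed

text \<open>Two one-sided bumps, starting at a and ending at b, stretched by n. For fixed x inside
  the interval both factors have the form exp(-1/(n t)) and tend to 1, so the bumps converge
  boundedly to the indicator without any normalization.\<close>

definition interval_bump :: "real \<Rightarrow> real \<Rightarrow> nat \<Rightarrow> real \<Rightarrow> real" where
  "interval_bump a b n x = exp_bump 0 (real n * x + (- real n * a)) * exp_bump 0 ((- real n) * x + real n * b)"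

lemma interval_bump_outside: "x \<notin> {a<..<b} \<Longrightarrow> interval_bump a b n x = 0"
proof -
  assume "x \<notin> {a<..<b}"
  then have "real n * (x - a) \<le> 0 \<or> real n * (b - x) \<le> 0"
    by (auto simp: not_less mult_nonneg_nonpos)
  then show ?thesis by (auto simp: interval_bump_def exp_bump_def algebra_simps)
qed

lemma test_function_interval_bump: "test_function (interval_bump a b n)"
  unfolding test_function_def
proof
  show "smooth (interval_bump a b n)"
    unfolding smooth_def interval_bump_def[abs_def]
    using smooth_exp_bump[of 0, unfolded smooth_def] by (intro allI C_k_mult C_k_affine) auto
  show "\<exists>R. \<forall>x. \<bar>x\<bar> > R \<longrightarrow> interval_bump a b n x = 0"
    by (intro exI[of _ "\<bar>a\<bar> + \<bar>b\<bar>"] allI impI interval_bump_outside) auto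
qed

lemma exp_bump_0_le: "0 \<le> exp_bump 0 x" "exp_bump 0 x \<le> 1"
  by (auto simp: exp_bump_def)

lemma abs_interval_bump_le: "\<bar>interval_bump a b n x\<bar> \<le> indicator {a..b} x"
proof (cases "x \<in> {a<..<b}")
  case True
  have "\<bar>interval_bump a b n x\<bar> \<le> 1 * 1"
    unfolding interval_bump_def abs_mult by (intro mult_mono) (auto simp: exp_bump_0_le abs_of_nonneg)
  then show ?thesis using True by simp
qed (simp add: interval_bump_outside)

lemma interval_bump_tendsto: "(\<lambda>n. interval_bump a b n x) \<longlonglongrightarrow> indicator {a<..<b} x"
proof (cases "x \<in> {a<..<b}")
  case True
  have e: "(\<lambda>n. exp_bump 0 (real n * t)) \<longlonglongrightarrow> 1" if "t > 0" for t :: real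
  proof -
    have "(\<lambda>n. exp (- (inverse (real n) * (1 / t)))) \<longlonglongrightarrow> exp (- (0 * (1 / t)))"
      by (intro tendsto_intros lim_inverse_n)
    then have "(\<lambda>n. exp (- (inverse (real n) * (1 / t)))) \<longlonglongrightarrow> 1" by simp
    then show ?thesis
    proof (rule Lim_transform_eventually)
      show "\<forall>\<^sub>F n in sequentially. exp (- (inverse (real n) * (1 / t))) = exp_bump 0 (real n * t)"
        by (rule eventually_sequentiallyI[of 1]) (use that in \<open>auto simp: exp_bump_def divide_inverse\<close>)
    qed
  qed
  have "(\<lambda>n. exp_bump 0 (real n * (x - a)) * exp_bump 0 (real n * (b - x))) \<longlonglongrightarrow> 1 * 1"
    by (intro tendsto_mult e) (use True in auto)
  then show ?thesis using True by (simp add: interval_bump_def algebra_simps)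
qed (simp add: interval_bump_outside)

text \<open>Test functions converging boundedly to the indicator of an interval turn equality of all
  pairings into equality of all interval integrals.\<close>

theorem weak_deriv_unique:
  assumes "has_weak_deriv f g" "has_weak_deriv f h"
  shows "AE x in lborel. g x = h x"
proof (rule AE_eq_if_interval_integrals_eq)
  have lim: "(\<lambda>n. LINT x|lborel. g x * interval_bump a b n x) \<longlonglongrightarrow> (LINT x:{a..b}|lborel. g x)"
    if g: "locally_integrable g" for a b and g :: "real \<Rightarrow> real"
  proof -
    have [measurable]: "g \<in> borel_measurable borel" using locally_integrableD(1)[OF g] .
    have [measurable]: "interval_bump a b n \<in> borel_measurable borel" for n
      using test_function_interval_bump[of a b n] C_k_imp_continuous
      by (auto simp: test_function_def smooth_def intro!: borel_measurable_continuous_onI)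
    have "(\<lambda>n. LINT x|lborel. g x * interval_bump a b n x) \<longlonglongrightarrow> (LINT x|lborel. g x * indicator {a<..<b} x)"
    proof (rule integral_dominated_convergence[where w = "\<lambda>x. \<bar>indicator {a..b} x * g x\<bar>"])
      show "integrable lborel (\<lambda>x. \<bar>indicator {a..b} x * g x\<bar>)"
        using locally_integrableD(2)[OF g, of a b] by (simp add: set_integrable_def)
      show "AE x in lborel. (\<lambda>n. g x * interval_bump a b n x) \<longlonglongrightarrow> g x * indicator {a<..<b} x"
        by (intro AE_I2 tendsto_mult tendsto_const interval_bump_tendsto)
      show "AE x in lborel. norm (g x * interval_bump a b n x) \<le> \<bar>indicator {a..b} x * g x\<bar>" for n
        using mult_left_mono[OF abs_interval_bump_le[of a b n]] by (intro AE_I2) (auto simp: abs_mult mult.commute)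
    qed measurable
    also have "(LINT x|lborel. g x * indicator {a<..<b} x) = (LINT x:{a..b}|lborel. g x)"
      unfolding set_lebesgue_integral_def
    proof (rule integral_cong_AE)
      show "AE x in lborel. g x * indicator {a<..<b} x = indicator {a..b} x *\<^sub>R g x"
        using AE_lborel_singleton[of a] AE_lborel_singleton[of b] by eventually_elim (auto simp: indicator_def)
    qed measurable
    finally show ?thesis .
  qed
  show g: "locally_integrable g" and h: "locally_integrable h" using assms by (auto simp: has_weak_deriv_def)
  fix a b :: real
  have "(LINT x|lborel. g x * interval_bump a b n x) = (LINT x|lborel. h x * interval_bump a b n x)" for n
  proof -
    let ?\<phi> = "interval_bump a b n"
    have "(LINT x|lborel. f x * deriv ?\<phi> x) = - (LINT x|lborel. g x * ?\<phi> x)"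
      "(LINT x|lborel. f x * deriv ?\<phi> x) = - (LINT x|lborel. h x * ?\<phi> x)"
      using assms test_function_interval_bump[of a b n] unfolding has_weak_deriv_def by blast+
    then show ?thesis by linarith
  qed
  then show "(LINT x:{a..b}|lborel. g x) = (LINT x:{a..b}|lborel. h x)"
    by (intro LIMSEQ_unique[OF lim[OF g, of a b]]) (simp add: lim[OF h])
qed

theorem primitive_has_weak_deriv:
  assumes F: "primitive F f"
  shows "has_weak_deriv F f"
  unfolding has_weak_deriv_def
proof (intro conjI allI impI)
  show "locally_integrable F" by (intro continuous_locally_integrable primitive_continuous[OF F])
  show "locally_integrable f" by (rule primitiveD(1)[OF F])
  fix \<phi> assume "test_function \<phi>"
  then obtain R where C: "\<And>k. C_k k \<phi>" and R: "\<And>x. \<bar>x\<bar> > R \<Longrightarrow> \<phi> x = 0" by (auto simp: test_function_def smooth_def)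
  \<comment> \<open>The endpoints of [-S, S] must lie strictly beyond R, where the test function
    vanishes; the maximum keeps S positive if R is negative.\<close>
  define S where "S = max R 0 + 1"
  have S: "S > 0" "S > R" by (auto simp: S_def)
  have d: "(\<phi> has_real_derivative deriv \<phi> x) (at x)" for x by (rule C_k_derivative[OF C])
  have c: "continuous_on UNIV \<phi>" "continuous_on UNIV (deriv \<phi>)"
    using C_k_imp_continuous[OF C[of 0]] C[of "Suc 0"] by (simp_all only: C_k_Suc C_k_0)
  have P: "primitive (\<lambda>x. F x * \<phi> x) (\<lambda>x. f x * \<phi> x + F x * deriv \<phi> x)"
    by (intro primitive_mult F primitive_C1 d c)
  have out: "\<phi> x = 0" "deriv \<phi> x = 0" if "x \<notin> {-S..S}" for x
  proof -
    have x: "\<bar>x\<bar> > R" using that S by auto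
    then show "\<phi> x = 0" by (rule R)
    have "(\<phi> has_real_derivative 0) (at x)"
    proof (rule has_field_derivative_transform_within_open[of "\<lambda>x. 0" _ _ "{y. \<bar>y\<bar> > R}"])
      show "open {y::real. \<bar>y\<bar> > R}" by (intro open_Collect_less continuous_intros)
    qed (use x R in auto)
    then show "deriv \<phi> x = 0" by (rule DERIV_imp_deriv)
  qed
  have i1: "set_integrable lborel {-S..S} (\<lambda>x. f x * \<phi> x)"
    by (intro set_integrable_mult_continuous primitiveD(1)[OF F] c)
  have i2: "set_integrable lborel {-S..S} (\<lambda>x. F x * deriv \<phi> x)"
    by (intro set_integrable_mult_continuous continuous_locally_integrable primitive_continuous[OF F] c)
  have "0 = (LINT x:{-S..S}|lborel. f x * \<phi> x + F x * deriv \<phi> x)"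
    using primitiveD(4)[OF P, of "-S" S] S R[of S] R[of "-S"] by simp
  also have "\<dots> = (LINT x:{-S..S}|lborel. f x * \<phi> x) + (LINT x:{-S..S}|lborel. F x * deriv \<phi> x)"
    by (rule set_integral_add(2)[OF i1 i2])
  also have "(LINT x:{-S..S}|lborel. f x * \<phi> x) = (LINT x|lborel. f x * \<phi> x)"
    unfolding set_lebesgue_integral_def by (intro Bochner_Integration.integral_cong) (use out in \<open>auto simp: indicator_def\<close>)
  also have "(LINT x:{-S..S}|lborel. F x * deriv \<phi> x) = (LINT x|lborel. F x * deriv \<phi> x)"
    unfolding set_lebesgue_integral_def by (intro Bochner_Integration.integral_cong) (use out in \<open>auto simp: indicator_def\<close>)
  finally show "(LINT x|lborel. F x * deriv \<phi> x) = - (LINT x|lborel. f x * \<phi> x)" by simp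
qed

lemma has_weak_deriv_cong_AE:
  assumes h: "has_weak_deriv f g" and f': "f' \<in> borel_measurable borel" "AE x in lborel. f x = f' x"
  shows "has_weak_deriv f' g"
proof -
  have lf: "locally_integrable f" using h by (simp add: has_weak_deriv_def)
  have "(LINT x|lborel. f' x * deriv \<phi> x) = (LINT x|lborel. f x * deriv \<phi> x)" if "test_function \<phi>" for \<phi>
  proof (rule integral_cong_AE)
    have "C_k (Suc 0) \<phi>" using that by (auto simp: test_function_def smooth_def)
    then have "deriv \<phi> \<in> borel_measurable borel"
      by (auto simp: C_k_Suc C_k_0 intro: borel_measurable_continuous_onI)
    then show "(\<lambda>x. f' x * deriv \<phi> x) \<in> borel_measurable lborel" "(\<lambda>x. f x * deriv \<phi> x) \<in> borel_measurable lborel"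
      using f'(1) locally_integrableD(1)[OF lf] by auto
    show "AE x in lborel. f' x * deriv \<phi> x = f x * deriv \<phi> x" using f'(2) by eventually_elim simp
  qed
  then show ?thesis using h locally_integrable_cong_AE[OF lf f'] by (simp add: has_weak_deriv_def)
qed

text \<open>The primitive witnesses that the choice in \<open>weak_deriv\<close> is effective, and
  uniqueness up to null sets identifies what was chosen.\<close>

lemma weak_deriv_AE:
  assumes F: "primitive F f" and f: "f' \<in> borel_measurable borel" "AE x in lborel. F x = f' x"
  shows "AE x in lborel. f x = weak_deriv f' x" "weak_deriv f' \<in> borel_measurable borel"
proof -
  have h: "has_weak_deriv f' f" by (rule has_weak_deriv_cong_AE[OF primitive_has_weak_deriv[OF F] f])
  then have w: "has_weak_deriv f' (weak_deriv f')" unfolding weak_deriv_def by (rule someI[of "has_weak_deriv f'"])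
  show "AE x in lborel. f x = weak_deriv f' x" by (rule weak_deriv_unique[OF h w])
  show "weak_deriv f' \<in> borel_measurable borel" using w by (auto simp: has_weak_deriv_def locally_integrable_def)
qed

lemma weak_deriv2_AE:
  assumes F: "primitive F F1" "primitive F1 F2" and f: "f \<in> borel_measurable borel" "AE x in lborel. F x = f x"
  shows "AE x in lborel. F2 x = weak_deriv (weak_deriv f) x"
proof -
  note 1 = weak_deriv_AE[OF F(1) f]
  show ?thesis by (rule weak_deriv_AE(1)[OF F(2) 1(2,1)])
qed

lemma AE_shift:
  assumes "AE x in lborel. P x"
  shows "AE x in lborel. P (x + h :: real)"
proof -
  from assms obtain N where N: "N \<in> null_sets lborel" "{x. \<not> P x} \<subseteq> N" by (auto simp: eventually_ae_filter)
  have "AE x in lborel. x \<notin> N" by (rule AE_not_in[OF N(1)])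
  then have "AE x in lborel. h + 1 * x \<notin> N"
    by (rule AE_borel_affine[rotated 2]) (use N(1) in auto)
  then show ?thesis by eventually_elim (use N(2) in \<open>auto simp: add.commute\<close>)
qed

lemma AE_reflect:
  assumes "AE x in lborel. P x"
  shows "AE x in lborel. P (- x :: real)"
proof -
  from assms obtain N where N: "N \<in> null_sets lborel" "{x. \<not> P x} \<subseteq> N" by (auto simp: eventually_ae_filter)
  have "AE x in lborel. x \<notin> N" by (rule AE_not_in[OF N(1)])
  then have "AE x in lborel. 0 + (- 1) * x \<notin> N"
    by (rule AE_borel_affine[rotated 2]) (use N(1) in auto)
  then show ?thesis by eventually_elim (use N(2) in auto)
qed

lemma delta_cong_AE:
  assumes "AE x in lborel. f x = g x"
  shows "AE x in lborel. delta f x = delta g x"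
  using AE_shift[OF assms, of "1/2"] AE_shift[OF assms, of "-1/2"]
  by eventually_elim (simp add: delta_def)

section \<open>The bounded inverse of the linearized operator\<close>

text \<open>All integrals of the difference vanish, so the zero function is a primitive of it; being
  continuous, the difference is then the derivative of zero at every point.\<close>

lemma continuous_AE_eq_imp_eq:
  fixes f g :: "real \<Rightarrow> real"
  assumes f: "continuous_on UNIV f" and g: "continuous_on UNIV g" and eq: "AE x in lborel. f x = g x"
  shows "f = g"
proof
  fix x
  let ?h = "\<lambda>x. f x - g x"
  have h: "continuous_on UNIV ?h" by (intro continuous_intros f g)
  have "(LINT x:{a..b}|lborel. ?h x) = 0" for a b
    unfolding set_lebesgue_integral_def by (rule integral_eq_zero_AE) (use eq in auto)
  then have "primitive (\<lambda>x. 0) ?h"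
    using continuous_locally_integrable[OF h] by (simp add: primitive_def)
  from primitive_has_derivative[OF this h, of x] have "?h x = 0" by (rule DERIV_unique) simp
  then show "f x = g x" by simp
qed

section \<open>Sobolev spaces of real order as weighted L^2 spaces of transforms\<close>

lemma powr_half_square: "((1 + k\<^sup>2) powr (s / 2))\<^sup>2 = (1 + k\<^sup>2) powr s" for k s :: real
  by (simp add: power2_eq_square powr_add[symmetric])

lemma sobolev_norm_fourier:
  assumes "is_fourier f g"
  shows "sobolev_norm s f = l2_norm (\<lambda>k. complex_of_real ((1 + k\<^sup>2) powr (s / 2)) * g k)"
proof -
  note F = is_fourier_fourier[OF assms]
  have [measurable]: "fourier f \<in> borel_measurable borel" "g \<in> borel_measurable borel"
    using is_fourier_measurable assms F by auto
  have "(LINT k|lborel. (1 + k\<^sup>2) powr s * (norm (fourier f k))\<^sup>2) = (LINT k|lborel. (1 + k\<^sup>2) powr s * (norm (g k))\<^sup>2)"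
    by (rule integral_cong_AE) (use is_fourier_unique_AE[OF F assms] in \<open>auto elim!: eventually_mono\<close>)
  then show ?thesis
    unfolding sobolev_norm_def l2_norm_def by (simp add: norm_mult power_mult_distrib powr_half_square)
qed

lemma sobolev_iff_fourier:
  "f \<in> sobolev s \<longleftrightarrow> (\<exists>g. is_fourier f g \<and> square_integrable (\<lambda>k. complex_of_real ((1 + k\<^sup>2) powr (s / 2)) * g k))"
proof -
  have "square_integrable (\<lambda>k. complex_of_real ((1 + k\<^sup>2) powr (s / 2)) * g k) \<longleftrightarrow>
     integrable lborel (\<lambda>k. (1 + k\<^sup>2) powr s * (norm (g k))\<^sup>2)" if "is_fourier f g" for g
  proof -
    have [measurable]: "g \<in> borel_measurable borel" by (rule is_fourier_measurable[OF that])
    show ?thesis unfolding square_integrable_def by (simp add: norm_mult power_mult_distrib powr_half_square)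
  qed
  then show ?thesis unfolding sobolev_def is_fourier_def by auto
qed

lemma sobolev_add:
  assumes "f \<in> sobolev s" "f' \<in> sobolev s"
  shows "(\<lambda>x. f x + f' x) \<in> sobolev s" "sobolev_norm s (\<lambda>x. f x + f' x) \<le> sobolev_norm s f + sobolev_norm s f'"
proof -
  let ?w = "\<lambda>g k. complex_of_real ((1 + k\<^sup>2) powr (s / 2)) * g k"
  obtain g g' where g: "is_fourier f g" "square_integrable (?w g)" and g': "is_fourier f' g'" "square_integrable (?w g')"
    using assms by (auto simp: sobolev_iff_fourier)
  have F: "is_fourier (\<lambda>x. f x + f' x) (\<lambda>k. g k + g' k)"
    using l2_ft_add[OF g(1)[unfolded is_fourier_iff_l2_ft] g'(1)[unfolded is_fourier_iff_l2_ft]] by (simp add: is_fourier_iff_l2_ft)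
  have e: "?w (\<lambda>k. g k + g' k) = (\<lambda>k. ?w g k + ?w g' k)" by (auto simp: distrib_left)
  show "(\<lambda>x. f x + f' x) \<in> sobolev s"
    unfolding sobolev_iff_fourier
  proof (intro exI conjI)
    show "square_integrable (?w (\<lambda>k. g k + g' k))"
      unfolding e by (rule square_integrable_add[OF g(2) g'(2)])
  qed (rule F)
  show "sobolev_norm s (\<lambda>x. f x + f' x) \<le> sobolev_norm s f + sobolev_norm s f'"
    unfolding sobolev_norm_fourier[OF F] sobolev_norm_fourier[OF g(1)] sobolev_norm_fourier[OF g'(1)] e
    by (rule l2_norm_triangle[OF g(2) g'(2)])
qed

lemma sobolev_cmult:
  assumes "f \<in> sobolev s"
  shows "(\<lambda>x. c * f x) \<in> sobolev s" "sobolev_norm s (\<lambda>x. c * f x) = \<bar>c\<bar> * sobolev_norm s f"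
proof -
  let ?w = "\<lambda>g k. complex_of_real ((1 + k\<^sup>2) powr (s / 2)) * g k"
  obtain g where g: "is_fourier f g" "square_integrable (?w g)"
    using assms by (auto simp: sobolev_iff_fourier)
  have F: "is_fourier (\<lambda>x. c * f x) (\<lambda>k. complex_of_real c * g k)"
    using l2_ft_cmult[OF g(1)[unfolded is_fourier_iff_l2_ft], of "complex_of_real c"] by (simp add: is_fourier_iff_l2_ft)
  have e: "?w (\<lambda>k. complex_of_real c * g k) = (\<lambda>k. complex_of_real c * ?w g k)" by auto
  show "(\<lambda>x. c * f x) \<in> sobolev s"
    unfolding sobolev_iff_fourier
  proof (intro exI conjI)
    show "square_integrable (?w (\<lambda>k. complex_of_real c * g k))"
      unfolding e by (rule square_integrable_cmult[OF g(2)])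
  qed (rule F)
  show "sobolev_norm s (\<lambda>x. c * f x) = \<bar>c\<bar> * sobolev_norm s f"
    unfolding sobolev_norm_fourier[OF F] sobolev_norm_fourier[OF g(1)] e l2_norm_cmult by simp
qed

text \<open>Also for functions without a Fourier transform, whose \<open>sobolev_norm\<close> is a junk value:
  the distance on classes has to be symmetric for arbitrary arguments.\<close>

lemma sobolev_norm_minus: "sobolev_norm s (\<lambda>x. - f x) = sobolev_norm s f"
proof (cases "\<exists>g. is_fourier f g")
  case True
  then obtain g where g: "is_fourier f g" by auto
  have F: "is_fourier (\<lambda>x. - f x) (\<lambda>k. - g k)"
    using l2_ft_cmult[of _ _ "-1"] g by (fastforce simp: is_fourier_iff_l2_ft)
  show ?thesis unfolding sobolev_norm_fourier[OF F] sobolev_norm_fourier[OF g] by simp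
next
  case False
  have "is_fourier f (\<lambda>k. - g k)" if "is_fourier (\<lambda>x. - f x) g" for g
    using l2_ft_cmult[of _ _ "-1"] that by (fastforce simp: is_fourier_iff_l2_ft)
  with False have "is_fourier (\<lambda>x. - f x) = is_fourier f" by blast
  then show ?thesis by (simp add: sobolev_norm_def fourier_def)
qed

lemma sobolev_cong_AE:
  assumes f: "f \<in> sobolev s" and f': "f' \<in> borel_measurable borel" "AE x in lborel. f x = f' x"
  shows "f' \<in> sobolev s" "sobolev_norm s f' = sobolev_norm s f"
proof -
  let ?w = "\<lambda>g k. complex_of_real ((1 + k\<^sup>2) powr (s / 2)) * g k"
  obtain g where g: "is_fourier f g" "square_integrable (?w g)"
    using f by (auto simp: sobolev_iff_fourier)
  have F: "is_fourier f' g"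
    unfolding is_fourier_iff_l2_ft
    by (rule l2_ft_cong[OF g(1)[unfolded is_fourier_iff_l2_ft]])
       (use f' is_fourier_measurable[OF g(1)] in \<open>auto elim!: eventually_mono\<close>)
  show "f' \<in> sobolev s" using F g(2) by (auto simp: sobolev_iff_fourier)
  show "sobolev_norm s f' = sobolev_norm s f"
    unfolding sobolev_norm_fourier[OF F] sobolev_norm_fourier[OF g(1)] ..
qed

lemma sobolev_norm_eq_0D:
  assumes "f \<in> sobolev s" "sobolev_norm s f = 0"
  shows "AE x in lborel. f x = 0"
proof -
  let ?w = "\<lambda>g k. complex_of_real ((1 + k\<^sup>2) powr (s / 2)) * g k"
  obtain g where g: "is_fourier f g" "square_integrable (?w g)"
    using assms by (auto simp: sobolev_iff_fourier)
  have "AE k in lborel. ?w g k = 0"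
    using l2_norm_eq_0D[OF g(2)] assms(2) sobolev_norm_fourier[OF g(1)] by simp
  then have "AE k in lborel. g k = 0"
  proof eventually_elim
    case (elim k)
    have "1 + k\<^sup>2 \<noteq> 0" by (smt (verit) zero_le_power2)
    with elim show ?case by simp
  qed
  then have "l2_norm g = 0" using l2_norm_cong_AE[OF is_fourier_measurable[OF g(1)], of "\<lambda>_. 0"] by simp
  then have "l2_norm f = 0" using l2_ft_norm[OF g(1)[unfolded is_fourier_iff_l2_ft]] by simp
  moreover have "square_integrable f" using g(1) by (simp add: is_fourier_def)
  ultimately show ?thesis by (rule l2_norm_eq_0D[rotated])
qed

lemma sobolev_zero: "(\<lambda>x. 0) \<in> sobolev s" "sobolev_norm s (\<lambda>x. 0) = 0"
proof -
  have "l2_ft (\<lambda>x. complex_of_real 0) (\<lambda>k. 0)"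
    using l2_ft_integrable[of "\<lambda>x. 0"] by (simp add: ft_def[abs_def])
  then have F: "is_fourier (\<lambda>x. 0) (\<lambda>k. 0)" by (simp add: is_fourier_iff_l2_ft)
  then show "(\<lambda>x. 0) \<in> sobolev s" by (auto simp: sobolev_iff_fourier)
  show "sobolev_norm s (\<lambda>x. 0) = 0" unfolding sobolev_norm_fourier[OF F] by simp
qed

lemma wsobolev_measurable: "f \<in> wsobolev s b \<Longrightarrow> f \<in> borel_measurable borel"
  by (auto simp: wsobolev_def sobolev_def dest: square_integrableD)

lemma wsobolev_diff:
  assumes "f \<in> wsobolev s b" "g \<in> wsobolev s b"
  shows "(\<lambda>x. f x - g x) \<in> wsobolev s b"
  using sobolev_add(1)[OF _ sobolev_cmult(1), of f s g "-1"]
    sobolev_add(1)[OF _ sobolev_cmult(1), of "\<lambda>x. cosh x powr b * f x" s "\<lambda>x. cosh x powr b * g x" "-1"] assms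
  by (simp add: wsobolev_def right_diff_distrib)

lemma wnorm_triangle:
  assumes "f \<in> wsobolev s b" "g \<in> wsobolev s b"
  shows "wnorm s b (\<lambda>x. f x + g x) \<le> wnorm s b f + wnorm s b g"
  using sobolev_add(2)[of "\<lambda>x. cosh x powr b * f x" s "\<lambda>x. cosh x powr b * g x"] assms
  by (simp add: wsobolev_def wnorm_def distrib_left)

lemma wnorm_diff_commute: "wnorm s b (\<lambda>x. f x - g x) = wnorm s b (\<lambda>x. g x - f x)"
  using sobolev_norm_minus[of s "\<lambda>x. cosh x powr b * (g x - f x)"]
  unfolding wnorm_def mult_minus_right[symmetric] minus_diff_eq .

lemma wsobolev_cong_AE:
  assumes f: "f \<in> wsobolev s b" and f': "f' \<in> borel_measurable borel" "AE x in lborel. f x = f' x"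
  shows "f' \<in> wsobolev s b" "wnorm s b f' = wnorm s b f"
proof -
  have AE: "AE x in lborel. cosh x powr b * f x = cosh x powr b * f' x" using f'(2) by eventually_elim simp
  note w = sobolev_cong_AE[OF _ measurable_cosh_powr_mult[OF f'(1)] AE, of s]
  show "f' \<in> wsobolev s b" using f w(1) sobolev_cong_AE(1)[OF _ f'] by (simp add: wsobolev_def)
  show "wnorm s b f' = wnorm s b f" using f w(2) by (simp add: wsobolev_def wnorm_def)
qed

lemma wnorm_eq_0D:
  assumes "f \<in> wsobolev s b" "wnorm s b f = 0"
  shows "AE x in lborel. f x = 0"
proof -
  have "AE x in lborel. cosh x powr b * f x = 0"
    using assms by (intro sobolev_norm_eq_0D[of _ s]) (auto simp: wsobolev_def wnorm_def)
  then show ?thesis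
    by eventually_elim (use cosh_real_pos in \<open>auto simp: less_imp_neq[THEN not_sym]\<close>)
qed

section \<open>The metric on almost everywhere classes and the homeomorphism hypothesis\<close>

lemma ae_rep_class:
  assumes "f \<in> borel_measurable borel"
  shows "ae_rep (ae_class f) \<in> borel_measurable borel" "AE x in lborel. ae_rep (ae_class f) x = f x"
proof -
  have "f \<in> ae_class f" using assms by (simp add: ae_class_def ae_eq_def)
  then have "ae_rep (ae_class f) \<in> ae_class f" unfolding ae_rep_def by (rule someI[of "\<lambda>g. g \<in> ae_class f"])
  then show "ae_rep (ae_class f) \<in> borel_measurable borel" "AE x in lborel. ae_rep (ae_class f) x = f x"
    by (auto simp: ae_class_def ae_eq_def)
qed

lemma ae_class_eq:
  assumes "AE x in lborel. f x = g x"
  shows "ae_class f = ae_class g"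
proof -
  have "AE x in lborel. h x = f x \<Longrightarrow> AE x in lborel. h x = g x" for h
    using assms by (auto elim: eventually_elim2)
  moreover have "AE x in lborel. h x = g x \<Longrightarrow> AE x in lborel. h x = f x" for h
    using assms by (auto elim: eventually_elim2)
  ultimately have "(AE x in lborel. h x = f x) \<longleftrightarrow> (AE x in lborel. h x = g x)" for h by blast
  then show ?thesis unfolding ae_class_def ae_eq_def by simp
qed

lemma ae_class_eqD:
  assumes "ae_class f = ae_class g" "f \<in> borel_measurable borel"
  shows "AE x in lborel. f x = g x"
proof -
  have "f \<in> ae_class f" using assms(2) by (simp add: ae_class_def ae_eq_def)
  then have "f \<in> ae_class g" using assms(1) by simp
  then show ?thesis by (simp add: ae_class_def ae_eq_def)
qed

lemma ae_rep_wsobolev: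
  assumes "X \<subseteq> wsobolev s b" "A \<in> ae_class ` X"
  shows "ae_rep A \<in> wsobolev s b" "ae_class (ae_rep A) = A"
proof -
  obtain f where f: "f \<in> X" "A = ae_class f" using assms(2) by auto
  have fm: "f \<in> borel_measurable borel" using wsobolev_measurable f assms(1) by blast
  note r = ae_rep_class[OF fm]
  show "ae_rep A \<in> wsobolev s b"
    unfolding f(2) by (rule wsobolev_cong_AE[of f]) (use f assms r in \<open>auto elim!: eventually_mono\<close>)
  show "ae_class (ae_rep A) = A" unfolding f(2) by (rule ae_class_eq[OF r(2)])
qed

text \<open>Separation rests on the fact that representatives of classes in X lie in the weighted
  space again, where a vanishing norm means equality almost everywhere.\<close>

lemma Metric_space_ae_classes:
  assumes X: "X \<subseteq> wsobolev s b"
  shows "Metric_space (ae_class ` X) (\<lambda>A B. wnorm s b (\<lambda>x. ae_rep A x - ae_rep B x))"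
proof
  show "0 \<le> wnorm s b (\<lambda>x. ae_rep A x - ae_rep B x)" for A B
    unfolding wnorm_def sobolev_norm_def by (intro real_sqrt_ge_zero Bochner_Integration.integral_nonneg) auto
  show "wnorm s b (\<lambda>x. ae_rep A x - ae_rep B x) = wnorm s b (\<lambda>x. ae_rep B x - ae_rep A x)" for A B
    by (rule wnorm_diff_commute)
  show "wnorm s b (\<lambda>x. ae_rep A x - ae_rep B x) = 0 \<longleftrightarrow> A = B" if AB: "A \<in> ae_class ` X" "B \<in> ae_class ` X" for A B
  proof
    assume "wnorm s b (\<lambda>x. ae_rep A x - ae_rep B x) = 0"
    then have "AE x in lborel. ae_rep A x - ae_rep B x = 0"
      by (intro wnorm_eq_0D[of _ s b] wsobolev_diff ae_rep_wsobolev[OF X] AB)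
    then have "AE x in lborel. ae_rep A x = ae_rep B x" by eventually_elim simp
    then have "ae_class (ae_rep A) = ae_class (ae_rep B)" by (rule ae_class_eq)
    then show "A = B" using ae_rep_wsobolev(2)[OF X] AB by simp
  qed (simp add: wnorm_def sobolev_zero)
  show "wnorm s b (\<lambda>x. ae_rep A x - ae_rep C x) \<le> wnorm s b (\<lambda>x. ae_rep A x - ae_rep B x) + wnorm s b (\<lambda>x. ae_rep B x - ae_rep C x)"
    if "A \<in> ae_class ` X" "B \<in> ae_class ` X" "C \<in> ae_class ` X" for A B C
    using wnorm_triangle[OF wsobolev_diff wsobolev_diff, OF ae_rep_wsobolev(1) ae_rep_wsobolev(1) ae_rep_wsobolev(1) ae_rep_wsobolev(1),
      OF X that(1) X that(2) X that(2) X that(3)] by simp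
qed

text \<open>The predicates \<open>has_weak_deriv f\<close> and \<open>has_weak_deriv f'\<close>
  coincide, so the choice operator returns the same function for both: equality everywhere, not
  merely almost everywhere.\<close>

lemma has_weak_deriv_fun_cong:
  assumes "f \<in> borel_measurable borel" "f' \<in> borel_measurable borel" "AE x in lborel. f x = f' x"
  shows "weak_deriv f = weak_deriv f'"
proof -
  have "has_weak_deriv f = has_weak_deriv f'"
  proof (intro ext iffI)
    fix g
    show "has_weak_deriv f' g" if "has_weak_deriv f g" by (rule has_weak_deriv_cong_AE[OF that assms(2,3)])
    show "has_weak_deriv f g" if "has_weak_deriv f' g"
      by (rule has_weak_deriv_cong_AE[OF that assms(1)]) (use assms(3) in \<open>auto elim!: eventually_mono\<close>)
  qed
  then show ?thesis by (simp add: weak_deriv_def)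
qed

lemma linearized_op_cong_AE:
  assumes "f \<in> borel_measurable borel" "f' \<in> borel_measurable borel" "AE x in lborel. f x = f' x"
  shows "AE x in lborel. linearized_op V c \<sigma> f x = linearized_op V c \<sigma> f' x"
proof -
  have "AE y in lborel. deriv (deriv V) (\<sigma> y) * f y = deriv (deriv V) (\<sigma> y) * f' y"
    using assms(3) by eventually_elim simp
  then have "AE x in lborel. delta (delta (\<lambda>y. deriv (deriv V) (\<sigma> y) * f y)) x = delta (delta (\<lambda>y. deriv (deriv V) (\<sigma> y) * f' y)) x"
    by (intro delta_cong_AE)
  then show ?thesis
    unfolding linearized_op_def has_weak_deriv_fun_cong[OF assms] by eventually_elim simp
qed

lemma delta_zero [simp]: "delta (\<lambda>x. 0) = (\<lambda>x. 0)"
  by (simp add: delta_def[abs_def])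

lemma primitive_zero: "primitive (\<lambda>x. 0) (\<lambda>x. 0)"
  by (rule primitive_C1) auto

lemma linearized_op_zero: "AE x in lborel. linearized_op V c \<sigma> (\<lambda>x. 0) x = 0"
  using weak_deriv2_AE[OF primitive_zero primitive_zero, of "\<lambda>x. 0"]
  unfolding linearized_op_def by (auto elim!: eventually_mono)

lemma wsobolev_even_subset: "wsobolev_even s b \<subseteq> wsobolev s b" "wsobolev_even0 s b \<subseteq> wsobolev s b"
  by (auto simp: wsobolev_even_def wsobolev_even0_def)

lemma zero_wsobolev: "(\<lambda>x. 0) \<in> wsobolev_even s b" "(\<lambda>x. 0) \<in> wsobolev_even0 s b" 
  by (auto simp: wsobolev_even_def wsobolev_even0_def wsobolev_def sobolev_zero ae_even_def)

lemma ae_even_cong: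
  assumes "ae_even f" "AE x in lborel. f x = g x"
  shows "ae_even g"
  using assms(1) assms(2) AE_reflect[OF assms(2)] unfolding ae_even_def
  by eventually_elim simp

text \<open>The class of f and the zero class are both mapped to the zero class, so injectivity on
  classes identifies them.\<close>

lemma linearized_homeo_inj:
  assumes h: "linearized_homeo V c \<beta> \<sigma> s" and f: "f \<in> wsobolev_even (s + 2) \<beta>"
    and 0: "AE x in lborel. linearized_op V c \<sigma> f x = 0"
  shows "AE x in lborel. f x = 0"
proof -
  let ?\<Phi> = "\<lambda>A. ae_class (linearized_op V c \<sigma> (ae_rep A))"
  let ?X = "wsobolev_even (s + 2) \<beta>"
  interpret M: Metric_space "ae_class ` ?X" "\<lambda>A B. wnorm (s + 2) \<beta> (\<lambda>x. ae_rep A x - ae_rep B x)"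
    by (rule Metric_space_ae_classes[OF wsobolev_even_subset(1)])
  have inj: "inj_on ?\<Phi> (ae_class ` ?X)"
    using h unfolding linearized_homeo_def homeomorphic_eq_everything_map wsobolev_topology_def M.topspace_mtopology by blast
  have fm: "f \<in> borel_measurable borel" using wsobolev_measurable f wsobolev_even_subset by blast
  have cl: "?\<Phi> (ae_class g) = ae_class (\<lambda>x. 0)" if "g \<in> borel_measurable borel" "AE x in lborel. linearized_op V c \<sigma> g x = 0" for g
    using linearized_op_cong_AE[OF ae_rep_class(1)[OF that(1)] that(1) ae_rep_class(2)[OF that(1)], of V c \<sigma>] that(2)
    by (intro ae_class_eq) (auto elim: eventually_elim2)
  have "?\<Phi> (ae_class f) = ?\<Phi> (ae_class (\<lambda>x. 0))"
    using cl[OF fm 0] cl[OF _ linearized_op_zero] by simp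
  then have "ae_class f = ae_class (\<lambda>x. 0)"
    using inj f zero_wsobolev(1)[of "s + 2" \<beta>] by (meson image_eqI inj_onD)
  then show ?thesis by (rule ae_class_eqD[OF _ fm])
qed

text \<open>The quantitative content of the homeomorphism: the image of the unit ball around the
  zero class is open and contains the zero class, hence a ball of some radius d.\<close>

lemma linearized_homeo_open:
  assumes h: "linearized_homeo V c \<beta> \<sigma> s"
  obtains d where "d > 0"
    "\<And>g. g \<in> wsobolev_even0 s \<beta> \<Longrightarrow> wnorm s \<beta> g < d \<Longrightarrow>
       \<exists>f \<in> wsobolev_even (s + 2) \<beta>. wnorm (s + 2) \<beta> f < 1 \<and> (AE x in lborel. linearized_op V c \<sigma> f x = g x)"
proof -
  let ?\<Phi> = "\<lambda>A. ae_class (linearized_op V c \<sigma> (ae_rep A))"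
  let ?X = "wsobolev_even (s + 2) \<beta>" and ?Y = "wsobolev_even0 s \<beta>"
  let ?O = "ae_class (\<lambda>x::real. 0::real)"
  interpret X: Metric_space "ae_class ` ?X" "\<lambda>A B. wnorm (s + 2) \<beta> (\<lambda>x. ae_rep A x - ae_rep B x)"
    by (rule Metric_space_ae_classes[OF wsobolev_even_subset(1)])
  interpret Y: Metric_space "ae_class ` ?Y" "\<lambda>A B. wnorm s \<beta> (\<lambda>x. ae_rep A x - ae_rep B x)"
    by (rule Metric_space_ae_classes[OF wsobolev_even_subset(2)])
  have open_map: "open_map X.mtopology Y.mtopology ?\<Phi>"
    using h unfolding linearized_homeo_def homeomorphic_eq_everything_map wsobolev_topology_def by blast
  have OX: "?O \<in> ae_class ` ?X" and OY: "?O \<in> ae_class ` ?Y" using zero_wsobolev by blast+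
  have "openin Y.mtopology (?\<Phi> ` X.mball ?O 1)"
    using open_map X.openin_mball by (simp add: open_map_def)
  moreover have "?\<Phi> ?O = ?O"
  proof (rule ae_class_eq)
    have "AE x in lborel. linearized_op V c \<sigma> (ae_rep ?O) x = linearized_op V c \<sigma> (\<lambda>x. 0) x"
      by (intro linearized_op_cong_AE ae_rep_class) auto
    then show "AE x in lborel. linearized_op V c \<sigma> (ae_rep ?O) x = 0"
      using linearized_op_zero by eventually_elim simp
  qed
  then have "?O \<in> ?\<Phi> ` X.mball ?O 1"
    by (intro rev_image_eqI[of ?O]) (use X.centre_in_mball_iff[of ?O 1] OX in auto)
  ultimately obtain d where d: "d > 0" "Y.mball ?O d \<subseteq> ?\<Phi> ` X.mball ?O 1"
    unfolding Y.openin_mtopology by blast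
  \<comment> \<open>Distances to the zero class are norms, although the chosen representative of the
    zero class may differ from 0 on a null set.\<close>
  have dist: "wnorm t \<beta> (\<lambda>x. ae_rep ?O x - ae_rep (ae_class g) x) = wnorm t \<beta> g" if "g \<in> wsobolev t \<beta>" for g t
  proof -
    have gm: "g \<in> borel_measurable borel" by (rule wsobolev_measurable[OF that])
    have "AE x in lborel. g x = ae_rep (ae_class g) x - ae_rep ?O x"
      using ae_rep_class(2)[OF gm] ae_rep_class(2)[of "\<lambda>x. 0"] by (auto elim: eventually_elim2)
    from wsobolev_cong_AE(2)[OF that _ this] show ?thesis
      using ae_rep_class(1)[OF gm] ae_rep_class(1)[of "\<lambda>x. 0"] by (simp add: wnorm_diff_commute[of t \<beta> "ae_rep ?O"])
  qed
  show thesis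
  proof (rule that[OF d(1)])
    fix g assume g: "g \<in> ?Y" "wnorm s \<beta> g < d"
    have gm: "g \<in> borel_measurable borel" using wsobolev_measurable g wsobolev_even_subset by blast
    have "ae_class g \<in> Y.mball ?O d"
      unfolding Y.in_mball
    proof (intro conjI OY)
      show "ae_class g \<in> ae_class ` ?Y" using g(1) by (rule imageI)
      show "wnorm s \<beta> (\<lambda>x. ae_rep ?O x - ae_rep (ae_class g) x) < d"
      proof -
        have "g \<in> wsobolev s \<beta>" using g(1) wsobolev_even_subset(2) by blast
        from dist[OF this] show ?thesis using g(2) by simp
      qed
    qed
    then obtain A where A: "A \<in> X.mball ?O 1" "ae_class g = ?\<Phi> A" using d(2) by blast
    then obtain f where f: "f \<in> ?X" "A = ae_class f" "wnorm (s + 2) \<beta> (\<lambda>x. ae_rep ?O x - ae_rep A x) < 1"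
      by (auto simp: X.in_mball)
    have fw: "f \<in> wsobolev (s + 2) \<beta>" using f(1) wsobolev_even_subset by blast
    have fm: "f \<in> borel_measurable borel" by (rule wsobolev_measurable[OF fw])
    have 1: "AE x in lborel. g x = linearized_op V c \<sigma> (ae_rep A) x" by (rule ae_class_eqD[OF A(2) gm])
    have 2: "AE x in lborel. linearized_op V c \<sigma> (ae_rep A) x = linearized_op V c \<sigma> f x"
      unfolding f(2) by (rule linearized_op_cong_AE[OF ae_rep_class(1)[OF fm] fm ae_rep_class(2)[OF fm]])
    have "AE x in lborel. linearized_op V c \<sigma> f x = g x" using 1 2 by eventually_elim simp
    then show "\<exists>f \<in> ?X. wnorm (s + 2) \<beta> f < 1 \<and> (AE x in lborel. linearized_op V c \<sigma> f x = g x)"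
      using f dist[OF fw] by auto
  qed
qed

text \<open>The linearized equation with explicit primitives F1 and F2 in place of chosen weak
  derivatives, around the continuous representative S of the profile. Right-hand sides count only up
  to null sets.\<close>

definition lin_eq :: "(real \<Rightarrow> real) \<Rightarrow> real \<Rightarrow> (real \<Rightarrow> real) \<Rightarrow> (real \<Rightarrow> real) \<Rightarrow> (real \<Rightarrow> real) \<Rightarrow> bool" where
  "lin_eq V c S F g \<longleftrightarrow> (\<exists>F1 F2. primitive F F1 \<and> primitive F1 F2 \<and>
     (AE x in lborel. c\<^sup>2 * F2 x - delta (delta (\<lambda>y. deriv (deriv V) (S y) * F y)) x = g x))"

lemma delta_cmult: "delta (\<lambda>x. t * f x) = (\<lambda>x. t * delta f x)"
  by (simp add: delta_def[abs_def] right_diff_distrib)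

lemma delta_diff: "delta (\<lambda>x. f x - g x) = (\<lambda>x. delta f x - delta g x)"
  by (auto simp: delta_def)

lemma lin_eq_cmult:
  assumes "lin_eq V c S F g"
  shows "lin_eq V c S (\<lambda>x. t * F x) (\<lambda>x. t * g x)"
proof -
  obtain F1 F2 where F: "primitive F F1" "primitive F1 F2"
    "AE x in lborel. c\<^sup>2 * F2 x - delta (delta (\<lambda>y. deriv (deriv V) (S y) * F y)) x = g x"
    using assms by (auto simp: lin_eq_def)
  have "AE x in lborel. c\<^sup>2 * (t * F2 x) - delta (delta (\<lambda>y. deriv (deriv V) (S y) * (t * F y))) x = t * g x"
    using F(3) unfolding mult.left_commute[of _ t] delta_cmult right_diff_distrib[symmetric] by eventually_elim simp
  then show ?thesis unfolding lin_eq_def using primitive_cmult F(1,2) by blast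
qed

lemma lin_eq_diff:
  assumes "lin_eq V c S F g" "lin_eq V c S F' g'"
  shows "lin_eq V c S (\<lambda>x. F x - F' x) (\<lambda>x. g x - g' x)"
proof -
  obtain F1 F2 where F: "primitive F F1" "primitive F1 F2"
    "AE x in lborel. c\<^sup>2 * F2 x - delta (delta (\<lambda>y. deriv (deriv V) (S y) * F y)) x = g x"
    using assms by (auto simp: lin_eq_def)
  obtain F1' F2' where F': "primitive F' F1'" "primitive F1' F2'"
    "AE x in lborel. c\<^sup>2 * F2' x - delta (delta (\<lambda>y. deriv (deriv V) (S y) * F' y)) x = g' x"
    using assms by (auto simp: lin_eq_def)
  have "AE x in lborel. c\<^sup>2 * (F2 x - F2' x) - delta (delta (\<lambda>y. deriv (deriv V) (S y) * (F y - F' y))) x = g x - g' x"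
    using F(3) F'(3) unfolding right_diff_distrib delta_diff by eventually_elim simp
  then show ?thesis unfolding lin_eq_def using primitive_diff[OF F(1) F'(1)] primitive_diff[OF F(2) F'(2)] by blast
qed

lemma linearized_op_AE:
  assumes "f \<in> borel_measurable borel" "AE x in lborel. f x = F x" "primitive F F1" "primitive F1 F2" "AE x in lborel. \<sigma> x = S x"
  shows "AE x in lborel. linearized_op V c \<sigma> f x = c\<^sup>2 * F2 x - delta (delta (\<lambda>y. deriv (deriv V) (S y) * F y)) x"
proof -
  have "AE y in lborel. deriv (deriv V) (\<sigma> y) * f y = deriv (deriv V) (S y) * F y"
    using assms(2,5) by eventually_elim simp
  then have "AE x in lborel. delta (delta (\<lambda>y. deriv (deriv V) (\<sigma> y) * f y)) x = delta (delta (\<lambda>y. deriv (deriv V) (S y) * F y)) x"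
    by (intro delta_cong_AE)
  moreover have "AE x in lborel. F2 x = weak_deriv (weak_deriv f) x"
    by (rule weak_deriv2_AE[OF assms(3,4,1)]) (use assms(2) in \<open>auto elim!: eventually_mono\<close>)
  ultimately show ?thesis unfolding linearized_op_def by eventually_elim simp
qed

lemma wbound_2_iff: "wbound b 2 r f \<longleftrightarrow> wsq b f \<and> wl2 b f \<le> r \<and>
   (\<exists>f1. primitive f f1 \<and> wsq b f1 \<and> wl2 b f1 \<le> r \<and> (\<exists>f2. primitive f1 f2 \<and> wsq b f2 \<and> wl2 b f2 \<le> r))"
  by (simp add: numeral_2_eq_2)

lemma wbound_zero: "wbound b m 0 (\<lambda>x. 0)"
proof (induction m)
  case (Suc m)
  then show ?case using primitive_zero by (auto simp: wsq_def wl2_def)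
qed (auto simp: wsq_def wl2_def)

text \<open>From exp t >= 1 + t + t^2/2 at t = 2b|x| and exp |x| <= 2 cosh x, the function cosh^(2b)
  exceeds a multiple of 1 + x^2; its inverse is therefore dominated by a multiple of 1/(1 +
  x^2).\<close>

lemma square_integrable_cosh_powr:
  assumes b: "b > 0"
  shows "square_integrable (\<lambda>x::real. cosh x powr (- b))"
proof -
  have le: "min 1 (2 * b\<^sup>2) * 2 powr (- (2 * b)) * (1 + x\<^sup>2) \<le> cosh x powr (2 * b)" for x :: real
  proof -
    have "min 1 (2 * b\<^sup>2) * (1 + x\<^sup>2) \<le> 1 + 2 * b\<^sup>2 * x\<^sup>2"
    proof -
      have "min 1 (2 * b\<^sup>2) * x\<^sup>2 \<le> 2 * b\<^sup>2 * x\<^sup>2" by (intro mult_right_mono) auto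
      then show ?thesis by (simp add: distrib_left)
    qed
    also have "\<dots> \<le> exp (2 * b * \<bar>x\<bar>)"
    proof -
      have "(2 * b * \<bar>x\<bar>)\<^sup>2 / 2 = 2 * b\<^sup>2 * x\<^sup>2" by (simp add: power_mult_distrib)
      moreover have "0 \<le> 2 * b * \<bar>x\<bar>" using b by simp
      ultimately show ?thesis using exp_lower_Taylor_quadratic[of "2 * b * \<bar>x\<bar>"] by linarith
    qed
    also have "\<dots> = (exp \<bar>x\<bar>) powr (2 * b)" by (simp add: powr_def mult_ac)
    also have "\<dots> \<le> (2 * cosh x) powr (2 * b)"
    proof (rule powr_mono2)
      show "exp \<bar>x\<bar> \<le> 2 * cosh x"
        unfolding cosh_def by (cases "x \<ge> 0") auto
    qed (use b in auto)
    also have "\<dots> = 2 powr (2 * b) * cosh x powr (2 * b)" by (rule powr_mult)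
    finally have "min 1 (2 * b\<^sup>2) * (1 + x\<^sup>2) \<le> 2 powr (2 * b) * cosh x powr (2 * b)" .
    from mult_right_mono[OF this, of "2 powr (- (2 * b))"] show ?thesis
      by (simp add: powr_minus mult_ac)
  qed
  let ?c = "min 1 (2 * b\<^sup>2) * 2 powr (- (2 * b))"
  have c: "?c > 0" using b by simp
  have pos: "1 + x\<^sup>2 > 0" for x :: real by (smt (verit) zero_le_power2)
  have w: "(\<lambda>x::real. cosh x powr a) \<in> borel_measurable borel" for a
    by (intro borel_measurable_continuous_onI continuous_cosh_powr)
  show ?thesis
    unfolding square_integrable_def
  proof
    show "integrable lborel (\<lambda>x::real. (norm (cosh x powr (- b)))\<^sup>2)"
    proof (rule integrable_mono_nonneg(1))
      show "integrable lborel (\<lambda>x::real. inverse ?c * inverse (1 + x\<^sup>2))"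
        using integrable_inverse_1_plus_power2 by simp
      fix x :: real
      have "(norm (cosh x powr (- b)))\<^sup>2 = inverse (cosh x powr (2 * b))"
        by (simp add: power2_eq_square powr_add[symmetric] powr_minus[symmetric])
      also have "\<dots> \<le> inverse (?c * (1 + x\<^sup>2))" by (rule le_imp_inverse_le[OF le]) (use c pos in simp)
      finally show "(norm (cosh x powr (- b)))\<^sup>2 \<le> inverse ?c * inverse (1 + x\<^sup>2)" by simp
    qed (use w in auto)
  qed (use w in simp)
qed

lemma wsq_integrable:
  assumes f: "wsq b f" and b: "b > 0"
  shows "integrable lborel f"
  using square_integrable_mult_integrable[OF square_integrable_cosh_powr[OF b] f[unfolded wsq_def]]
  unfolding cosh_powr_mult by simp

text \<open>The range space of the linearization; for b > 0 the weight forces integrability, so the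
  mean is a genuine integral and not a default value.\<close>

definition rhs_fun :: "real \<Rightarrow> (real \<Rightarrow> real) \<Rightarrow> bool" where
  "rhs_fun b g \<longleftrightarrow> wsq b g \<and> ae_even g \<and> (LINT x|lborel. g x) = 0"

lemma rhs_fun_cmult: "rhs_fun b g \<Longrightarrow> rhs_fun b (\<lambda>x. t * g x)"
  by (auto simp: rhs_fun_def wsq_cmult ae_even_def elim!: eventually_mono)

text \<open>Scaling: g is shrunk until it lies in the ball provided by openness, its preimage has
  norm below 1, and scaling back gives a bound linear in the norm of g. By injectivity every even
  solution in the weighted H^2 coincides with this one, whatever radius it was known to have, which
  gives the a priori estimate.\<close>

theorem linearized_inverse:
  assumes h: "linearized_homeo V c \<beta> \<sigma> 0" and \<beta>: "\<beta> > 0" and S: "AE x in lborel. \<sigma> x = S x"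
  obtains K where "K \<ge> 0"
    "\<And>g. rhs_fun \<beta> g \<Longrightarrow> \<exists>F. (\<forall>x. F (- x) = F x) \<and> wbound \<beta> 2 (K * wl2 \<beta> g) F \<and> lin_eq V c S F g"
    "\<And>F r g. (\<And>x. F (- x) = F x) \<Longrightarrow> wbound \<beta> 2 r F \<Longrightarrow> lin_eq V c S F g \<Longrightarrow> rhs_fun \<beta> g \<Longrightarrow> wbound \<beta> 2 (K * wl2 \<beta> g) F"
proof -
  obtain d where d: "d > 0" "\<And>g. g \<in> wsobolev_even0 0 \<beta> \<Longrightarrow> wnorm 0 \<beta> g < d \<Longrightarrow>
       \<exists>f \<in> wsobolev_even 2 \<beta>. wnorm 2 \<beta> f < 1 \<and> (AE x in lborel. linearized_op V c \<sigma> f x = g x)"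
    using linearized_homeo_open[OF h] by (metis add_0)
  obtain C1 where C1: "C1 \<ge> 0" "\<And>f r. f \<in> wsobolev (real 2) \<beta> \<Longrightarrow> wnorm (real 2) \<beta> f \<le> r \<Longrightarrow>
     \<exists>F. (AE x in lborel. f x = F x) \<and> wbound \<beta> 2 (C1 * r) F"
    using wsobolev_imp_wbound[of 2 \<beta>] by blast
  obtain C0 where C0: "C0 \<ge> 0" "\<And>f F r. wbound \<beta> 0 r F \<Longrightarrow> f \<in> borel_measurable borel \<Longrightarrow> AE x in lborel. f x = F x \<Longrightarrow>
     f \<in> wsobolev (real 0) \<beta> \<and> wnorm (real 0) \<beta> f \<le> C0 * r"
    using wbound_imp_wsobolev[of \<beta> 0] \<beta> by (metis less_imp_le)
  obtain C2 where C2: "\<And>f F r. wbound \<beta> 2 r F \<Longrightarrow> f \<in> borel_measurable borel \<Longrightarrow> AE x in lborel. f x = F x \<Longrightarrow>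
     f \<in> wsobolev (real 2) \<beta> \<and> wnorm (real 2) \<beta> f \<le> C2 * r"
    using wbound_imp_wsobolev[of \<beta> 2] \<beta> by (metis less_imp_le)
  \<comment> \<open>The bound C1 for the preimage of the scaled function, divided by the scaling
    factor t below; t is inversely proportional to the norm of g, so the quotient is K times that
    norm.\<close>
  define K where "K = C1 * (2 * (C0 + 1)) / d"
  have K0: "K \<ge> 0" using C0 C1 d by (simp add: K_def)
  have ex: "\<exists>F. (\<forall>x. F (- x) = F x) \<and> wbound \<beta> 2 (K * wl2 \<beta> g) F \<and> lin_eq V c S F g" if g: "rhs_fun \<beta> g" for g
  \<comment> \<open>A zero norm cannot be scaled; then g = 0 almost everywhere and F = 0
    serves.\<close>
  proof (cases "wl2 \<beta> g = 0")
    case True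
    have "AE x in lborel. cosh x powr \<beta> * g x = 0"
      using g True by (intro l2_norm_eq_0D) (auto simp: rhs_fun_def wsq_def wl2_def)
    then have "AE x in lborel. g x = 0"
      by eventually_elim (use cosh_real_pos in \<open>auto simp: less_imp_neq[THEN not_sym]\<close>)
    then have "lin_eq V c S (\<lambda>x. 0) g"
      unfolding lin_eq_def using primitive_zero by (intro exI[of _ "\<lambda>x. 0"]) auto
    then show ?thesis using True wbound_zero by (intro exI[of _ "\<lambda>x. 0"]) auto
  next
    case False
    define w where "w = wl2 \<beta> g"
    have w: "w > 0" using False wl2_nonneg[of \<beta> g] unfolding w_def by linarith
    \<comment> \<open>The factor 2 (C0 + 1) keeps the norm of the scaled function, at most C0 t w,
      strictly below d, also when C0 = 0.\<close>
    define t where "t = d / (2 * (C0 + 1) * w)"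
    have t: "t > 0" using d w C0 by (simp add: t_def)
    let ?g = "\<lambda>x. t * g x"
    have g': "rhs_fun \<beta> ?g" by (rule rhs_fun_cmult[OF g])
    then have sq: "wsq \<beta> ?g" by (simp add: rhs_fun_def)
    have "wbound \<beta> 0 (t * w) ?g" using sq t by (simp add: wl2_cmult w_def)
    from C0(2)[OF this wsq_measurable[OF sq]] have "?g \<in> wsobolev 0 \<beta>" "wnorm 0 \<beta> ?g \<le> C0 * (t * w)" by auto
    moreover have "C0 * (t * w) < d"
    proof -
      have "C0 * (t * w) = d * (C0 / (2 * (C0 + 1)))" using w by (simp add: t_def)
      also have "\<dots> < d * 1" using C0 d by (intro mult_strict_left_mono) (auto simp: divide_simps)
      finally show ?thesis by simp
    qed
    moreover have "?g \<in> wsobolev_even0 0 \<beta>"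
      using \<open>?g \<in> wsobolev 0 \<beta>\<close> g' wsq_integrable[OF sq \<beta>] by (simp add: wsobolev_even0_def wsobolev_even_def rhs_fun_def)
    ultimately obtain f where f: "f \<in> wsobolev_even 2 \<beta>" "wnorm 2 \<beta> f < 1" "AE x in lborel. linearized_op V c \<sigma> f x = ?g x"
      using d(2)[of ?g] by auto
    have fm: "f \<in> borel_measurable borel" using wsobolev_measurable f wsobolev_even_subset by blast
    obtain F where F: "AE x in lborel. f x = F x" "wbound \<beta> 2 (C1 * 1) F"
      using C1(2)[of f 1] f by (auto simp: wsobolev_even_def)
    obtain F1 F2 where P: "primitive F F1" "primitive F1 F2" using F(2) by (auto simp: wbound_2_iff)
    have "AE x in lborel. c\<^sup>2 * F2 x - delta (delta (\<lambda>y. deriv (deriv V) (S y) * F y)) x = ?g x"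
      using linearized_op_AE[OF fm F(1) P S, of V c] f(3) by eventually_elim simp
    then have "lin_eq V c S F ?g" using P by (auto simp: lin_eq_def)
    from lin_eq_cmult[OF this, of "1 / t"] have L: "lin_eq V c S (\<lambda>x. 1 / t * F x) g" using t by simp
    have cF: "continuous_on UNIV F" by (rule primitive_continuous[OF P(1)])
    have "ae_even F" using ae_even_cong[OF _ F(1)] f(1) by (simp add: wsobolev_even_def)
    then have "(\<lambda>x. F (- x)) = F"
      by (intro continuous_AE_eq_imp_eq cF continuous_on_compose2[OF cF] continuous_intros) (auto simp: ae_even_def)
    then have ev: "F (- x) = F x" for x by metis
    have "\<bar>1 / t\<bar> * (C1 * 1) = K * w" using t w d C0 by (simp add: t_def K_def)
    with wbound_cmult[OF F(2), of "1 / t"] have "wbound \<beta> 2 (K * wl2 \<beta> g) (\<lambda>x. 1 / t * F x)" by (simp add: w_def)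
    then show ?thesis using L ev by (intro exI[of _ "\<lambda>x. 1 / t * F x"]) auto
  qed
  have est: "wbound \<beta> 2 (K * wl2 \<beta> g) F" if F: "\<And>x. F (- x) = F x" "wbound \<beta> 2 r F" "lin_eq V c S F g" "rhs_fun \<beta> g" for F r g
  proof -
    obtain F' where F': "\<And>x. F' (- x) = F' x" "wbound \<beta> 2 (K * wl2 \<beta> g) F'" "lin_eq V c S F' g"
      using ex[OF F(4)] by blast
    let ?D = "\<lambda>x. F x - F' x"
    have D: "wbound \<beta> 2 (r + K * wl2 \<beta> g) ?D" by (rule wbound_diff[OF F(2) F'(2)])
    have Dm: "?D \<in> borel_measurable borel" by (rule wsq_measurable[OF wboundD(1)[OF D]])
    have "?D \<in> wsobolev_even 2 \<beta>"
      using C2[OF D Dm] F(1) F'(1) by (auto simp: wsobolev_even_def ae_even_def)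
    moreover have "lin_eq V c S ?D (\<lambda>x. 0)" using lin_eq_diff[OF F(3) F'(3)] by simp
    then obtain D1 D2 where P: "primitive ?D D1" "primitive D1 D2"
      "AE x in lborel. c\<^sup>2 * D2 x - delta (delta (\<lambda>y. deriv (deriv V) (S y) * ?D y)) x = 0"
      unfolding lin_eq_def by blast
    have "AE x in lborel. linearized_op V c \<sigma> ?D x = 0"
      using linearized_op_AE[OF Dm AE_I2[OF refl] P(1,2) S, of V c] P(3) by eventually_elim simp
    ultimately have "AE x in lborel. ?D x = 0" by (rule linearized_homeo_inj[OF h, unfolded add_0])
    then have "AE x in lborel. F x = F' x" by eventually_elim simp
    then have "F = F'"
      by (rule continuous_AE_eq_imp_eq[OF wbound_continuous wbound_continuous, of \<beta> 1 _ _ \<beta> 1,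
          unfolded One_nat_def numeral_2_eq_2[symmetric], OF F(2) F'(2)])
    then show ?thesis using F'(2) by simp
  qed
  show ?thesis by (rule that[OF K0 ex est])
qed

section \<open>The oscillator equation at resonant frequency\<close>

text \<open>The addition theorem and |sinh| <= cosh give cosh x <= exp |h| cosh (x + h). So the
  shifts by 1/2 in \<open>delta\<close> and those within the unit window move the weight at the cost
  of a constant factor.\<close>

lemma cosh_powr_shift:
  fixes x h :: real
  assumes b: "b \<ge> 0" and h: "\<bar>h\<bar> \<le> 1"
  shows "cosh x powr b \<le> exp b * cosh (x + h) powr b"
proof -
  have "cosh x = cosh (x + h) * cosh h - sinh (x + h) * sinh h"
    using cosh_diff[of "x + h" h] by simp
  also have "\<dots> \<le> cosh (x + h) * cosh h + cosh (x + h) * \<bar>sinh h\<bar>"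
  proof -
    have "\<bar>sinh (x + h)\<bar> \<le> cosh (x + h)"
    proof -
      have "(sinh (x + h))\<^sup>2 \<le> (cosh (x + h))\<^sup>2" using cosh_square_eq[of "x + h"] by simp
      then show ?thesis using cosh_real_pos[of "x + h"] by (simp add: abs_le_square_iff[symmetric])
    qed
    then have "\<bar>sinh (x + h)\<bar> * \<bar>sinh h\<bar> \<le> cosh (x + h) * \<bar>sinh h\<bar>" by (rule mult_right_mono) simp
    then have "- (sinh (x + h) * sinh h) \<le> cosh (x + h) * \<bar>sinh h\<bar>"
      by (metis abs_ge_minus_self abs_mult order_trans)
    then show ?thesis by simp
  qed
  also have "\<dots> = cosh (x + h) * exp \<bar>h\<bar>"
  proof -
    have "cosh h + \<bar>sinh h\<bar> = exp \<bar>h\<bar>"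
      by (cases "h \<ge> 0") (auto simp: sinh_def cosh_def abs_if field_simps not_le)
    then show ?thesis by (simp add: distrib_left[symmetric])
  qed
  finally have "cosh x \<le> exp \<bar>h\<bar> * cosh (x + h)" by (simp add: mult.commute)
  then have "cosh x powr b \<le> (exp \<bar>h\<bar> * cosh (x + h)) powr b"
    using cosh_real_pos[of x] b by (intro powr_mono2) auto
  also have "\<dots> = exp (b * \<bar>h\<bar>) * cosh (x + h) powr b"
    by (simp add: powr_mult powr_def[of "exp _"])
  also have "\<dots> \<le> exp b * cosh (x + h) powr b"
    using b h by (intro mult_right_mono) (auto simp: mult_left_le)
  finally show ?thesis .
qed

lemma wsq_shift:
  assumes f: "wsq b f" and b: "b \<ge> 0" and h: "\<bar>h\<bar> \<le> 1"
  shows "wsq b (\<lambda>x. f (x + h))" "wl2 b (\<lambda>x. f (x + h)) \<le> exp b * wl2 b f"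
proof -
  let ?G = "\<lambda>x. cosh x powr b * f x"
  have G: "square_integrable (\<lambda>x. ?G (x + h))" using f unfolding wsq_def by (rule square_integrable_shift)
  have m: "(\<lambda>x. cosh x powr b * f (x + h)) \<in> borel_measurable borel"
  proof (rule measurable_cosh_powr_mult)
    have [measurable]: "f \<in> borel_measurable borel" by (rule wsq_measurable[OF f])
    show "(\<lambda>x. f (x + h)) \<in> borel_measurable borel" by measurable
  qed
  have pt: "AE x in lborel. norm (cosh x powr b * f (x + h)) \<le> exp b * norm (?G (x + h))"
  proof (intro AE_I2)
    fix x show "norm (cosh x powr b * f (x + h)) \<le> exp b * norm (?G (x + h))"
      using mult_right_mono[OF cosh_powr_shift[OF b h, of x], of "\<bar>f (x + h)\<bar>"] by (simp add: abs_mult mult_ac)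
  qed
  show "wsq b (\<lambda>x. f (x + h))" unfolding wsq_def by (rule square_integrable_bound[OF G m pt])
  have "l2_norm (\<lambda>x. cosh x powr b * f (x + h)) \<le> exp b * l2_norm (\<lambda>x. ?G (x + h))"
    by (rule l2_norm_bound[OF G m pt]) simp
  also have "l2_norm (\<lambda>x. ?G (x + h)) = wl2 b f" unfolding wl2_def by (rule l2_norm_shift[of ?G])
  finally show "wl2 b (\<lambda>x. f (x + h)) \<le> exp b * wl2 b f" by (simp add: wl2_def)
qed

lemma wbound_shift:
  assumes "b \<ge> 0" "\<bar>h\<bar> \<le> 1"
  shows "wbound b m r f \<Longrightarrow> wbound b m (exp b * r) (\<lambda>x. f (x + h))"
proof (induction m arbitrary: f)
  case 0
  have "exp b * wl2 b f \<le> exp b * r" using 0 by simp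
  then have "wl2 b (\<lambda>x. f (x + h)) \<le> exp b * r" using wsq_shift(2)[OF wboundD(1)[OF 0] assms] by linarith
  then show ?case using wsq_shift[OF _ assms, of f] 0 by auto
next
  case (Suc m)
  then obtain f' where f': "primitive f f'" "wbound b m r f'" by auto
  have "exp b * wl2 b f \<le> exp b * r" using Suc.prems by simp
  then have "wl2 b (\<lambda>x. f (x + h)) \<le> exp b * r" using wsq_shift(2)[OF wboundD(1)[OF Suc.prems] assms] by linarith
  then show ?case using wsq_shift[OF _ assms, of f] Suc.prems primitive_shift[OF f'(1)] Suc.IH[OF f'(2)] by auto
qed

lemma wbound_delta:
  assumes b: "b \<ge> 0" and f: "wbound b m r f"
  shows "wbound b m (2 * exp b * r) (delta f)"
proof -
  have "wbound b m (exp b * r + exp b * r) (\<lambda>x. f (x + 1/2) - f (x + (- 1/2)))"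
    by (intro wbound_diff wbound_shift b f) auto
  moreover have "(\<lambda>x. f (x + 1/2) - f (x + (- 1/2))) = delta f" by (auto simp: delta_def)
  ultimately show ?thesis by (simp add: mult_ac)
qed

lemma wsq_delta:
  assumes b: "b \<ge> 0" and f: "wsq b f"
  shows "wsq b (delta f)" "wl2 b (delta f) \<le> 2 * exp b * wl2 b f"
  using wbound_delta[OF b, of 0 "wl2 b f" f] f by auto

text \<open>This is why the nonlinear terms have zero mean: each of them ends in an application of
  \<open>delta\<close>.\<close>

lemma integral_delta:
  assumes "integrable lborel f"
  shows "(LINT x|lborel. delta f x) = 0"
  using integrable_shift[OF assms, of "1/2"] integrable_shift[OF assms, of "-1/2"]
    integral_shift[of f "1/2"] integral_shift[of f "-1/2"] by (simp add: delta_def)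

section \<open>Convolution over a unit window\<close>

definition window_conv :: "(real \<Rightarrow> real) \<Rightarrow> (real \<Rightarrow> real) \<Rightarrow> real \<Rightarrow> real" where
  "window_conv \<phi> g x = (LINT y:{-1/2..1/2}|lborel. \<phi> y * g (x - y))"

lemma window_conv_measurable:
  assumes [measurable]: "\<phi> \<in> borel_measurable borel" "g \<in> borel_measurable borel"
  shows "window_conv \<phi> g \<in> borel_measurable borel"
  unfolding window_conv_def[abs_def] set_lebesgue_integral_def by measurable

lemma square_integrable_translate_reflect:
  "square_integrable g \<Longrightarrow> square_integrable (\<lambda>y. g (x - y))" for g :: "real \<Rightarrow> real"
  using square_integrable_reflect[OF square_integrable_shift[of g x]] by (simp add: add.commute)

lemma integrable_window_kernel:
  fixes G :: "real \<Rightarrow> real"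
  assumes G: "square_integrable G"
  shows "integrable (lborel \<Otimes>\<^sub>M lborel) (\<lambda>(y, x). indicator {-1/2..1/2} y * (G (x - y))\<^sup>2)"
proof (rule lborel_pair.Fubini_integrable)
  have [measurable]: "G \<in> borel_measurable borel" using square_integrableD[OF G] by auto
  show "(\<lambda>(y, x). indicator {-1/2..1/2} y * (G (x - y))\<^sup>2) \<in> borel_measurable (lborel \<Otimes>\<^sub>M lborel)" by measurable
  have i: "integrable lborel (\<lambda>x. (G (x - y))\<^sup>2)" "(LINT x|lborel. (G (x - y))\<^sup>2) = (l2_norm G)\<^sup>2" for y
    using integrable_shift[of "\<lambda>x. (G x)\<^sup>2" "-y"] integral_shift[of "\<lambda>x. (G x)\<^sup>2" "-y"] square_integrableD(2)[OF G]
    by (auto simp: l2_norm_sq)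
  have e: "(LINT x|lborel. norm (case (y, x) of (y, x) \<Rightarrow> indicator {-1/2..1/2} y * (G (x - y))\<^sup>2)) = indicator {-1/2..1/2} y * (l2_norm G)\<^sup>2" for y
    using i(2)[of y] by (simp add: abs_mult)
  then show "integrable lborel (\<lambda>y. LINT x|lborel. norm (case (y, x) of (y, x) \<Rightarrow> indicator {-1/2..1/2} y * (G (x - y))\<^sup>2))"
    unfolding e using integrable_indicator_Icc[where 'a = real] by simp
  show "AE y in lborel. integrable lborel (\<lambda>x. case (y, x) of (y, x) \<Rightarrow> indicator {-1/2..1/2} y * (G (x - y))\<^sup>2)"
    using i(1) by simp
qed

text \<open>Cauchy-Schwarz on an interval of length 1 bounds the squared average by the average of
  the square; Fubini then returns the squared norm of G with constant 1.\<close>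

lemma l2_norm_window_average:
  fixes G :: "real \<Rightarrow> real"
  assumes G: "square_integrable G"
  shows "square_integrable (\<lambda>x. LINT y:{-1/2..1/2}|lborel. \<bar>G (x - y)\<bar>)"
    "l2_norm (\<lambda>x. LINT y:{-1/2..1/2}|lborel. \<bar>G (x - y)\<bar>) \<le> l2_norm G"
proof -
  let ?A = "\<lambda>x. LINT y:{-1/2..1/2}|lborel. \<bar>G (x - y)\<bar>"
  let ?B = "\<lambda>x. LINT y|lborel. indicator {-1/2..1/2} y * (G (x - y))\<^sup>2"
  have [measurable]: "G \<in> borel_measurable borel" using square_integrableD[OF G] by auto
  have Am: "?A \<in> borel_measurable borel" unfolding set_lebesgue_integral_def by measurable
  note K = integrable_window_kernel[OF G]
  have iB: "integrable lborel ?B" using lborel_pair.integrable_snd[OF K] .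
  have "(LINT x|lborel. ?B x) = (LINT y|lborel. (LINT x|lborel. indicator {-1/2..1/2} y * (G (x - y))\<^sup>2))"
    using lborel_pair.Fubini_integral[OF K] .
  also have "\<dots> = (LINT y::real|lborel. indicator {-1/2..1/2} y * (l2_norm G)\<^sup>2)"
  proof -
    have "(LINT x|lborel. (G (x - y))\<^sup>2) = (l2_norm G)\<^sup>2" for y
      using integral_shift[of "\<lambda>x. (G x)\<^sup>2" "-y"] by (simp add: l2_norm_sq)
    then show ?thesis by (intro Bochner_Integration.integral_cong) auto
  qed
  also have "\<dots> = (l2_norm G)\<^sup>2" by simp
  finally have B: "(LINT x|lborel. ?B x) = (l2_norm G)\<^sup>2" .
  have AB: "(?A x)\<^sup>2 \<le> ?B x" for x
  proof -
    have "square_integrable (\<lambda>y. \<bar>G (x - y)\<bar>)"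
      using square_integrable_norm[OF square_integrable_translate_reflect[OF G, of x]] by simp
    from set_integral_power2_le[OF this, of "-1/2" "1/2"] show ?thesis by (simp add: set_lebesgue_integral_def)
  qed
  have Am2: "(\<lambda>x. (?A x)\<^sup>2) \<in> borel_measurable borel" using Am by measurable
  note I = integrable_mono_nonneg[OF iB Am2 zero_le_power2 AB]
  show "square_integrable ?A" unfolding square_integrable_def using Am I(1) by simp
  have "(l2_norm ?A)\<^sup>2 = (LINT x|lborel. (?A x)\<^sup>2)" unfolding l2_norm_sq by simp
  also have "\<dots> \<le> (LINT x|lborel. ?B x)" by (rule I(2))
  finally have "(l2_norm ?A)\<^sup>2 \<le> (l2_norm G)\<^sup>2" unfolding B .
  then show "l2_norm ?A \<le> l2_norm G" by (rule power2_le_imp_le) simp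
qed

text \<open>Under the integral the weight is carried from x to x - y, which costs exp b, and what
  remains is an average of the weighted function.\<close>

lemma wsq_window_conv:
  assumes g: "wsq b g" and b: "b \<ge> 0" and \<phi>: "\<phi> \<in> borel_measurable borel" "\<And>y. \<bar>\<phi> y\<bar> \<le> 1"
  shows "wsq b (window_conv \<phi> g)" "wl2 b (window_conv \<phi> g) \<le> exp b * wl2 b g"
proof -
  let ?G = "\<lambda>x. cosh x powr b * g x"
  have G: "square_integrable ?G" using g by (simp add: wsq_def)
  let ?A = "\<lambda>x. LINT y:{-1/2..1/2}|lborel. \<bar>?G (x - y)\<bar>"
  have m: "window_conv \<phi> g \<in> borel_measurable borel" by (rule window_conv_measurable[OF \<phi>(1) wsq_measurable[OF g]])
  have pt: "norm (cosh x powr b * window_conv \<phi> g x) \<le> exp b * norm (?A x)" for x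
  proof -
    have iG: "integrable lborel (\<lambda>y. indicator {-1/2..1/2} y * \<bar>?G (x - y)\<bar>)"
      using square_integrable_mult_integrable[OF square_integrable_indicator square_integrable_norm[OF square_integrable_translate_reflect[OF G, of x]]]
      by simp
    have "\<bar>cosh x powr b * window_conv \<phi> g x\<bar> = \<bar>LINT y|lborel. cosh x powr b * (indicator {-1/2..1/2} y * (\<phi> y * g (x - y)))\<bar>"
      by (simp add: window_conv_def set_lebesgue_integral_def)
    also have "\<dots> \<le> (LINT y|lborel. \<bar>cosh x powr b * (indicator {-1/2..1/2} y * (\<phi> y * g (x - y)))\<bar>)"
      by (rule integral_abs_bound)
    also have "\<dots> \<le> (LINT y|lborel. exp b * (indicator {-1/2..1/2} y * \<bar>?G (x - y)\<bar>))"
    proof (rule integral_mono')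
      show "integrable lborel (\<lambda>y. exp b * (indicator {-1/2..1/2} y * \<bar>?G (x - y)\<bar>))" using iG by simp
      fix y
      show "\<bar>cosh x powr b * (indicator {-1/2..1/2} y * (\<phi> y * g (x - y)))\<bar> \<le> exp b * (indicator {-1/2..1/2} y * \<bar>?G (x - y)\<bar>)"
      proof (cases "y \<in> {-1/2..1/2}")
        case True
        have "cosh x powr b * (\<bar>\<phi> y\<bar> * \<bar>g (x - y)\<bar>) \<le> (exp b * cosh (x - y) powr b) * (1 * \<bar>g (x - y)\<bar>)"
          using cosh_powr_shift[OF b, of "- y" x] True \<phi>(2) by (intro mult_mono) auto
        then show ?thesis using True by (simp add: abs_mult mult_ac)
      qed simp
      show "0 \<le> exp b * (indicator {-1/2..1/2} y * \<bar>?G (x - y)\<bar>)" by simp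
    qed
    also have "\<dots> = exp b * ?A x" by (simp add: set_lebesgue_integral_def)
    also have "\<dots> \<le> exp b * norm (?A x)" by simp
    finally show ?thesis by simp
  qed
  note A = l2_norm_window_average[OF G]
  show "wsq b (window_conv \<phi> g)"
    unfolding wsq_def by (rule square_integrable_bound[OF A(1) measurable_cosh_powr_mult[OF m], where C = "exp b"]) (use pt in auto)
  have "wl2 b (window_conv \<phi> g) \<le> exp b * l2_norm ?A"
    unfolding wl2_def by (rule l2_norm_bound[OF A(1) measurable_cosh_powr_mult[OF m]]) (use pt in auto)
  also have "\<dots> \<le> exp b * wl2 b g" using A(2) by (simp add: wl2_def)
  finally show "wl2 b (window_conv \<phi> g) \<le> exp b * wl2 b g" .
qed

lemma primitive_window_conv:
  assumes g: "primitive g g'" and g': "square_integrable g'" and c\<phi>: "continuous_on UNIV \<phi>" and \<phi>1: "\<And>y. \<bar>\<phi> y\<bar> \<le> 1"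
  shows "primitive (window_conv \<phi> g) (window_conv \<phi> g')"
  unfolding primitive_def
proof (intro conjI allI impI)
  have \<phi>[measurable]: "\<phi> \<in> borel_measurable borel" by (rule borel_measurable_continuous_onI[OF c\<phi>])
  have [measurable]: "g' \<in> borel_measurable borel" using primitiveD(2)[OF g] .
  show "locally_integrable (window_conv \<phi> g')"
    using wsq_window_conv(1)[of 0 g' \<phi>] g' \<phi> \<phi>1 by (intro square_integrable_locally_integrable) simp
  fix a b :: real assume ab: "a \<le> b"
  let ?I = "indicator {-1/2..1/2} :: real \<Rightarrow> real" and ?J = "indicator {a..b} :: real \<Rightarrow> real"
  let ?k = "\<lambda>y x. ?I y * (?J x * (\<phi> y * g' (x - y)))"
  have k: "integrable (lborel \<Otimes>\<^sub>M lborel) (\<lambda>(y, x). ?k y x)"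
  proof (rule Bochner_Integration.integrable_bound)
    have "integrable (lborel \<Otimes>\<^sub>M lborel) (\<lambda>(y, x). ?I y * ?J x)"
      by (rule integrable_product_bound[OF integrable_indicator_Icc[where 'a = real and a = "-1/2" and b = "1/2"]
         integrable_indicator_Icc[where 'a = real and a = a and b = b]]) auto
    from Bochner_Integration.integrable_add[OF this integrable_window_kernel[OF g']]
    show "integrable (lborel \<Otimes>\<^sub>M lborel) (\<lambda>p. (case p of (y, x) \<Rightarrow> ?I y * ?J x) + (case p of (y, x) \<Rightarrow> ?I y * (g' (x - y))\<^sup>2))" .
    \<comment> \<open>Since |t| <= 1 + t^2, a constant on the rectangle and the square on the window
      strip dominate the kernel; both are integrable, so Fubini applies to a merely square
      integrable g'.\<close>
    have "\<bar>?k y x\<bar> \<le> ?I y * ?J x + ?I y * (g' (x - y))\<^sup>2" for y x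
    proof (cases "y \<in> {-1/2..1/2} \<and> x \<in> {a..b}")
      case True
      have "\<bar>\<phi> y\<bar> * \<bar>g' (x - y)\<bar> \<le> 1 * \<bar>g' (x - y)\<bar>" using \<phi>1 by (intro mult_right_mono) auto
      also have "\<dots> \<le> 1 + (g' (x - y))\<^sup>2"
        using zero_le_power2[of "\<bar>g' (x - y)\<bar> - 1"] zero_le_power2[of "g' (x - y)"] by (simp add: power2_diff)
      finally show ?thesis using True by (simp add: abs_mult)
    qed (auto simp: indicator_def)
    then show "AE p in lborel \<Otimes>\<^sub>M lborel. norm (case p of (y, x) \<Rightarrow> ?k y x) \<le>
       norm ((case p of (y, x) \<Rightarrow> ?I y * ?J x) + (case p of (y, x) \<Rightarrow> ?I y * (g' (x - y))\<^sup>2))"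
      by (intro AE_I2) (fastforce simp: abs_of_nonneg)
  qed measurable
  have inner: "(LINT x|lborel. ?k y x) = ?I y * (\<phi> y * (g (b - y) - g (a - y)))" for y
  proof -
    have "g (b - y) - g (a - y) = (LINT x:{a..b}|lborel. g' (x - y))"
      using primitiveD(4)[OF primitive_shift[OF g, of "- y"] ab] by simp
    then show ?thesis by (simp add: set_lebesgue_integral_def mult.left_commute[of _ "\<phi> y"])
  qed
  have ic: "integrable lborel (\<lambda>y. ?I y * (\<phi> y * g (x - y)))" for x
  proof -
    have cg: "continuous_on UNIV (\<lambda>y. g (x - y))"
      by (intro continuous_on_compose2[OF primitive_continuous[OF g]] continuous_intros) auto
    show ?thesis
      using set_integrable_mult_continuous[OF continuous_locally_integrable[OF c\<phi>] cg, of "-1/2" "1/2"]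
      by (simp add: set_integrable_def)
  qed
  have "(LINT x:{a..b}|lborel. window_conv \<phi> g' x) = (LINT x|lborel. (LINT y|lborel. ?k y x))"
    unfolding window_conv_def set_lebesgue_integral_def
    by (simp only: real_scaleR_def integral_mult_right_zero[symmetric]) (simp only: mult.left_commute[of "?J _"])
  also have "\<dots> = (LINT y|lborel. (LINT x|lborel. ?k y x))" by (rule lborel_pair.Fubini_integral[OF k])
  also have "\<dots> = (LINT y|lborel. ?I y * (\<phi> y * g (b - y)) - ?I y * (\<phi> y * g (a - y)))"
    unfolding inner by (simp only: right_diff_distrib)
  also have "\<dots> = window_conv \<phi> g b - window_conv \<phi> g a"
    using ic by (simp add: window_conv_def set_lebesgue_integral_def)
  finally show "window_conv \<phi> g b - window_conv \<phi> g a = (LINT x:{a..b}|lborel. window_conv \<phi> g' x)" ..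
qed

lemma wbound_window_conv:
  assumes b: "b \<ge> 0" and c\<phi>: "continuous_on UNIV \<phi>" and \<phi>1: "\<And>y. \<bar>\<phi> y\<bar> \<le> 1"
  shows "wbound b m r g \<Longrightarrow> wbound b m (exp b * r) (window_conv \<phi> g)"
proof (induction m arbitrary: g)
  case 0
  have "exp b * wl2 b g \<le> exp b * r" using 0 by simp
  then have "wl2 b (window_conv \<phi> g) \<le> exp b * r"
    using wsq_window_conv(2)[OF wboundD(1)[OF 0] b borel_measurable_continuous_onI[OF c\<phi>] \<phi>1] by linarith
  then show ?case
    using wsq_window_conv[OF _ b borel_measurable_continuous_onI[OF c\<phi>] \<phi>1, of g] 0 by auto
next
  case (Suc m)
  then obtain g' where g': "primitive g g'" "wbound b m r g'" by auto
  have "exp b * wl2 b g \<le> exp b * r" using Suc.prems by simp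
  then have "wl2 b (window_conv \<phi> g) \<le> exp b * r"
    using wsq_window_conv(2)[OF wboundD(1)[OF Suc.prems] b borel_measurable_continuous_onI[OF c\<phi>] \<phi>1] by linarith
  moreover have "primitive (window_conv \<phi> g) (window_conv \<phi> g')"
    by (rule primitive_window_conv[OF g'(1) wsq_weaken(1)[OF wboundD(1)[OF g'(2)] b] c\<phi> \<phi>1])
  ultimately show ?case
    using wsq_window_conv[OF _ b borel_measurable_continuous_onI[OF c\<phi>] \<phi>1, of g] Suc.prems Suc.IH[OF g'(2)] by auto
qed

lemma primitive_reflect:
  assumes F: "primitive F f"
  shows "primitive (\<lambda>y. F (x - y)) (\<lambda>y. - f (x - y))"
proof -
  have ind: "indicator {a..b} y * f (x - y) = (\<lambda>z. indicator {x - b..x - a} z * f z) (x + (- 1) * y)" for a b y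
    by (auto simp: indicator_def)
  have i: "integrable lborel (\<lambda>z. indicator {x - b..x - a} z * f z)" for a b
    using primitiveD(3)[OF F, of "x - b" "x - a"] by (simp add: set_integrable_def)
  have "set_integrable lborel {a..b} (\<lambda>y. - f (x - y))" for a b
    using lborel_integrable_real_affine[OF i[of b a], of "-1" x] unfolding set_integrable_def real_scaleR_def mult_minus_right ind by simp
  moreover have "(LINT y:{a..b}|lborel. - f (x - y)) = - (LINT z:{x - b..x - a}|lborel. f z)" for a b
  proof -
    have "(LINT y:{a..b}|lborel. - f (x - y)) = - (LINT y|lborel. (\<lambda>z. indicator {x - b..x - a} z * f z) (x + (- 1) * y))"
      unfolding set_lebesgue_integral_def real_scaleR_def mult_minus_right ind by simp
    then show ?thesis
      using lborel_integral_real_affine[of "-1" "\<lambda>z. indicator {x - b..x - a} z * f z" x] by (simp add: set_lebesgue_integral_def)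
  qed
  moreover have "(\<lambda>y. - f (x - y)) \<in> borel_measurable borel" using primitiveD(2)[OF F] by measurable
  moreover have "F (x - b) - F (x - a) = - (LINT z:{x - b..x - a}|lborel. f z)" if "a \<le> b" for a b
    using primitiveD(4)[OF F, of "x - b" "x - a"] that by simp
  ultimately show ?thesis unfolding primitive_def locally_integrable_def by auto
qed

lemma set_integrable_window:
  assumes g: "locally_integrable g" and \<phi>: "continuous_on UNIV \<phi>"
  shows "set_integrable lborel {a..b} (\<lambda>y. \<phi> y * g (x - y))"
proof -
  have ind: "indicator {c..d} y * g (x - y) = (\<lambda>z. indicator {x - d..x - c} z * g z) (x + (- 1) * y)" for c d y
    by (auto simp: indicator_def)
  have "set_integrable lborel {c..d} (\<lambda>y. g (x - y))" for c d
  proof -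
    have "integrable lborel (\<lambda>z. indicator {x - d..x - c} z * g z)"
      using locally_integrableD(2)[OF g, of "x - d" "x - c"] by (simp add: set_integrable_def)
    from lborel_integrable_real_affine[OF this, of "-1" x] show ?thesis
      unfolding set_integrable_def real_scaleR_def ind by simp
  qed
  moreover have "(\<lambda>y. g (x - y)) \<in> borel_measurable borel" using locally_integrableD(1)[OF g] by measurable
  ultimately have "locally_integrable (\<lambda>y. g (x - y))" by (simp add: locally_integrable_def)
  from set_integrable_mult_continuous[OF this \<phi>] show ?thesis by (simp add: mult.commute)
qed

lemma window_conv_diff:
  assumes g: "locally_integrable g" and h: "locally_integrable h" and \<phi>: "continuous_on UNIV \<phi>"
  shows "window_conv \<phi> (\<lambda>x. g x - h x) x = window_conv \<phi> g x - window_conv \<phi> h x"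
  using set_integral_diff(2)[OF set_integrable_window[OF g \<phi>, of "-1/2" "1/2" x] set_integrable_window[OF h \<phi>, of "-1/2" "1/2" x]]
  by (simp add: window_conv_def right_diff_distrib)

lemma window_conv_cmult: "window_conv (\<lambda>y. c * \<phi> y) g x = c * window_conv \<phi> g x"
proof -
  have "window_conv (\<lambda>y. c * \<phi> y) g x = (LINT y|lborel. c * (indicator {-1/2..1/2} y * (\<phi> y * g (x - y))))"
    unfolding window_conv_def set_lebesgue_integral_def by (intro Bochner_Integration.integral_cong) auto
  then show ?thesis by (simp add: window_conv_def set_lebesgue_integral_def)
qed

text \<open>The ends 1/2 and -1/2 of the window contribute the values of g at x - 1/2 and x + 1/2.
  At frequency 2 pi n these boundary terms drop out for the sine and combine to a multiple of
  \<open>delta g\<close> for the cosine.\<close>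

lemma window_conv_by_parts:
  assumes g: "primitive g g'" and \<phi>: "\<And>y. (\<phi> has_real_derivative \<phi>' y) (at y)" and c\<phi>': "continuous_on UNIV \<phi>'"
  shows "window_conv \<phi> g' x = window_conv \<phi>' g x - (\<phi> (1/2) * g (x - 1/2) - \<phi> (- 1/2) * g (x + 1/2))"
proof -
  have c\<phi>: "continuous_on UNIV \<phi>" by (rule continuous_at_imp_continuous_on) (use \<phi> DERIV_isCont in blast)
  have "primitive (\<lambda>y. \<phi> y * g (x - y)) (\<lambda>y. \<phi>' y * g (x - y) + \<phi> y * - g' (x - y))"
    by (intro primitive_mult primitive_C1 \<phi> c\<phi>' primitive_reflect g)
  from primitiveD(4)[OF this, of "-1/2" "1/2"]
  have "\<phi> (1/2) * g (x - 1/2) - \<phi> (- 1/2) * g (x + 1/2) = (LINT y:{-1/2..1/2}|lborel. \<phi>' y * g (x - y) - \<phi> y * g' (x - y))"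
    by simp
  also have "\<dots> = window_conv \<phi>' g x - window_conv \<phi> g' x"
    unfolding window_conv_def
    by (intro set_integral_diff(2) set_integrable_window c\<phi> c\<phi>' primitiveD(1)[OF g] continuous_locally_integrable primitive_continuous[OF g])
  finally show ?thesis by simp
qed

text \<open>The solution operator of \<open>u'' + (2\<pi>n)\<^sup>2 u = \<delta> g\<close>. Convolution with the fundamental solution
  \<open>sin (2\<pi>n x) / (2\<pi>n)\<close> on \<open>x > 0\<close> followed by \<open>\<delta>\<close> has a kernel supported in the unit window,
  because the two shifts by \<open>1/2\<close> cancel outside it.\<close>

definition resolvent :: "nat \<Rightarrow> (real \<Rightarrow> real) \<Rightarrow> real \<Rightarrow> real" where
  "resolvent n g x = ((-1) ^ n / (2 * pi * real n)) * window_conv (\<lambda>y. sin (2 * pi * real n * y)) g x"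

lemma continuous_trig:
  "continuous_on UNIV (\<lambda>y::real. sin (a * y))" "continuous_on UNIV (\<lambda>y::real. cos (a * y))"
  by (intro continuous_intros)+

text \<open>Applied to the cosine, whose derivative is -w sin. Its value (-1)^n at both ends of the
  window equals the sign built into the kernel, so the two signs cancel in front of
  \<open>delta g\<close>. The second factor 1/w is bought with the derivative g'.\<close>

lemma resolvent_by_parts:
  assumes g: "primitive g g'" and n: "n \<ge> 1"
  shows "resolvent n g x = (1 / (2 * pi * real n)\<^sup>2) * delta g x
    + (- ((-1) ^ n / (2 * pi * real n)\<^sup>2)) * window_conv (\<lambda>y. cos (2 * pi * real n * y)) g' x"
proof -
  let ?w = "2 * pi * real n"
  have w: "?w \<noteq> 0" using n by simp
  have cn: "cos (?w * (1/2)) = (-1) ^ n" "cos (?w * (- 1/2)) = (-1) ^ n"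
    using cos_npi[of n] by (simp_all add: mult.commute)
  have "window_conv (\<lambda>y. cos (?w * y)) g' x = window_conv (\<lambda>y. - ?w * sin (?w * y)) g x - ((-1) ^ n * g (x - 1/2) - (-1) ^ n * g (x + 1/2))"
  proof -
    have "((\<lambda>y. cos (?w * y)) has_real_derivative - ?w * sin (?w * y)) (at y)" for y
      by (auto intro!: derivative_eq_intros)
    from window_conv_by_parts[OF g this, of x] show ?thesis unfolding cn by (simp add: continuous_intros)
  qed
  also have "window_conv (\<lambda>y. - ?w * sin (?w * y)) g x = - ?w * window_conv (\<lambda>y. sin (?w * y)) g x"
    by (rule window_conv_cmult)
  finally have "?w * window_conv (\<lambda>y. sin (?w * y)) g x = (-1) ^ n * delta g x - window_conv (\<lambda>y. cos (?w * y)) g' x"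
    by (simp add: delta_def algebra_simps)
  moreover have "e / w * X = 1 / w\<^sup>2 * D + (- (e / w\<^sup>2)) * C"
    if "e * e = 1" "w \<noteq> 0" "w * X = e * D - C" for e w X D C :: real
  proof -
    have "e * (w * X) = (e * e) * D - e * C" unfolding that(3) by (simp add: right_diff_distrib)
    then have *: "e * (w * X) = D - e * C" using that(1) by simp
    have "e / w * X = e * (w * X) / w\<^sup>2" using that(2) by (simp add: power2_eq_square)
    then show ?thesis unfolding * by (simp add: diff_divide_distrib)
  qed
  moreover have "(-1) ^ n * (-1) ^ n = (1::real)" by (simp add: power_add[symmetric] mult_2[symmetric])
  ultimately show ?thesis unfolding resolvent_def using w by blast
qed

text \<open>Convolution commutes with differentiation, so this is u'' = delta g - w^2 u for u =
  \<open>resolvent n g\<close>. Two integrations by parts are combined; in the one for the sine the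
  boundary terms vanish because w/2 is a multiple of pi, which is the resonance condition.\<close>

lemma resolvent_second_derivative:
  assumes g: "primitive g g1" "primitive g1 g2" and n: "n \<ge> 1"
  shows "resolvent n g2 x = delta g x - (2 * pi * real n)\<^sup>2 * resolvent n g x"
proof -
  let ?w = "2 * pi * real n"
  have w: "?w \<noteq> 0" using n by simp
  have sn: "sin (?w * (1/2)) = 0" "sin (?w * (- 1/2)) = 0"
    using sin_npi[of n] by (simp_all add: mult.commute)
  have "window_conv (\<lambda>y. sin (?w * y)) g2 x = window_conv (\<lambda>y. ?w * cos (?w * y)) g1 x"
  proof -
    have "((\<lambda>y. sin (?w * y)) has_real_derivative ?w * cos (?w * y)) (at y)" for y
      by (auto intro!: derivative_eq_intros)
    from window_conv_by_parts[OF g(2) this, of x] show ?thesis unfolding sn by (simp add: continuous_intros)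
  qed
  also have "\<dots> = ?w * window_conv (\<lambda>y. cos (?w * y)) g1 x"
    by (rule window_conv_cmult)
  finally have 1: "resolvent n g2 x = (-1) ^ n * window_conv (\<lambda>y. cos (?w * y)) g1 x"
    using w by (simp add: resolvent_def)
  have "?w\<^sup>2 * resolvent n g x = delta g x - (-1) ^ n * window_conv (\<lambda>y. cos (?w * y)) g1 x"
    unfolding resolvent_by_parts[OF g(1) n] using w by (simp add: field_simps)
  with 1 show ?thesis by simp
qed

lemma primitive_resolvent:
  assumes "primitive g g'" "square_integrable g'"
  shows "primitive (resolvent n g) (resolvent n g')"
  unfolding resolvent_def[abs_def]
  by (intro primitive_cmult primitive_window_conv assms continuous_trig) auto

lemma wbound_resolvent:
  assumes b: "b \<ge> 0" and n: "n \<ge> 1" and g: "wbound b m r g"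
  shows "wbound b m (exp b * r / real n) (resolvent n g)"
proof -
  have r: "r \<ge> 0" by (rule wboundD(3)[OF g])
  have "wbound b m (\<bar>(-1) ^ n / (2 * pi * real n)\<bar> * (exp b * r)) (resolvent n g)"
    unfolding resolvent_def[abs_def] by (intro wbound_cmult wbound_window_conv b g continuous_trig) auto
  then show ?thesis
  proof (rule wbound_mono_radius)
    have "\<bar>(-1) ^ n / (2 * pi * real n)\<bar> \<le> 1 / real n"
      using n pi_gt3 by (simp add: abs_mult power_abs frac_le)
    from mult_right_mono[OF this, of "exp b * r"] r
    show "\<bar>(-1) ^ n / (2 * pi * real n)\<bar> * (exp b * r) \<le> exp b * r / real n" by simp
  qed
qed

text \<open>One order of regularity is exchanged for the second factor 1/n. Of the constant 3, two
  come from \<open>delta\<close> and one from the convolution with the cosine.\<close>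

lemma wbound_resolvent_smoothing:
  assumes b: "b \<ge> 0" and n: "n \<ge> 1" and g: "wbound b (Suc m) r g"
  shows "wbound b m (3 * exp b * r / (real n)\<^sup>2) (resolvent n g)"
proof -
  have r: "r \<ge> 0" by (rule wboundD(3)[OF g])
  let ?w = "2 * pi * real n"
  obtain g' where g': "primitive g g'" "wbound b m r g'" using g by auto
  have gm: "wbound b m r g" by (rule wbound_lower[OF g]) simp
  have "wbound b m (\<bar>1 / ?w\<^sup>2\<bar> * (2 * exp b * r) + \<bar>- ((-1) ^ n / ?w\<^sup>2)\<bar> * (exp b * r)) (resolvent n g)"
    unfolding resolvent_by_parts[OF g'(1) n, abs_def]
    by (intro wbound_add wbound_cmult wbound_delta wbound_window_conv b gm g'(2) continuous_trig) auto
  then show ?thesis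
  proof (rule wbound_mono_radius)
    have "(real n)\<^sup>2 \<le> ?w\<^sup>2"
    proof (rule power_mono)
      have "1 * real n \<le> (2 * pi) * real n" using pi_gt3 by (intro mult_right_mono) auto
      then show "real n \<le> ?w" by simp
    qed simp
    then have i: "1 / ?w\<^sup>2 \<le> 1 / (real n)\<^sup>2" using n by (intro frac_le) auto
    have e: "\<bar>1 / ?w\<^sup>2\<bar> * (2 * exp b * r) + \<bar>- ((-1) ^ n / ?w\<^sup>2)\<bar> * (exp b * r) = (1 / ?w\<^sup>2) * (3 * exp b * r)"
      by (simp add: power_abs)
    have "(1 / ?w\<^sup>2) * (3 * exp b * r) \<le> (1 / (real n)\<^sup>2) * (3 * exp b * r)"
      using r by (intro mult_right_mono i) auto
    then show "\<bar>1 / ?w\<^sup>2\<bar> * (2 * exp b * r) + \<bar>- ((-1) ^ n / ?w\<^sup>2)\<bar> * (exp b * r) \<le> 3 * exp b * r / (real n)\<^sup>2"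
      unfolding e by simp
  qed
qed

lemma resolvent_diff:
  assumes "locally_integrable g" "locally_integrable h"
  shows "resolvent n (\<lambda>x. g x - h x) x = resolvent n g x - resolvent n h x"
  unfolding resolvent_def window_conv_diff[OF assms continuous_trig(1)] by (simp add: right_diff_distrib)

lemma resolvent_odd:
  assumes "\<And>x. g (- x) = g x"
  shows "resolvent n g (- x) = - resolvent n g x"
proof -
  let ?s = "\<lambda>y. sin (2 * pi * real n * y)"
  have "window_conv ?s g (- x) = (LINT y|lborel. indicator {-1/2..1/2} y * (?s y * g (- x - y)))"
    by (simp add: window_conv_def set_lebesgue_integral_def)
  also have "\<dots> = (LINT y|lborel. indicator {-1/2..1/2} (0 + (-1) * y) * (?s (0 + (-1) * y) * g (- x - (0 + (-1) * y))))"
    by (subst lborel_integral_real_affine[of "-1" _ 0]) auto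
  also have "\<dots> = (LINT y|lborel. - (indicator {-1/2..1/2} y * (?s y * g (x - y))))"
  proof (intro Bochner_Integration.integral_cong refl)
    fix y
    have "g (- x + y) = g (x - y)" using assms[of "x - y"] by simp
    then show "indicator {-1/2..1/2} (0 + (-1) * y) * (?s (0 + (-1) * y) * g (- x - (0 + (-1) * y))) = - (indicator {-1/2..1/2} y * (?s y * g (x - y)))"
      by (auto simp: indicator_def)
  qed
  also have "\<dots> = - window_conv ?s g x" by (simp add: window_conv_def set_lebesgue_integral_def)
  finally show ?thesis by (simp add: resolvent_def)
qed

lemma delta_odd:
  assumes "\<And>x. g (- x) = g x"
  shows "delta g (- x) = - delta g x"
  using assms[of "x + 1/2"] assms[of "x - 1/2"] by (simp add: delta_def)

lemma delta_even:
  assumes "\<And>x. g (- x) = - g x"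
  shows "delta g (- x) = delta g x"
  using assms[of "x + 1/2"] assms[of "x - 1/2"] by (simp add: delta_def)

section \<open>Composition estimates\<close>

lemma wbound_SucI:
  "primitive f f' \<Longrightarrow> wbound b m r f' \<Longrightarrow> wsq b f \<Longrightarrow> wl2 b f \<le> r \<Longrightarrow> wbound b (Suc m) r f"
  by auto

lemma set_integral_le_integral:
  fixes f :: "real \<Rightarrow> real"
  assumes "integrable lborel f" "\<And>x. f x \<ge> 0"
  shows "(LINT x:{a..b}|lborel. f x) \<le> (LINT x|lborel. f x)"
  unfolding set_lebesgue_integral_def
proof (rule integral_mono'[OF assms(1)])
  show "indicator {a..b} x *\<^sub>R f x \<le> f x" "0 \<le> f x" for x using assms(2)[of x] by (auto simp: indicator_def)
qed

text \<open>The local bound for the squared value is enlarged to the full norms of f and f', and 2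
  r^2 + 2 r^2 = (2r)^2.\<close>

lemma wbound_sup:
  assumes b: "b \<ge> 0" and f: "wbound b (Suc m) r f"
  shows "\<bar>f x\<bar> \<le> 2 * r"
proof -
  obtain f' where f': "primitive f f'" "wbound b m r f'" using f by auto
  have r: "r \<ge> 0" by (rule wboundD(3)[OF f])
  note F = wsq_weaken[OF wboundD(1)[OF f] b] and F' = wsq_weaken[OF wboundD(1)[OF f'(2)] b]
  have le: "(l2_norm h)\<^sup>2 \<le> r\<^sup>2" if "l2_norm h \<le> wl2 b h" "wl2 b h \<le> r" for h
    using that by (intro power_mono) auto
  have "(f x)\<^sup>2 \<le> 2 * (LINT y:{x..x+1}|lborel. (f y)\<^sup>2) + 2 * (LINT y:{x..x+1}|lborel. (f' y)\<^sup>2)"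
    by (rule primitive_power2_le[OF f'(1) F(1) F'(1)])
  also have "\<dots> \<le> 2 * (l2_norm f)\<^sup>2 + 2 * (l2_norm f')\<^sup>2"
    using square_integrableD(2)[OF F(1)] square_integrableD(2)[OF F'(1)] unfolding l2_norm_sq
    by (intro add_mono mult_left_mono order_trans[OF set_integral_le_integral]) auto
  also have "\<dots> \<le> 2 * r\<^sup>2 + 2 * r\<^sup>2"
    using le[OF F(2) wboundD(2)[OF f]] le[OF F'(2) wboundD(2)[OF f'(2)]] by simp
  also have "\<dots> = (2 * r)\<^sup>2" by (simp add: power2_eq_square)
  finally show ?thesis using r by (subst (asm) power2_le_iff_abs_le) auto
qed

lemma wbound_0_mult_bounded:
  assumes f: "wsq b f" "wl2 b f \<le> r" and h: "h \<in> borel_measurable borel" "\<And>x. \<bar>h x\<bar> \<le> C"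
  shows "wsq b (\<lambda>x. h x * f x)" "wl2 b (\<lambda>x. h x * f x) \<le> C * r"
proof -
  have C: "C \<ge> 0" using h(2)[of 0] by linarith
  have m: "(\<lambda>x. h x * f x) \<in> borel_measurable borel" using h(1) wsq_measurable[OF f(1)] by measurable
  have pt: "AE x in lborel. \<bar>h x * f x\<bar> \<le> C * \<bar>f x\<bar>" using h(2) by (simp add: abs_mult mult_right_mono)
  show "wsq b (\<lambda>x. h x * f x)" by (rule wsq_bound[OF f(1) m pt])
  have "wl2 b (\<lambda>x. h x * f x) \<le> C * wl2 b f" by (rule wl2_bound[OF f(1) m pt C])
  also have "\<dots> \<le> C * r" using f(2) C by (intro mult_left_mono)
  finally show "wl2 b (\<lambda>x. h x * f x) \<le> C * r" .
qed

text \<open>One factor has an extra order so that it is bounded already at m = 0. In the term v' u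
  of the product rule the roles are exchanged: u, still of order m + 1, is the smoother factor and
  v' the rougher one.\<close>

lemma wbound_mult:
  assumes b: "b \<ge> 0"
  shows "\<exists>C\<ge>0. \<forall>r s u v. wbound b m r u \<longrightarrow> wbound b (Suc m) s v \<longrightarrow> wbound b m (C * (r * s)) (\<lambda>x. v x * u x)"
proof (induction m)
  case 0
  have "wbound b 0 (2 * (r * s)) (\<lambda>x. v x * u x)" if u: "wbound b 0 r u" and v: "wbound b (Suc 0) s v" for r s u v
    using wbound_0_mult_bounded[of b u r v "2 * s"] wbound_sup[OF b v] u v wsq_measurable[OF wboundD(1)[OF v]]
    by (simp add: mult_ac)
  then show ?case by (intro exI[of _ 2] conjI allI impI) (simp, blast)
next
  case (Suc m)
  obtain C where C: "C \<ge> 0" "\<And>r s u v. wbound b m r u \<Longrightarrow> wbound b (Suc m) s v \<Longrightarrow> wbound b m (C * (r * s)) (\<lambda>x. v x * u x)"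
    using Suc.IH by blast
  have "wbound b (Suc m) ((2 * C + 2) * (r * s)) (\<lambda>x. v x * u x)" if u: "wbound b (Suc m) r u" and v: "wbound b (Suc (Suc m)) s v" for r s u v
  proof -
    obtain u' where u': "primitive u u'" "wbound b m r u'" using u by auto
    obtain v' where v': "primitive v v'" "wbound b (Suc m) s v'" using v by auto
    have rs: "r \<ge> 0" "s \<ge> 0" using wboundD(3) u v by blast+
    have vl: "wbound b (Suc m) s v" by (rule wbound_lower[OF v]) simp
    have v'l: "wbound b m s v'" by (rule wbound_lower[OF v'(2)]) simp
    have res1: "primitive (\<lambda>x. v x * u x) (\<lambda>x. v' x * u x + v x * u' x)" by (rule primitive_mult[OF v'(1) u'(1)])
    have "wbound b m (C * (s * r) + C * (r * s)) (\<lambda>x. u x * v' x + v x * u' x)"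
      by (intro wbound_add C(2) v'l u vl u'(2))
    then have "wbound b m (C * (s * r) + C * (r * s)) (\<lambda>x. v' x * u x + v x * u' x)" by (simp add: mult.commute)
    then have res2: "wbound b m ((2 * C + 2) * (r * s)) (\<lambda>x. v' x * u x + v x * u' x)"
      by (rule wbound_mono_radius) (use rs in \<open>simp add: algebra_simps\<close>)
    note B = wbound_0_mult_bounded[OF wboundD(1,2)[OF u] wsq_measurable[OF wboundD(1)[OF v]] wbound_sup[OF b v]]
    have res3: "wsq b (\<lambda>x. v x * u x)" by (rule B(1))
    have "0 \<le> C * (r * s)" using C(1) rs by simp
    then have res4: "wl2 b (\<lambda>x. v x * u x) \<le> (2 * C + 2) * (r * s)"
      using B(2) by (simp add: algebra_simps)
    show ?thesis by (rule wbound_SucI[OF res1 res2 res3 res4])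
  qed
  then show ?case using C(1) by (intro exI[of _ "2 * C + 2"] conjI allI impI) (simp, blast)
qed

lemma continuous_bounded_on_Icc:
  fixes G :: "real \<Rightarrow> real"
  assumes "continuous_on UNIV G"
  obtains C where "C \<ge> 0" "\<And>x. \<bar>x\<bar> \<le> a \<Longrightarrow> \<bar>G x\<bar> \<le> C"
proof -
  have "bounded (G ` {-a..a})"
    by (intro compact_imp_bounded compact_continuous_image continuous_on_subset[OF assms]) auto
  then obtain C where C: "\<And>y. y \<in> G ` {-a..a} \<Longrightarrow> norm y \<le> C" unfolding bounded_iff by blast
  show ?thesis
  proof (rule that[of "\<bar>C\<bar>"])
    fix x assume "\<bar>x\<bar> \<le> a"
    then have "x \<in> {-a..a}" by auto
    from C[OF imageI[OF this]] show "\<bar>G x\<bar> \<le> \<bar>C\<bar>" by simp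
  qed simp
qed

text \<open>Order at least 2 makes \<rho> continuously differentiable even for m = 0, so the chain
  rule is the classical one.\<close>

lemma primitive_comp_wbound:
  assumes G: "C_k (Suc 0) G" and r: "wbound b (max (Suc m) 2) M \<rho>"
  obtains \<rho>1 where "primitive \<rho> \<rho>1" "wbound b m M \<rho>1" "primitive (\<lambda>x. G (\<rho> x)) (\<lambda>x. deriv G (\<rho> x) * \<rho>1 x)"
proof -
  have r1: "wbound b (Suc (max m 1)) M \<rho>" by (rule wbound_lower[OF r]) auto
  then obtain \<rho>1 where P: "primitive \<rho> \<rho>1" "wbound b (max m 1) M \<rho>1" by auto
  have c1: "continuous_on UNIV \<rho>1" using wbound_lower[OF P(2), of 1] wbound_continuous[of b 0 M \<rho>1] by simp
  have cG: "continuous_on UNIV (deriv G)" using G by (simp add: C_k_Suc C_k_0)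
  have "primitive (\<lambda>x. G (\<rho> x)) (\<lambda>x. deriv G (\<rho> x) * \<rho>1 x)"
  proof (rule primitive_C1)
    show "((\<lambda>x. G (\<rho> x)) has_real_derivative deriv G (\<rho> x) * \<rho>1 x) (at x)" for x
      by (rule DERIV_chain2[OF C_k_derivative[OF G] primitive_has_derivative[OF P(1) c1]])
    show "continuous_on UNIV (\<lambda>x. deriv G (\<rho> x) * \<rho>1 x)"
      by (intro continuous_on_mult c1 continuous_on_compose2[OF cG primitive_continuous[OF P(1)]]) auto
  qed
  moreover have "wbound b m M \<rho>1" by (rule wbound_lower[OF P(2)]) simp
  ultimately show ?thesis using that P(1) by blast
qed

lemma wbound_max2_sup:
  assumes "b \<ge> 0" "wbound b (max m 2) M \<rho>"
  shows "\<bar>\<rho> x\<bar> \<le> 2 * M" "\<rho> \<in> borel_measurable borel" "wbound b 2 M \<rho>"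
proof -
  show *: "wbound b 2 M \<rho>" by (rule wbound_lower[OF assms(2)]) simp
  show "\<bar>\<rho> x\<bar> \<le> 2 * M" using wbound_sup[OF assms(1), of 1 M \<rho> x] * by (simp add: numeral_2_eq_2)
  show "\<rho> \<in> borel_measurable borel" by (rule wsq_measurable[OF wboundD(1)[OF *]])
qed

lemma comp_measurable:
  fixes G \<rho> :: "real \<Rightarrow> real"
  assumes "continuous_on UNIV G" "\<rho> \<in> borel_measurable borel"
  shows "(\<lambda>x. G (\<rho> x)) \<in> borel_measurable borel"
  using measurable_compose[OF assms(2) borel_measurable_continuous_onI[OF assms(1)]] .

text \<open>The bound is linear in the radius of f, while \<rho> enters only through the fixed
  radius M. In the derivative, G'(\<rho>) \<rho>1 f is a product of the same kind with G' in place
  of G and \<rho>1 f in place of f.\<close>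

lemma wbound_comp_mult:
  assumes b: "b \<ge> 0" and G: "C_k m G"
  shows "\<exists>C\<ge>0. \<forall>\<rho> r f. wbound b (max m 2) M \<rho> \<longrightarrow> wbound b m r f \<longrightarrow> wbound b m (C * r) (\<lambda>x. G (\<rho> x) * f x)"
  using G
proof (induction m arbitrary: G)
  case (0 G)
  have cG: "continuous_on UNIV G" using 0 by (simp add: C_k_0)
  obtain C where C: "C \<ge> 0" "\<And>x. \<bar>x\<bar> \<le> 2 * M \<Longrightarrow> \<bar>G x\<bar> \<le> C" using continuous_bounded_on_Icc[OF cG] by metis
  have "wbound b 0 (C * r) (\<lambda>x. G (\<rho> x) * f x)" if r: "wbound b (max 0 2) M \<rho>" and f: "wbound b 0 r f" for \<rho> r f
    using wbound_0_mult_bounded[OF wboundD(1,2)[OF f] comp_measurable[OF cG wbound_max2_sup(2)[OF b r]] C(2)[OF wbound_max2_sup(1)[OF b r]]]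
    by simp
  then show ?case using C(1) by blast
next
  case (Suc m G)
  have cG: "continuous_on UNIV G" by (rule C_k_imp_continuous[OF Suc.prems])
  have G1: "C_k m (deriv G)" "C_k m G" "C_k (Suc 0) G" using Suc.prems C_k_lower[OF Suc.prems] by (simp_all add: C_k_Suc[of m])
  obtain A where A: "A \<ge> 0" "\<And>x. \<bar>x\<bar> \<le> 2 * M \<Longrightarrow> \<bar>G x\<bar> \<le> A" using continuous_bounded_on_Icc[OF cG] by metis
  obtain C where C: "C \<ge> 0" "\<And>\<rho> r f. wbound b (max m 2) M \<rho> \<Longrightarrow> wbound b m r f \<Longrightarrow> wbound b m (C * r) (\<lambda>x. G (\<rho> x) * f x)"
    using Suc.IH[OF G1(2)] by blast
  obtain D where D: "D \<ge> 0" "\<And>\<rho> r f. wbound b (max m 2) M \<rho> \<Longrightarrow> wbound b m r f \<Longrightarrow> wbound b m (D * r) (\<lambda>x. deriv G (\<rho> x) * f x)"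
    using Suc.IH[OF G1(1)] by blast
  obtain P where P: "P \<ge> 0" "\<And>r s u v. wbound b m r u \<Longrightarrow> wbound b (Suc m) s v \<Longrightarrow> wbound b m (P * (r * s)) (\<lambda>x. v x * u x)"
    using wbound_mult[OF b] by blast
  have "wbound b (Suc m) ((A + C + D * (P * \<bar>M\<bar>)) * r) (\<lambda>x. G (\<rho> x) * f x)"
    if r: "wbound b (max (Suc m) 2) M \<rho>" and f: "wbound b (Suc m) r f" for \<rho> r f
  proof -
    have r0: "r \<ge> 0" by (rule wboundD(3)[OF f])
    have M0: "M \<ge> 0" by (rule wboundD(3)[OF r])
    obtain \<rho>1 where R: "primitive \<rho> \<rho>1" "wbound b m M \<rho>1" "primitive (\<lambda>x. G (\<rho> x)) (\<lambda>x. deriv G (\<rho> x) * \<rho>1 x)"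
      using primitive_comp_wbound[OF G1(3) r] .
    obtain f' where f': "primitive f f'" "wbound b m r f'" using f by auto
    have rl: "wbound b (max m 2) M \<rho>" by (rule wbound_lower[OF r]) auto
    have res1: "primitive (\<lambda>x. G (\<rho> x) * f x) (\<lambda>x. deriv G (\<rho> x) * \<rho>1 x * f x + G (\<rho> x) * f' x)"
      by (rule primitive_mult[OF R(3) f'(1)])
    have "wbound b m (D * (P * (M * r)) + C * r) (\<lambda>x. deriv G (\<rho> x) * (f x * \<rho>1 x) + G (\<rho> x) * f' x)"
      by (intro wbound_add C(2) D(2) P(2) rl R(2) f f'(2))
    then have "wbound b m (D * (P * (M * r)) + C * r) (\<lambda>x. deriv G (\<rho> x) * \<rho>1 x * f x + G (\<rho> x) * f' x)"
      by (simp add: mult_ac)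
    then have res2: "wbound b m ((A + C + D * (P * \<bar>M\<bar>)) * r) (\<lambda>x. deriv G (\<rho> x) * \<rho>1 x * f x + G (\<rho> x) * f' x)"
      by (rule wbound_mono_radius) (use A(1) r0 M0 in \<open>simp add: algebra_simps\<close>)
    note B = wbound_0_mult_bounded[OF wboundD(1,2)[OF f] comp_measurable[OF cG wbound_max2_sup(2)[OF b r]] A(2)[OF wbound_max2_sup(1)[OF b r]]]
    have res3: "wsq b (\<lambda>x. G (\<rho> x) * f x)" by (rule B(1))
    have "A * r \<le> (A + C + D * (P * \<bar>M\<bar>)) * r" using C(1) D(1) P(1) r0 by (intro mult_right_mono) auto
    then have res4: "wl2 b (\<lambda>x. G (\<rho> x) * f x) \<le> (A + C + D * (P * \<bar>M\<bar>)) * r" using B(2) by linarith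
    show ?thesis by (rule wbound_SucI[OF res1 res2 res3 res4])
  qed
  moreover have "0 \<le> A + C + D * (P * \<bar>M\<bar>)" using A(1) C(1) D(1) P(1) by simp
  ultimately show ?case by blast
qed

lemma C1_lipschitz:
  assumes G: "C_k (Suc 0) G"
  obtains L where "L \<ge> 0" "\<And>x y. \<bar>x\<bar> \<le> a \<Longrightarrow> \<bar>y\<bar> \<le> a \<Longrightarrow> \<bar>G x - G y\<bar> \<le> L * \<bar>x - y\<bar>"
proof -
  have cG: "continuous_on UNIV (deriv G)" using G by (simp add: C_k_Suc C_k_0)
  obtain L where L: "L \<ge> 0" "\<And>x. \<bar>x\<bar> \<le> a \<Longrightarrow> \<bar>deriv G x\<bar> \<le> L" using continuous_bounded_on_Icc[OF cG] by metis
  have "\<bar>G x - G y\<bar> \<le> L * \<bar>x - y\<bar>" if "\<bar>x\<bar> \<le> a" "\<bar>y\<bar> \<le> a" for x y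
  proof -
    have "norm (G x - G y) \<le> L * norm (x - y)"
      by (rule field_differentiable_bound[of "{-a..a}" G "deriv G"])
         (use that L C_k_derivative[OF G] in \<open>auto intro: has_field_derivative_at_within\<close>)
    then show ?thesis by simp
  qed
  then show ?thesis using that L(1) by blast
qed

text \<open>G(0) = 0 gives |G(\<rho>)| <= L |\<rho>|, so the composite inherits the decay of \<rho>;
  its derivative G'(\<rho>) \<rho>1 decays because \<rho>1 does, whatever the value of G' at
  0.\<close>

lemma wbound_comp:
  assumes b: "b \<ge> 0" and G: "C_k (Suc m) G" and G0: "G 0 = 0"
  shows "\<exists>C\<ge>0. \<forall>\<rho>. wbound b (max m 2) M \<rho> \<longrightarrow> wbound b m C (\<lambda>x. G (\<rho> x))"
proof -
  have G1: "C_k (Suc 0) G" by (rule C_k_lower[OF G]) simp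
  have cG: "continuous_on UNIV G" by (rule C_k_imp_continuous[OF G])
  obtain L where L: "L \<ge> 0" "\<And>x y. \<bar>x\<bar> \<le> 2 * \<bar>M\<bar> \<Longrightarrow> \<bar>y\<bar> \<le> 2 * \<bar>M\<bar> \<Longrightarrow> \<bar>G x - G y\<bar> \<le> L * \<bar>x - y\<bar>" using C1_lipschitz[OF G1] by metis
  have base: "wsq b (\<lambda>x. G (\<rho> x)) \<and> wl2 b (\<lambda>x. G (\<rho> x)) \<le> L * M" if r: "wbound b (max m 2) M \<rho>" for \<rho>
  proof -
    have pt: "AE x in lborel. \<bar>G (\<rho> x)\<bar> \<le> L * \<bar>\<rho> x\<bar>"
    proof (intro AE_I2)
      fix x show "\<bar>G (\<rho> x)\<bar> \<le> L * \<bar>\<rho> x\<bar>"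
        using L(2)[of "\<rho> x" 0] wbound_max2_sup(1)[OF b r, of x] wboundD(3)[OF r] by (simp add: G0)
    qed
    note m = comp_measurable[OF cG wbound_max2_sup(2)[OF b r]]
    have "wl2 b (\<lambda>x. G (\<rho> x)) \<le> L * wl2 b \<rho>" by (rule wl2_bound[OF wboundD(1)[OF r] m pt L(1)])
    also have "\<dots> \<le> L * M" by (rule mult_left_mono[OF wboundD(2)[OF r] L(1)])
    finally show ?thesis using wsq_bound[OF wboundD(1)[OF r] m pt] by simp
  qed
  show ?thesis
  proof (cases m)
    case 0
    have "wbound b m (L * \<bar>M\<bar>) (\<lambda>x. G (\<rho> x))" if "wbound b (max m 2) M \<rho>" for \<rho>
      using base[OF that] wboundD(3)[OF that] 0 by simp
    then show ?thesis using L(1) by (intro exI[of _ "L * \<bar>M\<bar>"] conjI allI impI) (simp, blast)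
  next
    case (Suc j)
    have "C_k j (deriv G)" using C_k_lower[OF G, of "Suc j"] Suc by (simp add: C_k_Suc)
    from wbound_comp_mult[OF b this, of M]
    obtain C where C: "C \<ge> 0" "\<And>\<rho> r f. wbound b (max j 2) M \<rho> \<Longrightarrow> wbound b j r f \<Longrightarrow> wbound b j (C * r) (\<lambda>x. deriv G (\<rho> x) * f x)"
      by blast
    have "wbound b m (L * \<bar>M\<bar> + C * \<bar>M\<bar>) (\<lambda>x. G (\<rho> x))" if r: "wbound b (max m 2) M \<rho>" for \<rho>
    proof -
      have M0: "M \<ge> 0" by (rule wboundD(3)[OF r])
      obtain \<rho>1 where R: "primitive \<rho> \<rho>1" "wbound b j M \<rho>1" "primitive (\<lambda>x. G (\<rho> x)) (\<lambda>x. deriv G (\<rho> x) * \<rho>1 x)"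
        using primitive_comp_wbound[OF G1 r[unfolded Suc]] .
      have res1: "primitive (\<lambda>x. G (\<rho> x)) (\<lambda>x. deriv G (\<rho> x) * \<rho>1 x)" by (rule R(3))
      have rl: "wbound b (max j 2) M \<rho>" by (rule wbound_lower[OF r]) (auto simp: Suc)
      have res2: "wbound b j (L * \<bar>M\<bar> + C * \<bar>M\<bar>) (\<lambda>x. deriv G (\<rho> x) * \<rho>1 x)"
        by (rule wbound_mono_radius[OF C(2)[OF rl R(2)]]) (use L(1) M0 in simp)
      have "0 \<le> C * \<bar>M\<bar>" using C(1) by simp
      then have res3: "wsq b (\<lambda>x. G (\<rho> x))" and res4: "wl2 b (\<lambda>x. G (\<rho> x)) \<le> L * \<bar>M\<bar> + C * \<bar>M\<bar>"
        using base[OF r] M0 by auto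
      show ?thesis unfolding Suc by (rule wbound_SucI[OF res1 res2 res3 res4])
    qed
    then show ?thesis using L(1) C(1) by (intro exI[of _ "L * \<bar>M\<bar> + C * \<bar>M\<bar>"] conjI allI impI) (simp, blast)
  qed
qed

text \<open>Linearity in the radius r of F is the point: it carries the rate 1/n^2 through the
  bootstrap.\<close>

lemma wbound_comp_diff:
  assumes b: "b \<ge> 0" and G: "C_k (Suc m) G"
  shows "\<exists>C\<ge>0. \<forall>S F r. wbound b (m + 2) M S \<longrightarrow> wbound b (max m 2) M F \<longrightarrow> wbound b m r F \<longrightarrow>
     wbound b m (C * r) (\<lambda>x. G (S x + F x) - G (S x))"
  using G
proof (induction m arbitrary: G)
  have base: "\<exists>L\<ge>0. \<forall>S F r. wbound b 2 M S \<longrightarrow> wbound b 2 M F \<longrightarrow> wsq b F \<and> wl2 b F \<le> r \<longrightarrow>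
      wsq b (\<lambda>x. G (S x + F x) - G (S x)) \<and> wl2 b (\<lambda>x. G (S x + F x) - G (S x)) \<le> L * r" if G1: "C_k (Suc 0) G" for G
  proof -
    have cG: "continuous_on UNIV G" by (rule C_k_imp_continuous[OF G1])
    obtain L where L: "L \<ge> 0" "\<And>x y. \<bar>x\<bar> \<le> 4 * M \<Longrightarrow> \<bar>y\<bar> \<le> 4 * M \<Longrightarrow> \<bar>G x - G y\<bar> \<le> L * \<bar>x - y\<bar>" using C1_lipschitz[OF G1] by metis
    have "wsq b (\<lambda>x. G (S x + F x) - G (S x)) \<and> wl2 b (\<lambda>x. G (S x + F x) - G (S x)) \<le> L * r"
      if S: "wbound b 2 M S" and F: "wbound b 2 M F" and r: "wsq b F" "wl2 b F \<le> r" for S F r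
    proof -
      note s = wbound_max2_sup[OF b, of 0 M, simplified]
      have [measurable]: "S \<in> borel_measurable borel" "F \<in> borel_measurable borel" using s(2) S F by auto
      have m: "(\<lambda>x. G (S x + F x) - G (S x)) \<in> borel_measurable borel"
        by (intro borel_measurable_diff comp_measurable[OF cG]) measurable
      have pt: "AE x in lborel. \<bar>G (S x + F x) - G (S x)\<bar> \<le> L * \<bar>F x\<bar>"
      proof (intro AE_I2)
        fix x
        have "\<bar>S x + F x\<bar> \<le> 4 * M" "\<bar>S x\<bar> \<le> 4 * M" using s(1)[OF S, of x] s(1)[OF F, of x] by linarith+
        from L(2)[OF this] show "\<bar>G (S x + F x) - G (S x)\<bar> \<le> L * \<bar>F x\<bar>" by simp
      qed
      have "wl2 b (\<lambda>x. G (S x + F x) - G (S x)) \<le> L * wl2 b F" by (rule wl2_bound[OF r(1) m pt L(1)])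
      also have "\<dots> \<le> L * r" by (rule mult_left_mono[OF r(2) L(1)])
      finally show ?thesis using wsq_bound[OF r(1) m pt] by simp
    qed
    then show ?thesis using L(1) by blast
  qed
  {
    case (0 G)
    obtain L where L: "L \<ge> 0" "\<And>S F r. wbound b 2 M S \<Longrightarrow> wbound b 2 M F \<Longrightarrow> wsq b F \<and> wl2 b F \<le> r \<Longrightarrow>
      wsq b (\<lambda>x. G (S x + F x) - G (S x)) \<and> wl2 b (\<lambda>x. G (S x + F x) - G (S x)) \<le> L * r" using base[OF 0] by blast
    then show ?case by (intro exI[of _ L] conjI allI impI) (use L in \<open>simp_all del: wbound.simps(2) add: numeral_2_eq_2\<close>)
  next
    case (Suc m G)
    have G1: "C_k (Suc 0) G" "C_k (Suc m) (deriv G)" "C_k m (deriv G)"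
      using C_k_lower[OF Suc.prems] Suc.prems by (simp_all add: C_k_Suc[of "Suc m"] C_k_lower[of "Suc m" "deriv G" m])
    obtain L where L: "L \<ge> 0" "\<And>S F r. wbound b 2 M S \<Longrightarrow> wbound b 2 M F \<Longrightarrow> wsq b F \<and> wl2 b F \<le> r \<Longrightarrow>
      wsq b (\<lambda>x. G (S x + F x) - G (S x)) \<and> wl2 b (\<lambda>x. G (S x + F x) - G (S x)) \<le> L * r" using base[OF G1(1)] by blast
    obtain C where C: "C \<ge> 0" "\<And>S F r. wbound b (m + 2) M S \<Longrightarrow> wbound b (max m 2) M F \<Longrightarrow> wbound b m r F \<Longrightarrow>
       wbound b m (C * r) (\<lambda>x. deriv G (S x + F x) - deriv G (S x))" using Suc.IH[OF G1(2)] by blast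
    obtain D where D: "D \<ge> 0" "\<And>\<rho> r f. wbound b (max m 2) (M + M) \<rho> \<Longrightarrow> wbound b m r f \<Longrightarrow> wbound b m (D * r) (\<lambda>x. deriv G (\<rho> x) * f x)"
      using wbound_comp_mult[OF b G1(3), of "M + M"] by blast
    obtain P where P: "P \<ge> 0" "\<And>r s u v. wbound b m r u \<Longrightarrow> wbound b (Suc m) s v \<Longrightarrow> wbound b m (P * (r * s)) (\<lambda>x. v x * u x)"
      using wbound_mult[OF b] by blast
    have "wbound b (Suc m) ((L + D + P * (C * \<bar>M\<bar>)) * r) (\<lambda>x. G (S x + F x) - G (S x))"
      if S: "wbound b (Suc m + 2) M S" and F: "wbound b (max (Suc m) 2) M F" and r: "wbound b (Suc m) r F" for S F r
    proof -
      have r0: "r \<ge> 0" by (rule wboundD(3)[OF r])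
      have M0: "M \<ge> 0" by (rule wboundD(3)[OF S])
      let ?R = "\<lambda>x. S x + F x"
      have Sm: "wbound b (max (Suc m) 2) M S" by (rule wbound_lower[OF S]) auto
      have R: "wbound b (max (Suc m) 2) (M + M) ?R" by (rule wbound_add[OF Sm F])
      obtain R1 where R1: "primitive ?R R1" "primitive (\<lambda>x. G (?R x)) (\<lambda>x. deriv G (?R x) * R1 x)"
        using primitive_comp_wbound[OF G1(1) R] by metis
      obtain S1 where S1a: "primitive S S1" "wbound b (m + 2) M S1"
        using S by (simp only: add_Suc wbound.simps(2)) blast
      have S1: "primitive S S1" "wbound b (Suc m) M S1" using S1a wbound_lower[OF S1a(2), of "Suc m"] by auto
      obtain S1' where S1': "primitive S S1'" "primitive (\<lambda>x. G (S x)) (\<lambda>x. deriv G (S x) * S1' x)"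
        using primitive_comp_wbound[OF G1(1) Sm] by metis
      obtain F1 where F1: "primitive F F1" "wbound b m r F1" using r by auto
      \<comment> \<open>The derivative G'(S + F)(S1 + F1) - G'(S) S1, regrouped so that each term
        contains F1 or a difference of values of G'. The difference falls under the induction
        hypothesis and is multiplied by S1, which has the additional order that the product estimate
        asks for.\<close>
      let ?d = "\<lambda>x. deriv G (?R x) * F1 x + S1 x * (deriv G (?R x) - deriv G (S x))"
      have Rl: "wbound b (max m 2) (M + M) ?R" by (rule wbound_lower[OF R]) auto
      have Sl: "wbound b (m + 2) M S" by (rule wbound_lower[OF S]) auto
      have Fl: "wbound b (max m 2) M F" by (rule wbound_lower[OF F]) auto
      have rl: "wbound b m r F" by (rule wbound_lower[OF r]) auto
      have d: "wbound b m (D * r + P * ((C * r) * M)) ?d"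
        by (intro wbound_add D(2) P(2) C(2) Rl F1(2) Sl Fl rl S1(2))
      then have res2: "wbound b m ((L + D + P * (C * \<bar>M\<bar>)) * r) ?d"
        by (rule wbound_mono_radius) (use L(1) r0 M0 in \<open>simp add: algebra_simps\<close>)
      have "AE x in lborel. deriv G (?R x) * R1 x - deriv G (S x) * S1' x = ?d x"
        using primitive_unique_AE[OF R1(1) primitive_add[OF S1(1) F1(1)]] primitive_unique_AE[OF S1'(1) S1(1)]
        by eventually_elim (simp add: algebra_simps)
      then have res1: "primitive (\<lambda>x. G (?R x) - G (S x)) ?d"
        by (rule primitive_cong_AE[OF primitive_diff[OF R1(2) S1'(2)] wsq_measurable[OF wboundD(1)[OF d]]])
      have S2: "wbound b 2 M S" by (rule wbound_lower[OF S]) auto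
      have F2: "wbound b 2 M F" by (rule wbound_lower[OF F]) auto
      note B = L(2)[OF S2 F2 conjI[OF wboundD(1,2)[OF r]]]
      have res3: "wsq b (\<lambda>x. G (?R x) - G (S x))" using B by simp
      have "L * r \<le> (L + D + P * (C * \<bar>M\<bar>)) * r" using D(1) C(1) P(1) r0 by (intro mult_right_mono) auto
      then have res4: "wl2 b (\<lambda>x. G (?R x) - G (S x)) \<le> (L + D + P * (C * \<bar>M\<bar>)) * r" using B by linarith
      show ?thesis by (rule wbound_SucI[OF res1 res2 res3 res4])
    qed
    moreover have "0 \<le> L + D + P * (C * \<bar>M\<bar>)" using L(1) D(1) P(1) C(1) by simp
    ultimately show ?case by blast
  }
qed

section \<open>The fixed point problem\<close>

lemma wl2_eq_0D:
  assumes "wsq b f" "wl2 b f = 0"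
  shows "AE x in lborel. f x = 0"
proof -
  have "AE x in lborel. cosh x powr b * f x = 0"
    using assms by (intro l2_norm_eq_0D) (auto simp: wsq_def wl2_def)
  then show ?thesis
    by eventually_elim (use cosh_real_pos in \<open>auto simp: less_imp_neq[THEN not_sym]\<close>)
qed

lemma wl2_diff_commute: "wl2 b (\<lambda>x. f x - g x) = wl2 b (\<lambda>x. g x - f x)"
  unfolding wl2_def right_diff_distrib by (rule l2_norm_diff_commute)

lemma wl2_triangle3:
  assumes "wsq b f" "wsq b g" "wsq b h"
  shows "wl2 b (\<lambda>x. f x - h x) \<le> wl2 b (\<lambda>x. f x - g x) + wl2 b (\<lambda>x. g x - h x)"
  using wl2_triangle[OF wsq_diff[OF assms(1,2)] wsq_diff[OF assms(2,3)]] by simp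

lemma wsq_geometric_limit:
  assumes g: "\<And>k. wsq b (g k)" and step: "\<And>k. wl2 b (\<lambda>x. g (Suc k) x - g k x) \<le> w * (1/2) ^ k" and w: "w \<ge> 0"
  obtains h where "wsq b h" "(\<lambda>k. wl2 b (\<lambda>x. g k x - h x)) \<longlonglongrightarrow> 0"
proof -
  \<comment> \<open>The factor 1 - 2^-j is kept because with it the geometric sum closes the
    induction exactly.\<close>
  have tail: "wl2 b (\<lambda>x. g (n + j) x - g n x) \<le> 2 * w * (1/2) ^ n * (1 - (1/2) ^ j)" for n j
  proof (induction j)
    case 0
    then show ?case by (simp add: wl2_def)
  next
    case (Suc j)
    have "wl2 b (\<lambda>x. g (n + Suc j) x - g n x) \<le> wl2 b (\<lambda>x. g (Suc (n + j)) x - g (n + j) x) + wl2 b (\<lambda>x. g (n + j) x - g n x)"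
      using wl2_triangle3[OF g[of "Suc (n + j)"] g[of "n + j"] g[of n]] by simp
    also have "\<dots> \<le> w * (1/2) ^ (n + j) + 2 * w * (1/2) ^ n * (1 - (1/2) ^ j)"
      by (intro add_mono step Suc.IH)
    also have "\<dots> = 2 * w * (1/2) ^ n * (1 - (1/2) ^ Suc j)" by (simp add: power_add algebra_simps)
    finally show ?case .
  qed
  have tail': "wl2 b (\<lambda>x. g m x - g n x) \<le> 2 * w * (1/2) ^ n" if "n \<le> m" for m n
  proof -
    have "2 * w * (1/2) ^ n * (1 - (1/2) ^ (m - n)) \<le> 2 * w * (1/2) ^ n * 1"
      using w by (intro mult_left_mono) auto
    then show ?thesis using tail[of n "m - n"] that by simp
  qed
  obtain H where H: "square_integrable H" "(\<lambda>n. l2_norm (\<lambda>x. cosh x powr b * g n x - H x)) \<longlonglongrightarrow> 0"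
  proof (rule l2_complete[of "\<lambda>n x. cosh x powr b * g n x"])
    show "square_integrable (\<lambda>x. cosh x powr b * g n x)" for n using g by (simp add: wsq_def)
    fix e :: real assume e: "e > 0"
    have "(\<lambda>n. 2 * w * (1/2) ^ n) \<longlonglongrightarrow> 2 * w * 0" by (intro tendsto_intros LIMSEQ_power_zero) simp
    then have "\<forall>\<^sub>F n in sequentially. dist (2 * w * (1/2) ^ n) 0 < e" using e by (intro tendstoD) auto
    then obtain N where N: "2 * w * (1/2) ^ N < e" using w by (auto simp: eventually_sequentially)
    have small: "2 * w * (1/2) ^ n < e" if "n \<ge> N" for n
    proof -
      have "2 * w * (1/2) ^ n \<le> 2 * w * (1/2) ^ N" using w that by (intro mult_left_mono power_decreasing) auto
      then show ?thesis using N by linarith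
    qed
    show "\<exists>N. \<forall>m\<ge>N. \<forall>n\<ge>N. l2_norm (\<lambda>x. cosh x powr b * g m x - cosh x powr b * g n x) < e"
    proof (intro exI allI impI)
      fix m n assume mn: "N \<le> m" "N \<le> n"
      have "wl2 b (\<lambda>x. g m x - g n x) < e"
      proof (cases "n \<le> m")
        case True
        then show ?thesis using tail'[OF True] small[OF mn(2)] by linarith
      next
        case False
        then show ?thesis using tail'[of m n] small[OF mn(1)] wl2_diff_commute[of b "g m" "g n"] by linarith
      qed
      then show "l2_norm (\<lambda>x. cosh x powr b * g m x - cosh x powr b * g n x) < e"
        by (simp add: wl2_def right_diff_distrib)
    qed
  qed
  have eq: "cosh x powr b * (cosh x powr (- b) * H x) = H x" for x unfolding cosh_powr_mult by simp
  show ?thesis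
  proof (rule that[of "\<lambda>x. cosh x powr (- b) * H x"])
    show "wsq b (\<lambda>x. cosh x powr (- b) * H x)" using H(1) by (simp add: wsq_def eq)
    show "(\<lambda>k. wl2 b (\<lambda>x. g k x - cosh x powr (- b) * H x)) \<longlonglongrightarrow> 0"
      using H(2) by (simp add: wl2_def right_diff_distrib eq)
  qed
qed

lemma wsq_reflect: "wsq b f \<Longrightarrow> wsq b (\<lambda>x. f (- x))"
  unfolding wsq_def using square_integrable_reflect[of "\<lambda>x. cosh x powr b * f x"] by simp

lemma wl2_reflect: "wl2 b (\<lambda>x. f (- x)) = wl2 b f"
  using lborel_integral_real_affine[of "-1" "\<lambda>x. (cosh x powr b * f x)\<^sup>2" 0] by (simp add: wl2_def l2_norm_def)

lemma eq_0_if_le_tendsto_0: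
  fixes a :: real
  assumes "a \<ge> 0" "\<And>k. a \<le> u k" "u \<longlonglongrightarrow> 0"
  shows "a = 0"
  using LIMSEQ_le_const[OF assms(3), of a] assms(1,2) by force

text \<open>Both side conditions are continuous in the weighted norm: the defect h(-x) - h(x) is
  bounded by twice the distance to the even function g k, and the mean by that distance times the
  norm of cosh^(-b), through Cauchy-Schwarz.\<close>

lemma rhs_fun_limit:
  assumes b: "b > 0" and g: "\<And>k. rhs_fun b (g k)" and h: "wsq b h" and lim: "(\<lambda>k. wl2 b (\<lambda>x. g k x - h x)) \<longlonglongrightarrow> 0"
  shows "rhs_fun b h"
proof -
  have gw: "wsq b (g k)" for k using g by (simp add: rhs_fun_def)
  have even: "wl2 b (\<lambda>x. h (- x) - h x) = 0"
  proof (rule eq_0_if_le_tendsto_0)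
    show "(\<lambda>k. 2 * wl2 b (\<lambda>x. g k x - h x)) \<longlonglongrightarrow> 0" using tendsto_mult[OF tendsto_const lim, of 2] by simp
    fix k
    have ev: "AE x in lborel. g k x - h x = g k (- x) - h x"
      using g[of k] unfolding rhs_fun_def ae_even_def by (auto elim!: eventually_mono)
    have "wl2 b (\<lambda>x. h (- x) - h x) \<le> wl2 b (\<lambda>x. h (- x) - g k (- x)) + wl2 b (\<lambda>x. g k (- x) - h x)"
      by (intro wl2_triangle3 wsq_reflect h gw)
    also have "wl2 b (\<lambda>x. h (- x) - g k (- x)) = wl2 b (\<lambda>x. g k x - h x)"
      using wl2_reflect[of b "\<lambda>x. h x - g k x"] by (simp add: wl2_diff_commute)
    also have "wl2 b (\<lambda>x. g k (- x) - h x) = wl2 b (\<lambda>x. g k x - h x)"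
      by (rule wl2_cong_AE[symmetric])
         (use ev wsq_measurable[OF wsq_diff[OF gw h]] wsq_measurable[OF wsq_diff[OF wsq_reflect[OF gw] h]] in auto)
    finally show "wl2 b (\<lambda>x. h (- x) - h x) \<le> 2 * wl2 b (\<lambda>x. g k x - h x)" by simp
  qed simp
  have "AE x in lborel. h (- x) - h x = 0" by (rule wl2_eq_0D[OF wsq_diff[OF wsq_reflect[OF h] h] even])
  then have "ae_even h" unfolding ae_even_def by eventually_elim simp
  moreover have "\<bar>LINT x|lborel. h x\<bar> = 0"
  proof (rule eq_0_if_le_tendsto_0)
    let ?C = "l2_norm (\<lambda>x::real. cosh x powr (- b))"
    show "(\<lambda>k. ?C * wl2 b (\<lambda>x. g k x - h x)) \<longlonglongrightarrow> 0" using tendsto_mult[OF tendsto_const lim, of ?C] by simp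
    fix k
    have d: "wsq b (\<lambda>x. g k x - h x)" by (rule wsq_diff[OF gw h])
    have "\<bar>LINT x|lborel. h x\<bar> = \<bar>LINT x|lborel. g k x - h x\<bar>"
      using g[of k] wsq_integrable[OF h b] wsq_integrable[OF gw b] by (simp add: rhs_fun_def)
    also have "\<dots> = \<bar>LINT x|lborel. cosh x powr (- b) * (cosh x powr b * (g k x - h x))\<bar>"
      unfolding cosh_powr_mult by simp
    also have "\<dots> \<le> (LINT x|lborel. norm (cosh x powr (- b)) * norm (cosh x powr b * (g k x - h x)))"
      by (rule order_trans[OF integral_abs_bound]) (simp add: abs_mult)
    also have "\<dots> \<le> ?C * wl2 b (\<lambda>x. g k x - h x)"
      unfolding wl2_def by (rule l2_cauchy_schwarz[OF square_integrable_cosh_powr[OF b] d[unfolded wsq_def]])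
    finally show "\<bar>LINT x|lborel. h x\<bar> \<le> ?C * wl2 b (\<lambda>x. g k x - h x)" .
  qed simp
  ultimately show ?thesis using h by (simp add: rhs_fun_def)
qed

lemma rhs_fun_diff:
  assumes "rhs_fun b f" "rhs_fun b g" "b > 0"
  shows "rhs_fun b (\<lambda>x. f x - g x)"
proof -
  have "ae_even (\<lambda>x. f x - g x)"
    using assms(1,2) unfolding rhs_fun_def ae_even_def by (auto elim: eventually_elim2)
  then show ?thesis using assms wsq_integrable[of b f] wsq_integrable[of b g] by (simp add: rhs_fun_def wsq_diff)
qed

lemma lin_eq_cong_AE:
  assumes "lin_eq V c S F g" "AE x in lborel. g x = h x"
  shows "lin_eq V c S F h"
proof -
  obtain F1 F2 where F: "primitive F F1" "primitive F1 F2"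
    "AE x in lborel. c\<^sup>2 * F2 x - delta (delta (\<lambda>y. deriv (deriv V) (S y) * F y)) x = g x"
    using assms by (auto simp: lin_eq_def)
  have "AE x in lborel. c\<^sup>2 * F2 x - delta (delta (\<lambda>y. deriv (deriv V) (S y) * F y)) x = h x"
    using F(3) assms(2) by eventually_elim simp
  then show ?thesis using F by (auto simp: lin_eq_def)
qed

text \<open>What the nonlinear argument takes from admissibility: an even continuous profile S with
  its equation, and the inverse of the linearization in the form of existence with a bound and an a
  priori estimate. The topology on classes no longer appears.\<close>

locale wave_setup =
  fixes V :: "real \<Rightarrow> real" and c \<beta> \<kappa> :: real and S :: "real \<Rightarrow> real" and K M :: real
  assumes V5: "C_k 5 V" and V0: "deriv V 0 = 0" and c: "c \<noteq> 0" and \<beta>: "\<beta> > 0" and \<kappa>: "\<kappa> > 0"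
    and S_even: "\<And>x. S (- x) = S x" and S_bound: "wbound \<beta> 2 M S"
    and S_eq: "\<exists>S1 S2. primitive S S1 \<and> primitive S1 S2 \<and> (AE x in lborel. c\<^sup>2 * S2 x = delta (delta (\<lambda>y. deriv V (S y))) x)"
    and K: "K \<ge> 0"
    and inv_ex: "\<And>g. rhs_fun \<beta> g \<Longrightarrow> \<exists>F. (\<forall>x. F (- x) = F x) \<and> wbound \<beta> 2 (K * wl2 \<beta> g) F \<and> lin_eq V c S F g"
    and inv_est: "\<And>F r g. (\<And>x. F (- x) = F x) \<Longrightarrow> wbound \<beta> 2 r F \<Longrightarrow> lin_eq V c S F g \<Longrightarrow> rhs_fun \<beta> g \<Longrightarrow>
        wbound \<beta> 2 (K * wl2 \<beta> g) F"
begin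

abbreviation "G \<equiv> deriv V"

definition Q :: "(real \<Rightarrow> real) \<Rightarrow> real \<Rightarrow> real" where
  "Q F y = G (S y + F y) - G (S y) - deriv G (S y) * F y"

text \<open>With S + F inserted, the equation of S subtracted and the second component eliminated,
  the part linear in F goes to the left side. The rest is this: the Taylor remainder
  \<open>Q F\<close> and the coupling \<kappa> delta rho2.\<close>

definition Phi :: "nat \<Rightarrow> (real \<Rightarrow> real) \<Rightarrow> real \<Rightarrow> real" where
  "Phi n F x = delta (delta (Q F)) x - \<kappa> / c\<^sup>2 * delta (resolvent n (\<lambda>y. G (S y + F y))) x"

lemma b0: "\<beta> \<ge> 0" using \<beta> by simp

lemma G4: "C_k 4 G" and G1_3: "C_k 3 (deriv G)"
  using V5 by (auto simp: C_k_Suc eval_nat_numeral)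

lemma Gk: "j \<le> 4 \<Longrightarrow> C_k j G" and G1k: "j \<le> 3 \<Longrightarrow> C_k j (deriv G)"
  using C_k_lower[OF G4] C_k_lower[OF G1_3] by auto

lemma M0: "M \<ge> 0" by (rule wboundD(3)[OF S_bound])

lemma bound2_sup:
  assumes "wbound \<beta> 2 r F"
  shows "\<bar>F x\<bar> \<le> 2 * r"
  using wbound_sup[OF b0, of 1 r F x] assms by (simp add: numeral_2_eq_2)

lemma bound2_continuous: "wbound \<beta> 2 r F \<Longrightarrow> continuous_on UNIV F"
  using wbound_continuous[of \<beta> 1 r F] by (simp add: numeral_2_eq_2)

lemma comp_bound:
  assumes "j \<le> 2"
  obtains C where "C \<ge> 0" "\<And>F. wbound \<beta> 2 r F \<Longrightarrow> wbound \<beta> j C (\<lambda>y. G (S y + F y))"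
proof -
  have "max j 2 = 2" using assms by auto
  then obtain C where C: "C \<ge> 0" "\<And>\<rho>. wbound \<beta> 2 (M + r) \<rho> \<Longrightarrow> wbound \<beta> j C (\<lambda>x. G (\<rho> x))"
    using wbound_comp[OF b0 Gk V0, of j "M + r"] assms by auto
  show ?thesis by (rule that[OF C(1)]) (intro C(2) wbound_add S_bound)
qed

lemma continuous_comp:
  assumes "wbound \<beta> 2 r F"
  shows "continuous_on UNIV (\<lambda>y. G (S y + F y))"
  by (intro continuous_on_compose2[OF C_k_imp_continuous[OF G4]] continuous_on_add bound2_continuous[OF S_bound] bound2_continuous[OF assms]) auto

lemma wsq_Q:
  assumes F: "wbound \<beta> 2 r F"
  shows "wsq \<beta> (Q F)"
proof -
  have 0: "wbound \<beta> 2 0 (\<lambda>x. 0)" by (rule wbound_zero)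
  obtain C where C: "\<And>F. wbound \<beta> 2 r F \<Longrightarrow> wbound \<beta> 0 C (\<lambda>y. G (S y + F y))" using comp_bound[of 0 r] by auto
  obtain D where D: "\<And>F. wbound \<beta> 2 0 F \<Longrightarrow> wbound \<beta> 0 D (\<lambda>y. G (S y + F y))" using comp_bound[of 0 0] by auto
  obtain E where E: "\<And>\<rho> r f. wbound \<beta> 2 M \<rho> \<Longrightarrow> wbound \<beta> 0 r f \<Longrightarrow> wbound \<beta> 0 (E * r) (\<lambda>x. deriv G (\<rho> x) * f x)"
    using wbound_comp_mult[OF b0 G1k, of 0 M] by auto
  have F0: "wbound \<beta> 0 r F" by (rule wbound_lower[OF F]) simp
  have "wbound \<beta> 0 (C + D + E * r) (\<lambda>y. G (S y + F y) - G (S y) - deriv G (S y) * F y)"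
    using wbound_diff[OF wbound_diff[OF C[OF F] D[OF 0]] E[OF S_bound F0]] by simp
  then show ?thesis by (simp add: Q_def[abs_def])
qed

lemma wsq_comp: "wbound \<beta> 2 r F \<Longrightarrow> wsq \<beta> (\<lambda>y. G (S y + F y))"
  using comp_bound[of 0 r] by (metis wboundD(1) zero_le)

lemma wsq_resolvent:
  assumes "wsq \<beta> g" "n \<ge> 1"
  shows "wsq \<beta> (resolvent n g)" "wl2 \<beta> (resolvent n g) \<le> exp \<beta> * wl2 \<beta> g / real n"
  using wbound_resolvent[OF b0 assms(2), of 0 "wl2 \<beta> g" g] assms(1) by auto

text \<open>\<open>delta\<close> and \<open>resolvent\<close> each reverse parity, and each term
  applies two of them to an even function; the outermost \<open>delta\<close> makes the mean
  vanish.\<close>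

lemma Phi_rhs:
  assumes ev: "\<And>x. F (- x) = F x" and F: "wbound \<beta> 2 r F" and n: "n \<ge> 1"
  shows "rhs_fun \<beta> (Phi n F)"
proof -
  let ?R = "resolvent n (\<lambda>y. G (S y + F y))"
  have q: "wsq \<beta> (delta (Q F))" by (rule wsq_delta[OF b0 wsq_Q[OF F]])
  have R: "wsq \<beta> ?R" by (rule wsq_resolvent[OF wsq_comp[OF F] n])
  have w: "wsq \<beta> (Phi n F)"
    unfolding Phi_def[abs_def] by (intro wsq_diff wsq_cmult wsq_delta b0 q R)
  have "delta (Q F) (- x) = - delta (Q F) x" for x by (rule delta_odd) (simp add: Q_def S_even ev)
  then have 1: "delta (delta (Q F)) (- x) = delta (delta (Q F)) x" for x by (rule delta_even)
  have "?R (- x) = - ?R x" for x by (rule resolvent_odd) (simp add: S_even ev)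
  then have 2: "delta ?R (- x) = delta ?R x" for x by (rule delta_even)
  have e: "ae_even (Phi n F)" by (simp add: ae_even_def Phi_def 1 2)
  have "(LINT x|lborel. Phi n F x) = (LINT x|lborel. delta (delta (Q F)) x) - \<kappa> / c\<^sup>2 * (LINT x|lborel. delta ?R x)"
    unfolding Phi_def
    using wsq_integrable[OF wsq_delta(1)[OF b0 q] \<beta>] wsq_integrable[OF wsq_delta(1)[OF b0 R] \<beta>] by simp
  also have "\<dots> = 0"
    using integral_delta[OF wsq_integrable[OF q \<beta>]] integral_delta[OF wsq_integrable[OF R \<beta>]] by simp
  finally show ?thesis using w e by (simp add: rhs_fun_def)
qed

lemma Phi_diff:
  assumes F: "wbound \<beta> 2 r F" and F': "wbound \<beta> 2 r' F'"
  shows "Phi n F x - Phi n F' x = delta (delta (\<lambda>y. Q F y - Q F' y)) x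
    - \<kappa> / c\<^sup>2 * delta (resolvent n (\<lambda>y. G (S y + F y) - G (S y + F' y))) x"
proof -
  have "resolvent n (\<lambda>y. G (S y + F y) - G (S y + F' y)) = (\<lambda>x. resolvent n (\<lambda>y. G (S y + F y)) x - resolvent n (\<lambda>y. G (S y + F' y)) x)"
    by (intro ext resolvent_diff continuous_locally_integrable continuous_comp[OF F] continuous_comp[OF F'])
  then show ?thesis by (simp add: Phi_def delta_diff right_diff_distrib)
qed

text \<open>Measured in weighted L^2, the remainder contributes the sup norm \<rho> and the
  resolvent its factor 1/n. The constant is independent of the H^2 radii r and r'.\<close>

lemma Phi_lipschitz:
  obtains L where "L \<ge> 0" "\<And>n \<rho> r r' F F'. n \<ge> 1 \<Longrightarrow> \<rho> \<le> 1 \<Longrightarrow> wbound \<beta> 2 r F \<Longrightarrow> wbound \<beta> 2 r' F' \<Longrightarrow>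
     (\<And>x. \<bar>F x\<bar> \<le> \<rho>) \<Longrightarrow> (\<And>x. \<bar>F' x\<bar> \<le> \<rho>) \<Longrightarrow>
     wl2 \<beta> (\<lambda>x. Phi n F x - Phi n F' x) \<le> L * (\<rho> + 1 / real n) * wl2 \<beta> (\<lambda>x. F x - F' x)"
proof -
  \<comment> \<open>S is bounded by 2M and F by \<rho> <= 1, so all arguments of G lie in this
    range.\<close>
  let ?a = "2 * M + 1"
  obtain A where A: "A \<ge> 0" "\<And>x y. \<bar>x\<bar> \<le> ?a \<Longrightarrow> \<bar>y\<bar> \<le> ?a \<Longrightarrow> \<bar>G x - G y\<bar> \<le> A * \<bar>x - y\<bar>"
    using C1_lipschitz[OF Gk, of ?a] by auto
  obtain B where B: "B \<ge> 0" "\<And>x y. \<bar>x\<bar> \<le> ?a \<Longrightarrow> \<bar>y\<bar> \<le> ?a \<Longrightarrow> \<bar>deriv G x - deriv G y\<bar> \<le> B * \<bar>x - y\<bar>"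
    using C1_lipschitz[OF G1k, of ?a] by auto
  let ?k = "\<kappa> / c\<^sup>2"
  have k: "?k \<ge> 0" using \<kappa> by simp
  define L where "L = 4 * exp \<beta> * exp \<beta> * B + ?k * (2 * exp \<beta> * (exp \<beta> * A))"
  have "wl2 \<beta> (\<lambda>x. Phi n F x - Phi n F' x) \<le> L * (\<rho> + 1 / real n) * wl2 \<beta> (\<lambda>x. F x - F' x)"
    if n: "n \<ge> 1" and \<rho>: "\<rho> \<le> 1" and F: "wbound \<beta> 2 r F" and F': "wbound \<beta> 2 r' F'"
      and s: "\<And>x. \<bar>F x\<bar> \<le> \<rho>" and s': "\<And>x. \<bar>F' x\<bar> \<le> \<rho>" for n \<rho> r r' F F'
  proof -
    let ?d = "\<lambda>x. F x - F' x" and ?q = "\<lambda>y. Q F y - Q F' y" and ?g = "\<lambda>y. G (S y + F y) - G (S y + F' y)"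
    define D where "D = wl2 \<beta> ?d"
    have D0: "D \<ge> 0" by (simp add: D_def)
    have \<rho>0: "\<rho> \<ge> 0" using s[of 0] by linarith
    have d: "wsq \<beta> ?d" by (intro wsq_diff wboundD(1)[OF F] wboundD(1)[OF F'])
    have q: "wsq \<beta> ?q" by (intro wsq_diff wsq_Q[OF F] wsq_Q[OF F'])
    have g: "wsq \<beta> ?g" by (intro wsq_diff wsq_comp[OF F] wsq_comp[OF F'])
    have Sx: "\<bar>S x\<bar> \<le> 2 * M" for x by (rule bound2_sup[OF S_bound])
    have "\<bar>?q x\<bar> \<le> B * \<rho> * \<bar>?d x\<bar>" for x
    proof -
      \<comment> \<open>Mean value inequality for t -> G(S + t) - G'(S) t, whose derivative G'(S +
        t) - G'(S) is at most B \<rho> for |t| <= \<rho>. This is the quadratic smallness of the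
        remainder.\<close>
      have "norm ((\<lambda>t. G (S x + t) - deriv G (S x) * t) (F x) - (\<lambda>t. G (S x + t) - deriv G (S x) * t) (F' x)) \<le> B * \<rho> * norm (F x - F' x)"
      proof (rule field_differentiable_bound[of "{-\<rho>..\<rho>}" _ "\<lambda>t. deriv G (S x + t) - deriv G (S x)"])
        fix t assume t: "t \<in> {-\<rho>..\<rho>}"
        have "((\<lambda>t. G (S x + t)) has_real_derivative deriv G (S x + t) * 1) (at t)"
          by (rule DERIV_chain2[OF C_k_derivative[OF Gk[of "Suc 0"]]]) (auto intro!: derivative_eq_intros)
        then have "((\<lambda>t. G (S x + t) - deriv G (S x) * t) has_real_derivative deriv G (S x + t) - deriv G (S x)) (at t)"
          by (auto intro!: derivative_eq_intros)
        then show "((\<lambda>t. G (S x + t) - deriv G (S x) * t) has_field_derivative deriv G (S x + t) - deriv G (S x)) (at t within {-\<rho>..\<rho>})"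
          by (rule has_field_derivative_at_within)
        have "\<bar>S x + t\<bar> \<le> ?a" "\<bar>S x\<bar> \<le> ?a" using t Sx[of x] \<rho> by auto
        from B(2)[OF this] have "\<bar>deriv G (S x + t) - deriv G (S x)\<bar> \<le> B * \<bar>t\<bar>" by simp
        also have "\<dots> \<le> B * \<rho>" using t by (intro mult_left_mono B(1)) auto
        finally show "norm (deriv G (S x + t) - deriv G (S x)) \<le> B * \<rho>" by simp
      qed (use s[of x] s'[of x] in \<open>auto simp: abs_le_iff\<close>)
      then show ?thesis by (simp add: Q_def algebra_simps)
    qed
    then have qb: "wl2 \<beta> ?q \<le> B * \<rho> * D"
      unfolding D_def using B(1) \<rho>0 by (intro wl2_bound[OF d wsq_measurable[OF q]]) auto
    have "\<bar>?g x\<bar> \<le> A * \<bar>?d x\<bar>" for x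
    proof -
      have "\<bar>S x + F x\<bar> \<le> ?a" "\<bar>S x + F' x\<bar> \<le> ?a" using s[of x] s'[of x] Sx[of x] \<rho> by auto
      from A(2)[OF this] show ?thesis by simp
    qed
    then have gb: "wl2 \<beta> ?g \<le> A * D"
      unfolding D_def using A(1) by (intro wl2_bound[OF d wsq_measurable[OF g]]) auto
    note dq = wsq_delta[OF b0 q] and rg = wsq_resolvent[OF g n]
    note ddq = wsq_delta[OF b0 dq(1)] and drg = wsq_delta[OF b0 rg(1)]
    have "wl2 \<beta> (\<lambda>x. Phi n F x - Phi n F' x) \<le> wl2 \<beta> (delta (delta ?q)) + wl2 \<beta> (\<lambda>x. ?k * delta (resolvent n ?g) x)"
      unfolding Phi_diff[OF F F'] by (intro wl2_triangle_diff ddq(1) wsq_cmult drg(1))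
    also have "wl2 \<beta> (\<lambda>x. ?k * delta (resolvent n ?g) x) = ?k * wl2 \<beta> (delta (resolvent n ?g))"
      unfolding wl2_cmult using k by (simp only: abs_of_nonneg)
    also have "wl2 \<beta> (delta (delta ?q)) \<le> 2 * exp \<beta> * (2 * exp \<beta> * (B * \<rho> * D))"
      using ddq(2) dq(2) qb by (meson mult_left_mono order_trans exp_ge_zero mult_nonneg_nonneg zero_le_numeral)
    also have "wl2 \<beta> (delta (resolvent n ?g)) \<le> 2 * exp \<beta> * (exp \<beta> * (A * D) / real n)"
    proof -
      have "exp \<beta> * wl2 \<beta> ?g / real n \<le> exp \<beta> * (A * D) / real n" using gb by (intro divide_right_mono mult_left_mono) auto
      then have "wl2 \<beta> (resolvent n ?g) \<le> exp \<beta> * (A * D) / real n" using rg(2) by linarith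
      then have "2 * exp \<beta> * wl2 \<beta> (resolvent n ?g) \<le> 2 * exp \<beta> * (exp \<beta> * (A * D) / real n)" by (intro mult_left_mono) auto
      then show ?thesis using drg(2) by linarith
    qed
    finally have "wl2 \<beta> (\<lambda>x. Phi n F x - Phi n F' x) \<le> 2 * exp \<beta> * (2 * exp \<beta> * (B * \<rho> * D)) + ?k * (2 * exp \<beta> * (exp \<beta> * (A * D) / real n))"
      using k by (smt (verit) mult_left_mono)
    also have "\<dots> = (4 * exp \<beta> * exp \<beta> * B) * (\<rho> * D) + (?k * (2 * exp \<beta> * (exp \<beta> * A))) * (1 / real n * D)" by (simp add: mult_ac)
    also have "\<dots> \<le> L * (\<rho> * D) + L * (1 / real n * D)"
    proof -
      have "0 \<le> 4 * exp \<beta> * exp \<beta> * B" using B(1) by simp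
      moreover have "0 \<le> ?k * (2 * exp \<beta> * (exp \<beta> * A))" by (intro mult_nonneg_nonneg k) (use A(1) in auto)
      ultimately have "4 * exp \<beta> * exp \<beta> * B \<le> L" "?k * (2 * exp \<beta> * (exp \<beta> * A)) \<le> L" unfolding L_def by linarith+
      then show ?thesis using \<rho>0 D0 by (intro add_mono mult_right_mono) auto
    qed
    also have "\<dots> = L * (\<rho> + 1 / real n) * D" by (simp add: algebra_simps)
    finally show ?thesis by (simp add: D_def)
  qed
  moreover have "L \<ge> 0" unfolding L_def by (intro add_nonneg_nonneg mult_nonneg_nonneg k) (use A(1) B(1) in auto)
  ultimately show ?thesis using that by blast
qed

text \<open>At F = 0 the remainder vanishes and G(S) has a derivative in weighted L^2 to spend, so
  the smoothing estimate gives 1/n^2, whereas the Lipschitz estimate uses only the factor 1/n of the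
  resolvent.\<close>

lemma Phi_zero:
  obtains L where "L \<ge> 0" "\<And>n. n \<ge> 1 \<Longrightarrow> wl2 \<beta> (Phi n (\<lambda>x. 0)) \<le> L / (real n)\<^sup>2"
proof -
  obtain C where C: "C \<ge> 0" "\<And>F. wbound \<beta> 2 0 F \<Longrightarrow> wbound \<beta> 1 C (\<lambda>y. G (S y + F y))" using comp_bound[of 1 0] by auto
  let ?g = "\<lambda>y. G (S y + 0)"
  have g: "wbound \<beta> (Suc 0) C ?g" using C(2)[OF wbound_zero] by simp
  let ?k = "\<kappa> / c\<^sup>2"
  have k: "?k \<ge> 0" using \<kappa> by simp
  have "wl2 \<beta> (Phi n (\<lambda>x. 0)) \<le> (?k * (2 * exp \<beta> * (3 * exp \<beta> * C))) / (real n)\<^sup>2" if n: "n \<ge> 1" for n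
  proof -
    have "wbound \<beta> 0 (\<bar>- ?k\<bar> * (2 * exp \<beta> * (3 * exp \<beta> * C / (real n)\<^sup>2))) (\<lambda>x. - ?k * delta (resolvent n ?g) x)"
      by (intro wbound_cmult wbound_delta wbound_resolvent_smoothing b0 n g)
    moreover have "Q (\<lambda>x. 0) = (\<lambda>x. 0)" by (simp add: Q_def[abs_def])
    then have "Phi n (\<lambda>x. 0) = (\<lambda>x. - ?k * delta (resolvent n ?g) x)" by (simp add: Phi_def[abs_def])
    ultimately have "wl2 \<beta> (Phi n (\<lambda>x. 0)) \<le> \<bar>- ?k\<bar> * (2 * exp \<beta> * (3 * exp \<beta> * C / (real n)\<^sup>2))" using wboundD(2) by metis
    then show ?thesis unfolding abs_minus_cancel abs_of_nonneg[OF k] by (simp add: mult_ac)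
  qed
  moreover have "?k * (2 * exp \<beta> * (3 * exp \<beta> * C)) \<ge> 0" by (intro mult_nonneg_nonneg k) (use C(1) in auto)
  ultimately show ?thesis using that by blast
qed

lemma inv_est_diff:
  assumes n: "n \<ge> 1" and F: "\<And>x. F (- x) = F x" "wbound \<beta> 2 r F" "lin_eq V c S F g" "rhs_fun \<beta> g"
    and F': "\<And>x. F' (- x) = F' x" "wbound \<beta> 2 r' F'" "lin_eq V c S F' g'" "rhs_fun \<beta> g'"
  shows "wl2 \<beta> (\<lambda>x. F x - F' x) \<le> K * wl2 \<beta> (\<lambda>x. g x - g' x)"
  by (rule wboundD(2)[OF inv_est])
     (use F F' in \<open>auto intro!: lin_eq_diff rhs_fun_diff \<beta> wbound_diff\<close>)

text \<open>The iteration that solves the linear equation with right-hand side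
  \<open>Phi n (F k)\<close> is followed through these right-hand sides g k, which are Cauchy in
  weighted L^2. Their limit h is again a valid right-hand side, \<open>H\<close> solves the linear
  equation for it, and only then h = \<open>Phi n H\<close> is verified; completeness of H^2 balls
  does not enter.\<close>

lemma Phi_fixed_point:
  obtains C N where "C \<ge> 0" "N \<ge> (1::nat)"
    "\<And>n. n \<ge> N \<Longrightarrow> \<exists>F. (\<forall>x. F (- x) = F x) \<and> wbound \<beta> 2 (C / (real n)\<^sup>2) F \<and> lin_eq V c S F (Phi n F)"
proof -
  obtain L where L: "L \<ge> 0" "\<And>n \<rho> r r' F F'. n \<ge> 1 \<Longrightarrow> \<rho> \<le> 1 \<Longrightarrow> wbound \<beta> 2 r F \<Longrightarrow> wbound \<beta> 2 r' F' \<Longrightarrow>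
     (\<And>x. \<bar>F x\<bar> \<le> \<rho>) \<Longrightarrow> (\<And>x. \<bar>F' x\<bar> \<le> \<rho>) \<Longrightarrow>
     wl2 \<beta> (\<lambda>x. Phi n F x - Phi n F' x) \<le> L * (\<rho> + 1 / real n) * wl2 \<beta> (\<lambda>x. F x - F' x)"
    by (rule Phi_lipschitz) blast
  obtain L0 where L0: "L0 \<ge> 0" "\<And>n. n \<ge> 1 \<Longrightarrow> wl2 \<beta> (Phi n (\<lambda>x. 0)) \<le> L0 / (real n)\<^sup>2" using Phi_zero by metis
  \<comment> \<open>The second threshold gives \<rho> <= 1, as the Lipschitz estimate demands; the
    third gives K q <= 1/2, the contraction.\<close>
  obtain N where N: "real N \<ge> max 1 (max (4 * K * L0) (2 * K * L * (4 * K * L0 + 1)))" using real_arch_simple by blast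
  have "\<exists>F. (\<forall>x. F (- x) = F x) \<and> wbound \<beta> 2 ((2 * K * L0) / (real n)\<^sup>2) F \<and> lin_eq V c S F (Phi n F)" if nN: "n \<ge> N" for n
  proof -
    have rn: "real n \<ge> 1" "real n \<ge> 4 * K * L0" "real n \<ge> 2 * K * L * (4 * K * L0 + 1)"
      using N nN by (auto simp: of_nat_mono order_trans[OF _ of_nat_mono[OF nN]])
    have n: "n \<ge> 1" using rn(1) by linarith
    \<comment> \<open>Twice the bound for \<open>Phi\<close> at 0: one half is taken by that value,
      the other by the Lipschitz part on the ball.\<close>
    define w where "w = 2 * L0 / (real n)\<^sup>2"
    \<comment> \<open>The sup norm on the ball of radius K w, with the factor 2 of the sup
      estimate.\<close>
    define \<rho> where "\<rho> = 2 * (K * w)"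
    have w0: "w \<ge> 0" using L0(1) by (simp add: w_def)
    have n2: "real n \<le> (real n)\<^sup>2" using rn(1) by (simp add: power2_eq_square)
    have \<rho>n: "\<rho> \<le> 4 * K * L0 / real n"
    proof -
      have "\<rho> = 4 * K * L0 / (real n)\<^sup>2" by (simp add: \<rho>_def w_def)
      also have "\<dots> \<le> 4 * K * L0 / real n" using n2 rn(1) K L0(1) by (intro frac_le) auto
      finally show ?thesis .
    qed
    have \<rho>1: "\<rho> \<le> 1"
    proof -
      have "4 * K * L0 / real n \<le> 1" using rn by simp
      then show ?thesis using \<rho>n by linarith
    qed
    define q where "q = L * (\<rho> + 1 / real n)"
    have q0: "q \<ge> 0" using L(1) K w0 by (simp add: q_def \<rho>_def)
    have Kq: "K * q \<le> 1 / 2"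
    proof -
      have "K * q \<le> K * (L * (4 * K * L0 / real n + 1 / real n))"
        unfolding q_def using \<rho>n K L(1) by (intro mult_left_mono) auto
      also have "\<dots> = (2 * K * L * (4 * K * L0 + 1)) / real n / 2" using rn(1) by (simp add: field_simps)
      also have "\<dots> \<le> 1 / 2" using rn(1,3) by (intro divide_right_mono) auto
      finally show ?thesis .
    qed
    define adm where "adm F \<longleftrightarrow> (\<forall>x. F (- x) = F x) \<and> wbound \<beta> 2 (K * w) F" for F
    have lip: "wl2 \<beta> (\<lambda>x. Phi n F x - Phi n F' x) \<le> q * wl2 \<beta> (\<lambda>x. F x - F' x)" if "adm F" "adm F'" for F F'
      unfolding q_def using that bound2_sup unfolding adm_def \<rho>_def[symmetric]
      by (intro L(2)[OF n \<rho>1, of "K * w" F "K * w" F']) (auto simp: \<rho>_def)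
    have rhs: "rhs_fun \<beta> (Phi n F)" if "adm F" for F using Phi_rhs[OF _ _ n] that by (auto simp: adm_def)
    have rhsw: "wsq \<beta> (Phi n F)" if "adm F" for F using rhs[OF that] by (simp add: rhs_fun_def)
    have adm0: "adm (\<lambda>x. 0)" using wbound_mono_radius[OF wbound_zero] K w0 by (simp add: adm_def)
    have Phiw: "wl2 \<beta> (Phi n F) \<le> w" if "adm F" for F
    proof -
      have "wl2 \<beta> (\<lambda>x. Phi n (\<lambda>x. 0) x + (Phi n F x - Phi n (\<lambda>x. 0) x)) \<le>
         wl2 \<beta> (Phi n (\<lambda>x. 0)) + wl2 \<beta> (\<lambda>x. Phi n F x - Phi n (\<lambda>x. 0) x)"
        by (intro wl2_triangle wsq_diff rhsw that adm0)
      then have "wl2 \<beta> (Phi n F) \<le> wl2 \<beta> (Phi n (\<lambda>x. 0)) + wl2 \<beta> (\<lambda>x. Phi n F x - Phi n (\<lambda>x. 0) x)" by simp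
      also have "\<dots> \<le> w / 2 + q * wl2 \<beta> F" using lip[OF that adm0] L0(2)[OF n] by (intro add_mono) (auto simp: w_def)
      also have "\<dots> \<le> w / 2 + q * (K * w)" using that q0 wboundD(2) by (intro add_left_mono mult_left_mono) (auto simp: adm_def)
      also have "\<dots> \<le> w / 2 + (1 / 2) * w" using mult_right_mono[OF Kq w0] by (simp add: mult_ac)
      finally show ?thesis by simp
    qed
    \<comment> \<open>A solution is chosen, since the inverse is given only through existence; the a
      priori estimate controls differences of the chosen solutions.\<close>
    define step where "step F = (SOME F'. (\<forall>x. F' (- x) = F' x) \<and> wbound \<beta> 2 (K * wl2 \<beta> (Phi n F)) F' \<and> lin_eq V c S F' (Phi n F))" for F
    have step: "adm (step F)" "lin_eq V c S (step F) (Phi n F)" if "adm F" for F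
    proof -
      have st: "(\<forall>x. step F (- x) = step F x) \<and> wbound \<beta> 2 (K * wl2 \<beta> (Phi n F)) (step F) \<and> lin_eq V c S (step F) (Phi n F)"
        unfolding step_def by (rule someI_ex[OF inv_ex[OF rhs[OF that]]])
      have "K * wl2 \<beta> (Phi n F) \<le> K * w" by (rule mult_left_mono[OF Phiw[OF that] K])
      then show "adm (step F)" "lin_eq V c S (step F) (Phi n F)" using st wbound_mono_radius by (auto simp: adm_def)
    qed
    define F where "F k = (step ^^ k) (\<lambda>x. 0)" for k
    have FS: "F (Suc k) = step (F k)" for k by (simp add: F_def)
    have aF: "adm (F k)" for k by (induction k) (auto simp: FS adm0 step, simp add: F_def adm0)
    define g where "g k = Phi n (F k)" for k
    have lF: "lin_eq V c S (F (Suc k)) (g k)" for k unfolding g_def FS by (rule step(2)[OF aF])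
    have gr: "rhs_fun \<beta> (g k)" and gw: "wsq \<beta> (g k)" and gb: "wl2 \<beta> (g k) \<le> w" for k
      using rhs[OF aF] rhsw[OF aF] Phiw[OF aF] by (auto simp: g_def)
    have est: "wl2 \<beta> (\<lambda>x. H x - F (Suc k) x) \<le> K * wl2 \<beta> (\<lambda>x. h x - g k x)"
      if "adm H" "lin_eq V c S H h" "rhs_fun \<beta> h" for H h k
      using that aF[of "Suc k"] unfolding adm_def by (intro inv_est_diff[OF n _ _ that(2,3) _ _ lF gr]) auto
    have half: "q * (K * a) \<le> a / 2" if "a \<ge> 0" for a using mult_right_mono[OF Kq that] by (simp add: mult_ac)
    \<comment> \<open>The induction starts from two elements of the ball of radius w; each further
      step combines the a priori estimate for F with the Lipschitz estimate for \<open>Phi\<close>,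
      and K q <= 1/2.\<close>
    have dec: "wl2 \<beta> (\<lambda>x. g (Suc k) x - g k x) \<le> (2 * w) * (1/2) ^ k" for k
    proof (induction k)
      case 0
      show ?case using wl2_triangle_diff[OF gw[of "Suc 0"] gw[of 0]] gb[of 0] gb[of "Suc 0"] by simp
    next
      case (Suc k)
      have "wl2 \<beta> (\<lambda>x. g (Suc (Suc k)) x - g (Suc k) x) \<le> q * wl2 \<beta> (\<lambda>x. F (Suc (Suc k)) x - F (Suc k) x)"
        unfolding g_def by (rule lip[OF aF aF])
      also have "\<dots> \<le> q * (K * wl2 \<beta> (\<lambda>x. g (Suc k) x - g k x))"
        by (intro mult_left_mono est aF lF gr q0)
      also have "\<dots> \<le> wl2 \<beta> (\<lambda>x. g (Suc k) x - g k x) / 2" by (rule half) simp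
      finally show ?case using Suc.IH by simp
    qed
    obtain h where h: "wsq \<beta> h" "(\<lambda>k. wl2 \<beta> (\<lambda>x. g k x - h x)) \<longlonglongrightarrow> 0"
      using wsq_geometric_limit[OF gw dec] w0 by auto
    have hr: "rhs_fun \<beta> h" by (rule rhs_fun_limit[OF \<beta> gr h])
    have hw: "wl2 \<beta> h \<le> w"
    proof (rule LIMSEQ_le_const)
      show "(\<lambda>k. w + wl2 \<beta> (\<lambda>x. g k x - h x)) \<longlonglongrightarrow> w" using tendsto_add[OF tendsto_const h(2), of w] by simp
      have "wl2 \<beta> h \<le> w + wl2 \<beta> (\<lambda>x. g k x - h x)" for k
        using wl2_triangle_diff[OF gw[of k] wsq_diff[OF gw[of k] h(1)]] gb[of k] by simp
      then show "\<exists>N. \<forall>k\<ge>N. wl2 \<beta> h \<le> w + wl2 \<beta> (\<lambda>x. g k x - h x)" by auto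
    qed
    obtain H where H: "\<forall>x. H (- x) = H x" "wbound \<beta> 2 (K * wl2 \<beta> h) H" "lin_eq V c S H h" using inv_ex[OF hr] by auto
    have aH: "adm H" using H wbound_mono_radius[OF H(2) mult_left_mono[OF hw K]] by (simp add: adm_def)
    \<comment> \<open>\<open>Phi n H\<close> is compared with g (k + 1), the value of
      \<open>Phi\<close> at F (k + 1): \<open>H\<close> and F (k + 1) solve the linear equation with
      right-hand sides h and g k, which are close.\<close>
    have "wl2 \<beta> (\<lambda>x. h x - Phi n H x) = 0"
    proof (rule eq_0_if_le_tendsto_0)
      show "(\<lambda>k. wl2 \<beta> (\<lambda>x. g (Suc k) x - h x) + wl2 \<beta> (\<lambda>x. g k x - h x)) \<longlonglongrightarrow> 0"
        using tendsto_add[OF LIMSEQ_Suc[OF h(2)] h(2)] by simp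
      fix k
      have "wl2 \<beta> (\<lambda>x. h x - Phi n H x) \<le> wl2 \<beta> (\<lambda>x. h x - g (Suc k) x) + wl2 \<beta> (\<lambda>x. g (Suc k) x - Phi n H x)"
        by (intro wl2_triangle3 h gw rhsw aH)
      moreover have "wl2 \<beta> (\<lambda>x. g (Suc k) x - Phi n H x) \<le> wl2 \<beta> (\<lambda>x. g k x - h x)"
      proof -
        have "wl2 \<beta> (\<lambda>x. g (Suc k) x - Phi n H x) \<le> q * wl2 \<beta> (\<lambda>x. H x - F (Suc k) x)"
          unfolding g_def wl2_diff_commute[of \<beta> H] by (rule lip[OF aF aH])
        also have "\<dots> \<le> q * (K * wl2 \<beta> (\<lambda>x. h x - g k x))"
          by (intro mult_left_mono est aH H hr q0)
        also have "\<dots> \<le> wl2 \<beta> (\<lambda>x. h x - g k x) / 2" by (rule half) simp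
        also have "\<dots> \<le> wl2 \<beta> (\<lambda>x. g k x - h x)" by (simp add: wl2_diff_commute[of \<beta> h])
        finally show ?thesis .
      qed
      ultimately show "wl2 \<beta> (\<lambda>x. h x - Phi n H x) \<le> wl2 \<beta> (\<lambda>x. g (Suc k) x - h x) + wl2 \<beta> (\<lambda>x. g k x - h x)"
        by (simp add: wl2_diff_commute[of \<beta> h])
    qed simp
    then have "AE x in lborel. h x - Phi n H x = 0" by (intro wl2_eq_0D[of \<beta>] wsq_diff h rhsw aH)
    then have "AE x in lborel. h x = Phi n H x" by eventually_elim simp
    then have "lin_eq V c S H (Phi n H)" by (rule lin_eq_cong_AE[OF H(3)])
    moreover have "K * w = 2 * K * L0 / (real n)\<^sup>2" by (simp add: w_def)
    ultimately show ?thesis using aH unfolding adm_def by metis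
  qed
  moreover have "N \<ge> 1" using N by simp
  moreover have "2 * K * L0 \<ge> 0" using K L0(1) by simp
  ultimately show ?thesis using that by blast
qed

text \<open>Here C is arbitrary and N depends on it. A competing wave lies in a ball determined by
  the constant of the theorem and by norm equivalence, possibly larger than the ball in which the
  fixed point was found.\<close>

lemma Phi_fixed_point_unique:
  obtains N where "\<And>n F F'. n \<ge> N \<Longrightarrow> (\<And>x. F (- x) = F x) \<Longrightarrow> (\<And>x. F' (- x) = F' x) \<Longrightarrow>
     wbound \<beta> 2 (C / (real n)\<^sup>2) F \<Longrightarrow> wbound \<beta> 2 (C / (real n)\<^sup>2) F' \<Longrightarrow>
     lin_eq V c S F (Phi n F) \<Longrightarrow> lin_eq V c S F' (Phi n F') \<Longrightarrow> F = F'"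
proof -
  obtain L where L: "L \<ge> 0" "\<And>n \<rho> r r' F F'. n \<ge> 1 \<Longrightarrow> \<rho> \<le> 1 \<Longrightarrow> wbound \<beta> 2 r F \<Longrightarrow> wbound \<beta> 2 r' F' \<Longrightarrow>
     (\<And>x. \<bar>F x\<bar> \<le> \<rho>) \<Longrightarrow> (\<And>x. \<bar>F' x\<bar> \<le> \<rho>) \<Longrightarrow>
     wl2 \<beta> (\<lambda>x. Phi n F x - Phi n F' x) \<le> L * (\<rho> + 1 / real n) * wl2 \<beta> (\<lambda>x. F x - F' x)"
    by (rule Phi_lipschitz) blast
  obtain N where N: "real N \<ge> max 1 (max (2 * \<bar>C\<bar>) (2 * K * L * (2 * \<bar>C\<bar> + 1)))" using real_arch_simple by blast
  have "F = F'" if nN: "n \<ge> N" and ev: "\<And>x. F (- x) = F x" "\<And>x. F' (- x) = F' x"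
    and F: "wbound \<beta> 2 (C / (real n)\<^sup>2) F" "wbound \<beta> 2 (C / (real n)\<^sup>2) F'"
    and e: "lin_eq V c S F (Phi n F)" "lin_eq V c S F' (Phi n F')" for n F F'
  proof -
    have rn: "real n \<ge> 1" "real n \<ge> 2 * \<bar>C\<bar>" "real n \<ge> 2 * K * L * (2 * \<bar>C\<bar> + 1)"
      using N nN by (auto simp: of_nat_mono order_trans[OF _ of_nat_mono[OF nN]])
    have n: "n \<ge> 1" using rn(1) by linarith
    let ?\<rho> = "2 * \<bar>C\<bar> / real n"
    have n2: "real n \<le> (real n)\<^sup>2" using rn(1) by (simp add: power2_eq_square)
    have "C / (real n)\<^sup>2 \<le> \<bar>C\<bar> / real n" using n2 rn(1) by (intro frac_le) auto
    then have s: "\<bar>F x\<bar> \<le> ?\<rho>" "\<bar>F' x\<bar> \<le> ?\<rho>" for x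
      using bound2_sup[OF F(1), of x] bound2_sup[OF F(2), of x] by simp_all
    have \<rho>1: "?\<rho> \<le> 1" using rn by simp
    define a where "a = wl2 \<beta> (\<lambda>x. F x - F' x)"
    have "a \<le> K * wl2 \<beta> (\<lambda>x. Phi n F x - Phi n F' x)"
      unfolding a_def
      by (rule inv_est_diff[OF n ev(1) F(1) e(1) Phi_rhs[OF ev(1) F(1) n] ev(2) F(2) e(2) Phi_rhs[OF ev(2) F(2) n]])
    also have "\<dots> \<le> K * (L * (?\<rho> + 1 / real n) * a)"
      unfolding a_def by (intro mult_left_mono K L(2)[OF n \<rho>1 F s])
    also have "\<dots> = (2 * K * L * (2 * \<bar>C\<bar> + 1)) / real n / 2 * a" using rn(1) by (simp add: field_simps)
    also have "\<dots> \<le> 1 / 2 * a" using rn(1,3) by (intro mult_right_mono divide_right_mono) (auto simp: a_def)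
    finally have "a = 0" using wl2_nonneg[of \<beta> "\<lambda>x. F x - F' x"] by (simp add: a_def)
    then have "AE x in lborel. F x - F' x = 0"
      unfolding a_def by (rule wl2_eq_0D[rotated]) (intro wsq_diff wboundD(1)[OF F(1)] wboundD(1)[OF F(2)])
    then have "AE x in lborel. F x = F' x" by eventually_elim simp
    then show "F = F'" by (rule continuous_AE_eq_imp_eq[OF bound2_continuous[OF F(1)] bound2_continuous[OF F(2)]])
  qed
  then show ?thesis using that by blast
qed

end

section \<open>Fixed points as travelling waves, and bootstrapping\<close>

lemma mu_relation:
  assumes "4 * pi\<^sup>2 * c\<^sup>2 * (real n)\<^sup>2 \<noteq> \<kappa>"
  shows "\<kappa> * (1 + mu c \<kappa> n) = c\<^sup>2 * mu c \<kappa> n * (2 * pi * real n)\<^sup>2"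
proof -
  define d where "d = 4 * pi\<^sup>2 * c\<^sup>2 * (real n)\<^sup>2 - \<kappa>"
  have d: "d \<noteq> 0" using assms by (simp add: d_def)
  have "\<kappa> * (1 + \<kappa> / d) = \<kappa> / d * (d + \<kappa>)" using d by (simp add: field_simps)
  also have "d + \<kappa> = c\<^sup>2 * (2 * pi * real n)\<^sup>2" by (simp add: d_def power_mult_distrib)
  finally have "\<kappa> * (1 + \<kappa> / d) = \<kappa> / d * (c\<^sup>2 * (2 * pi * real n)\<^sup>2)" .
  moreover have "mu c \<kappa> n = \<kappa> / d" by (simp add: mu_def d_def)
  ultimately show ?thesis by (simp only:) (simp only: mult_ac)
qed

text \<open>The energy \<open>(D')\<^sup>2 + w\<^sup>2 D\<^sup>2\<close> is constant and tends to \<open>0\<close> at infinity.\<close>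

lemma harmonic_oscillator_l2_zero:
  assumes D: "primitive D D1" "primitive D1 D2" and sq: "square_integrable D" "square_integrable D1" "square_integrable D2"
    and eq: "AE x in lborel. D2 x = - (w\<^sup>2 * D x)" and w: "w \<noteq> 0"
  shows "D x = 0"
proof -
  let ?E = "\<lambda>x. D1 x * D1 x + w\<^sup>2 * (D x * D x)"
  have P: "primitive ?E (\<lambda>x. (D2 x * D1 x + D1 x * D2 x) + w\<^sup>2 * (D1 x * D x + D x * D1 x))"
    by (intro primitive_add primitive_cmult primitive_mult D)
  have PE: "primitive ?E (\<lambda>x. 0)"
    by (rule primitive_cong_AE[OF P]) (use eq in \<open>auto elim!: eventually_mono simp: algebra_simps\<close>)
  then have const: "?E b = ?E a" if "a \<le> b" for a b using primitiveD(4)[OF PE that] by (simp add: set_lebesgue_integral_def)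
  have u: "filterlim (\<lambda>R::real. \<bar>x + R\<bar>) at_top at_top"
    by (intro filterlim_compose[OF filterlim_abs_real] filterlim_tendsto_add_at_top[OF tendsto_const filterlim_ident])
  have "((\<lambda>R. ?E (x + R)) \<longlongrightarrow> 0 * 0 + w\<^sup>2 * (0 * 0)) at_top"
    by (intro tendsto_intros primitive_tendsto_0[OF D(1) sq(1,2) u] primitive_tendsto_0[OF D(2) sq(2,3) u])
  moreover have "\<forall>\<^sub>F R in at_top. ?E (x + R) = ?E x"
    by (rule eventually_mono[OF eventually_ge_at_top[of 0]]) (rule const, simp)
  ultimately have "((\<lambda>R::real. ?E x) \<longlongrightarrow> 0) at_top" by (auto intro: Lim_transform_eventually)
  then have "?E x = 0" by (simp add: tendsto_const_iff)
  then have "w\<^sup>2 * (D x * D x) = 0" using zero_le_square[of "D1 x"] zero_le_square[of "D x"] zero_le_power2[of w]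
    by (smt (verit) mult_nonneg_nonneg)
  then show ?thesis using w by simp
qed

text \<open>The gain of the second-order equation: a bound for the second derivative at order m
  becomes one for F at order m + 2. The first derivatives from the two sources are continuous, hence
  equal.\<close>

lemma wbound_promote:
  assumes F: "wbound b 2 r F" and P: "primitive F F1" "primitive F1 F2" and h: "AE x in lborel. F2 x = h x" "wbound b m r' h"
  shows "wbound b (m + 2) (max r r') F"
proof -
  obtain f1 f2 where f: "primitive F f1" "wsq b f1" "wl2 b f1 \<le> r" "primitive f1 f2" using F by (auto simp: wbound_2_iff)
  have "f1 = F1"
    by (rule continuous_AE_eq_imp_eq[OF primitive_continuous[OF f(4)] primitive_continuous[OF P(2)] primitive_unique_AE[OF f(1) P(1)]])
  then have F1: "wsq b F1" "wl2 b F1 \<le> r" using f by auto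
  have "primitive F1 h" by (rule primitive_cong_AE[OF P(2) wsq_measurable[OF wboundD(1)[OF h(2)]] h(1)])
  moreover have "wbound b m (max r r') h" by (rule wbound_mono_radius[OF h(2)]) simp
  ultimately have "wbound b (Suc m) (max r r') F1" using F1 by auto
  then show ?thesis using P(1) wboundD(1,2)[OF F] by auto
qed

text \<open>The top derivative of the chain is only square integrable, hence one order is
  lost.\<close>

lemma wbound_imp_C_k: "wbound b (Suc k) r F \<Longrightarrow> C_k k F"
proof (induction k arbitrary: F)
  case 0
  then show ?case using wbound_continuous[OF 0] by (simp add: C_k_0)
next
  case (Suc k)
  then obtain F' where F': "primitive F F'" "wbound b (Suc k) r F'" by auto
  show ?case
    by (rule C_k_SucI[OF primitive_has_derivative[OF F'(1) wbound_continuous[OF F'(2)]] Suc.IH[OF F'(2)]])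
qed

lemma smooth_deriv: "smooth V \<Longrightarrow> C_k k (deriv V)"
  unfolding smooth_def using C_k_Suc[of k V] by blast

context wave_setup
begin

text \<open>The second equation divided by c^2 \<mu> reads rho2'' + (2 pi n)^2 rho2 = -(1/c^2) delta
  G(S + F), to which the solution operator applies.\<close>

definition rho2 :: "nat \<Rightarrow> (real \<Rightarrow> real) \<Rightarrow> real \<Rightarrow> real" where
  "rho2 n F x = - (1 / c\<^sup>2) * resolvent n (\<lambda>y. G (S y + F y)) x"

text \<open>The terms linear in F on both sides cancel. In the resulting form F'' is expressed by
  the full nonlinearity, which suits the translation to waves and the bootstrap.\<close>

lemma lin_eq_Phi_iff:
  assumes F: "primitive F F1" "primitive F1 F2"
  shows "lin_eq V c S F (Phi n F) \<longleftrightarrow>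
    (AE x in lborel. c\<^sup>2 * F2 x = delta (delta (\<lambda>y. G (S y + F y) - G (S y))) x - \<kappa> / c\<^sup>2 * delta (resolvent n (\<lambda>y. G (S y + F y))) x)"
    (is "_ \<longleftrightarrow> (AE x in lborel. c\<^sup>2 * F2 x = ?h x)")
proof -
  have Q: "delta (delta (Q F)) x = delta (delta (\<lambda>y. G (S y + F y) - G (S y))) x - delta (delta (\<lambda>y. deriv G (S y) * F y)) x" for x
    unfolding Q_def[abs_def] delta_diff by simp
  show ?thesis
  proof
    assume "lin_eq V c S F (Phi n F)"
    then obtain f1 f2 where f: "primitive F f1" "primitive f1 f2"
      "AE x in lborel. c\<^sup>2 * f2 x - delta (delta (\<lambda>y. deriv G (S y) * F y)) x = Phi n F x" by (auto simp: lin_eq_def)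
    have "f1 = F1"
      by (rule continuous_AE_eq_imp_eq[OF primitive_continuous[OF f(2)] primitive_continuous[OF F(2)] primitive_unique_AE[OF f(1) F(1)]])
    then have "AE x in lborel. f2 x = F2 x" using primitive_unique_AE[OF _ F(2)] f(2) by simp
    then show "AE x in lborel. c\<^sup>2 * F2 x = ?h x" using f(3) by eventually_elim (simp add: Phi_def Q)
  next
    assume "AE x in lborel. c\<^sup>2 * F2 x = ?h x"
    then have "AE x in lborel. c\<^sup>2 * F2 x - delta (delta (\<lambda>y. deriv G (S y) * F y)) x = Phi n F x"
      by eventually_elim (simp add: Phi_def Q)
    then show "lin_eq V c S F (Phi n F)" using F by (auto simp: lin_eq_def)
  qed
qed

lemma comp_primitives:
  assumes "wbound \<beta> 2 r F"
  obtains g1 g2 where "primitive (\<lambda>y. G (S y + F y)) g1" "primitive g1 g2"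
    "square_integrable (\<lambda>y. G (S y + F y))" "square_integrable g1" "square_integrable g2"
proof -
  obtain C where "wbound \<beta> 2 C (\<lambda>y. G (S y + F y))" using comp_bound[of 2 r] assms by auto
  then have "wbound 0 2 C (\<lambda>y. G (S y + F y))" by (rule wbound_weaken[OF _ b0])
  then show ?thesis using that by (auto simp: wbound_2_iff)
qed

lemma rho2_primitives:
  assumes F: "wbound \<beta> 2 r F" and n: "n \<ge> 1"
  obtains T1 T2 where "primitive (rho2 n F) T1" "primitive T1 T2"
    "square_integrable (rho2 n F)" "square_integrable T1" "square_integrable T2"
    "\<And>x. c\<^sup>2 * T2 x = - delta (\<lambda>y. G (S y + F y)) x - c\<^sup>2 * (2 * pi * real n)\<^sup>2 * rho2 n F x"
proof -
  let ?g = "\<lambda>y. G (S y + F y)"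
  obtain g1 g2 where g: "primitive ?g g1" "primitive g1 g2" and sq: "square_integrable ?g" "square_integrable g1" "square_integrable g2"
    using comp_primitives[OF F] .
  have r: "square_integrable (\<lambda>x. - (1 / c\<^sup>2) * resolvent n h x)" if "square_integrable h" for h
    using wbound_resolvent[OF order_refl n, of 0 "l2_norm h" h] that by (intro square_integrable_cmult) simp
  show ?thesis
  proof (rule that)
    show "primitive (rho2 n F) (\<lambda>x. - (1 / c\<^sup>2) * resolvent n g1 x)"
      unfolding rho2_def[abs_def] by (intro primitive_cmult primitive_resolvent g sq)
    show "primitive (\<lambda>x. - (1 / c\<^sup>2) * resolvent n g1 x) (\<lambda>x. - (1 / c\<^sup>2) * resolvent n g2 x)"
      by (intro primitive_cmult primitive_resolvent g sq)
    show "square_integrable (rho2 n F)" unfolding rho2_def[abs_def] by (rule r[OF sq(1)])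
    show "square_integrable (\<lambda>x. - (1 / c\<^sup>2) * resolvent n g1 x)" "square_integrable (\<lambda>x. - (1 / c\<^sup>2) * resolvent n g2 x)"
      by (rule r[OF sq(2)], rule r[OF sq(3)])
    show "c\<^sup>2 * (- (1 / c\<^sup>2) * resolvent n g2 x) = - delta ?g x - c\<^sup>2 * (2 * pi * real n)\<^sup>2 * rho2 n F x" for x
      unfolding resolvent_second_derivative[OF g n] rho2_def using c by (simp add: algebra_simps)
  qed
qed

text \<open>The first equation is the sum of the profile equation of S and the equation of F; the
  second holds by the construction of \<open>rho2\<close> and the relation between \<mu> and the
  frequency.\<close>

lemma wave_system_fixed_point:
  assumes F: "wbound \<beta> 2 r F" and lin: "lin_eq V c S F (Phi n F)" and n: "n \<ge> 1" "4 * pi\<^sup>2 * c\<^sup>2 * (real n)\<^sup>2 \<noteq> \<kappa>"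
  shows "wave_system V c \<kappa> (mu c \<kappa> n) (\<lambda>x. S x + F x) (rho2 n F)"
proof -
  let ?R = "\<lambda>x. S x + F x" and ?T = "rho2 n F"
  obtain S1 S2 where S: "primitive S S1" "primitive S1 S2" "AE x in lborel. c\<^sup>2 * S2 x = delta (delta (\<lambda>y. G (S y))) x"
    using S_eq by auto
  obtain F1 F2 where F12: "primitive F F1" "primitive F1 F2" using F by (auto simp: wbound_2_iff)
  have eqF: "AE x in lborel. c\<^sup>2 * F2 x = delta (delta (\<lambda>y. G (S y + F y) - G (S y))) x - \<kappa> / c\<^sup>2 * delta (resolvent n (\<lambda>y. G (S y + F y))) x"
    using lin lin_eq_Phi_iff[OF F12] by blast
  have R: "primitive ?R (\<lambda>x. S1 x + F1 x)" "primitive (\<lambda>x. S1 x + F1 x) (\<lambda>x. S2 x + F2 x)"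
    by (intro primitive_add S F12)+
  obtain T1 T2 where T: "primitive ?T T1" "primitive T1 T2"
    "\<And>x. c\<^sup>2 * T2 x = - delta (\<lambda>y. G (S y + F y)) x - c\<^sup>2 * (2 * pi * real n)\<^sup>2 * ?T x"
    by (rule rho2_primitives[OF F n(1)]) blast
  have wR: "AE x in lborel. S2 x + F2 x = weak_deriv (weak_deriv ?R) x"
    by (rule weak_deriv2_AE[OF R primitive_measurable[OF R(1)]]) simp
  have wT: "AE x in lborel. T2 x = weak_deriv (weak_deriv ?T) x"
    by (rule weak_deriv2_AE[OF T(1,2) primitive_measurable[OF T(1)]]) simp
  have dT: "delta ?T x = - (1 / c\<^sup>2) * delta (resolvent n (\<lambda>y. G (S y + F y))) x" for x
    unfolding rho2_def[abs_def] delta_cmult ..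
  have "AE x in lborel. c\<^sup>2 * weak_deriv (weak_deriv ?R) x - delta (delta (\<lambda>y. G (?R y))) x - \<kappa> * delta ?T x = 0"
    using wR S(3) eqF
  proof eventually_elim
    case (elim x)
    show ?case unfolding elim(1)[symmetric] distrib_left elim(2,3) dT delta_diff by simp
  qed
  moreover have "AE x in lborel. c\<^sup>2 * mu c \<kappa> n * weak_deriv (weak_deriv ?T) x
        + \<kappa> * (1 + mu c \<kappa> n) * ?T x + mu c \<kappa> n * delta (\<lambda>y. G (?R y)) x = 0"
    using wT
  proof eventually_elim
    case (elim x)
    have "c\<^sup>2 * mu c \<kappa> n * T2 x = mu c \<kappa> n * (c\<^sup>2 * T2 x)" by simp
    then show ?case unfolding elim[symmetric] mu_relation[OF n(2)] T(3) by (simp add: algebra_simps)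
  qed
  ultimately show ?thesis by (simp add: wave_system_def)
qed

text \<open>The second equation is exploited first: it forces the second component to be the
  solution operator applied to G(S + F), after which the first equation becomes the fixed point
  equation for F.\<close>

lemma wave_system_imp_fixed_point:
  assumes F: "wbound \<beta> 2 r F" and P: "wbound \<beta> 2 s P" and n: "n \<ge> 1" "4 * pi\<^sup>2 * c\<^sup>2 * (real n)\<^sup>2 \<noteq> \<kappa>"
    and \<rho>1: "\<rho>1 \<in> borel_measurable borel" "AE x in lborel. \<rho>1 x = S x + F x"
    and \<rho>2: "\<rho>2 \<in> borel_measurable borel" "AE x in lborel. \<rho>2 x = P x"
    and wave: "wave_system V c \<kappa> (mu c \<kappa> n) \<rho>1 \<rho>2"
  shows "lin_eq V c S F (Phi n F)" "P = rho2 n F"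
proof -
  let ?R = "\<lambda>x. S x + F x" and ?T = "rho2 n F" and ?\<mu> = "mu c \<kappa> n"
  have \<mu>: "?\<mu> \<noteq> 0" using \<kappa> n(2) by (simp add: mu_def)
  obtain S1 S2 where S: "primitive S S1" "primitive S1 S2" "AE x in lborel. c\<^sup>2 * S2 x = delta (delta (\<lambda>y. G (S y))) x"
    using S_eq by auto
  obtain F1 F2 where F12: "primitive F F1" "primitive F1 F2" using F by (auto simp: wbound_2_iff)
  have R: "primitive ?R (\<lambda>x. S1 x + F1 x)" "primitive (\<lambda>x. S1 x + F1 x) (\<lambda>x. S2 x + F2 x)"
    by (intro primitive_add S F12)+
  have "wbound 0 2 s P" by (rule wbound_weaken[OF P b0])
  then obtain P1 P2 where P12: "primitive P P1" "primitive P1 P2"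
    "square_integrable P" "square_integrable P1" "square_integrable P2" by (auto simp: wbound_2_iff)
  obtain T1 T2 where T: "primitive ?T T1" "primitive T1 T2"
    "square_integrable ?T" "square_integrable T1" "square_integrable T2"
    "\<And>x. c\<^sup>2 * T2 x = - delta (\<lambda>y. G (S y + F y)) x - c\<^sup>2 * (2 * pi * real n)\<^sup>2 * ?T x"
    by (rule rho2_primitives[OF F n(1)]) blast
  have wR: "AE x in lborel. S2 x + F2 x = weak_deriv (weak_deriv \<rho>1) x"
    by (rule weak_deriv2_AE[OF R \<rho>1(1)]) (use \<rho>1(2) in \<open>auto elim!: eventually_mono\<close>)
  have wP: "AE x in lborel. P2 x = weak_deriv (weak_deriv \<rho>2) x"
    by (rule weak_deriv2_AE[OF P12(1,2) \<rho>2(1)]) (use \<rho>2(2) in \<open>auto elim!: eventually_mono\<close>)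
  have Gc: "AE y in lborel. G (\<rho>1 y) = G (?R y)" using \<rho>1(2) by eventually_elim simp
  note d1 = delta_cong_AE[OF Gc] and d2 = delta_cong_AE[OF delta_cong_AE[OF Gc]] and dP = delta_cong_AE[OF \<rho>2(2)]
  have e2: "AE x in lborel. c\<^sup>2 * ?\<mu> * weak_deriv (weak_deriv \<rho>2) x + \<kappa> * (1 + ?\<mu>) * \<rho>2 x + ?\<mu> * delta (\<lambda>y. G (\<rho>1 y)) x = 0"
    using wave by (simp add: wave_system_def)
  have e1: "AE x in lborel. c\<^sup>2 * weak_deriv (weak_deriv \<rho>1) x - delta (delta (\<lambda>y. G (\<rho>1 y))) x - \<kappa> * delta \<rho>2 x = 0"
    using wave by (simp add: wave_system_def)
  \<comment> \<open>P and \<open>rho2 n F\<close> solve the same forced oscillator equation, so the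
    forcing cancels in the difference; \<mu> may be divided out because it is nonzero.\<close>
  have D: "AE x in lborel. P2 x - T2 x = - ((2 * pi * real n)\<^sup>2 * (P x - ?T x))"
    using e2 wP d1 \<rho>2(2)
  proof eventually_elim
    case (elim x)
    let ?w = "(2 * pi * real n)\<^sup>2"
    have "?\<mu> * (c\<^sup>2 * P2 x + c\<^sup>2 * ?w * P x + delta (\<lambda>y. G (?R y)) x) = 0"
      using elim unfolding mu_relation[OF n(2)] by (simp add: algebra_simps)
    then have "c\<^sup>2 * P2 x + c\<^sup>2 * ?w * P x + delta (\<lambda>y. G (?R y)) x = 0" using \<mu> by simp
    then have "c\<^sup>2 * (P2 x - T2 x + ?w * (P x - ?T x)) = 0" using T(6)[of x] by (simp add: algebra_simps)
    then show ?case using c by simp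
  qed
  \<comment> \<open>Square integrability excludes the free oscillations.\<close>
  have "P x - ?T x = 0" for x
  proof (rule harmonic_oscillator_l2_zero[OF _ _ _ _ _ D])
    show "primitive (\<lambda>x. P x - ?T x) (\<lambda>x. P1 x - T1 x)" "primitive (\<lambda>x. P1 x - T1 x) (\<lambda>x. P2 x - T2 x)"
      by (intro primitive_diff P12 T)+
    show "square_integrable (\<lambda>x. P x - ?T x)" "square_integrable (\<lambda>x. P1 x - T1 x)" "square_integrable (\<lambda>x. P2 x - T2 x)"
      by (intro square_integrable_diff P12 T)+
  qed (use n(1) in simp)
  then show PT: "P = ?T" by auto
  have dT: "delta ?T x = - (1 / c\<^sup>2) * delta (resolvent n (\<lambda>y. G (S y + F y))) x" for x
    unfolding rho2_def[abs_def] delta_cmult ..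
  have "AE x in lborel. c\<^sup>2 * F2 x = delta (delta (\<lambda>y. G (S y + F y) - G (S y))) x - \<kappa> / c\<^sup>2 * delta (resolvent n (\<lambda>y. G (S y + F y))) x"
    using e1 wR d2 dP S(3)
  proof eventually_elim
    case (elim x)
    have "c\<^sup>2 * (S2 x + F2 x) - delta (delta (\<lambda>y. G (?R y))) x - \<kappa> * delta ?T x = 0"
      using elim(1) unfolding elim(2)[symmetric] elim(3,4) PT by simp
    then have "c\<^sup>2 * S2 x + c\<^sup>2 * F2 x - delta (delta (\<lambda>y. G (?R y))) x + \<kappa> / c\<^sup>2 * delta (resolvent n (\<lambda>y. G (S y + F y))) x = 0"
      unfolding dT by (simp add: distrib_left)
    then show ?case unfolding elim(5) delta_diff by simp
  qed
  then show "lin_eq V c S F (Phi n F)" using lin_eq_Phi_iff[OF F12] by blast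
qed

lemma rho2_odd:
  assumes "\<And>x. F (- x) = F x"
  shows "rho2 n F (- x) = - rho2 n F x"
  using resolvent_odd[of "\<lambda>y. G (S y + F y)" n x] assms S_even by (simp add: rho2_def)

text \<open>The H^2 bound on F gives two derivatives of G(S + F), all used for the norm of
  \<open>rho2\<close>; none is left for smoothing, so the rate is 1/n.\<close>

lemma rho2_bound:
  obtains C where "C \<ge> 0" "\<And>n F. n \<ge> 1 \<Longrightarrow> wbound \<beta> 2 r F \<Longrightarrow> wbound \<beta> 2 (C / real n) (rho2 n F)"
proof -
  obtain C where C: "C \<ge> 0" "\<And>F. wbound \<beta> 2 r F \<Longrightarrow> wbound \<beta> 2 C (\<lambda>y. G (S y + F y))" using comp_bound[of 2 r] by auto
  have "wbound \<beta> 2 (1 / c\<^sup>2 * exp \<beta> * C / real n) (rho2 n F)" if "n \<ge> 1" "wbound \<beta> 2 r F" for n F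
    using wbound_cmult[OF wbound_resolvent[OF b0 that(1) C(2)[OF that(2)]], of "- (1 / c\<^sup>2)"] by (simp add: rho2_def[abs_def])
  then show ?thesis using that[of "1 / c\<^sup>2 * exp \<beta> * C"] C(1) by simp
qed

text \<open>Bootstrap on c^2 S'' = delta^2 G(S): composition and \<open>delta\<close> preserve the
  order, and the second derivative gains two.\<close>

lemma smooth_S_bound:
  assumes V: "smooth V"
  shows "\<exists>r. wbound \<beta> m r S"
proof -
  have "\<exists>r. wbound \<beta> (j + 2) r S" for j
  proof (induction j)
    case 0
    show ?case unfolding add_0 using S_bound by blast
  next
    case (Suc j)
    then obtain r where r: "wbound \<beta> (max (j + 2) 2) r S" by auto
    obtain S1 S2 where S: "primitive S S1" "primitive S1 S2" "AE x in lborel. c\<^sup>2 * S2 x = delta (delta (\<lambda>y. G (S y))) x"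
      using S_eq by auto
    obtain C where "wbound \<beta> (j + 2) C (\<lambda>x. G (S x))"
      using wbound_comp[OF b0 smooth_deriv[OF V] V0, of "j + 2" r] r by blast
    then have h: "wbound \<beta> (j + 2) (\<bar>1 / c\<^sup>2\<bar> * (2 * exp \<beta> * (2 * exp \<beta> * C))) (\<lambda>x. 1 / c\<^sup>2 * delta (delta (\<lambda>y. G (S y))) x)"
      by (intro wbound_cmult wbound_delta b0)
    have "AE x in lborel. S2 x = 1 / c\<^sup>2 * delta (delta (\<lambda>y. G (S y))) x"
      using S(3) by eventually_elim (use c in \<open>simp add: field_simps\<close>)
    from wbound_promote[OF S_bound S(1,2) this h] obtain r' where "wbound \<beta> (j + 2 + 2) r' S" by blast
    \<comment> \<open>Of the two orders gained, the induction keeps one.\<close>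
    then have "wbound \<beta> (Suc j + 2) r' S" by (rule wbound_lower) simp
    then show ?case by blast
  qed
  then obtain r where "wbound \<beta> (m + 2) r S" by blast
  then have "wbound \<beta> m r S" by (rule wbound_lower) simp
  then show ?thesis by blast
qed

text \<open>Each round gains two orders from F'' and spends one on smoothing the resolvent term to
  the rate 1/n^2, a net gain of one. The difference G(S + F) - G(S) keeps the rate because its bound
  is linear in that of F.\<close>

lemma smooth_fixed_point_bound:
  assumes V: "smooth V" and B: "B \<ge> 0"
  shows "\<exists>C\<ge>0. \<forall>n F. n \<ge> 1 \<longrightarrow> wbound \<beta> 2 (B / (real n)\<^sup>2) F \<longrightarrow> lin_eq V c S F (Phi n F) \<longrightarrow> wbound \<beta> (j + 2) (C / (real n)\<^sup>2) F"
proof (induction j)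
  case 0
  show ?case unfolding add_0 using B by blast
next
  case (Suc j)
  let ?m = "j + 2"
  obtain C where C: "C \<ge> 0" "\<And>n F. n \<ge> 1 \<Longrightarrow> wbound \<beta> 2 (B / (real n)\<^sup>2) F \<Longrightarrow> lin_eq V c S F (Phi n F) \<Longrightarrow> wbound \<beta> ?m (C / (real n)\<^sup>2) F"
    using Suc.IH by blast
  obtain r where r: "wbound \<beta> (?m + 2) r S" using smooth_S_bound[OF V] by blast
  \<comment> \<open>A common radius for S and F, uniform in n because C/n^2 <= C.\<close>
  define M' where "M' = max r C"
  have SM: "wbound \<beta> (?m + 2) M' S" by (rule wbound_mono_radius[OF r]) (simp add: M'_def)
  obtain D where D: "D \<ge> 0" "\<And>S F r. wbound \<beta> (?m + 2) M' S \<Longrightarrow> wbound \<beta> (max ?m 2) M' F \<Longrightarrow> wbound \<beta> ?m r F \<Longrightarrow>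
     wbound \<beta> ?m (D * r) (\<lambda>x. G (S x + F x) - G (S x))"
    using wbound_comp_diff[OF b0 smooth_deriv[OF V], of ?m M'] by blast
  obtain E where E: "E \<ge> 0" "\<And>\<rho>. wbound \<beta> (max ?m 2) (M' + M') \<rho> \<Longrightarrow> wbound \<beta> ?m E (\<lambda>x. G (\<rho> x))"
    using wbound_comp[OF b0 smooth_deriv[OF V] V0, of ?m "M' + M'"] by blast
  \<comment> \<open>The bound for F'' with 1/n^2 taken out: D C comes from the difference term, E
    from the smoothed resolvent term, and the factors 2 exp \<beta> from each
    \<open>delta\<close>.\<close>
  define H where "H = \<bar>1 / c\<^sup>2\<bar> * (2 * exp \<beta> * (2 * exp \<beta> * (D * C)) + \<bar>\<kappa> / c\<^sup>2\<bar> * (2 * exp \<beta> * (3 * exp \<beta> * E)))"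
  have H0: "H \<ge> 0" unfolding H_def by (intro mult_nonneg_nonneg add_nonneg_nonneg) (use D(1) C(1) E(1) in auto)
  have "wbound \<beta> (Suc j + 2) (max B H / (real n)\<^sup>2) F"
    if n: "n \<ge> 1" and F: "wbound \<beta> 2 (B / (real n)\<^sup>2) F" and lin: "lin_eq V c S F (Phi n F)" for n F
  proof -
    let ?N = "(real n)\<^sup>2"
    let ?g = "\<lambda>y. G (S y + F y)"
    have N: "?N \<ge> 1" using n by (simp add: one_le_power)
    have Fm: "wbound \<beta> ?m (C / ?N) F" by (rule C(2)[OF n F lin])
    have "C / ?N \<le> C / 1" by (rule frac_le) (use N C(1) in auto)
    then have FM: "wbound \<beta> (max ?m 2) M' F" using wbound_mono_radius[OF Fm, of M'] by (simp add: M'_def)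
    have SM2: "wbound \<beta> (max ?m 2) M' S" by (rule wbound_lower[OF SM]) simp
    have g: "wbound \<beta> (Suc (Suc j)) E ?g" using E(2)[OF wbound_add[OF SM2 FM]] by simp
    have r: "wbound \<beta> (Suc j) (3 * exp \<beta> * E / ?N) (resolvent n ?g)" by (rule wbound_resolvent_smoothing[OF b0 n g])
    have dG: "wbound \<beta> (Suc j) (D * (C / ?N)) (\<lambda>x. G (S x + F x) - G (S x))"
      by (rule wbound_lower[OF D(2)[OF SM FM Fm]]) simp
    let ?h = "\<lambda>x. 1 / c\<^sup>2 * (delta (delta (\<lambda>y. G (S y + F y) - G (S y))) x - \<kappa> / c\<^sup>2 * delta (resolvent n ?g) x)"
    have h: "wbound \<beta> (Suc j) (\<bar>1 / c\<^sup>2\<bar> * (2 * exp \<beta> * (2 * exp \<beta> * (D * (C / ?N))) + \<bar>\<kappa> / c\<^sup>2\<bar> * (2 * exp \<beta> * (3 * exp \<beta> * E / ?N)))) ?h"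
      by (intro wbound_cmult wbound_diff wbound_delta b0 r dG)
    obtain F1 F2 where F12: "primitive F F1" "primitive F1 F2" using F by (auto simp: wbound_2_iff)
    have "AE x in lborel. c\<^sup>2 * F2 x = delta (delta (\<lambda>y. G (S y + F y) - G (S y))) x - \<kappa> / c\<^sup>2 * delta (resolvent n ?g) x"
      using lin lin_eq_Phi_iff[OF F12] by blast
    then have "AE x in lborel. F2 x = ?h x"
    proof eventually_elim
      case (elim x)
      show ?case unfolding elim[symmetric] using c by simp
    qed
    from wbound_promote[OF F F12 this h]
    have w: "wbound \<beta> (Suc j + 2) (max (B / ?N) (\<bar>1 / c\<^sup>2\<bar> * (2 * exp \<beta> * (2 * exp \<beta> * (D * (C / ?N))) + \<bar>\<kappa> / c\<^sup>2\<bar> * (2 * exp \<beta> * (3 * exp \<beta> * E / ?N))))) F" .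
    have "\<bar>1 / c\<^sup>2\<bar> * (2 * exp \<beta> * (2 * exp \<beta> * (D * (C / ?N))) + \<bar>\<kappa> / c\<^sup>2\<bar> * (2 * exp \<beta> * (3 * exp \<beta> * E / ?N))) = H / ?N"
      unfolding H_def by (simp add: add_divide_distrib distrib_left)
    with w have w': "wbound \<beta> (Suc j + 2) (max (B / ?N) (H / ?N)) F" by simp
    show ?thesis by (rule wbound_mono_radius[OF w']) (auto intro: divide_right_mono)
  qed
  moreover have "max B H \<ge> 0" using B by simp
  ultimately show ?case by blast
qed

text \<open>One order above m is spent on smoothing, so G(S + F) is needed at order m + 1, and its
  composition estimate wants S + F at order 2 at least; m + 3 covers both.\<close>

lemma smooth_rho2_bound:
  assumes V: "smooth V" and r: "wbound \<beta> (m + 3) r S"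
  shows "\<exists>C\<ge>0. \<forall>n F. n \<ge> 1 \<longrightarrow> wbound \<beta> (m + 3) r F \<longrightarrow> wbound \<beta> m (C / (real n)\<^sup>2) (rho2 n F)"
proof -
  obtain E where E: "E \<ge> 0" "\<And>\<rho>. wbound \<beta> (max (Suc m) 2) (r + r) \<rho> \<Longrightarrow> wbound \<beta> (Suc m) E (\<lambda>x. G (\<rho> x))"
    using wbound_comp[OF b0 smooth_deriv[OF V] V0, of "Suc m" "r + r"] by blast
  have "wbound \<beta> m ((1 / c\<^sup>2 * (3 * exp \<beta> * E)) / (real n)\<^sup>2) (rho2 n F)" if n: "n \<ge> 1" and F: "wbound \<beta> (m + 3) r F" for n F
  proof -
    have "wbound \<beta> (max (Suc m) 2) (r + r) (\<lambda>y. S y + F y)"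
      by (intro wbound_add wbound_lower[OF F] wbound_lower[OF r]) auto
    from wbound_cmult[OF wbound_resolvent_smoothing[OF b0 n E(2)[OF this]], of "- (1 / c\<^sup>2)"]
    show ?thesis by (simp add: rho2_def[abs_def])
  qed
  then show ?thesis using E(1) by (intro exI[of _ "1 / c\<^sup>2 * (3 * exp \<beta> * E)"]) auto
qed

end

section \<open>Existence, uniqueness and estimates\<close>

lemma wsobolev_even_representative:
  assumes \<sigma>: "\<sigma> \<in> wsobolev_even 2 \<beta>"
  obtains S M where "AE x in lborel. \<sigma> x = S x" "wbound \<beta> 2 M S" "\<And>x. S (- x) = S x"
proof -
  obtain C where C: "\<And>f r. f \<in> wsobolev (real 2) \<beta> \<Longrightarrow> wnorm (real 2) \<beta> f \<le> r \<Longrightarrow>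
      \<exists>F. (AE x in lborel. f x = F x) \<and> wbound \<beta> 2 (C * r) F"
    using wsobolev_imp_wbound[of 2 \<beta>] by blast
  obtain S where S: "AE x in lborel. \<sigma> x = S x" "wbound \<beta> 2 (C * wnorm 2 \<beta> \<sigma>) S"
    using C[of \<sigma> "wnorm 2 \<beta> \<sigma>"] \<sigma> by (auto simp: wsobolev_even_def)
  have cS: "continuous_on UNIV S" using wbound_continuous[of \<beta> 1] S(2) by (simp add: numeral_2_eq_2)
  have "ae_even S" using ae_even_cong[OF _ S(1)] \<sigma> by (simp add: wsobolev_even_def)
  then have "(\<lambda>x. S (- x)) = S"
    by (intro continuous_AE_eq_imp_eq cS continuous_on_compose2[OF cS] continuous_intros) (auto simp: ae_even_def)
  then have "S (- x) = S x" for x by metis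
  then show ?thesis using that S by blast
qed

lemma admissible_wave_setup:
  assumes V: "C_k 5 V" "deriv V 0 = 0" and c: "c \<noteq> 0" and adm: "admissible_with V c \<beta> \<sigma>" and \<kappa>: "\<kappa> > 0"
  obtains S K M where "AE x in lborel. \<sigma> x = S x" "wave_setup V c \<beta> \<kappa> S K M"
proof -
  have \<beta>: "\<beta> > 0" and \<sigma>: "\<sigma> \<in> wsobolev_even 2 \<beta>" and h: "linearized_homeo V c \<beta> \<sigma> 0"
    and eq: "AE x in lborel. c\<^sup>2 * weak_deriv (weak_deriv \<sigma>) x - delta (delta (\<lambda>y. deriv V (\<sigma> y))) x = 0"
    using adm by (auto simp: admissible_with_def)
  obtain S M where S: "AE x in lborel. \<sigma> x = S x" "wbound \<beta> 2 M S" "\<And>x. S (- x) = S x"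
    by (rule wsobolev_even_representative[OF \<sigma>]) blast
  have \<sigma>m: "\<sigma> \<in> borel_measurable borel" using wsobolev_measurable \<sigma> wsobolev_even_subset by blast
  obtain S1 S2 where P: "primitive S S1" "primitive S1 S2" using S(2) by (auto simp: wbound_2_iff)
  have w: "AE x in lborel. S2 x = weak_deriv (weak_deriv \<sigma>) x"
    by (rule weak_deriv2_AE[OF P \<sigma>m]) (use S(1) in \<open>auto elim!: eventually_mono\<close>)
  have "AE y in lborel. deriv V (\<sigma> y) = deriv V (S y)" using S(1) by eventually_elim simp
  then have "AE x in lborel. delta (delta (\<lambda>y. deriv V (\<sigma> y))) x = delta (delta (\<lambda>y. deriv V (S y))) x"
    by (intro delta_cong_AE)
  then have "AE x in lborel. c\<^sup>2 * S2 x = delta (delta (\<lambda>y. deriv V (S y))) x"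
    using eq w by eventually_elim simp
  then have S_eq: "\<exists>S1 S2. primitive S S1 \<and> primitive S1 S2 \<and> (AE x in lborel. c\<^sup>2 * S2 x = delta (delta (\<lambda>y. deriv V (S y))) x)"
    using P by blast
  obtain K where K: "K \<ge> 0"
    "\<And>g. rhs_fun \<beta> g \<Longrightarrow> \<exists>F. (\<forall>x. F (- x) = F x) \<and> wbound \<beta> 2 (K * wl2 \<beta> g) F \<and> lin_eq V c S F g"
    "\<And>F r g. (\<And>x. F (- x) = F x) \<Longrightarrow> wbound \<beta> 2 r F \<Longrightarrow> lin_eq V c S F g \<Longrightarrow> rhs_fun \<beta> g \<Longrightarrow> wbound \<beta> 2 (K * wl2 \<beta> g) F"
    by (rule linearized_inverse[OF h \<beta> S(1)]) blast
  have "wave_setup V c \<beta> \<kappa> S K M"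
    by (rule wave_setup.intro) (use V c \<beta> \<kappa> S(2,3) S_eq K in blast)+
  then show ?thesis using that S(1) by blast
qed

context wave_setup
begin

text \<open>A is the constant of the norm comparison and is chosen before C and n, so all waves near
  \<sigma> with constant C come from fixed points in one ball of radius A C / n^2.\<close>

lemma nearby_wave_fixed_point:
  assumes \<sigma>: "\<sigma> \<in> wsobolev 2 \<beta>" "AE x in lborel. \<sigma> x = S x"
  obtains A where "A \<ge> 0" "\<And>C n \<rho>1 \<rho>2. nearby_wave V c \<kappa> \<beta> \<sigma> C n \<rho>1 \<rho>2 \<Longrightarrow> n \<ge> 1 \<Longrightarrow> 4 * pi\<^sup>2 * c\<^sup>2 * (real n)\<^sup>2 \<noteq> \<kappa> \<Longrightarrow>
     \<exists>F. (\<forall>x. F (- x) = F x) \<and> wbound \<beta> 2 (A * C / (real n)\<^sup>2) F \<and> lin_eq V c S F (Phi n F) \<and>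
       (AE x in lborel. \<rho>1 x = S x + F x) \<and> (AE x in lborel. \<rho>2 x = rho2 n F x)"
proof -
  obtain A where A: "A \<ge> 0" "\<And>f r. f \<in> wsobolev (real 2) \<beta> \<Longrightarrow> wnorm (real 2) \<beta> f \<le> r \<Longrightarrow>
      \<exists>F. (AE x in lborel. f x = F x) \<and> wbound \<beta> 2 (A * r) F"
    using wsobolev_imp_wbound[of 2 \<beta>] by blast
  have "\<exists>F. (\<forall>x. F (- x) = F x) \<and> wbound \<beta> 2 (A * C / (real n)\<^sup>2) F \<and> lin_eq V c S F (Phi n F) \<and>
       (AE x in lborel. \<rho>1 x = S x + F x) \<and> (AE x in lborel. \<rho>2 x = rho2 n F x)"
    if w: "nearby_wave V c \<kappa> \<beta> \<sigma> C n \<rho>1 \<rho>2" and n: "n \<ge> 1" "4 * pi\<^sup>2 * c\<^sup>2 * (real n)\<^sup>2 \<noteq> \<kappa>" for C n \<rho>1 \<rho>2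
  proof -
    have \<rho>: "\<rho>1 \<in> wsobolev 2 \<beta>" "\<rho>2 \<in> wsobolev 2 \<beta>" and ws: "wave_system V c \<kappa> (mu c \<kappa> n) \<rho>1 \<rho>2" and ev: "ae_even \<rho>1"
      and b: "wnorm 2 \<beta> (\<lambda>x. \<sigma> x - \<rho>1 x) \<le> C / (real n)\<^sup>2" "wnorm 2 \<beta> \<rho>2 \<le> C / real n"
      using w by (auto simp: nearby_wave_def)
    have "(\<lambda>x. \<sigma> x - \<rho>1 x) \<in> wsobolev 2 \<beta>" by (rule wsobolev_diff[OF \<sigma>(1) \<rho>(1)])
    then obtain E where E: "AE x in lborel. \<sigma> x - \<rho>1 x = E x" "wbound \<beta> 2 (A * (C / (real n)\<^sup>2)) E"
      using A(2)[unfolded of_nat_numeral, OF _ b(1)] by blast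
    define F where "F x = - E x" for x
    have F: "wbound \<beta> 2 (A * C / (real n)\<^sup>2) F" using wbound_cmult[OF E(2), of "-1"] by (simp add: F_def[abs_def])
    have \<rho>1: "AE x in lborel. \<rho>1 x = S x + F x"
      using E(1) \<sigma>(2) by eventually_elim (simp add: F_def)
    have cF: "continuous_on UNIV F" by (rule bound2_continuous[OF F])
    have "AE x in lborel. F (- x) = F x"
      using ev[unfolded ae_even_def] \<rho>1 AE_reflect[OF \<rho>1] by eventually_elim (simp add: S_even)
    then have "(\<lambda>x. F (- x)) = F"
      by (intro continuous_AE_eq_imp_eq cF continuous_on_compose2[OF cF] continuous_intros) auto
    then have "\<forall>x. F (- x) = F x" by metis
    moreover obtain P where P: "AE x in lborel. \<rho>2 x = P x" "wbound \<beta> 2 (A * (C / real n)) P"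
      using A(2)[unfolded of_nat_numeral, OF \<rho>(2) b(2)] by blast
    note fp = wave_system_imp_fixed_point[OF F P(2) n wsobolev_measurable[OF \<rho>(1)] \<rho>1 wsobolev_measurable[OF \<rho>(2)] P(1) ws]
    ultimately show ?thesis using F \<rho>1 P(1) fp by blast
  qed
  then show ?thesis using that A(1) by blast
qed

lemma fixed_point_nearby_wave:
  assumes \<sigma>: "\<sigma> \<in> wsobolev 2 \<beta>" "AE x in lborel. \<sigma> x = S x" and B: "B \<ge> 0"
  obtains C where "C > 0" "\<And>n F. (\<And>x. F (- x) = F x) \<Longrightarrow> wbound \<beta> 2 (B / (real n)\<^sup>2) F \<Longrightarrow> lin_eq V c S F (Phi n F) \<Longrightarrow> n \<ge> 1 \<Longrightarrow>
      4 * pi\<^sup>2 * c\<^sup>2 * (real n)\<^sup>2 \<noteq> \<kappa> \<Longrightarrow> nearby_wave V c \<kappa> \<beta> \<sigma> C n (\<lambda>x. S x + F x) (rho2 n F)"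
proof -
  obtain A where A: "A \<ge> 0" "\<And>f F r. wbound \<beta> 2 r F \<Longrightarrow> f \<in> borel_measurable borel \<Longrightarrow> AE x in lborel. f x = F x \<Longrightarrow>
     f \<in> wsobolev (real 2) \<beta> \<and> wnorm (real 2) \<beta> f \<le> A * r"
    using wbound_imp_wsobolev[OF b0, of 2] by blast
  obtain D where D: "D \<ge> 0" "\<And>n F. n \<ge> 1 \<Longrightarrow> wbound \<beta> 2 B F \<Longrightarrow> wbound \<beta> 2 (D / real n) (rho2 n F)"
    using rho2_bound by metis
  have \<sigma>m: "\<sigma> \<in> borel_measurable borel" by (rule wsobolev_measurable[OF \<sigma>(1)])
  \<comment> \<open>The sum serves the estimates of both components at once; adding 1 keeps C
    positive when the other terms vanish.\<close>
  define C where "C = A * B + A * D + 1"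
  have C: "C > 0" "A * B \<le> C" "A * D \<le> C" using A(1) B D(1) by (auto simp: C_def add_nonneg_pos)
  have "nearby_wave V c \<kappa> \<beta> \<sigma> C n (\<lambda>x. S x + F x) (rho2 n F)"
    if ev: "\<And>x. F (- x) = F x" and F: "wbound \<beta> 2 (B / (real n)\<^sup>2) F" and lin: "lin_eq V c S F (Phi n F)"
      and n: "n \<ge> 1" "4 * pi\<^sup>2 * c\<^sup>2 * (real n)\<^sup>2 \<noteq> \<kappa>" for n F
  proof -
    let ?R = "\<lambda>x. S x + F x"
    have n1: "(real n)\<^sup>2 \<ge> 1" using n by (simp add: one_le_power)
    have "B / (real n)\<^sup>2 \<le> B / 1" by (rule frac_le) (use n1 B in auto)
    then have FB: "wbound \<beta> 2 B F" using wbound_mono_radius[OF F] by simp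
    have R: "wbound \<beta> 2 (M + B) ?R" by (rule wbound_add[OF S_bound FB])
    have m: "f \<in> borel_measurable borel" if "wbound \<beta> 2 r f" for f r using wsq_measurable[OF wboundD(1)[OF that]] .
    have mF: "wbound \<beta> 2 (B / (real n)\<^sup>2) (\<lambda>x. - F x)" using wbound_cmult[OF F, of "-1"] by simp
    have d: "AE x in lborel. \<sigma> x - ?R x = - F x" using \<sigma>(2) by eventually_elim simp
    have dm: "(\<lambda>x. \<sigma> x - ?R x) \<in> borel_measurable borel" using \<sigma>m m[OF R] by measurable
    note r2 = D(2)[OF n(1) FB]
    have "wnorm 2 \<beta> (\<lambda>x. \<sigma> x - ?R x) \<le> A * (B / (real n)\<^sup>2)" using A(2)[OF mF dm d] by simp
    also have "\<dots> \<le> C / (real n)\<^sup>2" using C(2) by (simp add: divide_right_mono)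
    finally have b1: "wnorm 2 \<beta> (\<lambda>x. \<sigma> x - ?R x) \<le> C / (real n)\<^sup>2" .
    have "wnorm 2 \<beta> (rho2 n F) \<le> A * (D / real n)" using A(2)[OF r2 m[OF r2]] by simp
    also have "\<dots> \<le> C / real n" using C(3) by (simp add: divide_right_mono)
    finally have b2: "wnorm 2 \<beta> (rho2 n F) \<le> C / real n" .
    show ?thesis
      unfolding nearby_wave_def
      using A(2)[OF R m[OF R]] A(2)[OF r2 m[OF r2]] wave_system_fixed_point[OF F lin n] b1 b2
      by (auto simp: ae_even_def ae_odd_def S_even ev rho2_odd[of F, OF ev])
  qed
  then show ?thesis using that C(1) by blast
qed

lemma smooth_nearby_estimate:
  assumes V: "smooth V" and \<sigma>: "\<sigma> \<in> borel_measurable borel" "AE x in lborel. \<sigma> x = S x" and B: "B \<ge> 0"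
  obtains C where "C > 0" "\<And>n F \<rho>1 \<rho>2. n \<ge> 1 \<Longrightarrow> wbound \<beta> 2 (B / (real n)\<^sup>2) F \<Longrightarrow> lin_eq V c S F (Phi n F) \<Longrightarrow>
     \<rho>1 \<in> borel_measurable borel \<Longrightarrow> \<rho>2 \<in> borel_measurable borel \<Longrightarrow>
     AE x in lborel. \<rho>1 x = S x + F x \<Longrightarrow> AE x in lborel. \<rho>2 x = rho2 n F x \<Longrightarrow>
     (\<lambda>x. \<sigma> x - \<rho>1 x) \<in> wsobolev (real m) \<beta> \<and> \<rho>2 \<in> wsobolev (real m) \<beta> \<and>
     wnorm (real m) \<beta> (\<lambda>x. \<sigma> x - \<rho>1 x) + wnorm (real m) \<beta> \<rho>2 \<le> C / (real n)\<^sup>2"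
proof -
  obtain A where A: "A \<ge> 0" "\<And>f F r. wbound \<beta> m r F \<Longrightarrow> f \<in> borel_measurable borel \<Longrightarrow> AE x in lborel. f x = F x \<Longrightarrow>
     f \<in> wsobolev (real m) \<beta> \<and> wnorm (real m) \<beta> f \<le> A * r"
    using wbound_imp_wsobolev[OF b0, of m] by blast
  \<comment> \<open>Order m + 3 is what the estimate of \<open>rho2\<close> asks of F.\<close>
  obtain C1 where C1: "C1 \<ge> 0" "\<And>n F. n \<ge> 1 \<Longrightarrow> wbound \<beta> 2 (B / (real n)\<^sup>2) F \<Longrightarrow> lin_eq V c S F (Phi n F) \<Longrightarrow>
      wbound \<beta> (Suc m + 2) (C1 / (real n)\<^sup>2) F"
    using smooth_fixed_point_bound[OF V B, of "Suc m"] by blast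
  obtain r where r: "wbound \<beta> (m + 3) r S" using smooth_S_bound[OF V] by blast
  define s where "s = max r C1"
  have s: "wbound \<beta> (m + 3) s S" by (rule wbound_mono_radius[OF r]) (simp add: s_def)
  obtain C2 where C2: "C2 \<ge> 0" "\<And>n F. n \<ge> 1 \<Longrightarrow> wbound \<beta> (m + 3) s F \<Longrightarrow> wbound \<beta> m (C2 / (real n)\<^sup>2) (rho2 n F)"
    using smooth_rho2_bound[OF V s] by blast
  have "(\<lambda>x. \<sigma> x - \<rho>1 x) \<in> wsobolev (real m) \<beta> \<and> \<rho>2 \<in> wsobolev (real m) \<beta> \<and>
     wnorm (real m) \<beta> (\<lambda>x. \<sigma> x - \<rho>1 x) + wnorm (real m) \<beta> \<rho>2 \<le> (A * C1 + A * C2 + 1) / (real n)\<^sup>2"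
    if n: "n \<ge> 1" and F: "wbound \<beta> 2 (B / (real n)\<^sup>2) F" and lin: "lin_eq V c S F (Phi n F)"
      and m: "\<rho>1 \<in> borel_measurable borel" "\<rho>2 \<in> borel_measurable borel"
      and \<rho>: "AE x in lborel. \<rho>1 x = S x + F x" "AE x in lborel. \<rho>2 x = rho2 n F x" for n F \<rho>1 \<rho>2
  proof -
    have n1: "(real n)\<^sup>2 \<ge> 1" using n by (simp add: one_le_power)
    have F3: "wbound \<beta> (m + 3) (C1 / (real n)\<^sup>2) F" using C1(2)[OF n F lin] by (simp only: add_Suc_shift numeral_2_eq_2 numeral_3_eq_3)
    have "C1 / (real n)\<^sup>2 \<le> C1 / 1" by (rule frac_le) (use n1 C1(1) in auto)
    then have Fs: "wbound \<beta> (m + 3) s F" using wbound_mono_radius[OF F3, of s] by (simp add: s_def)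
    have Fm: "wbound \<beta> m (C1 / (real n)\<^sup>2) F" by (rule wbound_lower[OF F3]) simp
    have mF: "wbound \<beta> m (C1 / (real n)\<^sup>2) (\<lambda>x. - F x)" using wbound_cmult[OF Fm, of "-1"] by simp
    have d: "AE x in lborel. \<sigma> x - \<rho>1 x = - F x" using \<sigma>(2) \<rho>(1) by eventually_elim simp
    have dm: "(\<lambda>x. \<sigma> x - \<rho>1 x) \<in> borel_measurable borel" using \<sigma>(1) m(1) by measurable
    note a = A(2)[OF mF dm d] and b = A(2)[OF C2(2)[OF n Fs] m(2) \<rho>(2)]
    have "wnorm (real m) \<beta> (\<lambda>x. \<sigma> x - \<rho>1 x) + wnorm (real m) \<beta> \<rho>2 \<le> A * (C1 / (real n)\<^sup>2) + A * (C2 / (real n)\<^sup>2)"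
      using a b by (intro add_mono) auto
    also have "\<dots> = (A * C1 + A * C2) / (real n)\<^sup>2" by (simp add: add_divide_distrib)
    also have "\<dots> \<le> (A * C1 + A * C2 + 1) / (real n)\<^sup>2" by (intro divide_right_mono) auto
    finally show ?thesis using a b by blast
  qed
  moreover have "A * C1 + A * C2 + 1 > 0" using A(1) C1(1) C2(1) by (simp add: add_nonneg_pos)
  ultimately show ?thesis using that by blast
qed

lemma smooth_fixed_point_C_k:
  assumes V: "smooth V" and n: "n \<ge> 1" and B: "B \<ge> 0" and F: "wbound \<beta> 2 (B / (real n)\<^sup>2) F" and lin: "lin_eq V c S F (Phi n F)"
  shows "smooth (\<lambda>x. S x + F x)" "smooth (rho2 n F)"
proof -
  have b: "\<exists>r. wbound \<beta> m r S \<and> wbound \<beta> m r F" for m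
  proof -
    obtain C where "wbound \<beta> (m + 2) (C / (real n)\<^sup>2) F" using smooth_fixed_point_bound[OF V B, of m] n F lin by blast
    then have 1: "wbound \<beta> m (C / (real n)\<^sup>2) F" by (rule wbound_lower) simp
    obtain r where 2: "wbound \<beta> m r S" using smooth_S_bound[OF V] by blast
    show ?thesis
      using wbound_mono_radius[OF 1, of "max r (C / (real n)\<^sup>2)"] wbound_mono_radius[OF 2, of "max r (C / (real n)\<^sup>2)"] by auto
  qed
  show "smooth (\<lambda>x. S x + F x)"
    unfolding smooth_def
  proof
    fix k
    obtain r where "wbound \<beta> (Suc k) r S" "wbound \<beta> (Suc k) r F" using b by blast
    then show "C_k k (\<lambda>x. S x + F x)" by (rule wbound_imp_C_k[OF wbound_add])
  qed
  show "smooth (rho2 n F)"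
    unfolding smooth_def
  proof
    fix k
    obtain r where r: "wbound \<beta> (Suc k + 3) r S" "wbound \<beta> (Suc k + 3) r F" using b by blast
    obtain C where "wbound \<beta> (Suc k) (C / (real n)\<^sup>2) (rho2 n F)" using smooth_rho2_bound[OF V r(1)] n r(2) by blast
    then show "C_k k (rho2 n F)" by (rule wbound_imp_C_k)
  qed
qed

end

theorem theorem2p2:
  fixes V \<sigma> :: "real \<Rightarrow> real" and c \<beta> \<kappa> :: real
  assumes "C_k 5 V" and "deriv V 0 = 0"
    and "c \<noteq> 0" and "admissible_with V c \<beta> \<sigma>"
    and "\<kappa> > 0"
  shows "\<exists>C>0. \<exists>N\<ge>1.
    (\<forall>n\<ge>N. \<exists>\<rho>1 \<rho>2. nearby_wave V c \<kappa> \<beta> \<sigma> C n \<rho>1 \<rho>2 \<and>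
       (\<forall>\<rho>1' \<rho>2'. nearby_wave V c \<kappa> \<beta> \<sigma> C n \<rho>1' \<rho>2' \<longrightarrow> ae_eq \<rho>1' \<rho>1 \<and> ae_eq \<rho>2' \<rho>2)) \<and>
    (smooth V \<longrightarrow>
       (\<forall>n\<ge>N. \<forall>\<rho>1 \<rho>2. nearby_wave V c \<kappa> \<beta> \<sigma> C n \<rho>1 \<rho>2 \<longrightarrow> ae_smooth \<rho>1 \<and> ae_smooth \<rho>2) \<and>
       (\<forall>s\<ge>0. \<exists>C'>0. \<forall>n\<ge>N. \<forall>\<rho>1 \<rho>2. nearby_wave V c \<kappa> \<beta> \<sigma> C n \<rho>1 \<rho>2 \<longrightarrow>
          (\<lambda>x. \<sigma> x - \<rho>1 x) \<in> wsobolev s \<beta> \<and> \<rho>2 \<in> wsobolev s \<beta> \<and>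
          wnorm s \<beta> (\<lambda>x. \<sigma> x - \<rho>1 x) + wnorm s \<beta> \<rho>2 \<le> C' / (real n)\<^sup>2))"
proof -
  obtain S K M where \<sigma>S: "AE x in lborel. \<sigma> x = S x" and ws: "wave_setup V c \<beta> \<kappa> S K M"
    using admissible_wave_setup[OF assms] .
  interpret wave_setup V c \<beta> \<kappa> S K M by (rule ws)
  have \<sigma>w: "\<sigma> \<in> wsobolev 2 \<beta>" using assms(4) by (auto simp: admissible_with_def wsobolev_even_def)
  have \<sigma>m: "\<sigma> \<in> borel_measurable borel" by (rule wsobolev_measurable[OF \<sigma>w])
  obtain B N1 where B: "B \<ge> 0" and N1: "N1 \<ge> (1::nat)"
    and ex: "\<And>n. n \<ge> N1 \<Longrightarrow> \<exists>F. (\<forall>x. F (- x) = F x) \<and> wbound \<beta> 2 (B / (real n)\<^sup>2) F \<and> lin_eq V c S F (Phi n F)"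
    using Phi_fixed_point by metis
  obtain C where C: "C > 0" and near: "\<And>n F. (\<And>x. F (- x) = F x) \<Longrightarrow> wbound \<beta> 2 (B / (real n)\<^sup>2) F \<Longrightarrow> lin_eq V c S F (Phi n F) \<Longrightarrow> n \<ge> 1 \<Longrightarrow>
      4 * pi\<^sup>2 * c\<^sup>2 * (real n)\<^sup>2 \<noteq> \<kappa> \<Longrightarrow> nearby_wave V c \<kappa> \<beta> \<sigma> C n (\<lambda>x. S x + F x) (rho2 n F)"
    by (rule fixed_point_nearby_wave[OF \<sigma>w \<sigma>S B]) blast
  obtain A where A: "A \<ge> 0" and fp: "\<And>C n \<rho>1 \<rho>2. nearby_wave V c \<kappa> \<beta> \<sigma> C n \<rho>1 \<rho>2 \<Longrightarrow> n \<ge> 1 \<Longrightarrow> 4 * pi\<^sup>2 * c\<^sup>2 * (real n)\<^sup>2 \<noteq> \<kappa> \<Longrightarrow>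
     \<exists>F. (\<forall>x. F (- x) = F x) \<and> wbound \<beta> 2 (A * C / (real n)\<^sup>2) F \<and> lin_eq V c S F (Phi n F) \<and>
       (AE x in lborel. \<rho>1 x = S x + F x) \<and> (AE x in lborel. \<rho>2 x = rho2 n F x)"
    by (rule nearby_wave_fixed_point[OF \<sigma>w \<sigma>S]) blast
  \<comment> \<open>The constructed fixed point lies in the ball given by B, a competitor in the one
    given by A C; uniqueness is applied in the larger of the two.\<close>
  define D where "D = max B (A * C)"
  have D: "D \<ge> 0" using B by (simp add: D_def)
  obtain N2 where uniq: "\<And>n F F'. n \<ge> N2 \<Longrightarrow> (\<And>x. F (- x) = F x) \<Longrightarrow> (\<And>x. F' (- x) = F' x) \<Longrightarrow>
     wbound \<beta> 2 (D / (real n)\<^sup>2) F \<Longrightarrow> wbound \<beta> 2 (D / (real n)\<^sup>2) F' \<Longrightarrow>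
     lin_eq V c S F (Phi n F) \<Longrightarrow> lin_eq V c S F' (Phi n F') \<Longrightarrow> F = F'"
    by (rule Phi_fixed_point_unique[of D]) blast
  \<comment> \<open>Beyond N3 one has \<kappa> < c^2 n, so the denominator of \<mu> is positive and
    the resonance relation is available.\<close>
  obtain N3 :: nat where N3: "real N3 > \<kappa> / c\<^sup>2" using reals_Archimedean2 by blast
  define N where "N = max N1 (max N2 N3)"
  have N: "n \<ge> N1" "n \<ge> N2" "n \<ge> 1" "4 * pi\<^sup>2 * c\<^sup>2 * (real n)\<^sup>2 \<noteq> \<kappa>" if "n \<ge> N" for n
  proof -
    show n: "n \<ge> N1" "n \<ge> N2" "n \<ge> 1" using that N1 by (auto simp: N_def)
    have "real N3 \<le> real n" using that by (simp add: N_def)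
    then have "\<kappa> / c\<^sup>2 < real n" using N3 by linarith
    then have "\<kappa> < c\<^sup>2 * real n" using c by (simp add: pos_divide_less_eq mult.commute)
    also have "\<dots> \<le> c\<^sup>2 * (real n)\<^sup>2" using n(3) by (intro mult_left_mono) (auto simp: power2_eq_square)
    also have "\<dots> \<le> (4 * pi\<^sup>2) * (c\<^sup>2 * (real n)\<^sup>2)"
    proof -
      have "1 \<le> pi\<^sup>2" using pi_gt3 by (intro one_le_power) simp
      then have "1 * (c\<^sup>2 * (real n)\<^sup>2) \<le> (4 * pi\<^sup>2) * (c\<^sup>2 * (real n)\<^sup>2)" by (intro mult_right_mono) auto
      then show ?thesis by simp
    qed
    finally show "4 * pi\<^sup>2 * c\<^sup>2 * (real n)\<^sup>2 \<noteq> \<kappa>" by simp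
  qed
  have rad: "wbound \<beta> 2 (D / (real n)\<^sup>2) F" if "wbound \<beta> 2 (r / (real n)\<^sup>2) F" "r \<le> D" for r n F
    by (rule wbound_mono_radius[OF that(1)]) (use that(2) in \<open>simp add: divide_right_mono\<close>)
  have fpD: "\<exists>F. (\<forall>x. F (- x) = F x) \<and> wbound \<beta> 2 (D / (real n)\<^sup>2) F \<and> lin_eq V c S F (Phi n F) \<and>
       (AE x in lborel. \<rho>1 x = S x + F x) \<and> (AE x in lborel. \<rho>2 x = rho2 n F x)"
    if "nearby_wave V c \<kappa> \<beta> \<sigma> C n \<rho>1 \<rho>2" "n \<ge> N" for n \<rho>1 \<rho>2
    using fp[OF that(1) N(3,4)[OF that(2)]] rad[of "A * C" n] by (auto simp: D_def)
  have meas: "\<rho>1 \<in> borel_measurable borel" "\<rho>2 \<in> borel_measurable borel"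
    if "nearby_wave V c \<kappa> \<beta> \<sigma> C n \<rho>1 \<rho>2" for n \<rho>1 \<rho>2
    using that wsobolev_measurable by (auto simp: nearby_wave_def)
  have unique: "\<exists>\<rho>1 \<rho>2. nearby_wave V c \<kappa> \<beta> \<sigma> C n \<rho>1 \<rho>2 \<and>
       (\<forall>\<rho>1' \<rho>2'. nearby_wave V c \<kappa> \<beta> \<sigma> C n \<rho>1' \<rho>2' \<longrightarrow> ae_eq \<rho>1' \<rho>1 \<and> ae_eq \<rho>2' \<rho>2)" if n: "n \<ge> N" for n
  proof -
    obtain F where F: "\<And>x. F (- x) = F x" "wbound \<beta> 2 (B / (real n)\<^sup>2) F" "lin_eq V c S F (Phi n F)"
      using ex[OF N(1)[OF n]] by blast
    have FD: "wbound \<beta> 2 (D / (real n)\<^sup>2) F" by (rule rad[OF F(2)]) (simp add: D_def)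
    have "ae_eq \<rho>1' (\<lambda>x. S x + F x) \<and> ae_eq \<rho>2' (rho2 n F)" if w: "nearby_wave V c \<kappa> \<beta> \<sigma> C n \<rho>1' \<rho>2'" for \<rho>1' \<rho>2'
    proof -
      obtain F' where F': "\<And>x. F' (- x) = F' x" "wbound \<beta> 2 (D / (real n)\<^sup>2) F'" "lin_eq V c S F' (Phi n F')"
        "AE x in lborel. \<rho>1' x = S x + F' x" "AE x in lborel. \<rho>2' x = rho2 n F' x"
        using fpD[OF w n] by blast
      have "F' = F" by (rule uniq[OF N(2)[OF n] F'(1) F(1) F'(2) FD F'(3) F(3)])
      then show ?thesis using F'(4,5) by (simp add: ae_eq_def)
    qed
    then show ?thesis using near[OF F N(3,4)[OF n]] by blast
  qed
  have smooth1: "ae_smooth \<rho>1 \<and> ae_smooth \<rho>2"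
    if V: "smooth V" and n: "n \<ge> N" and w: "nearby_wave V c \<kappa> \<beta> \<sigma> C n \<rho>1 \<rho>2" for n \<rho>1 \<rho>2
  proof -
    obtain F where F: "wbound \<beta> 2 (D / (real n)\<^sup>2) F" "lin_eq V c S F (Phi n F)"
      "AE x in lborel. \<rho>1 x = S x + F x" "AE x in lborel. \<rho>2 x = rho2 n F x" using fpD[OF w n] by blast
    show ?thesis
      using smooth_fixed_point_C_k[OF V N(3)[OF n] D F(1,2)] F(3,4) unfolding ae_smooth_def ae_eq_def by blast
  qed
  have smooth2: "\<exists>C'>0. \<forall>n\<ge>N. \<forall>\<rho>1 \<rho>2. nearby_wave V c \<kappa> \<beta> \<sigma> C n \<rho>1 \<rho>2 \<longrightarrow>
          (\<lambda>x. \<sigma> x - \<rho>1 x) \<in> wsobolev s \<beta> \<and> \<rho>2 \<in> wsobolev s \<beta> \<and>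
          wnorm s \<beta> (\<lambda>x. \<sigma> x - \<rho>1 x) + wnorm s \<beta> \<rho>2 \<le> C' / (real n)\<^sup>2" if V: "smooth V" for s
  proof -
    \<comment> \<open>The norms increase with the order, so a real order is dominated by an integer
      one, to which the chains of primitives apply.\<close>
    obtain m :: nat where m: "s \<le> real m" using real_arch_simple by blast
    obtain C' where C': "C' > 0" and est: "\<And>n F \<rho>1 \<rho>2. n \<ge> 1 \<Longrightarrow> wbound \<beta> 2 (D / (real n)\<^sup>2) F \<Longrightarrow> lin_eq V c S F (Phi n F) \<Longrightarrow>
     \<rho>1 \<in> borel_measurable borel \<Longrightarrow> \<rho>2 \<in> borel_measurable borel \<Longrightarrow>
     AE x in lborel. \<rho>1 x = S x + F x \<Longrightarrow> AE x in lborel. \<rho>2 x = rho2 n F x \<Longrightarrow>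
     (\<lambda>x. \<sigma> x - \<rho>1 x) \<in> wsobolev (real m) \<beta> \<and> \<rho>2 \<in> wsobolev (real m) \<beta> \<and>
     wnorm (real m) \<beta> (\<lambda>x. \<sigma> x - \<rho>1 x) + wnorm (real m) \<beta> \<rho>2 \<le> C' / (real n)\<^sup>2"
      by (rule smooth_nearby_estimate[OF V \<sigma>m \<sigma>S D, of m]) blast
    have "(\<lambda>x. \<sigma> x - \<rho>1 x) \<in> wsobolev s \<beta> \<and> \<rho>2 \<in> wsobolev s \<beta> \<and>
          wnorm s \<beta> (\<lambda>x. \<sigma> x - \<rho>1 x) + wnorm s \<beta> \<rho>2 \<le> C' / (real n)\<^sup>2"
      if n: "n \<ge> N" and w: "nearby_wave V c \<kappa> \<beta> \<sigma> C n \<rho>1 \<rho>2" for n \<rho>1 \<rho>2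
    proof -
      obtain F where F: "wbound \<beta> 2 (D / (real n)\<^sup>2) F" "lin_eq V c S F (Phi n F)"
        "AE x in lborel. \<rho>1 x = S x + F x" "AE x in lborel. \<rho>2 x = rho2 n F x" using fpD[OF w n] by blast
      note e = est[OF N(3)[OF n] F(1,2) meas[OF w] F(3,4)]
      show ?thesis
        using wsobolev_mono[of "\<lambda>x. \<sigma> x - \<rho>1 x" "real m" \<beta> s, OF _ m] wsobolev_mono[of \<rho>2 "real m" \<beta> s, OF _ m] e by linarith
    qed
    then show ?thesis using C' by blast
  qed
  have "N \<ge> 1" using N1 by (simp add: N_def)
  then show ?thesis using C unique smooth1 smooth2 by blast
qed

end
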